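(* Let $G$ be a metric graph with finitely many edges and vertices and finite edge lengths, let $U\in L^2(G,\mathbb{R})$, and let $D=-\left(\frac{\partial^2}{\partial x^2}+U(x)\right)$ act on $G$ with self-adjoint non-Robin boundary conditions at all vertices. Then the operator $D$ admits a heat kernel $e(t,x,y)$, and this heat kernel is unique.
   Context: Metric graph: a combinatorial graph $G$ with finitely many vertices $V$ and edges $E$, each edge $\alpha$ being identified with an interval $[0,l(\alpha)]$ of finite length. Functions on $G$ are real-valued and given by their restrictions to the closed edges; at a vertex $v$ a function $f$ may have different values $f_\alpha(v)$ on the different edges (edge ends) $\alpha$ adjacent to $v$. $L^2(G,\mathbb{R})$ and $\int_G$ are defined by summing over edges. A point $x\in G$ at which functions are evaluated is understood as a point of a closed edge. Boundary conditions: at each vertex $v$ enumerate the adjacent edges $1,\dots,d$, let $\overrightarrow{f_v}=(f_1(v),\dots,f_d(v))$ and $\overrightarrow{f_v}'=(f_1'(v),\dots,f_d'(v))$, derivatives being oriented away from $v$. The conditions are $A_v\overrightarrow{f_v}+B_v\overrightarrow{f_v}'=0$ for real $d\times d$ matrices $A_v,B_v$ with $A_vB_v^*$ self-adjoint and $(A_v,B_v)$ of full rank (this is equivalent to self-adjointness of $D$). Put $\sigma^v=-(A_v+ikB_v)^{-1}(A_v-ikB_v)$ for real $k\neq0$. The conditions are non-Robin if $\sigma^v$ does not depend on $k$. Domain: $\mathrm{Dom}(D)$ consists of the $f\in L^2(G,\mathbb{R})$ that on each closed edge are $C^1$ with absolutely continuous derivative, satisfy $f''+Uf\in L^2(G,\mathbb{R})$,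 and satisfy the boundary conditions at all vertices. Heat kernel: a function $e(t,x,y)$, $t>0$, $x,y\in G$, with $(\partial_t+D_y)e(t,x,y)=0$ and $\lim_{t\to0}e(t,x,y)=\delta_x(y)$ (Dirac distribution). Precisely: for every $x$, $t\mapsto e(t,x,\cdot)$ is a continuously differentiable map $(0,\infty)\to L^2(G,\mathbb{R})$ with values in $\mathrm{Dom}(D)$ satisfying $\partial_te(t,x,\cdot)=-D\,e(t,x,\cdot)$, and $\lim_{t\to0^+}\int_Ge(t,x,y)\psi(y)\,dy=\psi(x)$ for every $\psi\in\mathrm{Dom}(D)$. *)

theory Defs
  imports
    "HOL-Analysis.Analysis"
    "Graph_Theory.Digraph"
    "Jordan_Normal_Form.DL_Rank"
    "Jordan_Normal_Form.Gauss_Jordan_Elimination"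
begin

text \<open>
  A metric graph is a finite directed multigraph (loops and parallel edges allowed) whose arc
  \<open>a\<close> is identified with \<open>[0, l a]\<close>; \<open>0\<close> is its end at \<open>tail G a\<close> and \<open>l a\<close> its end at
  \<open>head G a\<close>. The direction of an arc only records this identification.
\<close>

locale metric_graph = fin_digraph G for G :: "('v, 'e) pre_digraph" +
  fixes l :: "'e \<Rightarrow> real"
  assumes length_pos: "a \<in> arcs G \<Longrightarrow> 0 < l a"

text \<open>
  Points belong to closed edges: the ends of different edges at a common vertex are different
  points, so a function on points may take several values at a vertex.
\<close>

type_synonym 'e point = "'e \<times> real"

definition points :: "('v, 'e) pre_digraph \<Rightarrow> ('e \<Rightarrow> real) \<Rightarrow> 'e point set" where
  "points G l = (SIGMA a:arcs G. {0..l a})"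

definition edge_ends :: "('v, 'e) pre_digraph \<Rightarrow> ('e \<Rightarrow> real) \<Rightarrow> 'v \<Rightarrow> 'e point set" where
  "edge_ends G l v =
     {(a, 0) | a. a \<in> arcs G \<and> tail G a = v} \<union> {(a, l a) | a. a \<in> arcs G \<and> head G a = v}"

text \<open>A loop contributes both of its ends.\<close>

definition vertex_degree :: "('v, 'e) pre_digraph \<Rightarrow> ('e \<Rightarrow> real) \<Rightarrow> 'v \<Rightarrow> nat" where
  "vertex_degree G l v = card (edge_ends G l v)"

definition enumerates_ends ::
  "('v, 'e) pre_digraph \<Rightarrow> ('e \<Rightarrow> real) \<Rightarrow> ('v \<Rightarrow> nat \<Rightarrow> 'e point) \<Rightarrow> bool" where
  "enumerates_ends G l en \<longleftrightarrow>
     (\<forall>v\<in>verts G. bij_betw (en v) {..<vertex_degree G l v} (edge_ends G l v))"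


definition graph_integral ::
  "('v, 'e) pre_digraph \<Rightarrow> ('e \<Rightarrow> real) \<Rightarrow> ('e point \<Rightarrow> real) \<Rightarrow> real" where
  "graph_integral G l f = (\<Sum>a\<in>arcs G. \<integral>s. f (a, s) \<partial>lebesgue_on {0..l a})"

definition L2 :: "('v, 'e) pre_digraph \<Rightarrow> ('e \<Rightarrow> real) \<Rightarrow> ('e point \<Rightarrow> real) set" where
  "L2 G l = {f. \<forall>a\<in>arcs G.
     (\<lambda>s. f (a, s)) \<in> borel_measurable (lebesgue_on {0..l a}) \<and>
     integrable (lebesgue_on {0..l a}) (\<lambda>s. (f (a, s))\<^sup>2)}"

definition L2_norm ::
  "('v, 'e) pre_digraph \<Rightarrow> ('e \<Rightarrow> real) \<Rightarrow> ('e point \<Rightarrow> real) \<Rightarrow> real" where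
  "L2_norm G l f = sqrt (graph_integral G l (\<lambda>y. (f y)\<^sup>2))"


definition absolutely_continuous_on :: "real set \<Rightarrow> (real \<Rightarrow> real) \<Rightarrow> bool" where
  "absolutely_continuous_on S f \<longleftrightarrow>
     (\<forall>\<epsilon>>0. \<exists>\<delta>>0. \<forall>\<D> T. \<D> division_of T \<and> T \<subseteq> S \<and> (\<Sum>K\<in>\<D>. Sup K - Inf K) < \<delta> \<longrightarrow>
        (\<Sum>K\<in>\<D>. \<bar>f (Sup K) - f (Inf K)\<bar>) < \<epsilon>)"

text \<open>
  The derivative along an edge is one-sided at its two ends. Its value is arbitrary where the
  function is not differentiable.
\<close>

definition edge_deriv :: "('e \<Rightarrow> real) \<Rightarrow> ('e point \<Rightarrow> real) \<Rightarrow> 'e point \<Rightarrow> real" where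
  "edge_deriv l f = (\<lambda>(a, s). vector_derivative (\<lambda>r. f (a, r)) (at s within {0..l a}))"

definition C1_on_edges ::
  "('v, 'e) pre_digraph \<Rightarrow> ('e \<Rightarrow> real) \<Rightarrow> ('e point \<Rightarrow> real) \<Rightarrow> bool" where
  "C1_on_edges G l f \<longleftrightarrow> (\<forall>a\<in>arcs G.
     (\<forall>s\<in>{0..l a}. (\<lambda>r. f (a, r)) differentiable (at s within {0..l a})) \<and>
     continuous_on {0..l a} (\<lambda>s. edge_deriv l f (a, s)))"

definition outward_deriv :: "('e \<Rightarrow> real) \<Rightarrow> ('e point \<Rightarrow> real) \<Rightarrow> 'e point \<Rightarrow> real" where
  "outward_deriv l f p = (if snd p = 0 then edge_deriv l f p else - edge_deriv l f p)"

text \<open>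
  If \<open>f'\<close> is absolutely continuous, \<open>f''\<close> exists almost everywhere, so the following determines
  an element of \<open>L\<^sup>2\<close> up to null sets.
\<close>

definition schroedinger ::
  "('e \<Rightarrow> real) \<Rightarrow> ('e point \<Rightarrow> real) \<Rightarrow> ('e point \<Rightarrow> real) \<Rightarrow> 'e point \<Rightarrow> real" where
  "schroedinger l U f = (\<lambda>y. - (edge_deriv l (edge_deriv l f) y + U y * f y))"


definition self_adjoint_bc ::
  "('v, 'e) pre_digraph \<Rightarrow> ('e \<Rightarrow> real) \<Rightarrow> ('v \<Rightarrow> real mat) \<Rightarrow> ('v \<Rightarrow> real mat) \<Rightarrow> bool" where
  "self_adjoint_bc G l A B \<longleftrightarrow> (\<forall>v\<in>verts G. let d = vertex_degree G l v in
     A v \<in> carrier_mat d d \<and> B v \<in> carrier_mat d d \<and>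
     transpose_mat (A v * transpose_mat (B v)) = A v * transpose_mat (B v) \<and>
     vec_space.rank d (mat_of_cols d (cols (A v) @ cols (B v))) = d)"

text \<open>
  For self-adjoint conditions \<open>A v + \<i> k B v\<close> is invertible for every real \<open>k \<noteq> 0\<close>,
  so \<open>mat_inverse\<close> then returns the inverse.
\<close>

definition scattering_matrix :: "real mat \<Rightarrow> real mat \<Rightarrow> real \<Rightarrow> complex mat" where
  "scattering_matrix A B k =
     (let A' = map_mat complex_of_real A; B' = map_mat complex_of_real B; c = \<i> * complex_of_real k
      in - (the (mat_inverse (A' + c \<cdot>\<^sub>m B')) * (A' - c \<cdot>\<^sub>m B')))"

definition non_robin ::
  "('v, 'e) pre_digraph \<Rightarrow> ('v \<Rightarrow> real mat) \<Rightarrow> ('v \<Rightarrow> real mat) \<Rightarrow> bool" where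
  "non_robin G A B \<longleftrightarrow> (\<forall>v\<in>verts G. \<forall>k k'. k \<noteq> 0 \<and> k' \<noteq> 0 \<longrightarrow>
     scattering_matrix (A v) (B v) k = scattering_matrix (A v) (B v) k')"

definition boundary_condition ::
  "('v, 'e) pre_digraph \<Rightarrow> ('e \<Rightarrow> real) \<Rightarrow> ('v \<Rightarrow> nat \<Rightarrow> 'e point) \<Rightarrow>
   ('v \<Rightarrow> real mat) \<Rightarrow> ('v \<Rightarrow> real mat) \<Rightarrow> ('e point \<Rightarrow> real) \<Rightarrow> 'v \<Rightarrow> bool" where
  "boundary_condition G l en A B f v \<longleftrightarrow> (let d = vertex_degree G l v in
     A v *\<^sub>v vec d (\<lambda>i. f (en v i)) + B v *\<^sub>v vec d (\<lambda>i. outward_deriv l f (en v i)) = 0\<^sub>v d)"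

definition Dom ::
  "('v, 'e) pre_digraph \<Rightarrow> ('e \<Rightarrow> real) \<Rightarrow> ('v \<Rightarrow> nat \<Rightarrow> 'e point) \<Rightarrow>
   ('v \<Rightarrow> real mat) \<Rightarrow> ('v \<Rightarrow> real mat) \<Rightarrow> ('e point \<Rightarrow> real) \<Rightarrow> ('e point \<Rightarrow> real) set" where
  "Dom G l en A B U = {f. f \<in> L2 G l \<and> C1_on_edges G l f \<and>
     (\<forall>a\<in>arcs G. absolutely_continuous_on {0..l a} (\<lambda>s. edge_deriv l f (a, s))) \<and>
     schroedinger l U f \<in> L2 G l \<and>
     (\<forall>v\<in>verts G. boundary_condition G l en A B f v)}"


text \<open>
  \<open>u\<close> is continuously differentiable as a map \<open>(0,\<infinity>) \<rightarrow> L\<^sup>2\<close>, with derivative \<open>u'\<close>.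
\<close>

definition L2_C1 ::
  "('v, 'e) pre_digraph \<Rightarrow> ('e \<Rightarrow> real) \<Rightarrow>
   (real \<Rightarrow> 'e point \<Rightarrow> real) \<Rightarrow> (real \<Rightarrow> 'e point \<Rightarrow> real) \<Rightarrow> bool" where
  "L2_C1 G l u u' \<longleftrightarrow> (\<forall>t>0.
     u t \<in> L2 G l \<and> u' t \<in> L2 G l \<and>
     ((\<lambda>h. L2_norm G l (\<lambda>y. (u (t + h) y - u t y) / h - u' t y)) \<longlongrightarrow> 0) (at 0) \<and>
     ((\<lambda>s. L2_norm G l (\<lambda>y. u' s y - u' t y)) \<longlongrightarrow> 0) (at t))"

definition heat_kernel ::
  "('v, 'e) pre_digraph \<Rightarrow> ('e \<Rightarrow> real) \<Rightarrow> ('v \<Rightarrow> nat \<Rightarrow> 'e point) \<Rightarrow>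
   ('v \<Rightarrow> real mat) \<Rightarrow> ('v \<Rightarrow> real mat) \<Rightarrow> ('e point \<Rightarrow> real) \<Rightarrow>
   (real \<Rightarrow> 'e point \<Rightarrow> 'e point \<Rightarrow> real) \<Rightarrow> bool" where
  "heat_kernel G l en A B U e \<longleftrightarrow> (\<forall>x\<in>points G l.
     (\<forall>t>0. e t x \<in> Dom G l en A B U) \<and>
     L2_C1 G l (\<lambda>t. e t x) (\<lambda>t y. - schroedinger l U (e t x) y) \<and>
     (\<forall>\<psi>\<in>Dom G l en A B U.
        ((\<lambda>t. graph_integral G l (\<lambda>y. e t x y * \<psi> y)) \<longlongrightarrow> \<psi> x) (at_right 0)))"

end

theory Submission
  imports
    Defs
    "HOL-Complex_Analysis.Great_Picard"
begin

text \<open>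
  The non-Robin hypothesis makes the vertex conditions simple. If the scattering matrix of \<open>(A, B)\<close> does
  not depend on the spectral parameter, then it is a real symmetric involution \<open>\<rho>\<close>, and the condition
  \<open>A f + B f' = 0\<close> splits into \<open>\<rho> f = f\<close> and \<open>\<rho> f' = - f'\<close>
  (\<open>self_adjoint_non_robin_involution\<close>). Values and outward derivatives at a vertex thus lie in
  complementary orthogonal subspaces, so all boundary terms in Green's formula vanish.
  
  For large \<open>k\<close> the equation \<open>(D + k\<^sup>2) f = h\<close> is solved by following waves. The combinations
  \<open>u = f + f'/k\<close> and \<open>v = f - f'/k\<close> satisfy \<open>u' = k u - (h + U f)/k\<close> and \<open>v' = - k v + (h + U f)/k\<close>.
  Each is damped in its direction of travel, and the vertex conditions say that the amplitudes leaving a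
  vertex arise from the arriving ones through \<open>\<rho>\<close>. An arriving amplitude carries the factor
  \<open>exp (- k l)\<close> and the source carries the factor \<open>1/k\<close>, so for large \<open>k\<close> this is a contraction in
  the supremum norm although \<open>U\<close> is only square integrable. It gives existence (\<open>solution_exists\<close>) and
  the bound \<open>a_priori_bound\<close>, hence uniqueness. The same bound for all larger \<open>k\<close> shows that \<open>D\<close> is
  bounded below.
  
  The resolvent \<open>R = (D + k0\<^sup>2)\<inverse>\<close> is symmetric by Green's formula, bounded from \<open>L\<^sup>2\<close> to the
  supremum norm, and compact since it maps into Lipschitz functions (Arzela-Ascoli). A maximal orthonormal
  set \<open>S\<close> of eigenvectors exists by Zorn's lemma, and a vector orthogonal to \<open>S\<close> is a null vector
  (\<open>complement_null\<close>): otherwise the squared norm of \<open>R\<close> on the complement would be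
  a positive eigenvalue of \<open>R\<^sup>2\<close> there, and \<open>R\<close>, having no negative eigenvalues, would have an
  eigenvector missing from \<open>S\<close>.
  The limits in question are uniform limits of continuous functions.
  
  If \<open>R \<phi> = \<mu> \<phi>\<close>, then \<open>D \<phi> = \<lambda> \<phi>\<close> with \<open>\<lambda> = 1/\<mu> - k0\<^sup>2\<close>. The bound on \<open>R\<close> yields
  \<open>\<bar>\<phi> x\<bar> \<le> C/\<mu>\<close> and \<open>\<Sum> \<mu>\<^sup>2 < \<infinity>\<close>, so that
  \<open>\<Sum>\<phi>. exp (- \<lambda> t) \<phi> x \<phi> y\<close> and its derivative in \<open>t\<close> converge uniformly. This sum is a heat
  kernel (\<open>kernel_exists\<close>). Conversely, for any heat kernel \<open>e\<close> the coefficient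
  \<open>b t = \<integral> e t x y \<phi> y dy\<close> satisfies \<open>b' = - \<lambda> b\<close> by Green's formula and \<open>b t \<rightarrow> \<phi> x\<close>, so
  \<open>b t = exp (- \<lambda> t) \<phi> x\<close>. Two heat kernels therefore differ by a continuous function orthogonal to
  \<open>S\<close>, which is zero (\<open>kernel_unique\<close>).
  
  The domain of \<open>D\<close> is defined through absolutely continuous derivatives. Integration by parts in it rests
  on the fundamental theorem of calculus for absolutely continuous functions. It is proved from almost
  everywhere differentiability by Vitali coverings and an adapted gauge.
\<close>

section \<open>Almost everywhere differentiability\<close>

lemma additive_division:
  fixes F :: "real \<Rightarrow> real"
  assumes "\<D> division_of {u..v}" "u \<le> v"
  shows "(\<Sum>K\<in>\<D>. F (Sup K) - F (Inf K)) = F v - F u"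
proof -
  have K: "\<exists>c d. c \<le> d \<and> K = {c..d}" if "K \<in> \<D>" for K
    using division_ofD(3,4)[OF assms(1) that] by (metis atLeastatMost_empty_iff cbox_interval)
  have inj: "inj_on (\<lambda>K. (Inf K, K)) \<D>" by (auto intro: inj_onI)
  have "(\<lambda>K. (Inf K, K)) ` \<D> tagged_division_of {u..v}"
  proof (rule tagged_division_ofI)
    show "finite ((\<lambda>K. (Inf K, K)) ` \<D>)" using assms(1) by auto
    show "\<Union>{K. \<exists>x. (x, K) \<in> (\<lambda>K. (Inf K, K)) ` \<D>} = {u..v}"
      using division_ofD(6)[OF assms(1)] by (auto simp: image_def)
  next
    fix x K1 y K2 assume "(x, K1) \<in> (\<lambda>K. (Inf K, K)) ` \<D>" "(y, K2) \<in> (\<lambda>K. (Inf K, K)) ` \<D>" "(x, K1) \<noteq> (y, K2)"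
    then show "interior K1 \<inter> interior K2 = {}" using division_ofD(5)[OF assms(1)] by auto
  next
    fix x K assume "(x, K) \<in> (\<lambda>K. (Inf K, K)) ` \<D>"
    then have "K \<in> \<D>" "x = Inf K" by auto
    then show "x \<in> K" "K \<subseteq> {u..v}" "\<exists>a b. K = cbox a b"
      using K[of K] division_ofD(2)[OF assms(1)] by auto
  qed
  from additive_tagged_division_1[OF assms(2) this, of F] show ?thesis
    by (simp add: sum.reindex[OF inj] o_def)
qed

text \<open>
  A finite part of the disjoint family given by the Vitali covering theorem already exhausts \<open>S\<close> up to
  \<open>\<eta>\<close>. Finiteness is what makes the family extendable to a division of the whole interval.
\<close>

lemma finite_Vitali_intervals:
  fixes S :: "real set"
  assumes S: "S \<in> lmeasurable" "S \<subseteq> {u<..<v}" and \<eta>: "0 < \<eta>"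
    and cov: "\<And>x r. x \<in> S \<Longrightarrow> 0 < r \<Longrightarrow> \<exists>p q. p < q \<and> x \<in> {p..q} \<and> q - p < r \<and> P p q"
  obtains I where "finite I" "\<And>p q. (p, q) \<in> I \<Longrightarrow> u \<le> p \<and> p < q \<and> q \<le> v \<and> P p q"
    "pairwise (\<lambda>i j. disjnt {fst i..snd i} {fst j..snd j}) I"
    "measure lebesgue S - \<eta> \<le> (\<Sum>(p, q)\<in>I. measure lebesgue (S \<inter> {p..q}))"
    "measure lebesgue S - \<eta> \<le> (\<Sum>(p, q)\<in>I. q - p)"
proof -
  define K where "K = {(p, q). u \<le> p \<and> p < q \<and> q \<le> v \<and> P p q}"
  define c where "c = (\<lambda>i::real\<times>real. (fst i + snd i) / 2)"
  define r where "r = (\<lambda>i::real\<times>real. (snd i - fst i) / 2)"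
  have cb: "cball (c i) (r i) = {fst i..snd i}" for i
    by (auto simp: c_def r_def cball_eq_atLeastAtMost field_simps)
  have rpos: "0 < r i" if "i \<in> K" for i using that by (auto simp: K_def r_def)
  have fine: "\<exists>i. i \<in> K \<and> x \<in> cball (c i) (r i) \<and> r i < d" if xd: "x \<in> S" "0 < d" for x d
  proof -
    have x: "u < x" "x < v" using xd S(2) by auto
    obtain p q where pq: "p < q" "x \<in> {p..q}" "q - p < min d (min (x - u) (v - x))" "P p q"
      using cov[OF xd(1), of "min d (min (x - u) (v - x))"] x xd(2) by auto
    then have "(p, q) \<in> K" by (auto simp: K_def)
    moreover have "r (p, q) < d" using pq by (auto simp: r_def)
    ultimately show ?thesis using pq by (intro exI[of _ "(p, q)"]) (auto simp: cb)
  qed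
  obtain C where C: "countable C" "C \<subseteq> K" 
    "pairwise (\<lambda>i j. disjnt (cball (c i) (r i)) (cball (c j) (r j))) C"
    "negligible (S - (\<Union>i\<in>C. cball (c i) (r i)))"
    using Vitali_covering_theorem_cballs[of K r S c, OF rpos fine] by blast
  have neg: "negligible (S - (\<Union>i\<in>C. {fst i..snd i}))" using C(4) unfolding cb .
  have "\<exists>I. finite I \<and> I \<subseteq> C \<and> measure lebesgue S - \<eta> \<le> measure lebesgue (S \<inter> (\<Union>i\<in>I. {fst i..snd i}))"
  proof (cases "C = {}")
    case True
    then have "negligible S" using neg by auto
    then show ?thesis using \<eta> by (intro exI[of _ "{}"]) (auto simp: negligible_imp_measure0)
  next
    case False
    define A where "A = (\<lambda>n. S \<inter> (\<Union>m<n. {fst (from_nat_into C m)..snd (from_nat_into C m)}))"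
    have Am: "A n \<in> lmeasurable" for n
      unfolding A_def by (intro fmeasurable_Int_fmeasurable S(1) sets.finite_UN) auto
    have UA: "(\<Union>n. A n) = S \<inter> (\<Union>i\<in>C. {fst i..snd i})"
    proof -
      have "(\<Union>n. A n) = S \<inter> (\<Union>i\<in>range (from_nat_into C). {fst i..snd i})"
        unfolding A_def by (auto intro: lessI)
      then show ?thesis unfolding range_from_nat_into[OF False C(1)] .
    qed
    have mU: "(\<Union>n. A n) \<in> lmeasurable"
      unfolding UA using C(1) by (intro fmeasurable_Int_fmeasurable S(1) sets.countable_UN') auto
    have "(\<lambda>n. measure lebesgue (A n)) \<longlonglongrightarrow> measure lebesgue (\<Union>n. A n)"
    proof (rule Lim_measure_incseq)
      show "range A \<subseteq> sets lebesgue" using Am by (auto simp: fmeasurableD)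
      show "incseq A" unfolding A_def incseq_def by fastforce
      show "emeasure lebesgue (\<Union>n. A n) \<noteq> \<infinity>" using mU by (metis fmeasurableD2 infinity_ennreal_def)
    qed
    moreover have "measure lebesgue (\<Union>n. A n) = measure lebesgue S"
      unfolding UA using neg
      by (intro measure_negligible_symdiff[OF S(1)]) 
         (rule negligible_subset[OF neg], blast)
    ultimately have "eventually (\<lambda>n. measure lebesgue S - \<eta> < measure lebesgue (A n)) sequentially"
      using \<eta> by (intro order_tendstoD(1)) auto
    then obtain n where n: "measure lebesgue S - \<eta> < measure lebesgue (A n)"
      by (auto simp: eventually_sequentially)
    show ?thesis
      using n from_nat_into[OF False] unfolding A_def
      by (intro exI[of _ "from_nat_into C ` {..<n}"]) (auto simp: image_UN)
  qed
  then obtain I where I: "finite I" "I \<subseteq> C" 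
    "measure lebesgue S - \<eta> \<le> measure lebesgue (S \<inter> (\<Union>i\<in>I. {fst i..snd i}))" by blast
  have le1: "measure lebesgue (S \<inter> (\<Union>i\<in>I. {fst i..snd i})) \<le> (\<Sum>i\<in>I. measure lebesgue (S \<inter> {fst i..snd i}))"
  proof -
    have "S \<inter> (\<Union>i\<in>I. {fst i..snd i}) = (\<Union>i\<in>I. S \<inter> {fst i..snd i})" by auto
    moreover have "S \<inter> {fst i..snd i} \<in> sets lebesgue" for i
      using S(1) by (auto simp: fmeasurableD)
    ultimately show ?thesis using measure_UNION_le[OF I(1), of "\<lambda>i. S \<inter> {fst i..snd i}" lebesgue] by simp
  qed
  have le2: "(\<Sum>i\<in>I. measure lebesgue (S \<inter> {fst i..snd i})) \<le> (\<Sum>i\<in>I. snd i - fst i)"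
  proof (rule sum_mono)
    fix i assume "i \<in> I"
    then have "fst i \<le> snd i" using I C by (auto simp: K_def)
    have "measure lebesgue (S \<inter> {fst i..snd i}) \<le> measure lebesgue {fst i..snd i}"
      by (intro measure_mono_fmeasurable) (auto simp: S fmeasurable_Int_fmeasurable fmeasurableD)
    then show "measure lebesgue (S \<inter> {fst i..snd i}) \<le> snd i - fst i" using \<open>fst i \<le> snd i\<close> by simp
  qed
  show thesis
  proof (rule that[OF I(1)])
    show "u \<le> p \<and> p < q \<and> q \<le> v \<and> P p q" if "(p, q) \<in> I" for p q
      using that I C by (auto simp: K_def)
    show "pairwise (\<lambda>i j. disjnt {fst i..snd i} {fst j..snd j}) I"
      using C(3) I(2) unfolding cb by (meson pairwise_subset)
    show "measure lebesgue S - \<eta> \<le> (\<Sum>(p, q)\<in>I. measure lebesgue (S \<inter> {p..q}))"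
      using I(3) le1 by (simp add: case_prod_beta)
    show "measure lebesgue S - \<eta> \<le> (\<Sum>(p, q)\<in>I. q - p)"
      using I(3) le1 le2 by (simp add: case_prod_beta)
  qed
qed

lemma disjoint_intervals_extend:
  fixes I :: "(real \<times> real) set"
  assumes "finite I" and I: "\<And>p q. (p, q) \<in> I \<Longrightarrow> u \<le> p \<and> p < q \<and> q \<le> v"
    and dis: "pairwise (\<lambda>i j. disjnt {fst i..snd i} {fst j..snd j}) I"
  obtains \<D> where "\<D> division_of {u..v}" "(\<lambda>(p,q). {p..q}) ` I \<subseteq> \<D>" "inj_on (\<lambda>(p,q). {p..q}) I"
proof -
  have inj: "inj_on (\<lambda>(p,q). {p..q}) I"
    by (rule inj_onI) (use I in \<open>force simp: Icc_eq_Icc\<close>)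
  let ?C = "(\<lambda>(p,q). {p..q}) ` I"
  have "?C division_of (\<Union>?C)"
  proof (rule division_ofI)
    show "finite ?C" using assms(1) by simp
    fix K assume K: "K \<in> ?C"
    then show "K \<subseteq> \<Union>?C" by blast
    show "K \<noteq> {}" using K I by force
    show "\<exists>a b. K = cbox a b" using K by (force simp: cbox_interval)
  next
    fix K1 K2 assume "K1 \<in> ?C" "K2 \<in> ?C" "K1 \<noteq> K2"
    then have "K1 \<inter> K2 = {}" using dis by (force simp: pairwise_def disjnt_def)
    then show "interior K1 \<inter> interior K2 = {}" using interior_subset by blast
  qed simp
  moreover have "{{u..v}} division_of {u..v}" if "u \<le> v"
    using division_of_self[of u v] that by (auto simp: cbox_interval)
  moreover have "\<Union>?C \<subseteq> {u..v}" using I by (auto split: prod.splits) (force+)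
  ultimately show thesis
  proof (cases "I = {}")
    case True
    then show thesis using elementary_interval[of u v] that by (metis cbox_interval empty_subsetI image_empty inj)
  next
    case False
    then obtain p q where "(p,q) \<in> I" by (metis equals0I surj_pair)
    then have "u \<le> v" using I by force
    then show thesis
      using partial_division_extend[OF \<open>?C division_of (\<Union>?C)\<close> _ \<open>\<Union>?C \<subseteq> {u..v}\<close>] inj that
      by (metis \<open>u \<le> v \<Longrightarrow> {{u..v}} division_of {u..v}\<close>)
  qed
qed

text \<open>
  If arbitrarily short intervals around each point of \<open>E\<close> have slopes \<open>\<ge> \<epsilon>\<close> and others have slopes
  \<open>\<le> - \<epsilon>\<close>, then \<open>F\<close> oscillates so much that the variation on an interval exceeds
  \<open>n * \<epsilon> * measure E\<close> for every \<open>n\<close>. In the induction step, \<open>E\<close> is covered by disjoint intervals whose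
  slopes have the sign opposite to \<open>F v - F u\<close>. The variation inside them is bounded by the induction
  hypothesis, while outside of them \<open>F\<close> has to make up for the movement in the wrong direction, which
  costs another \<open>\<epsilon> * measure E\<close>.
\<close>

lemma oscillating_slopes_null:
  fixes F V :: "real \<Rightarrow> real"
  assumes V: "\<And>u v. a \<le> u \<Longrightarrow> u \<le> v \<Longrightarrow> v \<le> b \<Longrightarrow> \<bar>F v - F u\<bar> \<le> V v - V u"
    and E: "E \<in> lmeasurable" "E \<subseteq> {a<..<b}" and "0 < \<epsilon>"
    and up: "\<And>x r. x \<in> E \<Longrightarrow> 0 < r \<Longrightarrow> \<exists>p q. p < q \<and> x \<in> {p..q} \<and> q - p < r \<and> \<epsilon> * (q - p) \<le> F q - F p"
    and down: "\<And>x r. x \<in> E \<Longrightarrow> 0 < r \<Longrightarrow> \<exists>p q. p < q \<and> x \<in> {p..q} \<and> q - p < r \<and> F q - F p \<le> - \<epsilon> * (q - p)"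
  shows "negligible E"
proof (cases "a \<le> b")
  case False
  then have "E = {}" using E(2) by auto
  then show ?thesis by simp
next
  case ab: True
  have claim: "n * \<epsilon> * measure lebesgue (E \<inter> {u..v}) \<le> V v - V u" if uv: "a \<le> u" "u \<le> v" "v \<le> b" for n :: nat and u v
    using uv
  proof (induction n arbitrary: u v)
    case 0
    then show ?case using V[of u v] by simp
  next
    case (Suc n)
    define S where "S = E \<inter> {u<..<v}"
    have S: "S \<in> lmeasurable" "S \<subseteq> {u<..<v}"
      unfolding S_def using E(1) by (auto intro: fmeasurable_Int_fmeasurable)
    have mS: "measure lebesgue (E \<inter> {u..v}) = measure lebesgue S"
    proof -
      have "negligible ((E \<inter> {u..v} - S) \<union> (S - E \<inter> {u..v}))"
        by (rule negligible_subset[of "{u,v}"]) (auto simp: S_def)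
      then show ?thesis using measure_negligible_symdiff[OF S(1), of "E \<inter> {u..v}"]
        by (simp add: Un_commute)
    qed
    \<comment> \<open>The sign of the total increment; the covering intervals move against it.\<close>
    define \<sigma> :: real where "\<sigma> = (if 0 \<le> F v - F u then 1 else -1)"
    have \<sigma>: "0 \<le> \<sigma> * (F v - F u)" "\<sigma> * x \<le> \<bar>x\<bar>" for x by (auto simp: \<sigma>_def)
    define P where "P = (\<lambda>p q. \<sigma> * (F q - F p) \<le> - \<epsilon> * (q - p))"
    have cov: "\<exists>p q. p < q \<and> x \<in> {p..q} \<and> q - p < r \<and> P p q" if xr: "x \<in> S" "0 < r" for x r
    proof -
      have "x \<in> E" using xr by (simp add: S_def)
      show ?thesis
      proof (cases "0 \<le> F v - F u")
        case True then show ?thesis using down[OF \<open>x \<in> E\<close> xr(2)] by (auto simp: P_def \<sigma>_def)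
      next
        case False
        obtain p q where "p < q" "x \<in> {p..q}" "q - p < r" "\<epsilon> * (q - p) \<le> F q - F p"
          using up[OF \<open>x \<in> E\<close> xr(2)] by auto
        then show ?thesis using False by (intro exI[of _ p] exI[of _ q]) (auto simp: P_def \<sigma>_def)
      qed
    qed
    have "Suc n * \<epsilon> * (measure lebesgue S - \<eta>) \<le> V v - V u" if \<eta>: "0 < \<eta>" for \<eta>
    proof -
      obtain I where I: "finite I" "\<And>p q. (p, q) \<in> I \<Longrightarrow> u \<le> p \<and> p < q \<and> q \<le> v \<and> P p q"
        "pairwise (\<lambda>i j. disjnt {fst i..snd i} {fst j..snd j}) I"
        "measure lebesgue S - \<eta> \<le> (\<Sum>(p, q)\<in>I. measure lebesgue (S \<inter> {p..q}))"
        "measure lebesgue S - \<eta> \<le> (\<Sum>(p, q)\<in>I. q - p)"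
        using finite_Vitali_intervals[OF S \<eta> cov] by blast
      obtain \<D> where \<D>: "\<D> division_of {u..v}" "(\<lambda>(p,q). {p..q}) ` I \<subseteq> \<D>" "inj_on (\<lambda>(p,q). {p..q}) I"
        using disjoint_intervals_extend[OF I(1) _ I(3), of u v] I(2) by metis
      have fin: "finite \<D>" using \<D>(1) by auto
      let ?C = "(\<lambda>(p,q). {p..q}) ` I"
      have sumC: "(\<Sum>K\<in>?C. g (Sup K) - g (Inf K)) = (\<Sum>(p,q)\<in>I. g q - g p)" for g :: "real \<Rightarrow> real"
        using I(2) by (subst sum.reindex[OF \<D>(3)]) (fastforce intro!: sum.cong simp: less_imp_le)
      have split: "g v - g u = (\<Sum>(p,q)\<in>I. g q - g p) + (\<Sum>K\<in>\<D> - ?C. g (Sup K) - g (Inf K))" for g :: "real \<Rightarrow> real"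
        using additive_division[OF \<D>(1) Suc.prems(2), of g] sum.subset_diff[OF \<D>(2) fin, of "\<lambda>K. g (Sup K) - g (Inf K)"]
        by (simp add: sumC)
      have 1: "n * \<epsilon> * (measure lebesgue S - \<eta>) \<le> (\<Sum>(p,q)\<in>I. V q - V p)"
      proof -
        have "n * \<epsilon> * (measure lebesgue S - \<eta>) \<le> n * \<epsilon> * (\<Sum>(p, q)\<in>I. measure lebesgue (S \<inter> {p..q}))"
          using I(4) \<open>0 < \<epsilon>\<close> by (intro mult_left_mono) auto
        also have "\<dots> = (\<Sum>(p, q)\<in>I. n * \<epsilon> * measure lebesgue (S \<inter> {p..q}))"
          by (simp add: sum_distrib_left case_prod_beta)
        also have "\<dots> \<le> (\<Sum>(p,q)\<in>I. V q - V p)"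
        proof (rule sum_mono, clarify)
          fix p q assume pq: "(p, q) \<in> I"
          have "measure lebesgue (S \<inter> {p..q}) \<le> measure lebesgue (E \<inter> {p..q})"
            using E(1) S(1) by (intro measure_mono_fmeasurable) (auto simp: S_def fmeasurableD intro!: fmeasurable_Int_fmeasurable)
          then have "n * \<epsilon> * measure lebesgue (S \<inter> {p..q}) \<le> n * \<epsilon> * measure lebesgue (E \<inter> {p..q})"
            using \<open>0 < \<epsilon>\<close> by (intro mult_left_mono) auto
          also have "\<dots> \<le> V q - V p" using I(2)[OF pq] Suc.prems by (intro Suc.IH) auto
          finally show "n * \<epsilon> * measure lebesgue (S \<inter> {p..q}) \<le> V q - V p" .
        qed
        finally show ?thesis .
      qed
      have 2: "\<epsilon> * (measure lebesgue S - \<eta>) \<le> (\<Sum>K\<in>\<D> - ?C. V (Sup K) - V (Inf K))"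
      proof -
        have "\<epsilon> * (measure lebesgue S - \<eta>) \<le> \<epsilon> * (\<Sum>(p, q)\<in>I. q - p)"
          using I(5) \<open>0 < \<epsilon>\<close> by (intro mult_left_mono) auto
        also have "\<dots> = (\<Sum>(p, q)\<in>I. \<epsilon> * (q - p))"
          by (simp add: sum_distrib_left case_prod_beta)
        also have "\<dots> \<le> (\<Sum>(p,q)\<in>I. - \<sigma> * (F q - F p))"
          using I(2) by (intro sum_mono) (force simp: P_def)
        also have "\<dots> = - \<sigma> * (\<Sum>(p,q)\<in>I. F q - F p)"
          by (simp add: sum_distrib_left case_prod_beta sum_negf)
        also have "\<dots> = \<sigma> * (\<Sum>K\<in>\<D> - ?C. F (Sup K) - F (Inf K)) - \<sigma> * (F v - F u)"
          using split[of F] by (simp add: algebra_simps)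
        also have "\<dots> \<le> (\<Sum>K\<in>\<D> - ?C. \<sigma> * (F (Sup K) - F (Inf K)))"
          using \<sigma>(1) by (simp add: sum_distrib_left)
        also have "\<dots> \<le> (\<Sum>K\<in>\<D> - ?C. V (Sup K) - V (Inf K))"
        proof (rule sum_mono)
          fix K assume "K \<in> \<D> - ?C"
          then have "K \<subseteq> {u..v}" "K \<noteq> {}" "\<exists>c d. K = {c..d}"
            using division_ofD(2,3,4)[OF \<D>(1), of K] by (auto simp: cbox_interval)
          then have "u \<le> Inf K" "Inf K \<le> Sup K" "Sup K \<le> v" by auto
          then have "\<bar>F (Sup K) - F (Inf K)\<bar> \<le> V (Sup K) - V (Inf K)" using Suc.prems by (intro V) auto
          then show "\<sigma> * (F (Sup K) - F (Inf K)) \<le> V (Sup K) - V (Inf K)"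
            using \<sigma>(2)[of "F (Sup K) - F (Inf K)"] by linarith
        qed
        finally show ?thesis .
      qed
      have "V v - V u = (\<Sum>(p,q)\<in>I. V q - V p) + (\<Sum>K\<in>\<D> - ?C. V (Sup K) - V (Inf K))" by (rule split)
      then show ?thesis using 1 2 by (simp add: algebra_simps)
    qed note * = this
    have "Suc n * \<epsilon> * measure lebesgue S \<le> V v - V u"
    proof (rule field_le_epsilon)
      fix e :: real assume "0 < e"
      have pos: "0 < Suc n * \<epsilon>" using \<open>0 < \<epsilon>\<close> by simp
      have "Suc n * \<epsilon> * (measure lebesgue S - e / (Suc n * \<epsilon>)) = Suc n * \<epsilon> * measure lebesgue S - e"
        using pos by (simp add: field_simps)
      then show "Suc n * \<epsilon> * measure lebesgue S \<le> V v - V u + e"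
        using *[of "e / (Suc n * \<epsilon>)"] \<open>0 < e\<close> pos by (simp del: of_nat_Suc)
    qed
    then show ?case unfolding mS .
  qed
  have EE: "E \<inter> {a..b} = E" using E(2) by auto
  have le: "real n * (\<epsilon> * measure lebesgue E) \<le> V b - V a" for n
    using claim[of a b n] ab unfolding EE by (simp add: mult.assoc)
  have "measure lebesgue E = 0"
  proof (rule ccontr)
    assume "measure lebesgue E \<noteq> 0"
    then have "0 < \<epsilon> * measure lebesgue E" using \<open>0 < \<epsilon>\<close> by (simp add: zero_less_measure_iff)
    then obtain n where "V b - V a < real n * (\<epsilon> * measure lebesgue E)" using reals_Archimedean3 by blast
    then show False using le[of n] by linarith
  qed
  then show ?thesis using E(1) by (simp add: negligible_iff_measure)
qed

text \<open>
  Slopes of size \<open>M\<close> on disjoint intervals that fill half of \<open>E\<close> force a variation of at least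
  \<open>M * measure E / 2\<close>.
\<close>

lemma steep_slopes_null:
  fixes F V :: "real \<Rightarrow> real"
  assumes V: "\<And>u v. a \<le> u \<Longrightarrow> u \<le> v \<Longrightarrow> v \<le> b \<Longrightarrow> \<bar>F v - F u\<bar> \<le> V v - V u"
    and E: "E \<in> lmeasurable" "E \<subseteq> {a<..<b}"
    and steep: "\<And>M x r. x \<in> E \<Longrightarrow> 0 < r \<Longrightarrow> \<exists>p q. p < q \<and> x \<in> {p..q} \<and> q - p < r \<and> real M * (q - p) \<le> \<bar>F q - F p\<bar>"
  shows "negligible E"
proof (cases "a \<le> b")
  case False
  then have "E = {}" using E(2) by auto
  then show ?thesis by simp
next
  case ab: True
  have le: "real M * (measure lebesgue E / 2) \<le> V b - V a" if mE: "0 < measure lebesgue E" for M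
  proof -
    have \<eta>: "0 < measure lebesgue E / 2" using mE by simp
    define P where "P = (\<lambda>p q. real M * (q - p) \<le> \<bar>F q - F p\<bar>)"
    have cov: "\<exists>p q. p < q \<and> x \<in> {p..q} \<and> q - p < r \<and> P p q" if "x \<in> E" "0 < r" for x r
      using steep[OF that] unfolding P_def .
    obtain I where I: "finite I" "\<And>p q. (p, q) \<in> I \<Longrightarrow> a \<le> p \<and> p < q \<and> q \<le> b \<and> P p q"
        "pairwise (\<lambda>i j. disjnt {fst i..snd i} {fst j..snd j}) I"
        "measure lebesgue E - measure lebesgue E / 2 \<le> (\<Sum>(p, q)\<in>I. measure lebesgue (E \<inter> {p..q}))"
        "measure lebesgue E - measure lebesgue E / 2 \<le> (\<Sum>(p, q)\<in>I. q - p)"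
      using finite_Vitali_intervals[OF E \<eta> cov] by blast
    obtain \<D> where \<D>: "\<D> division_of {a..b}" "(\<lambda>(p,q). {p..q}) ` I \<subseteq> \<D>" "inj_on (\<lambda>(p,q). {p..q}) I"
      using disjoint_intervals_extend[OF I(1) _ I(3), of a b] I(2) by metis
    have fin: "finite \<D>" using \<D>(1) by auto
    have pos: "0 \<le> V (Sup K) - V (Inf K)" if "K \<in> \<D>" for K
    proof -
      have "K \<subseteq> {a..b}" "K \<noteq> {}" "\<exists>c d. K = {c..d}"
        using division_ofD(2,3,4)[OF \<D>(1) that] by (auto simp: cbox_interval)
      then have "a \<le> Inf K" "Inf K \<le> Sup K" "Sup K \<le> b" by auto
      then show ?thesis using V[of "Inf K" "Sup K"] by linarith
    qed
    have "real M * (measure lebesgue E / 2) \<le> real M * (\<Sum>(p, q)\<in>I. q - p)"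
      using I(5) by (intro mult_left_mono) auto
    also have "\<dots> = (\<Sum>(p, q)\<in>I. real M * (q - p))" by (simp add: sum_distrib_left case_prod_beta)
    also have "\<dots> \<le> (\<Sum>(p, q)\<in>I. V q - V p)"
    proof (rule sum_mono, clarify)
      fix p q assume "(p, q) \<in> I"
      from I(2)[OF this] have "a \<le> p" "p \<le> q" "q \<le> b" "real M * (q - p) \<le> \<bar>F q - F p\<bar>" by (simp_all add: P_def)
      then show "real M * (q - p) \<le> V q - V p" using V[of p q] by linarith
    qed
    also have "\<dots> = (\<Sum>K\<in>(\<lambda>(p,q). {p..q}) ` I. V (Sup K) - V (Inf K))"
      using I(2) by (subst sum.reindex[OF \<D>(3)]) (fastforce intro!: sum.cong simp: less_imp_le)
    also have "\<dots> \<le> (\<Sum>K\<in>\<D>. V (Sup K) - V (Inf K))"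
      using \<D>(2) fin pos by (intro sum_mono2) auto
    also have "\<dots> = V b - V a" by (rule additive_division[OF \<D>(1) ab])
    finally show ?thesis .
  qed
  have "measure lebesgue E = 0"
  proof (rule ccontr)
    assume "measure lebesgue E \<noteq> 0"
    then have *: "0 < measure lebesgue E" by (simp add: zero_less_measure_iff)
    then have "0 < measure lebesgue E / 2" by simp
    then obtain n where "V b - V a < real n * (measure lebesgue E / 2)" using reals_Archimedean3 by blast
    then show False using le[OF *, of n] by linarith
  qed
  then show ?thesis using E(1) by (simp add: negligible_iff_measure)
qed

text \<open>
  Difference quotients over short intervals containing \<open>x\<close> fail to converge only if they cross two
  rationals \<open>s < t\<close> infinitely often or are unbounded. The first exceptional set is null because
  \<open>F x - (s + t) / 2 * x\<close> has oscillating slopes there, the second because it has steep slopes.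
\<close>

lemma bounded_variation_differentiable_ae:
  fixes F V :: "real \<Rightarrow> real"
  assumes V: "\<And>u v. a \<le> u \<Longrightarrow> u \<le> v \<Longrightarrow> v \<le> b \<Longrightarrow> \<bar>F v - F u\<bar> \<le> V v - V u"
    and cont: "continuous_on {a..b} F"
  shows "\<exists>N. negligible N \<and> (\<forall>x\<in>{a<..<b} - N. F differentiable (at x))"
proof -
  define Up where "Up = (\<lambda>s n. \<Union>{{p<..<q} | p q. a \<le> p \<and> q \<le> b \<and> p < q \<and> q - p < inverse (real (Suc n)) \<and> s * (q - p) < F q - F p})"
  define Dn where "Dn = (\<lambda>s n. \<Union>{{p<..<q} | p q. a \<le> p \<and> q \<le> b \<and> p < q \<and> q - p < inverse (real (Suc n)) \<and> F q - F p < s * (q - p)})"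
  \<comment> \<open>The points around which arbitrarily short intervals have slope above \<open>s\<close>, and below \<open>s\<close>.\<close>
  define LU where "LU = (\<lambda>s. \<Inter>n. Up s n)"
  define LD where "LD = (\<lambda>s. \<Inter>n. Dn s n)"
  have borel: "LU s \<in> sets borel" "LD s \<in> sets borel" for s
  proof -
    have "open (Up s n)" "open (Dn s n)" for n
      unfolding Up_def Dn_def by (auto intro!: open_Union)
    then show "LU s \<in> sets borel" "LD s \<in> sets borel"
      unfolding LU_def LD_def by (intro sets.countable_INT' borel_open; auto)+
  qed
  have "Up s 0 \<subseteq> {a<..<b}" "Dn s 0 \<subseteq> {a<..<b}" for s
    unfolding Up_def Dn_def by auto
  then have sub: "LU s \<subseteq> {a<..<b}" "LD s \<subseteq> {a<..<b}" for s
    unfolding LU_def LD_def by blast+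
  have lm: "A \<in> lmeasurable" if "A \<in> sets borel" "A \<subseteq> {a<..<b}" for A
    using that by (intro bounded_set_imp_lmeasurable bounded_subset[OF bounded_Ioo that(2)]) auto
  have LU: "\<exists>p q. p < q \<and> x \<in> {p..q} \<and> q - p < r \<and> a \<le> p \<and> q \<le> b \<and> s * (q - p) < F q - F p" if xr: "x \<in> LU s" "0 < r" for x r s
  proof -
    obtain n where "inverse (real (Suc n)) < r" using reals_Archimedean[OF xr(2)] by auto
    moreover have "x \<in> Up s n" using that by (auto simp: LU_def)
    ultimately show ?thesis unfolding Up_def by (auto intro: less_imp_le) (metis less_imp_le order.strict_trans)
  qed
  have LD: "\<exists>p q. p < q \<and> x \<in> {p..q} \<and> q - p < r \<and> a \<le> p \<and> q \<le> b \<and> F q - F p < s * (q - p)" if xr: "x \<in> LD s" "0 < r" for x r s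
  proof -
    obtain n where "inverse (real (Suc n)) < r" using reals_Archimedean[OF xr(2)] by auto
    moreover have "x \<in> Dn s n" using that by (auto simp: LD_def)
    ultimately show ?thesis unfolding Dn_def by (auto intro: less_imp_le) (metis less_imp_le order.strict_trans)
  qed
  define N1 where "N1 = (\<Union>st\<in>{st \<in> \<rat> \<times> \<rat>. fst st < snd st}. LD (fst st) \<inter> LU (snd st))"
  define N2 where "N2 = (\<Inter>M::nat. LU (real M))"
  define N3 where "N3 = (\<Inter>M::nat. LD (- real M))"
  have neg1: "negligible (LD s \<inter> LU t)" if "s < t" for s t
  proof (rule oscillating_slopes_null[where F="\<lambda>x. F x - (s+t)/2 * x" and V="\<lambda>x. V x + \<bar>(s+t)/2\<bar> * x" and \<epsilon>="(t-s)/2"])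
    show "\<bar>F v - (s + t) / 2 * v - (F u - (s + t) / 2 * u)\<bar> \<le> V v + \<bar>(s + t) / 2\<bar> * v - (V u + \<bar>(s + t) / 2\<bar> * u)"
      if "a \<le> u" "u \<le> v" "v \<le> b" for u v
    proof -
      have "F v - (s + t) / 2 * v - (F u - (s + t) / 2 * u) = (F v - F u) - (s + t) / 2 * (v - u)"
        by (simp add: field_simps)
      then have "\<bar>F v - (s + t) / 2 * v - (F u - (s + t) / 2 * u)\<bar> = \<bar>(F v - F u) - (s + t) / 2 * (v - u)\<bar>"
        by simp
      also have "\<dots> \<le> \<bar>F v - F u\<bar> + \<bar>(s + t) / 2 * (v - u)\<bar>" by (rule abs_triangle_ineq4)
      also have "\<bar>(s + t) / 2 * (v - u)\<bar> = \<bar>(s + t) / 2\<bar> * (v - u)" using that by (simp add: abs_mult)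
      also have "\<bar>F v - F u\<bar> + \<bar>(s + t) / 2\<bar> * (v - u) \<le> (V v - V u) + \<bar>(s + t) / 2\<bar> * (v - u)"
        using V[OF that] by simp
      finally show ?thesis by (simp only: right_diff_distrib)
    qed
    show "LD s \<inter> LU t \<in> lmeasurable" using borel sub by (intro lm) auto
    show "LD s \<inter> LU t \<subseteq> {a<..<b}" using sub by auto
    show "0 < (t - s) / 2" using that by simp
    show "\<exists>p q. p < q \<and> x \<in> {p..q} \<and> q - p < r \<and> (t - s) / 2 * (q - p) \<le> F q - (s + t) / 2 * q - (F p - (s + t) / 2 * p)"
      if x: "x \<in> LD s \<inter> LU t" and r: "0 < r" for x r
    proof -
      obtain p q where "p < q" "x \<in> {p..q}" "q - p < r" "t * (q - p) < F q - F p"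
        using LU[of x t r] x r by auto
      then show ?thesis by (intro exI[of _ p] exI[of _ q]) (simp add: field_simps)
    qed
    show "\<exists>p q. p < q \<and> x \<in> {p..q} \<and> q - p < r \<and> F q - (s + t) / 2 * q - (F p - (s + t) / 2 * p) \<le> - ((t - s) / 2) * (q - p)"
      if x: "x \<in> LD s \<inter> LU t" and r: "0 < r" for x r
    proof -
      obtain p q where "p < q" "x \<in> {p..q}" "q - p < r" "F q - F p < s * (q - p)"
        using LD[of x s r] x r by auto
      then show ?thesis by (intro exI[of _ p] exI[of _ q]) (simp add: field_simps)
    qed
  qed
  have n1: "negligible N1"
    unfolding N1_def
  proof (rule negligible_countable_Union)
    show "countable ((\<lambda>st. LD (fst st) \<inter> LU (snd st)) ` {st \<in> \<rat> \<times> \<rat>. fst st < snd st})"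
      by (rule countable_image, rule countable_subset[of _ "\<rat> \<times> \<rat>"]) (auto intro: countable_SIGMA countable_rat)
  qed (use neg1 in auto)
  have subN: "N2 \<subseteq> {a<..<b}" "N3 \<subseteq> {a<..<b}" 
    unfolding N2_def N3_def by (rule order_trans[OF INF_lower[OF UNIV_I[of 0]] sub(1)], rule order_trans[OF INF_lower[OF UNIV_I[of 0]] sub(2)])
  have n2: "negligible N2"
  proof (rule steep_slopes_null[where F=F and V=V, OF V])
    show "N2 \<in> lmeasurable" by (intro lm subN) (auto simp: N2_def borel intro!: sets.countable_INT')
    show "N2 \<subseteq> {a<..<b}" by (rule subN)
    show "\<exists>p q. p < q \<and> x \<in> {p..q} \<and> q - p < r \<and> real M * (q - p) \<le> \<bar>F q - F p\<bar>" if "x \<in> N2" "0 < r" for M x r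
    proof -
      have "x \<in> LU (real M)" using that by (auto simp: N2_def)
      from LU[OF this that(2)] show ?thesis by (meson abs_ge_self less_imp_le order_trans)
    qed
  qed
  have n3: "negligible N3"
  proof (rule steep_slopes_null[where F=F and V=V, OF V])
    show "N3 \<in> lmeasurable" by (intro lm subN) (auto simp: N3_def borel intro!: sets.countable_INT')
    show "N3 \<subseteq> {a<..<b}" by (rule subN)
    show "\<exists>p q. p < q \<and> x \<in> {p..q} \<and> q - p < r \<and> real M * (q - p) \<le> \<bar>F q - F p\<bar>" if xN: "x \<in> N3" "0 < r" for M x r
    proof -
      have "x \<in> LD (- real M)" using xN by (auto simp: N3_def)
      from LD[OF this xN(2)] obtain p q where "p < q" "x \<in> {p..q}" "q - p < r" "F q - F p < - real M * (q - p)" by auto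
      then show ?thesis by (intro exI[of _ p] exI[of _ q]) auto
    qed
  qed
  have "F differentiable (at x)" if x: "x \<in> {a<..<b}" and nx: "x \<notin> N1" "x \<notin> N2" "x \<notin> N3" for x
  proof -
    \<comment> \<open>The eventual upper bounds of the slopes at \<open>x\<close>; their infimum is the derivative.\<close>
    define A where "A = {s. \<exists>\<delta>>0. \<forall>p q. a \<le> p \<and> q \<le> b \<and> p < x \<and> x < q \<and> q - p < \<delta> \<longrightarrow> F q - F p \<le> s * (q - p)}"
    have notLU: "s \<in> A" if xs: "x \<notin> LU s" for s
    proof -
      obtain n where n: "x \<notin> Up s n" using xs by (auto simp: LU_def)
      have "F q - F p \<le> s * (q - p)" if pq: "a \<le> p" "q \<le> b" "p < x" "x < q" "q - p < inverse (real (Suc n))" for p q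
      proof (rule ccontr)
        assume "\<not> F q - F p \<le> s * (q - p)"
        then have "x \<in> Up s n" unfolding Up_def using pq
          by (intro UnionI[of "{p<..<q}"] CollectI exI[of _ p] exI[of _ q] conjI) (auto simp del: of_nat_Suc)
        then show False using n by simp
      qed
      then show ?thesis unfolding A_def by (auto intro!: exI[of _ "inverse (real (Suc n))"])
    qed
    have notLD: "\<exists>\<delta>>0. \<forall>p q. a \<le> p \<and> q \<le> b \<and> p < x \<and> x < q \<and> q - p < \<delta> \<longrightarrow> s * (q - p) \<le> F q - F p" if xs: "x \<notin> LD s" for s
    proof -
      obtain n where n: "x \<notin> Dn s n" using xs by (auto simp: LD_def)
      have "s * (q - p) \<le> F q - F p" if pq: "a \<le> p" "q \<le> b" "p < x" "x < q" "q - p < inverse (real (Suc n))" for p q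
      proof (rule ccontr)
        assume "\<not> s * (q - p) \<le> F q - F p"
        then have "x \<in> Dn s n" unfolding Dn_def using pq
          by (intro UnionI[of "{p<..<q}"] CollectI exI[of _ p] exI[of _ q] conjI) (auto simp del: of_nat_Suc)
        then show False using n by simp
      qed
      then show ?thesis by (auto intro!: exI[of _ "inverse (real (Suc n))"])
    qed
    have exq: "\<exists>p q. a \<le> p \<and> q \<le> b \<and> p < x \<and> x < q \<and> q - p < \<delta>" if "0 < \<delta>" for \<delta>
    proof (intro exI conjI)
      define h where "h = min (\<delta>/3) (min (x - a) (b - x))"
      have h: "0 < h" "h \<le> \<delta>/3" "h \<le> x - a" "h \<le> b - x" using x that unfolding h_def by (simp, intro min.cobounded1, linarith, linarith)
      show "a \<le> x - h" "x + h \<le> b" "x - h < x" "x < x + h" "x + h - (x - h) < \<delta>" using h that by auto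
    qed
    have Ane: "A \<noteq> {}" using nx(2) notLU by (auto simp: N2_def)
    obtain M :: nat where "x \<notin> LD (- real M)" using nx(3) by (auto simp: N3_def)
    from notLD[OF this] obtain \<delta>1 where \<delta>1: "\<delta>1 > 0" "\<And>p q. a \<le> p \<and> q \<le> b \<and> p < x \<and> x < q \<and> q - p < \<delta>1 \<Longrightarrow> - real M * (q - p) \<le> F q - F p" by auto
    have Abd: "- real M \<le> s" if sA: "s \<in> A" for s
    proof -
      obtain \<delta> where \<delta>: "\<delta> > 0" "\<And>p q. a \<le> p \<and> q \<le> b \<and> p < x \<and> x < q \<and> q - p < \<delta> \<Longrightarrow> F q - F p \<le> s * (q - p)"
        using sA by (auto simp: A_def)
      obtain p q where pq: "a \<le> p" "q \<le> b" "p < x" "x < q" "q - p < min \<delta> \<delta>1" using exq[of "min \<delta> \<delta>1"] \<delta> \<delta>1 by auto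
      have "- real M * (q - p) \<le> s * (q - p)" using \<delta>(2)[of p q] \<delta>1(2)[of p q] pq by auto
      moreover have "0 < q - p" using pq by auto
      ultimately show ?thesis using mult_le_cancel_right_pos by blast
    qed
    then have bdd: "bdd_below A" by (auto simp: bdd_below_def)
    define d where "d = Inf A"
    have close: "\<exists>\<delta>>0. \<forall>p q. a \<le> p \<and> q \<le> b \<and> p < x \<and> x < q \<and> q - p < \<delta> \<longrightarrow> \<bar>F q - F p - d * (q - p)\<bar> \<le> e * (q - p)" if e: "0 < e" for e
    proof -
      obtain s0 where s0: "s0 \<in> A" "s0 < d + e" using cInf_lessD[OF Ane, of "d + e"] e by (auto simp: d_def)
      obtain \<delta>2 where \<delta>2: "\<delta>2 > 0" "\<And>p q. a \<le> p \<and> q \<le> b \<and> p < x \<and> x < q \<and> q - p < \<delta>2 \<Longrightarrow> F q - F p \<le> s0 * (q - p)"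
        using s0 by (auto simp: A_def)
      obtain s where s: "s \<in> \<rat>" "d - e < s" "s < d" using Rats_dense_in_real[of "d - e" d] e by auto
      obtain t where t: "t \<in> \<rat>" "s < t" "t < d" using Rats_dense_in_real[of s d] s by auto
      have "t \<notin> A" using cInf_lower[OF _ bdd, of t] t by (auto simp: d_def)
      then have "x \<in> LU t" using notLU by blast
      then have "x \<notin> LD s" using nx(1) s t by (auto simp: N1_def)
      from notLD[OF this] obtain \<delta>3 where \<delta>3: "\<delta>3 > 0" "\<And>p q. a \<le> p \<and> q \<le> b \<and> p < x \<and> x < q \<and> q - p < \<delta>3 \<Longrightarrow> s * (q - p) \<le> F q - F p" by auto
      show ?thesis
      proof (intro exI[of _ "min \<delta>2 \<delta>3"] conjI allI impI)
        show "0 < min \<delta>2 \<delta>3" using \<delta>2 \<delta>3 by simp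
        fix p q assume pq: "a \<le> p \<and> q \<le> b \<and> p < x \<and> x < q \<and> q - p < min \<delta>2 \<delta>3"
        have "F q - F p \<le> s0 * (q - p)" "s * (q - p) \<le> F q - F p" using \<delta>2(2)[of p q] \<delta>3(2)[of p q] pq by auto
        moreover have "s0 * (q - p) \<le> (d + e) * (q - p)" "(d - e) * (q - p) \<le> s * (q - p)"
          using s0 s pq by (auto intro!: mult_right_mono)
        ultimately show "\<bar>F q - F p - d * (q - p)\<bar> \<le> e * (q - p)" by (simp add: algebra_simps abs_le_iff)
      qed
    qed
    have Fx: "isCont F x" using cont x by (simp add: continuous_on_interior)
    have "(F has_derivative (\<lambda>h. d * h)) (at x)"
      unfolding has_derivative_at_alt
    proof (intro conjI allI impI)
      show "bounded_linear ((*) d)" by (rule bounded_linear_mult_right)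
      fix e :: real assume "0 < e"
      from close[OF this] obtain \<delta> where \<delta>: "\<delta> > 0" "\<And>p q. a \<le> p \<and> q \<le> b \<and> p < x \<and> x < q \<and> q - p < \<delta> \<Longrightarrow> \<bar>F q - F p - d * (q - p)\<bar> \<le> e * (q - p)" by auto
      define \<delta>' where "\<delta>' = min \<delta> (min (x - a) (b - x))"
      have \<delta>': "0 < \<delta>'" "\<delta>' \<le> \<delta>" "\<delta>' \<le> x - a" "\<delta>' \<le> b - x" using \<delta> x by (auto simp: \<delta>'_def)
      \<comment> \<open>Intervals with \<open>x\<close> in the interior are shrunk to intervals with end point \<open>x\<close> by continuity.\<close>
      have right: "\<bar>F y - F x - d * (y - x)\<bar> \<le> e * (y - x)" if y: "x < y" "y - x < \<delta>'" for y
      proof -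
        have lim: "((\<lambda>p. e * (y - p) - \<bar>F y - F p - d * (y - p)\<bar>) \<longlongrightarrow> e * (y - x) - \<bar>F y - F x - d * (y - x)\<bar>) (at_left x)"
          using Fx by (intro tendsto_intros) (auto simp: isCont_def intro: tendsto_mono[OF at_le])
        have ev: "eventually (\<lambda>p. 0 \<le> e * (y - p) - \<bar>F y - F p - d * (y - p)\<bar>) (at_left x)"
          unfolding eventually_at_left_field
        proof (intro exI[of _ "y - \<delta>'"] conjI allI impI)
          show "y - \<delta>' < x" using y by simp
          fix p assume "y - \<delta>' < p" "p < x"
          then show "0 \<le> e * (y - p) - \<bar>F y - F p - d * (y - p)\<bar>" using \<delta>(2)[of p y] y \<delta>' by simp
        qed
        have "0 \<le> e * (y - x) - \<bar>F y - F x - d * (y - x)\<bar>"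
          by (rule tendsto_lowerbound[OF lim ev]) simp
        then show ?thesis by simp
      qed
      have left: "\<bar>F x - F y - d * (x - y)\<bar> \<le> e * (x - y)" if y: "y < x" "x - y < \<delta>'" for y
      proof -
        have lim: "((\<lambda>q. e * (q - y) - \<bar>F q - F y - d * (q - y)\<bar>) \<longlongrightarrow> e * (x - y) - \<bar>F x - F y - d * (x - y)\<bar>) (at_right x)"
          using Fx by (intro tendsto_intros) (auto simp: isCont_def intro: tendsto_mono[OF at_le])
        have ev: "eventually (\<lambda>q. 0 \<le> e * (q - y) - \<bar>F q - F y - d * (q - y)\<bar>) (at_right x)"
          unfolding eventually_at_right_field
        proof (intro exI[of _ "y + \<delta>'"] conjI allI impI)
          show "x < y + \<delta>'" using y by simp
          fix q assume "x < q" "q < y + \<delta>'"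
          then show "0 \<le> e * (q - y) - \<bar>F q - F y - d * (q - y)\<bar>" using \<delta>(2)[of y q] y \<delta>' by simp
        qed
        have "0 \<le> e * (x - y) - \<bar>F x - F y - d * (x - y)\<bar>"
          by (rule tendsto_lowerbound[OF lim ev]) simp
        then show ?thesis by simp
      qed
      show "\<exists>\<delta>>0. \<forall>y. norm (y - x) < \<delta> \<longrightarrow> norm (F y - F x - d * (y - x)) \<le> e * norm (y - x)"
      proof (intro exI[of _ \<delta>'] conjI allI impI)
        show "0 < \<delta>'" by fact
        fix y assume y: "norm (y - x) < \<delta>'"
        consider "y = x" | "x < y" | "y < x" by linarith
        then show "norm (F y - F x - d * (y - x)) \<le> e * norm (y - x)"
        proof cases
          case 1 then show ?thesis by simp
        next
          case 2 then show ?thesis using right[of y] y by simp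
        next
          case 3
          have "norm (F y - F x - d * (y - x)) = \<bar>F x - F y - d * (x - y)\<bar>" by (simp add: algebra_simps)
          then show ?thesis using left[of y] y 3 by simp
        qed
      qed
    qed
    then show ?thesis by (auto simp: differentiable_def)
  qed
  then show ?thesis using n1 n2 n3 by (intro exI[of _ "N1 \<union> N2 \<union> N3"]) auto
qed

section \<open>Absolutely continuous functions\<close>

lemma division_interval:
  fixes K :: "real set"
  assumes "\<D> division_of T" "K \<in> \<D>"
  obtains "K = {Inf K..Sup K}" "Inf K \<le> Sup K" "Inf K \<in> T" "Sup K \<in> T"
proof -
  obtain c d where "K = {c..d}" using division_ofD(4)[OF assms] by (auto simp: cbox_interval)
  moreover have "K \<noteq> {}" "K \<subseteq> T" using division_ofD(2,3)[OF assms] by auto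
  ultimately show thesis by (intro that) auto
qed

lemma absolutely_continuous_onD:
  assumes "absolutely_continuous_on S F" "0 < \<epsilon>"
  obtains \<delta> where "0 < \<delta>" "\<And>\<D> T. \<D> division_of T \<Longrightarrow> T \<subseteq> S \<Longrightarrow> (\<Sum>K\<in>\<D>. Sup K - Inf K) < \<delta> \<Longrightarrow>
        (\<Sum>K\<in>\<D>. \<bar>F (Sup K) - F (Inf K)\<bar>) < \<epsilon>"
  using assms unfolding absolutely_continuous_on_def by meson

lemma absolutely_continuous_onI:
  assumes "\<And>\<epsilon>. 0 < \<epsilon> \<Longrightarrow> \<exists>\<delta>>0. \<forall>\<D> T. \<D> division_of T \<longrightarrow> T \<subseteq> S \<longrightarrow> (\<Sum>K\<in>\<D>. Sup K - Inf K) < \<delta> \<longrightarrow>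
        (\<Sum>K\<in>\<D>. \<bar>F (Sup K) - F (Inf K)\<bar>) < \<epsilon>"
  shows "absolutely_continuous_on S F"
  unfolding absolutely_continuous_on_def using assms by meson

lemma absolutely_continuous_imp_small:
  assumes "absolutely_continuous_on {a..b} F" "0 < \<epsilon>"
  obtains \<delta> where "0 < \<delta>" "\<And>u v. a \<le> u \<Longrightarrow> u \<le> v \<Longrightarrow> v \<le> b \<Longrightarrow> v - u < \<delta> \<Longrightarrow> \<bar>F v - F u\<bar> < \<epsilon>"
proof -
  obtain \<delta> where \<delta>: "0 < \<delta>" "\<And>\<D> T. \<D> division_of T \<Longrightarrow> T \<subseteq> {a..b} \<Longrightarrow> (\<Sum>K\<in>\<D>. Sup K - Inf K) < \<delta> \<Longrightarrow>
        (\<Sum>K\<in>\<D>. \<bar>F (Sup K) - F (Inf K)\<bar>) < \<epsilon>"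
    using absolutely_continuous_onD[OF assms] by blast
  show thesis
  proof (rule that[OF \<delta>(1)])
    fix u v assume uv: "a \<le> u" "u \<le> v" "v \<le> b" "v - u < \<delta>"
    have "{{u..v}} division_of {u..v}" using division_of_self[of u v] uv by (auto simp: cbox_interval)
    from \<delta>(2)[OF this] show "\<bar>F v - F u\<bar> < \<epsilon>" using uv by auto
  qed
qed

lemma absolutely_continuous_imp_continuous:
  assumes "absolutely_continuous_on {a..b} F"
  shows "continuous_on {a..b} F"
proof (rule continuous_onI)
  fix x e :: real assume x: "x \<in> {a..b}" and "0 < e"
  then obtain \<delta> where \<delta>: "0 < \<delta>" "\<And>u v. a \<le> u \<Longrightarrow> u \<le> v \<Longrightarrow> v \<le> b \<Longrightarrow> v - u < \<delta> \<Longrightarrow> \<bar>F v - F u\<bar> < e"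
    using absolutely_continuous_imp_small[OF assms] by metis
  show "\<exists>d>0. \<forall>x'\<in>{a..b}. dist x' x < d \<longrightarrow> dist (F x') (F x) \<le> e"
  proof (intro exI[of _ \<delta>] conjI ballI impI)
    fix y assume "y \<in> {a..b}" "dist y x < \<delta>"
    then show "dist (F y) (F x) \<le> e"
      using \<delta>(2)[of x y] \<delta>(2)[of y x] x by (cases "x \<le> y") (auto simp: dist_real_def abs_minus_commute less_imp_le)
  qed (rule \<delta>)
qed

lemma lipschitz_imp_absolutely_continuous:
  assumes "\<And>u v. u \<in> S \<Longrightarrow> v \<in> S \<Longrightarrow> u \<le> v \<Longrightarrow> \<bar>F v - F u\<bar> \<le> L * (v - u)"
  shows "absolutely_continuous_on S F"
proof (rule absolutely_continuous_onI)
  fix \<epsilon> :: real assume "0 < \<epsilon>"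
  define L' where "L' = \<bar>L\<bar> + 1"
  have "0 < L'" by (simp add: L'_def)
  show "\<exists>\<delta>>0. \<forall>\<D> T. \<D> division_of T \<longrightarrow> T \<subseteq> S \<longrightarrow> (\<Sum>K\<in>\<D>. Sup K - Inf K) < \<delta> \<longrightarrow>
        (\<Sum>K\<in>\<D>. \<bar>F (Sup K) - F (Inf K)\<bar>) < \<epsilon>"
  proof (intro exI[of _ "\<epsilon> / L'"] conjI allI impI)
    show "0 < \<epsilon> / L'" using \<open>0 < \<epsilon>\<close> \<open>0 < L'\<close> by simp
    fix \<D> T assume D: "\<D> division_of T" "T \<subseteq> S" "(\<Sum>K\<in>\<D>. Sup K - Inf K) < \<epsilon> / L'"
    have "(\<Sum>K\<in>\<D>. \<bar>F (Sup K) - F (Inf K)\<bar>) \<le> (\<Sum>K\<in>\<D>. L' * (Sup K - Inf K))"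
    proof (rule sum_mono)
      fix K assume "K \<in> \<D>"
      from division_interval[OF D(1) this] D(2) have K: "Inf K \<le> Sup K" "Inf K \<in> S" "Sup K \<in> S" by blast+
      then have "\<bar>F (Sup K) - F (Inf K)\<bar> \<le> L * (Sup K - Inf K)" by (intro assms)
      also have "\<dots> \<le> L' * (Sup K - Inf K)" using K(1) by (intro mult_right_mono) (auto simp: L'_def)
      finally show "\<bar>F (Sup K) - F (Inf K)\<bar> \<le> L' * (Sup K - Inf K)" .
    qed
    also have "\<dots> = L' * (\<Sum>K\<in>\<D>. Sup K - Inf K)" by (simp add: sum_distrib_left)
    also have "\<dots> < \<epsilon>" using D(3) \<open>0 < L'\<close> by (simp add: field_simps)
    finally show "(\<Sum>K\<in>\<D>. \<bar>F (Sup K) - F (Inf K)\<bar>) < \<epsilon>" .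
  qed
qed

lemma absolutely_continuous_on_add:
  assumes "absolutely_continuous_on S F" "absolutely_continuous_on S H"
  shows "absolutely_continuous_on S (\<lambda>x. F x + H x)"
proof (rule absolutely_continuous_onI)
  fix \<epsilon> :: real assume "0 < \<epsilon>"
  then have e: "0 < \<epsilon> / 2" by simp
  obtain \<delta>1 where 1: "0 < \<delta>1" "\<And>\<D> T. \<D> division_of T \<Longrightarrow> T \<subseteq> S \<Longrightarrow> (\<Sum>K\<in>\<D>. Sup K - Inf K) < \<delta>1 \<Longrightarrow>
        (\<Sum>K\<in>\<D>. \<bar>F (Sup K) - F (Inf K)\<bar>) < \<epsilon> / 2"
    using absolutely_continuous_onD[OF assms(1) e] by blast
  obtain \<delta>2 where 2: "0 < \<delta>2" "\<And>\<D> T. \<D> division_of T \<Longrightarrow> T \<subseteq> S \<Longrightarrow> (\<Sum>K\<in>\<D>. Sup K - Inf K) < \<delta>2 \<Longrightarrow>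
        (\<Sum>K\<in>\<D>. \<bar>H (Sup K) - H (Inf K)\<bar>) < \<epsilon> / 2"
    using absolutely_continuous_onD[OF assms(2) e] by blast
  show "\<exists>\<delta>>0. \<forall>\<D> T. \<D> division_of T \<longrightarrow> T \<subseteq> S \<longrightarrow> (\<Sum>K\<in>\<D>. Sup K - Inf K) < \<delta> \<longrightarrow>
        (\<Sum>K\<in>\<D>. \<bar>F (Sup K) + H (Sup K) - (F (Inf K) + H (Inf K))\<bar>) < \<epsilon>"
  proof (intro exI[of _ "min \<delta>1 \<delta>2"] conjI allI impI)
    show "0 < min \<delta>1 \<delta>2" using 1 2 by simp
    fix \<D> T assume D: "\<D> division_of T" "T \<subseteq> S" "(\<Sum>K\<in>\<D>. Sup K - Inf K) < min \<delta>1 \<delta>2"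
    have "(\<Sum>K\<in>\<D>. \<bar>F (Sup K) + H (Sup K) - (F (Inf K) + H (Inf K))\<bar>)
        \<le> (\<Sum>K\<in>\<D>. \<bar>F (Sup K) - F (Inf K)\<bar> + \<bar>H (Sup K) - H (Inf K)\<bar>)"
      by (intro sum_mono) linarith
    also have "\<dots> < \<epsilon>" using 1(2)[OF D(1,2)] 2(2)[OF D(1,2)] D(3) by (simp add: sum.distrib)
    finally show "(\<Sum>K\<in>\<D>. \<bar>F (Sup K) + H (Sup K) - (F (Inf K) + H (Inf K))\<bar>) < \<epsilon>" .
  qed
qed

lemma absolutely_continuous_on_mult:
  assumes F: "absolutely_continuous_on {a..b} F" and H: "absolutely_continuous_on {a..b} H"
  shows "absolutely_continuous_on {a..b} (\<lambda>x. F x * H x :: real)"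
proof (rule absolutely_continuous_onI)
  fix \<epsilon> :: real assume "0 < \<epsilon>"
  have "bounded (F ` {a..b})" "bounded (H ` {a..b})"
    using absolutely_continuous_imp_continuous[OF F] absolutely_continuous_imp_continuous[OF H]
    by (auto intro!: compact_imp_bounded compact_continuous_image)
  then obtain MF MH where M: "\<And>x. x \<in> {a..b} \<Longrightarrow> \<bar>F x\<bar> \<le> MF" "\<And>x. x \<in> {a..b} \<Longrightarrow> \<bar>H x\<bar> \<le> MH" "0 < MF" "0 < MH"
    by (metis bounded_pos_less imageI less_imp_le real_norm_def)
  have e: "0 < \<epsilon> / (2 * MH)" "0 < \<epsilon> / (2 * MF)" using \<open>0 < \<epsilon>\<close> M by auto
  obtain \<delta>1 where 1: "0 < \<delta>1" "\<And>\<D> T. \<D> division_of T \<Longrightarrow> T \<subseteq> {a..b} \<Longrightarrow> (\<Sum>K\<in>\<D>. Sup K - Inf K) < \<delta>1 \<Longrightarrow>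
        (\<Sum>K\<in>\<D>. \<bar>F (Sup K) - F (Inf K)\<bar>) < \<epsilon> / (2 * MH)"
    using absolutely_continuous_onD[OF F e(1)] by blast
  obtain \<delta>2 where 2: "0 < \<delta>2" "\<And>\<D> T. \<D> division_of T \<Longrightarrow> T \<subseteq> {a..b} \<Longrightarrow> (\<Sum>K\<in>\<D>. Sup K - Inf K) < \<delta>2 \<Longrightarrow>
        (\<Sum>K\<in>\<D>. \<bar>H (Sup K) - H (Inf K)\<bar>) < \<epsilon> / (2 * MF)"
    using absolutely_continuous_onD[OF H e(2)] by blast
  show "\<exists>\<delta>>0. \<forall>\<D> T. \<D> division_of T \<longrightarrow> T \<subseteq> {a..b} \<longrightarrow> (\<Sum>K\<in>\<D>. Sup K - Inf K) < \<delta> \<longrightarrow>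
        (\<Sum>K\<in>\<D>. \<bar>F (Sup K) * H (Sup K) - F (Inf K) * H (Inf K)\<bar>) < \<epsilon>"
  proof (intro exI[of _ "min \<delta>1 \<delta>2"] conjI allI impI)
    show "0 < min \<delta>1 \<delta>2" using 1 2 by simp
    fix \<D> T assume D: "\<D> division_of T" "T \<subseteq> {a..b}" "(\<Sum>K\<in>\<D>. Sup K - Inf K) < min \<delta>1 \<delta>2"
    have "(\<Sum>K\<in>\<D>. \<bar>F (Sup K) * H (Sup K) - F (Inf K) * H (Inf K)\<bar>)
        \<le> (\<Sum>K\<in>\<D>. MH * \<bar>F (Sup K) - F (Inf K)\<bar> + MF * \<bar>H (Sup K) - H (Inf K)\<bar>)"
    proof (rule sum_mono)
      fix K assume "K \<in> \<D>"
      from division_interval[OF D(1) this] D(2) have K: "Inf K \<in> {a..b}" "Sup K \<in> {a..b}" by blast+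
      have "F (Sup K) * H (Sup K) - F (Inf K) * H (Inf K) = H (Sup K) * (F (Sup K) - F (Inf K)) + F (Inf K) * (H (Sup K) - H (Inf K))"
        by (simp add: algebra_simps)
      also have "\<bar>\<dots>\<bar> \<le> \<bar>H (Sup K)\<bar> * \<bar>F (Sup K) - F (Inf K)\<bar> + \<bar>F (Inf K)\<bar> * \<bar>H (Sup K) - H (Inf K)\<bar>"
        by (metis abs_mult abs_triangle_ineq)
      also have "\<dots> \<le> MH * \<bar>F (Sup K) - F (Inf K)\<bar> + MF * \<bar>H (Sup K) - H (Inf K)\<bar>"
        using M(1)[OF K(1)] M(2)[OF K(2)] by (intro add_mono mult_right_mono) auto
      finally show "\<bar>F (Sup K) * H (Sup K) - F (Inf K) * H (Inf K)\<bar> \<le> MH * \<bar>F (Sup K) - F (Inf K)\<bar> + MF * \<bar>H (Sup K) - H (Inf K)\<bar>" .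
    qed
    also have "\<dots> = MH * (\<Sum>K\<in>\<D>. \<bar>F (Sup K) - F (Inf K)\<bar>) + MF * (\<Sum>K\<in>\<D>. \<bar>H (Sup K) - H (Inf K)\<bar>)"
      by (simp add: sum.distrib sum_distrib_left)
    also have "\<dots> < MH * (\<epsilon> / (2 * MH)) + MF * (\<epsilon> / (2 * MF))"
      using 1(2)[OF D(1,2)] 2(2)[OF D(1,2)] D(3) M by (intro add_strict_mono mult_strict_left_mono) auto
    also have "\<dots> = \<epsilon>" using M by simp
    finally show "(\<Sum>K\<in>\<D>. \<bar>F (Sup K) * H (Sup K) - F (Inf K) * H (Inf K)\<bar>) < \<epsilon>" .
  qed
qed

lemma absolutely_continuous_on_subset:
  assumes "absolutely_continuous_on S F" "T \<subseteq> S"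
  shows "absolutely_continuous_on T F"
proof (rule absolutely_continuous_onI)
  fix \<epsilon> :: real assume "0 < \<epsilon>"
  then obtain \<delta> where \<delta>: "0 < \<delta>" "\<And>\<D> T. \<D> division_of T \<Longrightarrow> T \<subseteq> S \<Longrightarrow> (\<Sum>K\<in>\<D>. Sup K - Inf K) < \<delta> \<Longrightarrow>
        (\<Sum>K\<in>\<D>. \<bar>F (Sup K) - F (Inf K)\<bar>) < \<epsilon>"
    using absolutely_continuous_onD[OF assms(1)] by blast
  show "\<exists>\<delta>>0. \<forall>\<D> T'. \<D> division_of T' \<longrightarrow> T' \<subseteq> T \<longrightarrow> (\<Sum>K\<in>\<D>. Sup K - Inf K) < \<delta> \<longrightarrow>
        (\<Sum>K\<in>\<D>. \<bar>F (Sup K) - F (Inf K)\<bar>) < \<epsilon>"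
  proof (intro exI[of _ \<delta>] conjI allI impI \<delta>(1))
    fix \<D> T' assume "\<D> division_of T'" "T' \<subseteq> T" "(\<Sum>K\<in>\<D>. Sup K - Inf K) < \<delta>"
    then show "(\<Sum>K\<in>\<D>. \<bar>F (Sup K) - F (Inf K)\<bar>) < \<epsilon>" using assms(2) by (intro \<delta>(2)[of \<D> T']) auto
  qed
qed

text \<open>
  On an interval shorter than the \<open>\<delta>\<close> belonging to \<open>\<epsilon> = 1\<close>, every division has variation at most 1, so
  the variation function is finite there. Being null is a local property.
\<close>

theorem absolutely_continuous_differentiable_ae:
  assumes ac: "absolutely_continuous_on {a..b} F"
  shows "negligible {x\<in>{a<..<b}. \<not> F differentiable (at x)}" (is "negligible ?B")
proof (subst locally_negligible_alt, rule ballI)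
  fix x assume x: "x \<in> ?B"
  have "(0::real) < 1" by simp
  from absolutely_continuous_onD[OF ac this] obtain \<delta> where \<delta>: "0 < \<delta>" 
    "\<And>\<D> T. \<D> division_of T \<Longrightarrow> T \<subseteq> {a..b} \<Longrightarrow> (\<Sum>K\<in>\<D>. Sup K - Inf K) < \<delta> \<Longrightarrow>
        (\<Sum>K\<in>\<D>. \<bar>F (Sup K) - F (Inf K)\<bar>) < 1" by blast
  define c d where "c = max a (x - \<delta>/3)" and "d = min b (x + \<delta>/3)"
  have cd: "a \<le> c" "c < x" "x < d" "d \<le> b" "d - c < \<delta>" using x \<delta>(1) by (auto simp: c_def d_def)
  have short: "(\<Sum>K\<in>\<D>. \<bar>F (Sup K) - F (Inf K)\<bar>) \<le> 1" if D: "\<D> division_of {c..y}" "y \<in> {c..d}" for \<D> y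
  proof -
    have "(\<Sum>K\<in>\<D>. Sup K - Inf K) = y - c" using additive_division[OF D(1), of "\<lambda>x. x"] D(2) by simp
    moreover have "{c..y} \<subseteq> {a..b}" "y - c < \<delta>" using D(2) cd by auto
    ultimately show ?thesis using \<delta>(2)[OF D(1)] by linarith
  qed
  define W where "W = (\<lambda>y. {\<Sum>K\<in>\<D>. \<bar>F (Sup K) - F (Inf K)\<bar> | \<D>. \<D> division_of {c..y}})"
  define V where "V = (\<lambda>y. Sup (W y))"
  have bdd: "bdd_above (W y)" if "y \<in> {c..d}" for y
    using short[OF _ that] unfolding W_def by (intro bdd_aboveI[of _ 1]) auto
  have ne: "W y \<noteq> {}" for y
    using elementary_interval[of c y] unfolding W_def by (auto simp: cbox_interval)
  have V: "\<bar>F v - F u\<bar> \<le> V v - V u" if uv: "c \<le> u" "u \<le> v" "v \<le> d" for u v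
  proof (cases "u = v")
    case False
    with uv have "u < v" by simp
    have "s \<le> V v - \<bar>F v - F u\<bar>" if s: "s \<in> W u" for s
    proof -
      obtain \<D> where D: "\<D> division_of {c..u}" "s = (\<Sum>K\<in>\<D>. \<bar>F (Sup K) - F (Inf K)\<bar>)"
        using s by (auto simp: W_def)
      have s1: "{{u..v}} division_of {u..v}" using division_of_self[of u v] uv by (auto simp: cbox_interval)
      have "interior {c..u} \<inter> interior {u..v} = {}" by auto
      from division_disjoint_union[OF D(1) s1 this] have D': "insert {u..v} \<D> division_of {c..v}"
        using uv by (simp add: Un_commute ivl_disj_un_two_touch(4))
      have notin: "{u..v} \<notin> \<D>"
      proof
        assume "{u..v} \<in> \<D>"
        then have "{u..v} \<subseteq> {c..u}" using division_ofD(2)[OF D(1)] by blast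
        then show False using \<open>u < v\<close> by auto
      qed
      have "(\<Sum>K\<in>insert {u..v} \<D>. \<bar>F (Sup K) - F (Inf K)\<bar>) \<in> W v"
        unfolding W_def using D' by blast
      then have "(\<Sum>K\<in>insert {u..v} \<D>. \<bar>F (Sup K) - F (Inf K)\<bar>) \<le> V v"
        unfolding V_def using bdd[of v] uv by (intro cSup_upper) auto
      then show ?thesis using notin D(1) uv D(2) by (simp add: division_of_finite)
    qed
    then have "V u \<le> V v - \<bar>F v - F u\<bar>" unfolding V_def by (intro cSup_least ne)
    then show ?thesis by simp
  qed simp
  have "continuous_on {c..d} F" 
    using cd by (intro continuous_on_subset[OF absolutely_continuous_imp_continuous[OF ac]]) auto
  from bounded_variation_differentiable_ae[OF V this] obtain N where
    N: "negligible N" "\<forall>x\<in>{c<..<d} - N. F differentiable (at x)" by blast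
  have "negligible (?B \<inter> {c<..<d})" by (rule negligible_subset[OF N(1)]) (use N(2) in blast)
  then show "\<exists>U. openin (top_of_set ?B) U \<and> x \<in> U \<and> negligible U"
    using x cd by (intro exI[of _ "?B \<inter> {c<..<d}"]) (auto intro!: openin_open_Int)
qed

section \<open>The fundamental theorem of calculus\<close>

lemma division_total_length:
  fixes \<D> :: "real set set"
  assumes D: "\<D> division_of T"
  shows "(\<Sum>K\<in>\<D>. Sup K - Inf K) = measure lebesgue T"
proof -
  have "measure lebesgue (\<Union>\<D>) = (\<Sum>K\<in>\<D>. measure lebesgue K)"
  proof (rule measure_negligible_finite_Union)
    show "finite \<D>" using D by auto
    show "K \<in> lmeasurable" if "K \<in> \<D>" for K
      using division_ofD(4)[OF D that] by auto
    show "pairwise (\<lambda>S T. negligible (S \<inter> T)) \<D>"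
    proof (rule pairwiseI)
      fix K L assume KL: "K \<in> \<D>" "L \<in> \<D>" "K \<noteq> L"
      then have "convex (K \<inter> L)" using division_ofD(4)[OF D] by (metis convex_Int convex_box(1))
      then show "negligible (K \<inter> L)" using division_ofD(5)[OF D KL]
        by (simp add: negligible_convex_interior)
    qed
  qed
  also have "\<dots> = (\<Sum>K\<in>\<D>. Sup K - Inf K)"
  proof (rule sum.cong[OF refl])
    fix K assume "K \<in> \<D>"
    from division_interval[OF D this] have K: "K = {Inf K..Sup K}" "Inf K \<le> Sup K" by blast+
    show "measure lebesgue K = Sup K - Inf K"
      by (rule trans[OF arg_cong[OF K(1), of "measure lebesgue"]]) (use K(2) in simp)
  qed
  finally show ?thesis using division_ofD(6)[OF D] by simp
qed

text \<open>
  The gauge treats the two kinds of tags differently. At a tag outside the null set \<open>N\<close> it is the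
  neighbourhood in which \<open>F\<close> is close to its linear approximation. The intervals with tags in \<open>N\<close> are
  confined to an open set \<open>Q\<close> of measure below \<open>\<delta>\<close>, where absolute continuity makes the total
  increment of \<open>F\<close> small. Replacing \<open>g\<close> by 0 on \<open>N\<close> removes these intervals
  from the Riemann sum.
\<close>

theorem absolutely_continuous_FTC:
  fixes F g :: "real \<Rightarrow> real"
  assumes ab: "a \<le> b" and ac: "absolutely_continuous_on {a..b} F" and N: "negligible N"
    and der: "\<And>x. x \<in> {a..b} \<Longrightarrow> x \<notin> N \<Longrightarrow> (F has_real_derivative g x) (at x within {a..b})"
  shows "(g has_integral (F b - F a)) {a..b}"
proof -
  define g0 where "g0 = (\<lambda>x. if x \<in> N then 0 else g x)"
  have "(g0 has_integral (F b - F a)) (cbox a b)"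
    unfolding has_integral
  proof (intro allI impI)
    fix e :: real assume e: "0 < e"
    define e1 where "e1 = e / (2 * (b - a + 1))"
    have e1: "0 < e1" "e1 * (b - a) < e / 2" using e ab by (auto simp: e1_def field_simps)
    have "\<exists>d>0. \<forall>y\<in>{a..b}. \<bar>y - x\<bar> < d \<longrightarrow> \<bar>F y - F x - g0 x * (y - x)\<bar> \<le> e1 * \<bar>y - x\<bar>"
      if x: "x \<in> {a..b} - N" for x
      using der[of x] x e1(1) unfolding has_field_derivative_def has_derivative_within_alt
      by (auto simp: g0_def)
    then obtain d where d: "\<And>x. x \<in> {a..b} - N \<Longrightarrow> 0 < d x"
      "\<And>x y. x \<in> {a..b} - N \<Longrightarrow> y \<in> {a..b} \<Longrightarrow> \<bar>y - x\<bar> < d x \<Longrightarrow> \<bar>F y - F x - g0 x * (y - x)\<bar> \<le> e1 * \<bar>y - x\<bar>"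
      by metis
    have "0 < e / 2" using e by simp
    from absolutely_continuous_onD[OF ac this] obtain \<delta> where \<delta>: "0 < \<delta>" 
      "\<And>\<D> T. \<D> division_of T \<Longrightarrow> T \<subseteq> {a..b} \<Longrightarrow> (\<Sum>K\<in>\<D>. Sup K - Inf K) < \<delta> \<Longrightarrow>
        (\<Sum>K\<in>\<D>. \<bar>F (Sup K) - F (Inf K)\<bar>) < e / 2" by blast
    obtain Q where Q: "open Q" "N \<subseteq> Q" "Q - N \<in> lmeasurable" "emeasure lebesgue (Q - N) < ennreal \<delta>"
      using sets_lebesgue_outer_open[OF negligible_imp_sets[OF N] \<delta>(1)] by blast
    have Qm: "Q \<in> lmeasurable" "measure lebesgue Q < \<delta>"
    proof -
      have eq: "Q = (Q - N) \<union> N" using Q(2) by auto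
      show "Q \<in> lmeasurable" using Q(3) negligible_imp_measurable[OF N] by (subst eq) (rule fmeasurable.Un)
      have "measure lebesgue Q = measure lebesgue (Q - N)"
        by (rule measure_negligible_symdiff[OF Q(3)]) (use N eq in \<open>auto intro: negligible_subset\<close>)
      also have "\<dots> < \<delta>" using Q(4) \<delta>(1)
        by (metis Q(3) emeasure_eq_measure2 ennreal_less_iff measure_nonneg)
      finally show "measure lebesgue Q < \<delta>" .
    qed
    define \<gamma> where "\<gamma> = (\<lambda>x. if x \<in> N then Q else if x \<in> {a..b} then ball x (d x) else UNIV)"
    have gauge: "gauge \<gamma>"
      unfolding gauge_def \<gamma>_def using Q d(1) by auto
    show "\<exists>\<gamma>. gauge \<gamma> \<and> (\<forall>\<D>. \<D> tagged_division_of cbox a b \<and> \<gamma> fine \<D> \<longrightarrow>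
        norm ((\<Sum>(x, k)\<in>\<D>. measure lborel k *\<^sub>R g0 x) - (F b - F a)) < e)"
    proof (intro exI[of _ \<gamma>] conjI allI impI gauge)
      fix p assume p: "p tagged_division_of cbox a b \<and> \<gamma> fine p"
      then have tag: "p tagged_division_of {a..b}" and fine: "\<gamma> fine p" by (auto simp: cbox_interval)
      have fin: "finite p" using tag by auto
      have K: "x \<in> K" "K \<subseteq> {a..b}" "K = {Inf K..Sup K}" "Inf K \<le> Sup K" "Inf K \<in> K" "Sup K \<in> K" "K \<subseteq> \<gamma> x"
        if xK: "(x, K) \<in> p" for x K
      proof -
        show 1: "x \<in> K" "K \<subseteq> {a..b}" using tagged_division_ofD(2,3)[OF tag xK] by auto
        obtain c d where "K = {c..d}" using tagged_division_ofD(4)[OF tag xK] by (auto simp: cbox_interval)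
        then show "K = {Inf K..Sup K}" "Inf K \<le> Sup K" "Inf K \<in> K" "Sup K \<in> K" using 1(1) by auto
        show "K \<subseteq> \<gamma> x" using fine xK by (auto simp: fine_def)
      qed
      define D where "D = (\<lambda>(x, K). measure lborel K * g0 x - (F (Sup K) - F (Inf K)))"
      define p1 where "p1 = {xK \<in> p. fst xK \<notin> N}"
      define p2 where "p2 = {xK \<in> p. fst xK \<in> N}"
      have p12: "p = p1 \<union> p2" "p1 \<inter> p2 = {}" "p1 \<subseteq> p" "p2 \<subseteq> p" by (auto simp: p1_def p2_def)
      have "(\<Sum>(x, k)\<in>p. measure lborel k *\<^sub>R g0 x) - (F b - F a) = (\<Sum>xK\<in>p. D xK)"
        using additive_tagged_division_1[OF ab tag, of F] by (simp add: D_def case_prod_beta sum_subtractf)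
      also have "\<dots> = (\<Sum>xK\<in>p1. D xK) + (\<Sum>xK\<in>p2. D xK)"
        using sum.union_disjoint[of p1 p2 D] finite_subset[OF p12(3) fin] finite_subset[OF p12(4) fin] p12(1,2) by simp
      also have "\<bar>\<dots>\<bar> \<le> (\<Sum>xK\<in>p1. \<bar>D xK\<bar>) + (\<Sum>xK\<in>p2. \<bar>D xK\<bar>)"
        by (intro order_trans[OF abs_triangle_ineq] add_mono sum_abs)
      also have "\<dots> < e / 2 + e / 2"
      proof (rule add_strict_mono)
        have "(\<Sum>xK\<in>p1. \<bar>D xK\<bar>) \<le> (\<Sum>(x,K)\<in>p1. e1 * (Sup K - Inf K))"
        proof (rule sum_mono, clarify)
          fix x K assume "(x, K) \<in> p1"
          then have xK: "(x, K) \<in> p" "x \<notin> N" by (auto simp: p1_def)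
          note K = K[OF xK(1)]
          have x: "x \<in> {a..b} - N" using K(1,2) xK(2) by auto
          have "K \<subseteq> ball x (d x)" using K(7) x by (auto simp: \<gamma>_def)
          then have "\<bar>Sup K - x\<bar> < d x" "\<bar>Inf K - x\<bar> < d x" using K(5,6) by (auto simp: dist_real_def abs_minus_commute)
          then have b: "\<bar>F (Sup K) - F x - g0 x * (Sup K - x)\<bar> \<le> e1 * \<bar>Sup K - x\<bar>"
            "\<bar>F (Inf K) - F x - g0 x * (Inf K - x)\<bar> \<le> e1 * \<bar>Inf K - x\<bar>"
            using d(2)[OF x] K(2,5,6) by auto
          have xx: "Inf K \<le> x" "x \<le> Sup K" using K(1) by (subst (asm) K(3), auto)+
          have len: "measure lborel K = Sup K - Inf K" 
            by (rule trans[OF arg_cong[OF K(3), of "measure lborel"]]) (use K(4) in simp)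
          then have "D (x, K) = (F (Inf K) - F x - g0 x * (Inf K - x)) - (F (Sup K) - F x - g0 x * (Sup K - x))"
            unfolding D_def prod.case len by (simp add: algebra_simps)
          then have "\<bar>D (x, K)\<bar> \<le> e1 * \<bar>Inf K - x\<bar> + e1 * \<bar>Sup K - x\<bar>" using b by linarith
          also have "\<dots> = e1 * (Sup K - Inf K)" using xx by (simp add: algebra_simps)
          finally show "\<bar>D (x, K)\<bar> \<le> e1 * (Sup K - Inf K)" .
        qed
        also have "\<dots> \<le> (\<Sum>(x,K)\<in>p. e1 * (Sup K - Inf K))"
          using fin p12(3) K(4) e1 by (intro sum_mono2) auto
        also have "\<dots> = e1 * (b - a)"
          using additive_tagged_division_1[OF ab tag, of "\<lambda>x. x"] by (simp add: sum_distrib_left[symmetric] case_prod_beta)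
        also have "\<dots> < e / 2" by (rule e1(2))
        finally show "(\<Sum>xK\<in>p1. \<bar>D xK\<bar>) < e / 2" .
      next
        have part: "p2 tagged_partial_division_of {a..b}"
          by (rule tagged_partial_division_subset[OF _ p12(4)]) (use tag in \<open>auto simp: tagged_division_of_def\<close>)
        let ?\<D> = "snd ` p2"
        have div: "?\<D> division_of \<Union>?\<D>" by (rule partial_division_of_tagged_division[OF part])
        have "(\<Sum>xK\<in>p2. \<bar>D xK\<bar>) = (\<Sum>xK\<in>p2. \<bar>F (Sup (snd xK)) - F (Inf (snd xK))\<bar>)"
          by (rule sum.cong) (auto simp: D_def p2_def g0_def)
        also have "\<dots> = (\<Sum>K\<in>?\<D>. \<bar>F (Sup K) - F (Inf K)\<bar>)"
        proof (subst sum.reindex_nontrivial)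
          show "finite p2" using fin p12(4) finite_subset by blast
          fix xK yL assume *: "xK \<in> p2" "yL \<in> p2" "xK \<noteq> yL" "snd xK = snd yL"
          obtain x y K where eq: "xK = (x, K)" "yL = (y, K)" using * by (metis surj_pair snd_conv)
          have "(x, K) \<in> p" "(y, K) \<in> p" "(x, K) \<noteq> (y, K)" using * eq p12 by auto
          from tagged_division_ofD(5)[OF tag this] have "interior K = {}" by simp
          then have "\<not> Inf K < Sup K" using K(3)[OF \<open>(x, K) \<in> p\<close>] by (metis greaterThanLessThan_empty_iff interior_atLeastAtMost_real not_le)
          then have "Inf K = Sup K" using K(4)[OF \<open>(x, K) \<in> p\<close>] by simp
          then show "\<bar>F (Sup (snd xK)) - F (Inf (snd xK))\<bar> = 0" using eq by simp
        qed simp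
        also have "\<dots> < e / 2"
        proof (rule \<delta>(2)[OF div])
          show "\<Union>?\<D> \<subseteq> {a..b}" using K(2) p12(4) by fastforce
          have "\<Union>?\<D> \<subseteq> Q" using K(7) by (force simp: p2_def \<gamma>_def)
          then have "measure lebesgue (\<Union>?\<D>) \<le> measure lebesgue Q"
            using Qm(1) div by (intro measure_mono_fmeasurable) (auto intro!: fmeasurableD lmeasurable_division)
          then show "(\<Sum>K\<in>?\<D>. Sup K - Inf K) < \<delta>" using Qm(2) division_total_length[OF div] by simp
        qed
        finally show "(\<Sum>xK\<in>p2. \<bar>D xK\<bar>) < e / 2" .
      qed
      finally show "norm ((\<Sum>(x, k)\<in>p. measure lborel k *\<^sub>R g0 x) - (F b - F a)) < e" by simp
    qed
  qed
  then have "(g0 has_integral (F b - F a)) {a..b}" by (simp add: cbox_interval)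
  then show ?thesis by (rule has_integral_spike[OF N, rotated]) (auto simp: g0_def)
qed

text \<open>
  By Henstock's lemma the Riemann sums of \<open>\<bar>d\<bar>\<close> are close to sums of \<open>\<bar>integral K d\<bar>\<close>, which vanish.
\<close>

lemma zero_integrals_imp_negligible:
  fixes d :: "real \<Rightarrow> real"
  assumes d: "d integrable_on {a..b}"
    and z: "\<And>u v. a \<le> u \<Longrightarrow> u \<le> v \<Longrightarrow> v \<le> b \<Longrightarrow> integral {u..v} d = 0"
  shows "negligible {x\<in>{a..b}. d x \<noteq> 0}"
proof -
  have "((\<lambda>x. \<bar>d x\<bar>) has_integral 0) (cbox a b)"
    unfolding has_integral
  proof (intro allI impI)
    fix e :: real assume e: "0 < e"
    have "d integrable_on cbox a b" using d by (simp add: cbox_interval)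
    from Henstock_lemma[OF this e] obtain \<gamma> where \<gamma>: "gauge \<gamma>"
      "\<And>p. p tagged_partial_division_of (cbox a b) \<Longrightarrow> \<gamma> fine p \<Longrightarrow>
             (\<Sum>(x,k)\<in>p. norm(measure lborel k *\<^sub>R d x - integral k d)) < e" by blast
    show "\<exists>\<gamma>. gauge \<gamma> \<and> (\<forall>\<D>. \<D> tagged_division_of cbox a b \<and> \<gamma> fine \<D> \<longrightarrow>
        norm ((\<Sum>(x, k)\<in>\<D>. measure lborel k *\<^sub>R \<bar>d x\<bar>) - 0) < e)"
    proof (intro exI[of _ \<gamma>] conjI allI impI \<gamma>(1))
      fix p assume p: "p tagged_division_of cbox a b \<and> \<gamma> fine p"
      have "(\<Sum>(x, k)\<in>p. measure lborel k *\<^sub>R \<bar>d x\<bar>) = (\<Sum>(x,k)\<in>p. norm(measure lborel k *\<^sub>R d x - integral k d))"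
      proof (rule sum.cong[OF refl], clarify)
        fix x K assume xK: "(x, K) \<in> p"
        have "x \<in> K" "K \<subseteq> {a..b}" using p tagged_division_ofD(2,3)[OF conjunct1[OF p] xK] by (auto simp: cbox_interval)
        moreover obtain u v where "K = {u..v}" using tagged_division_ofD(4)[OF conjunct1[OF p] xK] by (auto simp: cbox_interval)
        ultimately have "integral K d = 0" using z[of u v] by auto
        then show "measure lborel K *\<^sub>R \<bar>d x\<bar> = norm (measure lborel K *\<^sub>R d x - integral K d)" by (simp add: abs_mult)
      qed
      moreover have "0 \<le> (\<Sum>(x, k)\<in>p. measure lborel k *\<^sub>R \<bar>d x\<bar>)" by (intro sum_nonneg) auto
      ultimately show "norm ((\<Sum>(x, k)\<in>p. measure lborel k *\<^sub>R \<bar>d x\<bar>) - 0) < e"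
        using \<gamma>(2)[of p] p by (auto simp: tagged_division_of_def)
    qed
  qed
  then have hi: "((\<lambda>x. \<bar>d x\<bar>) has_integral 0) {a..b}" by (simp add: cbox_interval)
  then have "(\<lambda>x. \<bar>d x\<bar>) absolutely_integrable_on {a..b}"
    by (intro nonnegative_absolutely_integrable_1) auto
  then have i: "integrable (lebesgue_on {a..b}) (\<lambda>x. \<bar>d x\<bar>)"
    by (intro absolutely_integrable_imp_integrable) auto
  have "integral\<^sup>L (lebesgue_on {a..b}) (\<lambda>x. \<bar>d x\<bar>) = 0"
    using lebesgue_integral_eq_integral[OF i] hi by (simp add: integral_unique)
  then have "AE x in lebesgue_on {a..b}. d x = 0"
    using integral_nonneg_eq_0_iff_AE[OF i] by simp
  then have "AE x in lebesgue. x \<in> {a..b} \<longrightarrow> d x = 0"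
    by (simp add: AE_restrict_space_iff)
  then have "{x. \<not> (x \<in> {a..b} \<longrightarrow> d x = 0)} \<in> null_sets lebesgue"
    by (simp add: AE_iff_null_sets[symmetric] eventually_ae_filter AE_iff_measurable)
       (metis (mono_tags) AE_E3 completion.complete2 mem_Collect_eq subsetI)
  then show ?thesis unfolding negligible_iff_null_sets by (simp add: conj_ac cong: conj_cong)
qed

section \<open>Square integrable functions and their primitives\<close>

definition square_integrable :: "'a measure \<Rightarrow> ('a \<Rightarrow> real) \<Rightarrow> bool" where
  "square_integrable M f \<longleftrightarrow> f \<in> borel_measurable M \<and> integrable M (\<lambda>x. (f x)\<^sup>2)"

lemma square_integrable_mult_integrable:
  assumes "square_integrable M f" "square_integrable M g"
  shows "integrable M (\<lambda>x. f x * g x)"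
proof (rule Bochner_Integration.integrable_bound)
  show "integrable M (\<lambda>x. (f x)\<^sup>2 + (g x)\<^sup>2)" using assms by (auto simp: square_integrable_def)
  show "(\<lambda>x. f x * g x) \<in> borel_measurable M" using assms by (auto simp: square_integrable_def)
  have "\<bar>u * v\<bar> \<le> \<bar>u\<^sup>2 + v\<^sup>2\<bar>" for u v :: real
    using sum_squares_bound[of "\<bar>u\<bar>" "\<bar>v\<bar>"] mult_nonneg_nonneg[OF abs_ge_zero[of u] abs_ge_zero[of v]]
    by (simp only: abs_mult power2_abs)
  then show "AE x in M. norm (f x * g x) \<le> norm ((f x)\<^sup>2 + (g x)\<^sup>2)" by simp
qed

lemma square_integrable_cmult:
  "square_integrable M f \<Longrightarrow> square_integrable M (\<lambda>x. c * f x)"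
  by (auto simp: square_integrable_def power_mult_distrib)

lemma square_integrable_add:
  assumes "square_integrable M f" "square_integrable M g"
  shows "square_integrable M (\<lambda>x. f x + g x)"
proof -
  have "(\<lambda>x. (f x + g x)\<^sup>2) = (\<lambda>x. (f x)\<^sup>2 + (g x)\<^sup>2 + 2 * (f x * g x))"
    by (auto simp: power2_eq_square algebra_simps)
  then show ?thesis using assms square_integrable_mult_integrable[OF assms]
    by (auto simp: square_integrable_def)
qed

lemma square_integrable_bounded_mult:
  assumes "square_integrable M f" "g \<in> borel_measurable M" "\<And>x. x \<in> space M \<Longrightarrow> \<bar>g x\<bar> \<le> B"
  shows "square_integrable M (\<lambda>x. g x * f x)"
  unfolding square_integrable_def
proof
  show m: "(\<lambda>x. g x * f x) \<in> borel_measurable M" using assms by (auto simp: square_integrable_def)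
  show "integrable M (\<lambda>x. (g x * f x)\<^sup>2)"
  proof (rule Bochner_Integration.integrable_bound)
    show "integrable M (\<lambda>x. B\<^sup>2 * (f x)\<^sup>2)" using assms by (auto simp: square_integrable_def)
    show "(\<lambda>x. (g x * f x)\<^sup>2) \<in> borel_measurable M" using m by measurable
    show "AE x in M. norm ((g x * f x)\<^sup>2) \<le> norm (B\<^sup>2 * (f x)\<^sup>2)"
    proof (rule AE_I2)
      fix x assume "x \<in> space M"
      then have "\<bar>g x\<bar> \<le> \<bar>B\<bar>" using assms(3)[of x] by linarith
      then have "(g x)\<^sup>2 \<le> B\<^sup>2" by (simp add: abs_le_square_iff)
      then show "norm ((g x * f x)\<^sup>2) \<le> norm (B\<^sup>2 * (f x)\<^sup>2)"
        by (simp add: power_mult_distrib mult_right_mono)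
    qed
  qed
qed

lemma square_integrable_const:
  "finite_measure M \<Longrightarrow> square_integrable M (\<lambda>x. c)"
  by (auto simp: square_integrable_def finite_measure.integrable_const)

lemma finite_measure_interval: "finite_measure (lebesgue_on {a..b::real})"
  by (rule finite_measure_lebesgue_on) auto

lemma continuous_imp_square_integrable:
  fixes f :: "real \<Rightarrow> real"
  assumes "continuous_on {a..b} f"
  shows "square_integrable (lebesgue_on {a..b}) f"
proof -
  have "continuous_on {a..b} (\<lambda>x. (f x)\<^sup>2)" by (intro continuous_intros assms)
  then have "integrable (lebesgue_on {a..b}) (\<lambda>x. (f x)\<^sup>2)"
    by (intro absolutely_integrable_imp_integrable absolutely_integrable_continuous_real) auto
  moreover have "f \<in> borel_measurable (lebesgue_on {a..b})"
    by (intro continuous_imp_measurable_on_sets_lebesgue assms) auto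
  ultimately show ?thesis by (simp add: square_integrable_def)
qed

lemma square_integrable_imp_integrable:
  assumes "finite_measure M" "square_integrable M f"
  shows "integrable M f"
  using square_integrable_mult_integrable[OF assms(2) square_integrable_const[OF assms(1), of 1]] by simp

lemma square_integrable_subinterval:
  assumes "square_integrable (lebesgue_on {a..b::real}) f" "a \<le> u" "v \<le> b"
  shows "f absolutely_integrable_on {u..v}" "(\<lambda>x. (f x)\<^sup>2) absolutely_integrable_on {u..v}"
proof -
  have *: "h absolutely_integrable_on {u..v}" if "integrable (lebesgue_on {a..b}) h" for h :: "real \<Rightarrow> real"
  proof -
    have "h absolutely_integrable_on {a..b}"
      using that by (simp add: integrable_restrict_space set_integrable_def)
    then show ?thesis using assms(2,3) by (rule_tac set_integrable_subset) auto
  qed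
  show "f absolutely_integrable_on {u..v}" "(\<lambda>x. (f x)\<^sup>2) absolutely_integrable_on {u..v}"
    using * square_integrable_imp_integrable[OF finite_measure_interval assms(1)] assms(1) by (auto simp: square_integrable_def)
qed

text \<open>
  As \<open>g\<close> is a derivative only almost everywhere, it may be changed on null sets. This is the
  form in which second derivatives of elements of the domain appear.
\<close>

definition ac_primitive :: "real \<Rightarrow> real \<Rightarrow> (real \<Rightarrow> real) \<Rightarrow> (real \<Rightarrow> real) \<Rightarrow> bool" where
  "ac_primitive a b F g \<longleftrightarrow> absolutely_continuous_on {a..b} F \<and>
     (\<exists>N. negligible N \<and> (\<forall>x\<in>{a..b} - N. (F has_real_derivative g x) (at x within {a..b})))"

lemma ac_primitive_continuous: "ac_primitive a b F g \<Longrightarrow> continuous_on {a..b} F"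
  by (simp add: ac_primitive_def absolutely_continuous_imp_continuous)

lemma ac_primitive_FTC:
  assumes "ac_primitive a b F g" "a \<le> u" "u \<le> v" "v \<le> b"
  shows "(g has_integral (F v - F u)) {u..v}"
proof -
  obtain N where N: "negligible N" "\<forall>x\<in>{a..b} - N. (F has_real_derivative g x) (at x within {a..b})"
    using assms by (auto simp: ac_primitive_def)
  show ?thesis
  proof (rule absolutely_continuous_FTC[OF assms(3) _ N(1)])
    show "absolutely_continuous_on {u..v} F"
      using assms by (auto simp: ac_primitive_def intro: absolutely_continuous_on_subset)
    fix x assume "x \<in> {u..v}" "x \<notin> N"
    then have "(F has_real_derivative g x) (at x within {a..b})" using N(2) assms by auto
    then show "(F has_real_derivative g x) (at x within {u..v})"
      by (rule DERIV_subset) (use assms in auto)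
  qed
qed

lemma ac_primitive_add:
  assumes "ac_primitive a b F g" "ac_primitive a b H h"
  shows "ac_primitive a b (\<lambda>x. F x + H x) (\<lambda>x. g x + h x)"
proof -
  obtain N M where "negligible N" "\<forall>x\<in>{a..b} - N. (F has_real_derivative g x) (at x within {a..b})"
    "negligible M" "\<forall>x\<in>{a..b} - M. (H has_real_derivative h x) (at x within {a..b})"
    using assms by (auto simp: ac_primitive_def)
  then show ?thesis using assms unfolding ac_primitive_def
    by (intro conjI absolutely_continuous_on_add exI[of _ "N \<union> M"]) (auto intro!: derivative_intros)
qed

lemma ac_primitive_mult:
  assumes "ac_primitive a b F g" "ac_primitive a b H h"
  shows "ac_primitive a b (\<lambda>x. F x * H x) (\<lambda>x. g x * H x + F x * h x)"
proof -
  obtain N M where "negligible N" "\<forall>x\<in>{a..b} - N. (F has_real_derivative g x) (at x within {a..b})"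
    "negligible M" "\<forall>x\<in>{a..b} - M. (H has_real_derivative h x) (at x within {a..b})"
    using assms by (auto simp: ac_primitive_def)
  then show ?thesis using assms unfolding ac_primitive_def
    by (intro conjI absolutely_continuous_on_mult exI[of _ "N \<union> M"]) 
       (auto intro!: derivative_eq_intros)
qed

lemma C1_imp_ac_primitive:
  assumes der: "\<And>x. x \<in> {a..b} \<Longrightarrow> (F has_real_derivative g x) (at x within {a..b})"
    and cont: "continuous_on {a..b} g"
  shows "ac_primitive a b F g"
  unfolding ac_primitive_def
proof
  have "bounded (g ` {a..b})" using cont by (intro compact_imp_bounded compact_continuous_image) auto
  then obtain B where B: "\<forall>x\<in>{a..b}. \<bar>g x\<bar> \<le> B"
    by (auto simp: bounded_iff)
  show "absolutely_continuous_on {a..b} F"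
  proof (rule lipschitz_imp_absolutely_continuous)
    fix u v assume uv: "u \<in> {a..b}" "v \<in> {a..b}" "u \<le> v"
    have "norm (F v - F u) \<le> B * norm (v - u)"
      by (rule field_differentiable_bound[OF _ der]) (use B uv in auto)
    then show "\<bar>F v - F u\<bar> \<le> B * (v - u)" using uv by simp
  qed
qed (use der in \<open>auto intro!: exI[of _ "{}"]\<close>)

lemma ac_primitive_cmult:
  "ac_primitive a b F g \<Longrightarrow> ac_primitive a b (\<lambda>x. c * F x) (\<lambda>x. c * g x)"
  using ac_primitive_mult[OF C1_imp_ac_primitive[of a b "\<lambda>x. c" "\<lambda>x. 0"], of F g] by simp

lemma ac_primitive_cong_ae:
  assumes "ac_primitive a b F g" "negligible {x\<in>{a..b}. g x \<noteq> h x}"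
  shows "ac_primitive a b F h"
proof -
  obtain N where "negligible N" "\<forall>x\<in>{a..b} - N. (F has_real_derivative g x) (at x within {a..b})"
    using assms by (auto simp: ac_primitive_def)
  then have "\<forall>x\<in>{a..b} - (N \<union> {x\<in>{a..b}. g x \<noteq> h x}). (F has_real_derivative h x) (at x within {a..b})"
    by (metis (mono_tags, lifting) Diff_iff UnI1 UnI2 mem_Collect_eq)
  moreover have "negligible (N \<union> {x\<in>{a..b}. g x \<noteq> h x})" using \<open>negligible N\<close> assms(2) by simp
  ultimately show ?thesis using assms(1) unfolding ac_primitive_def by blast
qed

lemma absolutely_continuous_imp_ac_primitive:
  assumes "absolutely_continuous_on {a..b} F"
  shows "ac_primitive a b F (\<lambda>x. vector_derivative F (at x within {a..b}))"
  unfolding ac_primitive_def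
proof (intro conjI assms exI[of _ "{x\<in>{a<..<b}. \<not> F differentiable (at x)} \<union> {a, b}"] ballI)
  show "negligible ({x\<in>{a<..<b}. \<not> F differentiable (at x)} \<union> {a, b})"
    using absolutely_continuous_differentiable_ae[OF assms] by simp
  fix x assume "x \<in> {a..b} - ({x\<in>{a<..<b}. \<not> F differentiable (at x)} \<union> {a, b})"
  then have "F differentiable (at x)" by auto
  then have "F differentiable (at x within {a..b})" by (rule differentiable_at_withinI)
  then show "(F has_real_derivative vector_derivative F (at x within {a..b})) (at x within {a..b})"
    by (simp add: has_real_derivative_iff_has_vector_derivative vector_derivative_works)
qed

lemma ac_primitive_continuous_deriv:
  assumes "ac_primitive a b F g" "continuous_on {a..b} g" "x \<in> {a..b}"
  shows "(F has_real_derivative g x) (at x within {a..b})"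
proof -
  have eq: "F a + integral {a..y} g = F y" if "y \<in> {a..b}" for y
    using ac_primitive_FTC[OF assms(1), of a y] that by (auto simp: integral_unique)
  have "((\<lambda>y. F a + integral {a..y} g) has_real_derivative 0 + g x) (at x within {a..b})"
    by (intro derivative_intros integral_has_real_derivative assms)
  then have "((\<lambda>y. F a + integral {a..y} g) has_real_derivative g x) (at x within {a..b})" by simp
  then show ?thesis
    by (rule has_field_derivative_transform_within[where d=1]) (use eq assms(3) in auto)
qed

text \<open>
  For every \<open>\<eta>\<close>, \<open>\<bar>g\<bar> \<le> 1 / (4 * \<eta>) + \<eta> * g\<^sup>2\<close> bounds the increments over a division by a multiple of its
  total length and a small multiple of \<open>\<integral> g\<^sup>2\<close>, so the integral is absolutely continuous. The difference of
  its derivative and \<open>g\<close> has vanishing integral over every interval and is therefore null.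
\<close>

lemma indefinite_integral_ac_primitive:
  assumes g: "square_integrable (lebesgue_on {a..b}) g"
  shows "ac_primitive a b (\<lambda>x. integral {a..x} g) g"
proof -
  note ai = square_integrable_subinterval[OF g]
  have int: "g integrable_on {u..v}" "(\<lambda>x. \<bar>g x\<bar>) integrable_on {u..v}" "(\<lambda>x. (g x)\<^sup>2) integrable_on {u..v}" if "a \<le> u" "v \<le> b" for u v
    using ai[OF that] by (auto simp: absolutely_integrable_on_def)
  have diff: "integral {a..v} g - integral {a..u} g = integral {u..v} g" if "a \<le> u" "u \<le> v" "v \<le> b" for u v
    using Henstock_Kurzweil_Integration.integral_combine[of a u v g] that int[of a v] by simp
  define Q where "Q = integral {a..b} (\<lambda>x. (g x)\<^sup>2)"
  have Q0: "0 \<le> Q" unfolding Q_def by (intro Henstock_Kurzweil_Integration.integral_nonneg int) auto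
  have ac: "absolutely_continuous_on {a..b} (\<lambda>x. integral {a..x} g)"
  proof (rule absolutely_continuous_onI)
    fix \<epsilon> :: real assume e: "0 < \<epsilon>"
    define \<eta> where "\<eta> = \<epsilon> / (2 * (Q + 1))"
    have \<eta>: "0 < \<eta>" "\<eta> * Q \<le> \<epsilon> / 2" using e Q0 by (auto simp: \<eta>_def field_simps)
    show "\<exists>\<delta>>0. \<forall>\<D> T. \<D> division_of T \<longrightarrow> T \<subseteq> {a..b} \<longrightarrow> (\<Sum>K\<in>\<D>. Sup K - Inf K) < \<delta> \<longrightarrow>
        (\<Sum>K\<in>\<D>. \<bar>integral {a..Sup K} g - integral {a..Inf K} g\<bar>) < \<epsilon>"
    proof (intro exI[of _ "2 * \<eta> * \<epsilon>"] conjI allI impI)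
      show "0 < 2 * \<eta> * \<epsilon>" using \<eta> e by simp
      fix \<D> T assume D: "\<D> division_of T" "T \<subseteq> {a..b}" "(\<Sum>K\<in>\<D>. Sup K - Inf K) < 2 * \<eta> * \<epsilon>"
      have "(\<Sum>K\<in>\<D>. \<bar>integral {a..Sup K} g - integral {a..Inf K} g\<bar>)
          \<le> (\<Sum>K\<in>\<D>. (Sup K - Inf K) / (4 * \<eta>) + \<eta> * integral K (\<lambda>x. (g x)\<^sup>2))"
      proof (rule sum_mono)
        fix K assume K: "K \<in> \<D>"
        obtain u v where uv: "K = {u..v}" "u \<le> v"
          by (rule division_interval[OF D(1) K])
        have "{u..v} \<subseteq> {a..b}" using division_ofD(2)[OF D(1) K] D(2) uv(1) by blast
        then have ab: "a \<le> u" "v \<le> b" using uv(2) by auto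
        have sq: "(\<lambda>x. \<eta> * (g x)\<^sup>2) integrable_on {u..v}" using integrable_cmul[OF int(3)[OF ab], of \<eta>] by simp
        have "\<bar>integral {a..v} g - integral {a..u} g\<bar> = \<bar>integral {u..v} g\<bar>" using diff uv ab by simp
        also have "\<dots> \<le> integral {u..v} (\<lambda>x. 1 / (4 * \<eta>) + \<eta> * (g x)\<^sup>2)"
        proof -
          have "\<bar>g x\<bar> \<le> 1 / (4 * \<eta>) + \<eta> * (g x)\<^sup>2" for x
          proof -
            have "0 \<le> (2 * \<eta> * \<bar>g x\<bar> - 1)\<^sup>2" by simp
            also have "\<dots> = 4 * \<eta> * (1 / (4 * \<eta>) + \<eta> * (g x)\<^sup>2 - \<bar>g x\<bar>)"
              using \<eta>(1) by (simp add: power2_eq_square field_simps)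
            finally show ?thesis using \<eta>(1) by (simp add: zero_le_mult_iff)
          qed
          then have "norm (integral {u..v} g) \<le> integral {u..v} (\<lambda>x. 1 / (4 * \<eta>) + \<eta> * (g x)\<^sup>2)"
            using int[OF ab] by (intro integral_norm_bound_integral) 
              (auto intro!: Henstock_Kurzweil_Integration.integrable_add sq)
          then show ?thesis by simp
        qed
        also have "\<dots> = (v - u) / (4 * \<eta>) + \<eta> * integral {u..v} (\<lambda>x. (g x)\<^sup>2)"
          using int[OF ab] uv sq by (subst Henstock_Kurzweil_Integration.integral_add) auto
        finally show "\<bar>integral {a..Sup K} g - integral {a..Inf K} g\<bar> \<le> (Sup K - Inf K) / (4 * \<eta>) + \<eta> * integral K (\<lambda>x. (g x)\<^sup>2)"
          using uv by simp
      qed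
      also have "\<dots> = (\<Sum>K\<in>\<D>. Sup K - Inf K) / (4 * \<eta>) + \<eta> * (\<Sum>K\<in>\<D>. integral K (\<lambda>x. (g x)\<^sup>2))"
        by (simp add: sum.distrib sum_divide_distrib sum_distrib_left)
      also have "(\<Sum>K\<in>\<D>. integral K (\<lambda>x. (g x)\<^sup>2)) = integral T (\<lambda>x. (g x)\<^sup>2)"
      proof (rule integral_combine_division_bottomup[OF D(1), symmetric])
        fix K assume K: "K \<in> \<D>"
        obtain u v where uv: "K = {u..v}" "u \<le> v"
          by (rule division_interval[OF D(1) K])
        have "{u..v} \<subseteq> {a..b}" using division_ofD(2)[OF D(1) K] D(2) uv(1) by blast
        then have ab: "a \<le> u" "v \<le> b" using uv(2) by auto
        show "(\<lambda>x. (g x)\<^sup>2) integrable_on K" using int[OF ab] uv by simp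
      qed
      also have "(\<Sum>K\<in>\<D>. Sup K - Inf K) / (4 * \<eta>) + \<eta> * integral T (\<lambda>x. (g x)\<^sup>2) < (2 * \<eta> * \<epsilon>) / (4 * \<eta>) + \<eta> * Q"
      proof (rule add_less_le_mono)
        show "(\<Sum>K\<in>\<D>. Sup K - Inf K) / (4 * \<eta>) < (2 * \<eta> * \<epsilon>) / (4 * \<eta>)"
          using D(3) \<eta>(1) by (intro divide_strict_right_mono) auto
        have "(\<lambda>x. (g x)\<^sup>2) integrable_on T"
          by (rule integrable_on_subdivision[OF D(1) _ D(2)]) (use int[of a b] in auto)
        then have "integral T (\<lambda>x. (g x)\<^sup>2) \<le> Q"
          unfolding Q_def using D(2) int(3)[of a b] by (intro integral_subset_le) auto
        then show "\<eta> * integral T (\<lambda>x. (g x)\<^sup>2) \<le> \<eta> * Q" using \<eta>(1) by simp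
      qed
      also have "\<dots> \<le> \<epsilon>" using \<eta> by simp
      finally show "(\<Sum>K\<in>\<D>. \<bar>integral {a..Sup K} g - integral {a..Inf K} g\<bar>) < \<epsilon>" .
    qed
  qed
  define h where "h = (\<lambda>x. vector_derivative (\<lambda>x. integral {a..x} g) (at x within {a..b}))"
  have h: "ac_primitive a b (\<lambda>x. integral {a..x} g) h"
    unfolding h_def by (rule absolutely_continuous_imp_ac_primitive[OF ac])
  have "negligible {x\<in>{a..b}. h x - g x \<noteq> 0}"
  proof (cases "a \<le> b")
    case True
    show ?thesis
    proof (rule zero_integrals_imp_negligible)
      have "h integrable_on {a..b}" using ac_primitive_FTC[OF h, of a b] True by auto
      then show "(\<lambda>x. h x - g x) integrable_on {a..b}"
        using int[of a b] by (intro Henstock_Kurzweil_Integration.integrable_diff) auto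
      fix u v assume uv: "a \<le> u" "u \<le> v" "v \<le> b"
      have "(h has_integral integral {u..v} g) {u..v}"
        using ac_primitive_FTC[OF h uv] diff[OF uv] by simp
      moreover have "(g has_integral integral {u..v} g) {u..v}"
        using int(1)[OF uv(1,3)] by (rule integrable_integral)
      ultimately have "((\<lambda>x. h x - g x) has_integral integral {u..v} g - integral {u..v} g) {u..v}"
        by (rule has_integral_diff)
      then show "integral {u..v} (\<lambda>x. h x - g x) = 0" by (simp add: integral_unique)
    qed
  qed auto
  then show ?thesis by (intro ac_primitive_cong_ae[OF h]) simp
qed

section \<open>Vertex conditions as symmetric involutions\<close>

lemma mat_mult_vec_component:
  assumes "A \<in> carrier_mat d d" "i < d"
  shows "(A *\<^sub>v vec d f) $ i = (\<Sum>j<d. A $$ (i, j) * f j)"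
  using assms by (auto simp: scalar_prod_def lessThan_atLeast0)

lemma mat_mult_index:
  fixes X Y :: "'a :: comm_ring_1 mat"
  assumes "X \<in> carrier_mat d d" "Y \<in> carrier_mat d d" "i < d" "l < d"
  shows "(X * Y) $$ (i, l) = (\<Sum>j<d. X $$ (i, j) * Y $$ (j, l))"
  using assms by (auto simp: scalar_prod_def lessThan_atLeast0)

lemma sum_product_swap:
  fixes a b :: "nat \<Rightarrow> nat \<Rightarrow> 'a :: comm_ring_1"
  shows "(\<Sum>i<d. (\<Sum>j<d. a j i * p j) * (\<Sum>m<d. b m i * q m)) = (\<Sum>j<d. \<Sum>m<d. p j * q m * (\<Sum>i<d. a j i * b m i))"
proof -
  have "(\<Sum>i<d. (\<Sum>j<d. a j i * p j) * (\<Sum>m<d. b m i * q m)) = (\<Sum>i<d. \<Sum>j<d. \<Sum>m<d. p j * q m * (a j i * b m i))"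
    by (simp add: sum_product mult_ac)
  also have "\<dots> = (\<Sum>j<d. \<Sum>i<d. \<Sum>m<d. p j * q m * (a j i * b m i))" by (rule sum.swap)
  also have "\<dots> = (\<Sum>j<d. \<Sum>m<d. \<Sum>i<d. p j * q m * (a j i * b m i))"
    by (rule sum.cong[OF refl], rule sum.swap)
  finally show ?thesis by (simp add: sum_distrib_left)
qed

lemma sum_kronecker:
  fixes v :: "nat \<Rightarrow> 'a :: comm_ring_1"
  assumes "l < d"
  shows "(\<Sum>i<d. (if i = l then 1 else 0) * v i) = v l" "(\<Sum>i<d. (if l = i then 1 else 0) * v i) = v l"
    "(\<Sum>i<d. v i * (if i = l then 1 else 0)) = v l"
proof -
  have *: "(\<Sum>i<d. if i = l then v i else 0) = v l" using assms by (simp add: sum.delta)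
  show "(\<Sum>i<d. (if i = l then 1 else 0) * v i) = v l" "(\<Sum>i<d. (if l = i then 1 else 0) * v i) = v l"
    "(\<Sum>i<d. v i * (if i = l then 1 else 0)) = v l"
    by (rule trans[OF _ *], rule sum.cong, auto)+
qed

lemma nonsingular_imp_inverse:
  fixes M :: "nat \<Rightarrow> nat \<Rightarrow> 'a :: field"
  assumes inj: "\<And>v. \<forall>i<d. (\<Sum>j<d. M i j * v j) = 0 \<Longrightarrow> \<forall>j<d. v j = 0"
  shows "det (mat d d (\<lambda>(i, j). M i j)) \<noteq> 0"
    and "\<exists>N. (\<forall>i<d. \<forall>l<d. (\<Sum>j<d. M i j * N j l) = (if i = l then 1 else 0)) \<and>
             (\<forall>i<d. \<forall>l<d. (\<Sum>j<d. N i j * M j l) = (if i = l then 1 else 0))"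
proof -
  let ?M = "mat d d (\<lambda>(i, j). M i j)"
  have M: "?M \<in> carrier_mat d d" by simp
  show "det ?M \<noteq> 0"
  proof
    assume "det ?M = 0"
    then obtain v where v: "v \<in> carrier_vec d" "v \<noteq> 0\<^sub>v d" "?M *\<^sub>v v = 0\<^sub>v d"
      using det_0_iff_vec_prod_zero[OF M] by auto
    have "\<forall>i<d. (\<Sum>j<d. M i j * v $ j) = 0"
    proof (intro allI impI)
      fix i assume i: "i < d"
      have vv: "vec d (($) v) = v" using v(1) by auto
      have "(\<Sum>j<d. M i j * v $ j) = (?M *\<^sub>v vec d (($) v)) $ i"
        using mat_mult_vec_component[OF M i] i by simp
      then show "(\<Sum>j<d. M i j * v $ j) = 0" using v i by (simp add: vv)
    qed
    from inj[OF this] have "v = 0\<^sub>v d" using v(1) by auto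
    then show False using v by simp
  qed
  then obtain N where N: "mat_inverse ?M = Some N"
    using mat_inverse(1)[OF M, where b="()"] det_non_zero_imp_unit[OF M, of "()"] by (cases "mat_inverse ?M") auto
  from mat_inverse(2)[OF M N] have N2: "?M * N = 1\<^sub>m d" "N * ?M = 1\<^sub>m d" "N \<in> carrier_mat d d" by auto
  have 1: "(\<Sum>j<d. M i j * N $$ (j, l)) = (if i = l then 1 else 0)" if il: "i < d" "l < d" for i l
  proof -
    have "(\<Sum>j<d. M i j * N $$ (j, l)) = (?M * N) $$ (i, l)"
      using il N2(3) by (auto simp: scalar_prod_def lessThan_atLeast0 intro!: sum.cong)
    then show ?thesis using il N2 by simp
  qed
  have 2: "(\<Sum>j<d. N $$ (i, j) * M j l) = (if i = l then 1 else 0)" if il: "i < d" "l < d" for i l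
  proof -
    have "(\<Sum>j<d. N $$ (i, j) * M j l) = (N * ?M) $$ (i, l)"
      using il N2(3) by (auto simp: scalar_prod_def lessThan_atLeast0 intro!: sum.cong)
    then show ?thesis using il N2 by simp
  qed
  show "\<exists>N. (\<forall>i<d. \<forall>l<d. (\<Sum>j<d. M i j * N j l) = (if i = l then 1 else 0)) \<and>
             (\<forall>i<d. \<forall>l<d. (\<Sum>j<d. N i j * M j l) = (if i = l then 1 else 0))"
    by (rule exI[of _ "\<lambda>i j. N $$ (i, j)"]) (use 1 2 in auto)
qed

text \<open>
  Full rank provides \<open>d\<close> independent columns among those of \<open>A\<close> and \<open>B\<close>. A vector \<open>w\<close> orthogonal to all
  columns is in the kernel of the transpose of the invertible matrix which they form.
\<close>

lemma full_rank_imp_joint_kernel_trivial: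
  fixes A B :: "real mat"
  assumes A: "A \<in> carrier_mat d d" and B: "B \<in> carrier_mat d d"
    and rank: "vec_space.rank d (mat_of_cols d (cols A @ cols B)) = d"
    and wA: "\<forall>j<d. (\<Sum>i<d. A $$ (i, j) * w i) = 0" and wB: "\<forall>j<d. (\<Sum>i<d. B $$ (i, j) * w i) = 0"
  shows "\<forall>i<d. w i = (0::real)"
proof -
  interpret vec_space "TYPE(real)" d .
  let ?M = "mat_of_cols d (cols A @ cols B)"
  have cM: "cols ?M = cols A @ cols B" using A B cols_dim by (intro cols_mat_of_cols) (auto dest: subsetD[OF cols_dim])
  have M: "?M \<in> carrier_mat d (2 * d)" using A B by (intro carrier_matI) auto
  let ?P = "\<lambda>T. T \<subseteq> set (cols ?M) \<and> lin_indpt T"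
  have "\<exists>S. finite S \<and> maximal S ?P \<and> {} \<subseteq> S"
    by (rule maximal_exists_superset[of "set (cols ?M)"]) (auto simp: finite_lin_indpt2 lin_dep_def)
  then obtain S where S: "finite S" "maximal S ?P" by blast
  then have S2: "S \<subseteq> set (cols ?M)" "lin_indpt S" by (auto simp: maximal_def)
  have "card S = d" using rank_card_indpt[OF M S(2)] rank by simp
  obtain xs where xs: "set xs = S" "distinct xs" using finite_distinct_list[OF S(1)] by blast
  have len: "length xs = d" using \<open>card S = d\<close> xs distinct_card by fastforce
  have xd: "set xs \<subseteq> carrier_vec d" using S2(1) xs(1) cols_dim M by (metis subset_trans carrier_matD(1))
  let ?N = "mat_of_cols d xs"
  have cN: "cols ?N = xs" using xd by (rule cols_mat_of_cols)
  have N: "?N \<in> carrier_mat d d" using len by (intro carrier_matI) auto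
  have "rank ?N = d" using lin_indpt_full_rank[OF N] cN xs S2 by simp
  then have "det ?N \<noteq> 0" using det_rank_iff[OF N] by simp
  then have "det (transpose_mat ?N) \<noteq> 0" using det_transpose[OF N] by simp
  moreover have "transpose_mat ?N *\<^sub>v vec d w = 0\<^sub>v d"
  proof (rule eq_vecI)
    fix j assume "j < dim_vec (0\<^sub>v d :: real vec)"
    then have j: "j < d" by simp
    have "col ?N j = xs ! j" using j len xd by (intro col_mat_of_cols) auto
    then have "(transpose_mat ?N *\<^sub>v vec d w) $ j = (xs ! j) \<bullet> vec d w"
      using j N by (simp add: len)
    moreover have "xs ! j \<in> set (cols A @ cols B)" using j len xs S2 cM by (metis nth_mem subsetD)
    moreover have "c \<bullet> vec d w = 0" if c: "c \<in> set (cols A)" for c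
    proof -
      obtain j where "j < d" "c = col A j" using c A by (auto simp: cols_def)
      then show ?thesis using wA A by (auto simp: scalar_prod_def lessThan_atLeast0)
    qed
    moreover have "c \<bullet> vec d w = 0" if c: "c \<in> set (cols B)" for c
    proof -
      obtain j where "j < d" "c = col B j" using c B by (auto simp: cols_def)
      then show ?thesis using wB B by (auto simp: scalar_prod_def lessThan_atLeast0)
    qed
    ultimately show "(transpose_mat ?N *\<^sub>v vec d w) $ j = 0\<^sub>v d $ j" using j by auto
  qed (use len in simp)
  ultimately have "vec d w = 0\<^sub>v d"
    using det_0_iff_vec_prod_zero[of "transpose_mat ?N" d] N by (metis transpose_carrier_mat vec_carrier)
  then show ?thesis by (metis index_vec index_zero_vec(1))
qed

text \<open>
  The matrix \<open>A + \<i> k B\<close> is invertible: a vector in the kernel of its transpose has \<open>A\<^sup>T v\<close> and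
  \<open>- \<i> k B\<^sup>T v\<close> equal, and the symmetry of \<open>A B\<^sup>T\<close> forces both to vanish. Hence the scattering
  matrix \<open>\<sigma>\<close> satisfies \<open>(A + \<i> k B) \<sigma> = - (A - \<i> k B)\<close>. If \<open>\<sigma>\<close> is constant, comparing two values of
  \<open>k\<close> gives \<open>A \<sigma> = - A\<close> and \<open>B \<sigma> = B\<close>, and the real part of \<open>\<sigma>\<close> satisfies the same equations.
\<close>

lemma constant_scattering_equations:
  fixes A B :: "real mat"
  assumes A: "A \<in> carrier_mat d d" and B: "B \<in> carrier_mat d d"
    and sym: "transpose_mat (A * transpose_mat B) = A * transpose_mat B"
    and rank: "vec_space.rank d (mat_of_cols d (cols A @ cols B)) = d"
    and scat: "\<And>k k'. k \<noteq> 0 \<Longrightarrow> k' \<noteq> 0 \<Longrightarrow> scattering_matrix A B k = scattering_matrix A B k'"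
  obtains \<rho> :: "nat \<Rightarrow> nat \<Rightarrow> real" where
    "\<forall>i<d. \<forall>l<d. (\<Sum>j<d. A $$ (i, j) * \<rho> j l) = - A $$ (i, l)"
    "\<forall>i<d. \<forall>l<d. (\<Sum>j<d. B $$ (i, j) * \<rho> j l) = B $$ (i, l)"
proof -
  define a where "a = (\<lambda>i j. A $$ (i, j))"
  define b where "b = (\<lambda>i j. B $$ (i, j))"
  have inj: "\<forall>i<d. w i = 0" if "\<forall>j<d. (\<Sum>i<d. a i j * w i) = 0" "\<forall>j<d. (\<Sum>i<d. b i j * w i) = 0" for w
    by (rule full_rank_imp_joint_kernel_trivial[OF A B rank that[unfolded a_def b_def]])
  have S: "(\<Sum>j<d. a i j * b m j) = (\<Sum>j<d. a m j * b i j)" if im: "i < d" "m < d" for i m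
  proof -
    have "(A * transpose_mat B) $$ (i, m) = (\<Sum>j<d. a i j * b m j)" if "i < d" "m < d" for i m
      using that A B by (auto simp: scalar_prod_def a_def b_def lessThan_atLeast0)
    moreover have "(A * transpose_mat B) $$ (i, m) = (A * transpose_mat B) $$ (m, i)"
      using arg_cong[OF sym, of "\<lambda>M. M $$ (i, m)"] im A B by simp
    ultimately show ?thesis using im by simp
  qed
  define A' where "A' = map_mat complex_of_real A"
  define B' where "B' = map_mat complex_of_real B"
  have A': "A' \<in> carrier_mat d d" and B': "B' \<in> carrier_mat d d" using A B by (auto simp: A'_def B'_def)
  have key: "(A' + c \<cdot>\<^sub>m B') * scattering_matrix A B k = - (A' - c \<cdot>\<^sub>m B')" "scattering_matrix A B k \<in> carrier_mat d d"
    if k: "k \<noteq> 0" and c: "c = \<i> * complex_of_real k" for k c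
  proof -
    let ?C = "A' + c \<cdot>\<^sub>m B'"
    have C: "?C \<in> carrier_mat d d" using A' B' by simp
    define M where "M = (\<lambda>i j. complex_of_real (a j i) + c * complex_of_real (b j i))"
    have tr: "transpose_mat ?C = mat d d (\<lambda>(i, j). M i j)"
      using A B by (auto simp: M_def A'_def B'_def a_def b_def)
    have "det (transpose_mat ?C) \<noteq> 0"
      unfolding tr
    proof (rule nonsingular_imp_inverse(1))
      fix v :: "nat \<Rightarrow> complex" assume v: "\<forall>i<d. (\<Sum>j<d. M i j * v j) = 0"
      define x where "x = (\<lambda>j. Re (v j))"
      define y where "y = (\<lambda>j. Im (v j))"
      define ax where "ax = (\<lambda>i. \<Sum>j<d. a j i * x j)"
      define ay where "ay = (\<lambda>i. \<Sum>j<d. a j i * y j)"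
      define bx where "bx = (\<lambda>i. \<Sum>j<d. b j i * x j)"
      define by' where "by' = (\<lambda>i. \<Sum>j<d. b j i * y j)"
      have re: "ax i - k * by' i = 0" "ay i + k * bx i = 0" if "i < d" for i
      proof -
        have "(\<Sum>j<d. M i j * v j) = 0" using v that by auto
        then have "Re (\<Sum>j<d. M i j * v j) = 0" "Im (\<Sum>j<d. M i j * v j) = 0" by auto
        then show "ax i - k * by' i = 0" "ay i + k * bx i = 0"
          by (simp_all add: M_def c ax_def by'_def ay_def bx_def x_def y_def sum_subtractf sum.distrib sum_distrib_left sum_negf algebra_simps)
      qed
      have sym2: "(\<Sum>i<d. (\<Sum>j<d. a j i * p j) * (\<Sum>j<d. b j i * q j)) = (\<Sum>i<d. (\<Sum>j<d. b j i * p j) * (\<Sum>j<d. a j i * q j))" for p q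
      proof -
        have "(\<Sum>i<d. (\<Sum>j<d. a j i * p j) * (\<Sum>j<d. b j i * q j)) = (\<Sum>j<d. \<Sum>m<d. p j * q m * (\<Sum>i<d. b j i * a m i))"
          unfolding sum_product_swap using S by (intro sum.cong refl) (simp add: mult.commute)
        then show ?thesis unfolding sum_product_swap[where a=b and b=a and p=p and q=q] by simp
      qed
      have "(\<Sum>i<d. (ax i)\<^sup>2 + (ay i)\<^sup>2) = (\<Sum>i<d. k * (ax i * by' i) - k * (bx i * ay i))"
      proof (rule sum.cong[OF refl])
        fix i assume "i \<in> {..<d}"
        then have "ax i = k * by' i" "ay i = - k * bx i" using re[of i] by auto
        then have "(ax i)\<^sup>2 = ax i * (k * by' i)" "(ay i)\<^sup>2 = (- k * bx i) * ay i" by (simp_all add: power2_eq_square)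
        then show "(ax i)\<^sup>2 + (ay i)\<^sup>2 = k * (ax i * by' i) - k * (bx i * ay i)" by simp
      qed
      also have "\<dots> = k * ((\<Sum>i<d. ax i * by' i) - (\<Sum>i<d. bx i * ay i))"
        by (simp add: sum_subtractf sum_distrib_left right_diff_distrib)
      also have "\<dots> = 0" using sym2[of x y] by (simp add: ax_def ay_def bx_def by'_def)
      finally have "\<forall>i\<in>{..<d}. (ax i)\<^sup>2 + (ay i)\<^sup>2 = 0" by (subst (asm) sum_nonneg_eq_0_iff) auto
      then have a0: "\<forall>i<d. ax i = 0" "\<forall>i<d. ay i = 0" by (auto simp: add_nonneg_eq_0_iff)
      have b0: "\<forall>i<d. bx i = 0" "\<forall>i<d. by' i = 0"
      proof (safe)
        fix i assume "i < d"
        then show "bx i = 0" "by' i = 0" using re[of i] a0 k by simp_all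
      qed
      have "\<forall>i<d. x i = 0"
        by (rule inj[of x, OF a0(1)[unfolded ax_def] b0(1)[unfolded bx_def]])
      moreover have "\<forall>i<d. y i = 0"
        by (rule inj[of y, OF a0(2)[unfolded ay_def] b0(2)[unfolded by'_def]])
      ultimately show "\<forall>j<d. v j = 0" by (auto simp: x_def y_def complex_eq_iff)
    qed
    then have "det ?C \<noteq> 0" using det_transpose[OF C] by simp
    then have "mat_inverse ?C \<noteq> None"
      using mat_inverse(1)[OF C, where b="()"] det_non_zero_imp_unit[OF C, of "()"] by blast
    then obtain N where N: "mat_inverse ?C = Some N" by (metis not_None_eq)
    from mat_inverse(2)[OF C N] have N2: "?C * N = 1\<^sub>m d" "N \<in> carrier_mat d d" by auto
    have s: "scattering_matrix A B k = - (N * (A' - c \<cdot>\<^sub>m B'))"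
      using N by (simp add: scattering_matrix_def Let_def A'_def B'_def c)
    have D: "A' - c \<cdot>\<^sub>m B' \<in> carrier_mat d d" using A' B' by auto
    show "scattering_matrix A B k \<in> carrier_mat d d" unfolding s using mult_carrier_mat[OF N2(2) D] by simp
    have "?C * - (N * (A' - c \<cdot>\<^sub>m B')) = - (?C * (N * (A' - c \<cdot>\<^sub>m B')))"
      using C N2(2) A' B' by (intro uminus_mult_right_mat) auto
    also have "?C * (N * (A' - c \<cdot>\<^sub>m B')) = (?C * N) * (A' - c \<cdot>\<^sub>m B')"
      using C N2(2) A' B' by (intro assoc_mult_mat[symmetric]) auto
    also have "\<dots> = A' - c \<cdot>\<^sub>m B'" using N2(1) A' B' by (simp add: left_mult_one_mat)
    finally show "?C * scattering_matrix A B k = - (A' - c \<cdot>\<^sub>m B')" unfolding s .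
  qed
  define \<sigma> where "\<sigma> = scattering_matrix A B 1"
  have \<sigma>: "\<sigma> \<in> carrier_mat d d" using key(2)[of 1 \<i>] by (simp add: \<sigma>_def)
  have eq: "(\<Sum>j<d. (complex_of_real (a i j) + c * complex_of_real (b i j)) * \<sigma> $$ (j, l)) = c * complex_of_real (b i l) - complex_of_real (a i l)"
    if k: "k \<noteq> 0" and c: "c = \<i> * complex_of_real k" and il: "i < d" "l < d" for k c i l
  proof -
    have "(A' + c \<cdot>\<^sub>m B') * \<sigma> = - (A' - c \<cdot>\<^sub>m B')"
      using key(1)[OF k c] scat[OF k, of 1] by (simp add: \<sigma>_def)
    then have 1: "((A' + c \<cdot>\<^sub>m B') * \<sigma>) $$ (i, l) = (- (A' - c \<cdot>\<^sub>m B')) $$ (i, l)" by simp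
    have "((A' + c \<cdot>\<^sub>m B') * \<sigma>) $$ (i, l) = (\<Sum>j<d. (A' + c \<cdot>\<^sub>m B') $$ (i, j) * \<sigma> $$ (j, l))"
      using il A' B' \<sigma> by (intro mat_mult_index) auto
    also have "\<dots> = (\<Sum>j<d. (complex_of_real (a i j) + c * complex_of_real (b i j)) * \<sigma> $$ (j, l))"
      using il A B by (intro sum.cong) (auto simp: A'_def B'_def a_def b_def)
    finally show ?thesis using 1 il A B by (simp add: A'_def B'_def a_def b_def)
  qed
  have eqs: "(\<Sum>j<d. a i j * Re (\<sigma> $$ (j, l))) = - a i l \<and> (\<Sum>j<d. b i j * Re (\<sigma> $$ (j, l))) = b i l" if il: "i < d" "l < d" for i l
  proof -
    define SA where "SA = (\<Sum>j<d. complex_of_real (a i j) * \<sigma> $$ (j, l))"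
    define SB where "SB = (\<Sum>j<d. complex_of_real (b i j) * \<sigma> $$ (j, l))"
    have e: "SA + c * SB = c * complex_of_real (b i l) - complex_of_real (a i l)" if "k \<noteq> 0" "c = \<i> * complex_of_real k" for c k
      using eq[OF that il] by (simp add: SA_def SB_def sum.distrib sum_distrib_left algebra_simps)
    have e1: "SA + \<i> * SB = \<i> * complex_of_real (b i l) - complex_of_real (a i l)" using e[of 1 \<i>] by simp
    have e2: "SA + 2 * \<i> * SB = 2 * \<i> * complex_of_real (b i l) - complex_of_real (a i l)" using e[of 2 "2 * \<i>"] by simp
    have "\<i> * SB = (SA + 2 * \<i> * SB) - (SA + \<i> * SB)" by simp
    also have "\<dots> = \<i> * complex_of_real (b i l)" unfolding e1 e2 by simp
    finally have "\<i> * SB = \<i> * complex_of_real (b i l)" .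
    then have SB: "SB = complex_of_real (b i l)" by simp
    with e1 have SA: "SA = - complex_of_real (a i l)" by (simp add: eq_neg_iff_add_eq_0 algebra_simps)
    show ?thesis using arg_cong[OF SA, of Re] arg_cong[OF SB, of Re] by (simp add: SA_def SB_def)
  qed
  show thesis
    by (rule that[of "\<lambda>j l. Re (\<sigma> $$ (j, l))"]) (use eqs in \<open>auto simp: a_def b_def\<close>)
qed
text \<open>
  With \<open>\<rho>\<close> as above, \<open>A (1 + \<rho>) = 0\<close> and \<open>B (1 - \<rho>) = 0\<close>, which makes the two conditions on the right
  sufficient. They are necessary because \<open>f - g/k = \<rho> (f + g/k)\<close> for all \<open>k \<noteq> 0\<close>: both sides have
  the same image under the injective matrix \<open>A - k B\<close>.
\<close>

theorem self_adjoint_non_robin_involution: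
  fixes A B :: "real mat"
  assumes A: "A \<in> carrier_mat d d" and B: "B \<in> carrier_mat d d"
    and sym: "transpose_mat (A * transpose_mat B) = A * transpose_mat B"
    and rank: "vec_space.rank d (mat_of_cols d (cols A @ cols B)) = d"
    and scat: "\<And>k k'. k \<noteq> 0 \<Longrightarrow> k' \<noteq> 0 \<Longrightarrow> scattering_matrix A B k = scattering_matrix A B k'"
  obtains \<rho> :: "nat \<Rightarrow> nat \<Rightarrow> real" where
    "\<And>i l. i < d \<Longrightarrow> l < d \<Longrightarrow> \<rho> i l = \<rho> l i"
    "\<And>i l. i < d \<Longrightarrow> l < d \<Longrightarrow> (\<Sum>j<d. \<rho> i j * \<rho> j l) = (if i = l then 1 else 0)"
    "\<And>f g. A *\<^sub>v vec d f + B *\<^sub>v vec d g = 0\<^sub>v d \<longleftrightarrow>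
       (\<forall>i<d. f i = (\<Sum>j<d. \<rho> i j * f j)) \<and> (\<forall>i<d. g i = - (\<Sum>j<d. \<rho> i j * g j))"
proof -
  obtain \<rho> :: "nat \<Rightarrow> nat \<Rightarrow> real" where
    \<rho>0: "\<forall>i<d. \<forall>l<d. (\<Sum>j<d. A $$ (i, j) * \<rho> j l) = - A $$ (i, l)"
    "\<forall>i<d. \<forall>l<d. (\<Sum>j<d. B $$ (i, j) * \<rho> j l) = B $$ (i, l)"
    using constant_scattering_equations[OF A B sym rank scat] by blast
  define a where "a = (\<lambda>i j. A $$ (i, j))"
  define b where "b = (\<lambda>i j. B $$ (i, j))"
  have inj: "\<forall>i<d. w i = 0" if "\<forall>j<d. (\<Sum>i<d. a i j * w i) = 0" "\<forall>j<d. (\<Sum>i<d. b i j * w i) = 0" for w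
    by (rule full_rank_imp_joint_kernel_trivial[OF A B rank that[unfolded a_def b_def]])
  have \<rho>: "(\<Sum>j<d. a i j * \<rho> j l) = - a i l" "(\<Sum>j<d. b i j * \<rho> j l) = b i l" if "i < d" "l < d" for i l
    using \<rho>0 that by (auto simp: a_def b_def)
  define ap where "ap = (\<lambda>f i. \<Sum>j<d. \<rho> i j * f j)"
  have a\<rho>: "(\<Sum>j<d. a i j * ap f j) = - (\<Sum>j<d. a i j * f j)" 
    and b\<rho>: "(\<Sum>j<d. b i j * ap f j) = (\<Sum>j<d. b i j * f j)" if i: "i < d" for f i
  proof -
    have "(\<Sum>j<d. c j * ap f j) = (\<Sum>l<d. (\<Sum>j<d. c j * \<rho> j l) * f l)" for c
      unfolding ap_def sum_distrib_left sum_distrib_right by (subst sum.swap) (simp add: mult.assoc)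
    then show "(\<Sum>j<d. a i j * ap f j) = - (\<Sum>j<d. a i j * f j)" "(\<Sum>j<d. b i j * ap f j) = (\<Sum>j<d. b i j * f j)"
      using \<rho> i by (simp_all add: sum_negf)
  qed
  \<comment> \<open>Multiplying the two matrix equations by a row vector \<open>w\<close> shows that \<open>A\<^sup>T w\<close> and \<open>B\<^sup>T w\<close>
      are eigenvectors of \<open>\<rho>\<^sup>T\<close> for \<open>-1\<close> and \<open>1\<close>.\<close>
  have tr: "(\<Sum>j<d. \<rho> j l * (\<Sum>i<d. a i j * w i)) = - (\<Sum>i<d. a i l * w i)" 
     "(\<Sum>j<d. \<rho> j l * (\<Sum>i<d. b i j * w i)) = (\<Sum>i<d. b i l * w i)" if l: "l < d" for l w
  proof -
    have "(\<Sum>j<d. \<rho> j l * (\<Sum>i<d. c i j * w i)) = (\<Sum>i<d. (\<Sum>j<d. c i j * \<rho> j l) * w i)" for c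
      unfolding sum_distrib_left sum_distrib_right by (subst sum.swap) (simp add: algebra_simps)
    then show "(\<Sum>j<d. \<rho> j l * (\<Sum>i<d. a i j * w i)) = - (\<Sum>i<d. a i l * w i)" 
     "(\<Sum>j<d. \<rho> j l * (\<Sum>i<d. b i j * w i)) = (\<Sum>i<d. b i l * w i)"
      using \<rho> l by (simp_all add: sum_negf)
  qed
  have trinj: "\<forall>i<d. w i = 0" if k: "k \<noteq> 0" and w: "\<forall>j<d. (\<Sum>i<d. (a i j - k * b i j) * w i) = 0" for k w
  proof -
    define p where "p = (\<lambda>j. \<Sum>i<d. a i j * w i)"
    define q where "q = (\<lambda>j. \<Sum>i<d. b i j * w i)"
    have pq: "p j = k * q j" if "j < d" for j
      using w that by (simp add: p_def q_def sum_subtractf sum_distrib_left algebra_simps)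
    have "- p l = k * q l" if l: "l < d" for l
    proof -
      have "- p l = (\<Sum>j<d. \<rho> j l * p j)" using tr(1)[OF l, of w] by (simp add: p_def)
      also have "\<dots> = k * (\<Sum>j<d. \<rho> j l * q j)" using pq by (simp add: sum_distrib_left algebra_simps)
      also have "\<dots> = k * q l" using tr(2)[OF l, of w] by (simp add: q_def)
      finally show ?thesis .
    qed
    then have "\<forall>l<d. q l = 0" using pq k by force
    moreover from this have "\<forall>l<d. p l = 0" using pq by simp
    ultimately show ?thesis unfolding p_def q_def using inj by blast
  qed
  have invT: "\<exists>N :: nat \<Rightarrow> nat \<Rightarrow> real. (\<forall>i<d. \<forall>l<d. (\<Sum>j<d. (a j i - k * b j i) * N j l) = (if i = l then 1 else 0)) \<and>
             (\<forall>i<d. \<forall>l<d. (\<Sum>j<d. N i j * (a l j - k * b l j)) = (if i = l then 1 else 0))" if k: "k \<noteq> 0" for k :: real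
  proof -
    define M where "M = (\<lambda>i j. a j i - k * b j i)"
    have "\<forall>j<d. v j = 0" if v: "\<forall>i<d. (\<Sum>j<d. M i j * v j) = 0" for v
      by (rule trinj[OF k]) (use v in \<open>simp add: M_def\<close>)
    from nonsingular_imp_inverse(2)[of d M, OF this] show ?thesis by (simp add: M_def)
  qed
  have inj2: "\<forall>j<d. v j = 0" if k: "k \<noteq> 0" and v: "\<forall>i<d. (\<Sum>j<d. (a i j - k * b i j) * v j) = 0" for k v
  proof -
    obtain N :: "nat \<Rightarrow> nat \<Rightarrow> real" where N: "\<forall>i<d. \<forall>l<d. (\<Sum>j<d. (a j i - k * b j i) * N j l) = (if i = l then 1 else 0)"
      using invT[OF k] by blast
    have "v l = 0" if l: "l < d" for l
    proof -
      have "v l = (\<Sum>i<d. (if i = l then 1 else 0) * v i)" using sum_kronecker(1)[OF l, of v] by simp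
      also have "\<dots> = (\<Sum>i<d. (\<Sum>j<d. (a j i - k * b j i) * N j l) * v i)" using N l by simp
      also have "\<dots> = (\<Sum>j<d. N j l * (\<Sum>i<d. (a j i - k * b j i) * v i))"
        unfolding sum_distrib_left sum_distrib_right by (subst sum.swap) (simp add: mult_ac)
      also have "\<dots> = 0" using v by simp
      finally show ?thesis .
    qed
    then show ?thesis by blast
  qed
  have ap_lin: "ap (\<lambda>j. f j + c * g j) i = ap f i + c * ap g i" for f g c i
    by (simp add: ap_def sum.distrib sum_distrib_left algebra_simps)
  have outin: "f i - g i / k = ap (\<lambda>j. f j + g j / k) i" 
    if k: "k \<noteq> 0" and fg: "\<forall>i<d. (\<Sum>j<d. a i j * f j) + (\<Sum>j<d. b i j * g j) = 0" and i: "i < d" for f g k i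
  proof -
    define p where "p = (\<lambda>j. f j + g j / k)"
    define v where "v = (\<lambda>j. (f j - g j / k) - ap p j)"
    have "\<forall>j<d. v j = 0"
    proof (rule inj2[OF k], intro allI impI)
      fix i assume i: "i < d"
      have "(\<Sum>j<d. (a i j - k * b i j) * v j) = (\<Sum>j<d. a i j * f j) - (\<Sum>j<d. a i j * g j) / k - (\<Sum>j<d. a i j * ap p j)
           - k * ((\<Sum>j<d. b i j * f j) - (\<Sum>j<d. b i j * g j) / k - (\<Sum>j<d. b i j * ap p j))"
        by (simp add: v_def sum_subtractf sum_distrib_left sum_divide_distrib algebra_simps)
      also have "\<dots> = (\<Sum>j<d. a i j * f j) - (\<Sum>j<d. a i j * g j) / k + (\<Sum>j<d. a i j * p j)
           - k * ((\<Sum>j<d. b i j * f j) - (\<Sum>j<d. b i j * g j) / k - (\<Sum>j<d. b i j * p j))"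
        using a\<rho>[OF i] b\<rho>[OF i] by simp
      also have "\<dots> = (\<Sum>j<d. a i j * f j) - (\<Sum>j<d. a i j * g j) / k + ((\<Sum>j<d. a i j * f j) + (\<Sum>j<d. a i j * g j) / k)
           - k * ((\<Sum>j<d. b i j * f j) - (\<Sum>j<d. b i j * g j) / k - ((\<Sum>j<d. b i j * f j) + (\<Sum>j<d. b i j * g j) / k))"
        by (simp add: p_def sum.distrib sum_divide_distrib algebra_simps)
      also have "\<dots> = 2 * ((\<Sum>j<d. a i j * f j) + (\<Sum>j<d. b i j * g j))" using k by (simp add: field_simps)
      finally show "(\<Sum>j<d. (a i j - k * b i j) * v j) = 0" using fg i by simp
    qed
    then show ?thesis using i by (auto simp: v_def p_def)
  qed
  have fwd: "f i = ap f i" "g i = - ap g i" if fg: "\<forall>i<d. (\<Sum>j<d. a i j * f j) + (\<Sum>j<d. b i j * g j) = 0" and i: "i < d" for f g i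
  proof -
    have 1: "f i - g i = ap f i + ap g i" using outin[of 1 f g, OF _ fg i] ap_lin[of f 1 g i] by simp
    have 2: "f i - g i / 2 = ap f i + ap g i / 2" using outin[of 2 f g, OF _ fg i] ap_lin[of f "1/2" g i] by simp
    show "f i = ap f i" "g i = - ap g i" using 1 2 by linarith+
  qed
  have S: "(\<Sum>j<d. a i j * b m j) = (\<Sum>j<d. a m j * b i j)" if im: "i < d" "m < d" for i m
  proof -
    have "(A * transpose_mat B) $$ (i, m) = (\<Sum>j<d. a i j * b m j)" if "i < d" "m < d" for i m
      using that A B by (auto simp: scalar_prod_def a_def b_def lessThan_atLeast0)
    moreover have "(A * transpose_mat B) $$ (i, m) = (A * transpose_mat B) $$ (m, i)"
      using arg_cong[OF sym, of "\<lambda>M. M $$ (i, m)"] im A B by simp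
    ultimately show ?thesis using im by simp
  qed
  \<comment> \<open>Pairs \<open>(B\<^sup>T w, - A\<^sup>T w)\<close> satisfy the boundary condition; this is the symmetry of \<open>A B\<^sup>T\<close>.\<close>
  have lag: "(\<Sum>j<d. a i j * (\<Sum>m<d. b m j * w m)) + (\<Sum>j<d. b i j * - (\<Sum>m<d. a m j * w m)) = 0" if i: "i < d" for i w
  proof -
    have "(\<Sum>j<d. a i j * (\<Sum>m<d. b m j * w m)) = (\<Sum>m<d. (\<Sum>j<d. a i j * b m j) * w m)"
      unfolding sum_distrib_left sum_distrib_right by (subst sum.swap) (simp add: mult_ac)
    also have "\<dots> = (\<Sum>m<d. (\<Sum>j<d. a m j * b i j) * w m)" using S i by simp
    also have "\<dots> = (\<Sum>j<d. b i j * (\<Sum>m<d. a m j * w m))"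
      unfolding sum_distrib_left sum_distrib_right by (subst sum.swap) (simp add: mult_ac)
    finally show ?thesis by (simp add: sum_negf)
  qed
  \<comment> \<open>As \<open>(A - B)\<^sup>T\<close> is invertible, every vector is a difference \<open>A\<^sup>T w - B\<^sup>T w\<close>, on which
      \<open>\<rho>\<close> and \<open>\<rho>\<^sup>T\<close> act in the same way. This gives both symmetry and \<open>\<rho>\<^sup>2 = 1\<close>.\<close>
  have decomp: "\<exists>p q :: nat \<Rightarrow> real. (\<forall>i<d. v i = p i - q i) \<and> (\<forall>i<d. ap p i = - p i) \<and> (\<forall>i<d. ap q i = q i) \<and>
      (\<forall>i<d. (\<Sum>j<d. \<rho> j i * p j) = - p i) \<and> (\<forall>i<d. (\<Sum>j<d. \<rho> j i * q j) = q i)" for v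
  proof -
    obtain N :: "nat \<Rightarrow> nat \<Rightarrow> real" where N: "\<forall>i<d. \<forall>l<d. (\<Sum>j<d. (a j i - 1 * b j i) * N j l) = (if i = l then 1 else 0)"
      using invT[of 1] by auto
    define w where "w = (\<lambda>j. \<Sum>l<d. N j l * v l)"
    define p where "p = (\<lambda>i. \<Sum>m<d. a m i * w m)"
    define q where "q = (\<lambda>i. \<Sum>m<d. b m i * w m)"
    have "v i = p i - q i" if i: "i < d" for i
    proof -
      have "p i - q i = (\<Sum>j<d. (a j i - 1 * b j i) * w j)" by (simp add: p_def q_def sum_subtractf algebra_simps)
      also have "\<dots> = (\<Sum>l<d. (\<Sum>j<d. (a j i - 1 * b j i) * N j l) * v l)"
        unfolding w_def sum_distrib_left sum_distrib_right by (subst sum.swap) (simp add: mult_ac)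
      also have "\<dots> = (\<Sum>l<d. (if i = l then 1 else 0) * v l)" using N i by simp
      also have "\<dots> = v i" by (rule sum_kronecker(2)[OF i])
      finally show ?thesis by simp
    qed
    moreover have "ap q i = q i" "ap p i = - p i" if i: "i < d" for i
    proof -
      have fg: "\<forall>i<d. (\<Sum>j<d. a i j * q j) + (\<Sum>j<d. b i j * - p j) = 0" using lag[of _ w] by (simp add: p_def q_def)
      from fwd(1)[OF this i] show "ap q i = q i" by simp
      from fwd(2)[OF fg i] show "ap p i = - p i" by (simp add: ap_def sum_negf)
    qed
    moreover have "\<forall>i<d. (\<Sum>j<d. \<rho> j i * p j) = - p i" "\<forall>i<d. (\<Sum>j<d. \<rho> j i * q j) = q i"
      using tr[of _ w] by (simp_all add: p_def q_def)
    ultimately show ?thesis by (intro exI[of _ p] exI[of _ q]) simp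
  qed
  define e :: "nat \<Rightarrow> nat \<Rightarrow> real" where "e = (\<lambda>l j. if j = l then 1 else 0)"
  have e: "(\<Sum>j<d. c j * e l j) = c l" if "l < d" for c l unfolding e_def by (rule sum_kronecker(3)[OF that])
  have sy: "\<rho> i l = \<rho> l i" and inv: "(\<Sum>j<d. \<rho> i j * \<rho> j l) = (if i = l then 1 else 0)" 
    if il: "i < d" "l < d" for i l
  proof -
    obtain p q :: "nat \<Rightarrow> real" where pq: "\<forall>i<d. e l i = p i - q i" "\<forall>i<d. ap p i = - p i" "\<forall>i<d. ap q i = q i"
      "\<forall>i<d. (\<Sum>j<d. \<rho> j i * p j) = - p i" "\<forall>i<d. (\<Sum>j<d. \<rho> j i * q j) = q i" using decomp[of "e l"] by blast
    have ape: "ap (e l) i = - p i - q i" if "i < d" for i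
    proof -
      have "ap (e l) i = ap p i - ap q i" using pq(1) by (simp add: ap_def right_diff_distrib sum_subtractf)
      then show ?thesis using pq that by simp
    qed
    have tre: "(\<Sum>j<d. \<rho> j i * e l j) = - p i - q i"
    proof -
      have "(\<Sum>j<d. \<rho> j i * e l j) = (\<Sum>j<d. \<rho> j i * p j) - (\<Sum>j<d. \<rho> j i * q j)" 
        using pq(1) by (simp add: right_diff_distrib sum_subtractf)
      then show ?thesis using pq il by simp
    qed
    have col: "\<rho> j l = ap (e l) j" if "j < d" for j using e[OF il(2), of "\<rho> j"] by (simp add: ap_def)
    show "\<rho> i l = \<rho> l i"
      using ape[OF il(1)] tre col[OF il(1)] e[OF il(2), of "\<lambda>j. \<rho> j i"] by simp
    have "(\<Sum>j<d. \<rho> i j * \<rho> j l) = ap (\<lambda>j. - p j - q j) i" using ape col by (simp add: ap_def)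
    also have "\<dots> = - ap p i - ap q i" by (simp add: ap_def right_diff_distrib sum_subtractf sum_negf)
    also have "\<dots> = e l i" using pq il by simp
    finally show "(\<Sum>j<d. \<rho> i j * \<rho> j l) = (if i = l then 1 else 0)" by (simp add: e_def)
  qed
  have main: "A *\<^sub>v vec d f + B *\<^sub>v vec d g = 0\<^sub>v d \<longleftrightarrow>
       (\<forall>i<d. f i = (\<Sum>j<d. \<rho> i j * f j)) \<and> (\<forall>i<d. g i = - (\<Sum>j<d. \<rho> i j * g j))" for f g
  proof -
    have bc: "A *\<^sub>v vec d f + B *\<^sub>v vec d g = 0\<^sub>v d \<longleftrightarrow> (\<forall>i<d. (\<Sum>j<d. a i j * f j) + (\<Sum>j<d. b i j * g j) = 0)"
    proof -
      have "A *\<^sub>v vec d f + B *\<^sub>v vec d g = 0\<^sub>v d \<longleftrightarrow> (\<forall>i<d. (A *\<^sub>v vec d f + B *\<^sub>v vec d g) $ i = 0)"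
        using A B by (auto simp: vec_eq_iff)
      moreover have "(A *\<^sub>v vec d f + B *\<^sub>v vec d g) $ i = (\<Sum>j<d. a i j * f j) + (\<Sum>j<d. b i j * g j)" if "i < d" for i
        using mat_mult_vec_component[OF A that, of f] mat_mult_vec_component[OF B that, of g] A B that by (simp add: a_def b_def)
      ultimately show ?thesis by auto
    qed
    show ?thesis
    proof
      assume "A *\<^sub>v vec d f + B *\<^sub>v vec d g = 0\<^sub>v d"
      then have fg: "\<forall>i<d. (\<Sum>j<d. a i j * f j) + (\<Sum>j<d. b i j * g j) = 0" by (rule iffD1[OF bc])
      show "(\<forall>i<d. f i = (\<Sum>j<d. \<rho> i j * f j)) \<and> (\<forall>i<d. g i = - (\<Sum>j<d. \<rho> i j * g j))"
        using fwd[OF fg] unfolding ap_def by blast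
    next
      assume fg: "(\<forall>i<d. f i = (\<Sum>j<d. \<rho> i j * f j)) \<and> (\<forall>i<d. g i = - (\<Sum>j<d. \<rho> i j * g j))"
      show "A *\<^sub>v vec d f + B *\<^sub>v vec d g = 0\<^sub>v d"
      proof (rule iffD2[OF bc], intro allI impI)
        fix i assume i: "i < d"
        have apf: "ap f j = f j" and apg: "ap g j = - g j" if j: "j < d" for j
        proof -
          have "f j = (\<Sum>m<d. \<rho> j m * f m)" "g j = - (\<Sum>m<d. \<rho> j m * g m)" using fg j by blast+
          then show "ap f j = f j" "ap g j = - g j" unfolding ap_def by linarith+
        qed
        have "(\<Sum>j<d. a i j * ap f j) = (\<Sum>j<d. a i j * f j)" using apf by (intro sum.cong) auto
        moreover have "(\<Sum>j<d. b i j * ap g j) = - (\<Sum>j<d. b i j * g j)" using apg by (simp add: sum_negf)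
        ultimately show "(\<Sum>j<d. a i j * f j) + (\<Sum>j<d. b i j * g j) = 0" using a\<rho>[OF i, of f] b\<rho>[OF i, of g] by linarith
      qed
    qed
  qed
  show thesis by (rule that[of \<rho>, OF sy inv main])
qed

section \<open>Eigenvectors of compact symmetric operators\<close>

text \<open>
  Elements are functions and not classes modulo null functions, since the heat kernel is evaluated at
  points. The form is therefore only semidefinite.
\<close>

locale semi_inner_space =
  fixes H :: "('p \<Rightarrow> real) set" and ip :: "('p \<Rightarrow> real) \<Rightarrow> ('p \<Rightarrow> real) \<Rightarrow> real"
  assumes zero_H: "(\<lambda>y. 0) \<in> H"
    and add_H: "f \<in> H \<Longrightarrow> g \<in> H \<Longrightarrow> (\<lambda>y. f y + g y) \<in> H"
    and cmult_H: "f \<in> H \<Longrightarrow> (\<lambda>y. c * f y) \<in> H"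
    and ip_sym: "ip f g = ip g f"
    and ip_add: "f \<in> H \<Longrightarrow> g \<in> H \<Longrightarrow> h \<in> H \<Longrightarrow> ip (\<lambda>y. f y + g y) h = ip f h + ip g h"
    and ip_cmult: "f \<in> H \<Longrightarrow> h \<in> H \<Longrightarrow> ip (\<lambda>y. c * f y) h = c * ip f h"
    and ip_nonneg: "f \<in> H \<Longrightarrow> 0 \<le> ip f f"
begin

lemma diff_H: "f \<in> H \<Longrightarrow> g \<in> H \<Longrightarrow> (\<lambda>y. f y - g y) \<in> H"
  using add_H[of f "\<lambda>y. -1 * g y"] cmult_H[of g "-1"] by simp

lemma ip_diff: "f \<in> H \<Longrightarrow> g \<in> H \<Longrightarrow> h \<in> H \<Longrightarrow> ip (\<lambda>y. f y - g y) h = ip f h - ip g h"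
  using ip_add[of f "\<lambda>y. -1 * g y" h] ip_cmult[of g h "-1"] cmult_H[of g "-1"] by simp

lemma ip_diff_right: "f \<in> H \<Longrightarrow> g \<in> H \<Longrightarrow> h \<in> H \<Longrightarrow> ip h (\<lambda>y. f y - g y) = ip h f - ip h g"
  using ip_diff[of f g h] by (simp add: ip_sym)

lemma ip_cmult_right: "f \<in> H \<Longrightarrow> h \<in> H \<Longrightarrow> ip h (\<lambda>y. c * f y) = c * ip h f"
  using ip_cmult[of f h c] by (simp add: ip_sym)

lemma ip_zero: "h \<in> H \<Longrightarrow> ip (\<lambda>y. 0) h = 0"
  using ip_cmult[OF zero_H, of h 0] by simp

lemma norm_diff_expand:
  assumes "f \<in> H" "g \<in> H"
  shows "ip (\<lambda>y. f y - c * g y) (\<lambda>y. f y - c * g y) = ip f f - 2 * c * ip f g + c\<^sup>2 * ip g g"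
proof -
  have cg: "(\<lambda>y. c * g y) \<in> H" using assms cmult_H by blast
  have d: "(\<lambda>y. f y - c * g y) \<in> H" using assms cg diff_H by blast
  have "ip (\<lambda>y. f y - c * g y) (\<lambda>y. f y - c * g y) = (ip f f - c * ip f g) - c * (ip g f - c * ip g g)"
    by (simp only: ip_diff[OF assms(1) cg d] ip_diff_right[OF assms(1) cg assms(1)] ip_diff_right[OF assms(1) cg assms(2)]
        ip_cmult[OF assms(2) d] ip_cmult_right[OF assms(2) assms(1)] ip_cmult_right[OF assms(2) assms(2)])
  also have "\<dots> = ip f f - 2 * c * ip f g + c\<^sup>2 * ip g g"
    by (simp add: ip_sym[of g f] power2_eq_square algebra_simps)
  finally show ?thesis .
qed

lemma Cauchy_Schwarz:
  assumes "f \<in> H" "g \<in> H"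
  shows "(ip f g)\<^sup>2 \<le> ip f f * ip g g"
proof (cases "ip g g = 0")
  case False
  define t where "t = ip f g / ip g g"
  have pos: "0 < ip g g" using False ip_nonneg[OF assms(2)] by linarith
  have "(\<lambda>y. f y - t * g y) \<in> H" using assms cmult_H diff_H by blast
  then have "0 \<le> ip (\<lambda>y. f y - t * g y) (\<lambda>y. f y - t * g y)" by (rule ip_nonneg)
  also have "\<dots> = ip f f - (ip f g)\<^sup>2 / ip g g"
    unfolding norm_diff_expand[OF assms] t_def using pos by (simp add: power2_eq_square field_simps)
  finally show ?thesis using pos by (simp add: field_simps)
next
  case True
  have "ip f g = 0"
  proof (rule ccontr)
    assume nz: "ip f g \<noteq> 0"
    define t where "t = (ip f f + 1) / (2 * ip f g)"
    have "(\<lambda>y. f y - t * g y) \<in> H" using assms cmult_H diff_H by blast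
    then have "0 \<le> ip (\<lambda>y. f y - t * g y) (\<lambda>y. f y - t * g y)" by (rule ip_nonneg)
    also have "\<dots> = -1" unfolding norm_diff_expand[OF assms] True t_def using nz by (simp add: field_simps)
    finally show False by simp
  qed
  then show ?thesis using True by simp
qed

lemma ip_cmult_both: "f \<in> H \<Longrightarrow> ip (\<lambda>y. c * f y) (\<lambda>y. c * f y) = c\<^sup>2 * ip f f"
  by (simp only: ip_cmult[OF _ cmult_H] ip_cmult_right power2_eq_square mult.assoc)

lemma norm_add_le:
  assumes "f \<in> H" "g \<in> H"
  shows "ip (\<lambda>y. f y + g y) (\<lambda>y. f y + g y) \<le> 2 * ip f f + 2 * ip g g"
proof -
  have d: "(\<lambda>y. f y - 1 * g y) \<in> H" "(\<lambda>y. f y - (-1) * g y) \<in> H" using diff_H[OF assms] add_H[OF assms] by simp_all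
  show ?thesis
    using norm_diff_expand[OF assms, of 1] norm_diff_expand[OF assms, of "-1"] ip_nonneg[OF d(1)] by simp
qed

end

text \<open>
  The abstract properties of the resolvent which the spectral theory uses. \<open>K\<close> plays the role of the
  continuous functions, on which the form is definite. \<open>C\<close> bounds \<open>R\<close> from the \<open>L\<^sup>2\<close> norm to the
  supremum norm, and \<open>L\<close> is the total measure. Compactness gives limits that are uniform and lie in
  \<open>K\<close>, which takes the place of completeness of \<open>H\<close>.
\<close>

locale compact_symmetric = semi_inner_space H ip
  for H :: "('p \<Rightarrow> real) set" and ip +
  fixes K :: "('p \<Rightarrow> real) set" and R :: "('p \<Rightarrow> real) \<Rightarrow> 'p \<Rightarrow> real" and C L :: real
  assumes ip_le_sup: "finite F \<Longrightarrow> F \<subseteq> H \<Longrightarrow> (\<And>x. (\<Sum>f\<in>F. (f x)\<^sup>2) \<le> B) \<Longrightarrow> (\<Sum>f\<in>F. ip f f) \<le> L * B"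
    and K_H: "K \<subseteq> H"
    and K_zero: "f \<in> K \<Longrightarrow> ip f f = 0 \<Longrightarrow> f = (\<lambda>y. 0)"
    and K_limit: "(\<And>n::nat. fs n \<in> K) \<Longrightarrow> (\<And>e. 0 < e \<Longrightarrow> \<exists>N. \<forall>n\<ge>N. \<forall>x. \<bar>fs n x - g x\<bar> \<le> e) \<Longrightarrow> g \<in> K"
    and R_K: "f \<in> H \<Longrightarrow> R f \<in> K"
    and R_add: "f \<in> H \<Longrightarrow> g \<in> H \<Longrightarrow> R (\<lambda>y. f y + g y) = (\<lambda>y. R f y + R g y)"
    and R_cmult: "f \<in> H \<Longrightarrow> R (\<lambda>y. c * f y) = (\<lambda>y. c * R f y)"
    and R_sym: "f \<in> H \<Longrightarrow> g \<in> H \<Longrightarrow> ip (R f) g = ip f (R g)"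
    and C_nonneg: "0 \<le> C"
    and L_nonneg: "0 \<le> L"
    and R_bound: "f \<in> H \<Longrightarrow> \<bar>R f x\<bar> \<le> C * sqrt (ip f f)"
    and R_compact: "(\<And>n::nat. fs n \<in> H) \<Longrightarrow> (\<And>n. ip (fs n) (fs n) \<le> 1) \<Longrightarrow>
       \<exists>(r :: nat \<Rightarrow> nat) g. strict_mono r \<and> g \<in> K \<and> (\<forall>e>0. \<exists>N. \<forall>n\<ge>N. \<forall>x. \<bar>R (fs (r n)) x - g x\<bar> \<le> e)"
    and R_injective: "f \<in> H \<Longrightarrow> R f = (\<lambda>y. 0) \<Longrightarrow> ip f f = 0"
    and R_no_negative_eigenvalue: "f \<in> K \<Longrightarrow> 0 < s \<Longrightarrow> R f = (\<lambda>y. - s * f y) \<Longrightarrow> f = (\<lambda>y. 0)"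
begin

lemma R_H: "f \<in> H \<Longrightarrow> R f \<in> H" using R_K K_H by blast

lemma R_diff: "f \<in> H \<Longrightarrow> g \<in> H \<Longrightarrow> R (\<lambda>y. f y - g y) = (\<lambda>y. R f y - R g y)"
  using R_add[of f "\<lambda>y. -1 * g y"] R_cmult[of g "-1"] cmult_H[of g "-1"] by simp

lemma R_zero: "R (\<lambda>y. 0) = (\<lambda>y. 0)"
  using R_cmult[OF zero_H, of 0] by simp

lemma norm_le_sup:
  assumes "f \<in> H" "\<And>x. \<bar>f x\<bar> \<le> B"
  shows "ip f f \<le> L * B\<^sup>2"
proof -
  have "(f x)\<^sup>2 \<le> B\<^sup>2" for x using assms(2)[of x] by (meson abs_ge_zero order_trans power2_le_iff_abs_le)
  then show ?thesis using ip_le_sup[of "{f}" "B\<^sup>2"] assms(1) by simp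
qed

lemma null_imp_R_zero:
  assumes "f \<in> H" "ip f f = 0"
  shows "R f = (\<lambda>y. 0)"
proof
  fix y show "R f y = 0" using R_bound[OF assms(1), of y] assms(2) by simp
qed

lemma R_norm_le:
  assumes "f \<in> H"
  shows "ip (R f) (R f) \<le> L * C\<^sup>2 * ip f f"
proof -
  have "ip (R f) (R f) \<le> L * (C * sqrt (ip f f))\<^sup>2"
    using R_bound[OF assms] by (intro norm_le_sup R_H assms) auto
  then show ?thesis using ip_nonneg[OF assms] by (simp add: power_mult_distrib mult_ac)
qed

definition eigenvector :: "('p \<Rightarrow> real) \<Rightarrow> real \<Rightarrow> bool" where
  "eigenvector \<phi> \<mu> \<longleftrightarrow> \<phi> \<in> K \<and> ip \<phi> \<phi> = 1 \<and> 0 < \<mu> \<and> R \<phi> = (\<lambda>y. \<mu> * \<phi> y)"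

definition orthonormal_eigenvectors :: "('p \<Rightarrow> real) set \<Rightarrow> bool" where
  "orthonormal_eigenvectors S \<longleftrightarrow> (\<forall>\<phi>\<in>S. \<exists>\<mu>. eigenvector \<phi> \<mu>) \<and> (\<forall>\<phi>\<in>S. \<forall>\<psi>\<in>S. \<phi> \<noteq> \<psi> \<longrightarrow> ip \<phi> \<psi> = 0)"

lemma maximal_orthonormal_eigenvectors_exist:
  "\<exists>S. orthonormal_eigenvectors S \<and> (\<forall>S'. orthonormal_eigenvectors S' \<and> S \<subseteq> S' \<longrightarrow> S' = S)"
proof -
  have "\<exists>M\<in>Collect orthonormal_eigenvectors. \<forall>X\<in>Collect orthonormal_eigenvectors. M \<subseteq> X \<longrightarrow> X = M"
  proof (rule subset_Zorn_nonempty)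
    have "orthonormal_eigenvectors {}" by (simp add: orthonormal_eigenvectors_def)
    then show "Collect orthonormal_eigenvectors \<noteq> {}" by blast
  next
    fix \<C> assume "\<C> \<noteq> {}" and ch: "subset.chain (Collect orthonormal_eigenvectors) \<C>"
    have sub: "\<And>A. A \<in> \<C> \<Longrightarrow> orthonormal_eigenvectors A" using ch by (auto simp: subset_chain_def)
    have tot: "\<And>A B. A \<in> \<C> \<Longrightarrow> B \<in> \<C> \<Longrightarrow> A \<subseteq> B \<or> B \<subseteq> A" using ch by (auto simp: subset_chain_def)
    have "orthonormal_eigenvectors (\<Union>\<C>)"
      unfolding orthonormal_eigenvectors_def
    proof (intro conjI ballI impI)
      fix \<phi> assume "\<phi> \<in> \<Union>\<C>"
      then show "\<exists>\<mu>. eigenvector \<phi> \<mu>" using sub unfolding orthonormal_eigenvectors_def by blast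
    next
      fix \<phi> \<psi> assume "\<phi> \<in> \<Union>\<C>" "\<psi> \<in> \<Union>\<C>" and ne: "\<phi> \<noteq> \<psi>"
      then obtain A B where "A \<in> \<C>" "B \<in> \<C>" "\<phi> \<in> A" "\<psi> \<in> B" by blast
      then obtain D where "D \<in> \<C>" "\<phi> \<in> D" "\<psi> \<in> D" using tot[of A B] by blast
      then show "ip \<phi> \<psi> = 0" using sub[of D] ne unfolding orthonormal_eigenvectors_def by blast
    qed
    then show "\<Union>\<C> \<in> Collect orthonormal_eigenvectors" by simp
  qed
  then show ?thesis by blast
qed

definition S :: "('p \<Rightarrow> real) set" where
  "S = (SOME S. orthonormal_eigenvectors S \<and> (\<forall>S'. orthonormal_eigenvectors S' \<and> S \<subseteq> S' \<longrightarrow> S' = S))"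

lemma S_props: "orthonormal_eigenvectors S" "\<And>S'. orthonormal_eigenvectors S' \<Longrightarrow> S \<subseteq> S' \<Longrightarrow> S' = S"
  using someI_ex[OF maximal_orthonormal_eigenvectors_exist] unfolding S_def[symmetric] by blast+

definition \<mu> :: "('p \<Rightarrow> real) \<Rightarrow> real" where "\<mu> \<phi> = (SOME m. eigenvector \<phi> m)"

lemma S_eigenvector: "\<phi> \<in> S \<Longrightarrow> eigenvector \<phi> (\<mu> \<phi>)"
  using S_props(1) unfolding orthonormal_eigenvectors_def \<mu>_def by (meson someI_ex)

lemma S_facts:
  assumes "\<phi> \<in> S"
  shows "\<phi> \<in> K" "\<phi> \<in> H" "ip \<phi> \<phi> = 1" "0 < \<mu> \<phi>" "R \<phi> = (\<lambda>y. \<mu> \<phi> * \<phi> y)"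
  using S_eigenvector[OF assms] K_H unfolding eigenvector_def by blast+

lemma S_orthogonal: "\<phi> \<in> S \<Longrightarrow> \<psi> \<in> S \<Longrightarrow> ip \<phi> \<psi> = (if \<phi> = \<psi> then 1 else 0)"
  using S_props(1) S_facts(3) unfolding orthonormal_eigenvectors_def by auto

definition V :: "('p \<Rightarrow> real) set" where "V = {w\<in>H. \<forall>\<phi>\<in>S. ip w \<phi> = 0}"

lemma V_H: "w \<in> V \<Longrightarrow> w \<in> H" by (simp add: V_def)

lemma V_cmult: "w \<in> V \<Longrightarrow> (\<lambda>y. c * w y) \<in> V"
  by (auto simp: V_def cmult_H ip_cmult S_facts(2))

lemma V_R: "w \<in> V \<Longrightarrow> R w \<in> V"
proof -
  assume w: "w \<in> V"
  have "ip (R w) \<phi> = 0" if p: "\<phi> \<in> S" for \<phi>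
  proof -
    have "ip (R w) \<phi> = ip w (\<lambda>y. \<mu> \<phi> * \<phi> y)" using R_sym[OF V_H[OF w] S_facts(2)[OF p]] S_facts(5)[OF p] by simp
    also have "\<dots> = \<mu> \<phi> * ip w \<phi>" by (rule ip_cmult_right[OF S_facts(2)[OF p] V_H[OF w]])
    finally show ?thesis using w p by (simp add: V_def)
  qed
  then show ?thesis using R_H[OF V_H[OF w]] by (simp add: V_def)
qed

text \<open>
  A normalised eigenvector orthogonal to \<open>S\<close> could be added to the maximal set \<open>S\<close>.
\<close>

lemma no_eigenvector_in_V:
  assumes "x \<in> V" "x \<in> K" "0 < s" "R x = (\<lambda>y. s * x y)"
  shows "ip x x = 0"
proof (rule ccontr)
  assume "ip x x \<noteq> 0"
  then have pos: "0 < ip x x" using ip_nonneg[OF V_H[OF assms(1)]] by linarith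
  define \<phi> where "\<phi> = (\<lambda>y. (1 / sqrt (ip x x)) * x y)"
  have xH: "x \<in> H" using assms(1) V_H by blast
  have pV: "\<phi> \<in> V" unfolding \<phi>_def by (rule V_cmult[OF assms(1)])
  have n1: "ip \<phi> \<phi> = 1"
  proof -
    have "ip \<phi> \<phi> = (1 / sqrt (ip x x)) * ip x \<phi>" unfolding \<phi>_def by (rule ip_cmult[OF xH cmult_H[OF xH]])
    also have "ip x \<phi> = (1 / sqrt (ip x x)) * ip x x" unfolding \<phi>_def by (rule ip_cmult_right[OF xH xH])
    finally show ?thesis using pos by (simp add: real_sqrt_mult_self field_simps)
  qed
  have R\<phi>: "R \<phi> = (\<lambda>y. s * \<phi> y)"
    unfolding \<phi>_def R_cmult[OF xH] assms(4) by (simp add: mult_ac)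
  have "\<phi> = (\<lambda>y. (1 / s) * R \<phi> y)" unfolding R\<phi> using assms(3) by simp
  moreover have "(\<lambda>y. (1 / s) * R \<phi> y) \<in> K"
    using R_K[OF cmult_H[OF V_H[OF pV], of "1 / s"]] unfolding R_cmult[OF V_H[OF pV]] .
  ultimately have "\<phi> \<in> K" by simp
  then have "eigenvector \<phi> s" using n1 assms(3) R\<phi> by (simp add: eigenvector_def)
  then have "orthonormal_eigenvectors (insert \<phi> S)"
    using S_props(1) pV unfolding orthonormal_eigenvectors_def V_def by (auto simp: ip_sym)
  then have "insert \<phi> S = S" by (rule S_props(2)) blast
  then have "\<phi> \<in> S" by blast
  then show False using pV n1 unfolding V_def by fastforce
qed

text \<open>
  Let \<open>s2\<close> be the squared norm of \<open>R\<close> on \<open>V\<close> and suppose that it is positive. For a maximising sequence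
  \<open>v n\<close>, the vectors \<open>R (v n)\<close> converge along a subsequence to some \<open>y\<close>, and \<open>v n - R (R (v n)) / s2\<close>
  tends to 0 in norm. So \<open>v n\<close> tends to \<open>x = R y / s2\<close>, which satisfies \<open>R x = y\<close> and
  \<open>R (R x) = s2 * x\<close>. With \<open>s = sqrt s2\<close>, the vector \<open>R x - s * x\<close> is an eigenvector for \<open>- s\<close> and
  hence zero, so \<open>x\<close> is an eigenvector for \<open>s\<close> in \<open>V\<close>, a contradiction.
\<close>

theorem R_vanishes_on_complement:
  assumes "w \<in> V"
  shows "R w = (\<lambda>y. 0)"
proof -
  define Q where "Q = {ip (R w) (R w) | w. w \<in> V \<and> ip w w \<le> 1}"
  define s2 where "s2 = Sup Q"
  have zV: "(\<lambda>y. 0) \<in> V" using zero_H ip_zero S_facts(2) by (auto simp: V_def)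
  have "ip (R (\<lambda>y. 0)) (R (\<lambda>y. 0)) \<in> Q" using zV ip_zero[OF zero_H] unfolding Q_def by force
  then have Qne: "Q \<noteq> {}" "0 \<in> Q" using ip_zero[OF zero_H] by (auto simp: R_zero)
  have bdd: "bdd_above Q"
  proof (rule bdd_aboveI)
    fix q assume "q \<in> Q"
    then obtain w where w: "w \<in> V" "ip w w \<le> 1" "q = ip (R w) (R w)" by (auto simp: Q_def)
    have "q \<le> L * C\<^sup>2 * ip w w" unfolding w(3) by (rule R_norm_le[OF V_H[OF w(1)]])
    also have "\<dots> \<le> L * C\<^sup>2 * 1" using w(2) L_nonneg by (intro mult_left_mono) auto
    finally show "q \<le> L * C\<^sup>2" by simp
  qed
  have s2_ge: "0 \<le> s2" unfolding s2_def by (rule cSup_upper[OF Qne(2) bdd])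
  have le: "ip (R u) (R u) \<le> s2 * ip u u" if u: "u \<in> V" for u
  proof (cases "ip u u = 0")
    case True
    then show ?thesis using null_imp_R_zero[OF V_H[OF u]] ip_zero[OF zero_H] by simp
  next
    case False
    then have pos: "0 < ip u u" using ip_nonneg[OF V_H[OF u]] by linarith
    define c where "c = 1 / sqrt (ip u u)"
    have uH: "u \<in> H" using u V_H by blast
    have c2: "c\<^sup>2 * ip u u = 1" using pos by (simp add: c_def power_divide)
    have sq: "ip (\<lambda>y. c * v y) (\<lambda>y. c * v y) = c\<^sup>2 * ip v v" if v: "v \<in> H" for v
      by (simp add: ip_cmult[OF v cmult_H[OF v]] ip_cmult_right[OF v v] power2_eq_square)
    have "ip (R (\<lambda>y. c * u y)) (R (\<lambda>y. c * u y)) \<in> Q"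
      unfolding Q_def using V_cmult[OF u, of c] sq[OF uH] c2 by (intro CollectI exI[of _ "\<lambda>y. c * u y"]) simp
    then have "ip (R (\<lambda>y. c * u y)) (R (\<lambda>y. c * u y)) \<le> s2" unfolding s2_def by (rule cSup_upper[OF _ bdd])
    then have "c\<^sup>2 * ip (R u) (R u) \<le> s2" unfolding R_cmult[OF uH] sq[OF R_H[OF uH]] .
    then have "c\<^sup>2 * ip (R u) (R u) * ip u u \<le> s2 * ip u u" using pos by (intro mult_right_mono) auto
    moreover have "c\<^sup>2 * ip (R u) (R u) * ip u u = ip (R u) (R u)" using c2 by (simp add: mult_ac)
    ultimately show ?thesis by linarith
  qed
  have "s2 = 0"
  proof (rule ccontr)
    assume "s2 \<noteq> 0"
    then have s2: "0 < s2" using s2_ge by simp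
    have "\<exists>w. w \<in> V \<and> ip w w \<le> 1 \<and> s2 - 1 / real (Suc n) < ip (R w) (R w)" for n
    proof -
      have "s2 - 1 / real (Suc n) < Sup Q" unfolding s2_def[symmetric] by simp
      then obtain q where "q \<in> Q" "s2 - 1 / real (Suc n) < q" using less_cSupD[OF Qne(1)] by blast
      then show ?thesis by (auto simp: Q_def)
    qed
    then obtain w where w: "\<And>n. w n \<in> V" "\<And>n. ip (w n) (w n) \<le> 1" "\<And>n. s2 - 1 / real (Suc n) < ip (R (w n)) (R (w n))"
      by metis
    have wH: "w n \<in> H" for n using w(1) V_H by blast
    from R_compact[where fs=w, OF wH w(2)] obtain r :: "nat \<Rightarrow> nat" and y where r: "strict_mono r" and yK: "y \<in> K"
      and lim: "\<And>e. 0 < e \<Longrightarrow> \<exists>N. \<forall>n\<ge>N. \<forall>x. \<bar>R (w (r n)) x - y x\<bar> \<le> e" by blast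
    have yH: "y \<in> H" using yK K_H by blast
    define v where "v = (\<lambda>n. w (r n))"
    have v: "v n \<in> V" "v n \<in> H" "ip (v n) (v n) \<le> 1" for n using w wH by (auto simp: v_def)
    have vlow: "s2 - 1 / real (Suc n) < ip (R (v n)) (R (v n))" for n
    proof -
      have "n \<le> r n" using r by (rule seq_suble)
      then have "1 / real (Suc (r n)) \<le> 1 / real (Suc n)" by (intro divide_left_mono) auto
      then show ?thesis using w(3)[of "r n"] by (simp add: v_def)
    qed
    define d where "d = (\<lambda>n y'. R (v n) y' - y y')"
    have dH: "d n \<in> H" for n unfolding d_def by (rule diff_H[OF R_H[OF v(2)] yH])
    have Nd: "(\<lambda>n. ip (d n) (d n)) \<longlonglongrightarrow> 0"
    proof (rule LIMSEQ_I)
      fix e :: real assume "0 < e"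
      define e1 where "e1 = sqrt (e / (2 * (L + 1)))"
      have "0 < L * e + e * 2" using \<open>0 < e\<close> mult_nonneg_nonneg[OF L_nonneg, of e] by linarith
      then have e1: "0 < e1" "L * e1\<^sup>2 < e" using \<open>0 < e\<close> L_nonneg by (auto simp: e1_def field_simps)
      from lim[OF e1(1)] obtain N where N: "\<forall>n\<ge>N. \<forall>x. \<bar>R (w (r n)) x - y x\<bar> \<le> e1" by blast
      have "norm (ip (d n) (d n) - 0) < e" if "N \<le> n" for n
      proof -
        have "ip (d n) (d n) \<le> L * e1\<^sup>2"
          by (rule norm_le_sup[OF dH]) (use N that in \<open>auto simp: d_def v_def\<close>)
        then show ?thesis using e1(2) ip_nonneg[OF dH, of n] by simp
      qed
      then show "\<exists>no. \<forall>n\<ge>no. norm (ip (d n) (d n) - 0) < e" by blast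
    qed
    define x where "x = (\<lambda>y'. (1 / s2) * R y y')"
    have xH: "x \<in> H" unfolding x_def by (rule cmult_H[OF R_H[OF yH]])
    \<comment> \<open>How far \<open>v n\<close> is from being an eigenvector of \<open>R\<^sup>2\<close> for \<open>s2\<close>.\<close>
    define p where "p = (\<lambda>n y'. v n y' - (1 / s2) * R (R (v n)) y')"
    have pH: "p n \<in> H" for n unfolding p_def by (rule diff_H[OF v(2) cmult_H[OF R_H[OF R_H[OF v(2)]]]])
    have Np: "ip (p n) (p n) \<le> (1 / s2) * (1 / real (Suc n))" for n
    proof -
      have RR: "R (v n) \<in> V" "R (v n) \<in> H" using V_R[OF v(1)] V_H by blast+
      have c: "ip (v n) (R (R (v n))) = ip (R (v n)) (R (v n))" using R_sym[OF v(2) RR(2), of n] by simp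
      have "ip (p n) (p n) = ip (v n) (v n) - 2 * (1 / s2) * ip (R (v n)) (R (v n)) + (1 / s2)\<^sup>2 * ip (R (R (v n))) (R (R (v n)))"
        unfolding p_def norm_diff_expand[OF v(2) R_H[OF RR(2)]] c ..
      also have "\<dots> \<le> 1 - 2 * (1 / s2) * ip (R (v n)) (R (v n)) + (1 / s2)\<^sup>2 * (s2 * ip (R (v n)) (R (v n)))"
        using v(3)[of n] le[OF RR(1)] s2_ge by (intro add_mono diff_mono mult_left_mono) auto
      also have "\<dots> = (1 / s2) * (s2 - ip (R (v n)) (R (v n)))"
        using s2 by (simp add: power2_eq_square field_simps)
      also have "\<dots> \<le> (1 / s2) * (1 / real (Suc n))"
        using vlow[of n] s2 by (intro mult_left_mono) auto
      finally show ?thesis .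
    qed
    have Np0: "(\<lambda>n. ip (p n) (p n)) \<longlonglongrightarrow> 0"
    proof (rule tendsto_sandwich[OF _ _ tendsto_const])
      show "eventually (\<lambda>n. 0 \<le> ip (p n) (p n)) sequentially" using ip_nonneg[OF pH] by simp
      show "eventually (\<lambda>n. ip (p n) (p n) \<le> (1 / s2) * (1 / real (Suc n))) sequentially" using Np by simp
      show "(\<lambda>n. (1 / s2) * (1 / real (Suc n))) \<longlonglongrightarrow> 0"
        using tendsto_mult[OF tendsto_const[of "1 / s2"] LIMSEQ_Suc[OF lim_1_over_n]] by simp
    qed
    define q where "q = (\<lambda>n y'. v n y' - x y')"
    have qH: "q n \<in> H" for n unfolding q_def by (rule diff_H[OF v(2) xH])
    have Nq: "(\<lambda>n. ip (q n) (q n)) \<longlonglongrightarrow> 0"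
    proof (rule tendsto_sandwich[OF _ _ tendsto_const])
      show "eventually (\<lambda>n. 0 \<le> ip (q n) (q n)) sequentially" using ip_nonneg[OF qH] by simp
      show "eventually (\<lambda>n. ip (q n) (q n) \<le> 2 * ip (p n) (p n) + 2 * ((1 / s2)\<^sup>2 * (L * C\<^sup>2 * ip (d n) (d n)))) sequentially"
      proof (rule always_eventually, rule allI)
        fix n
        have RdH: "R (d n) \<in> H" by (rule R_H[OF dH])
        have "q n = (\<lambda>y'. p n y' + (1 / s2) * R (d n) y')"
          unfolding q_def p_def x_def d_def R_diff[OF R_H[OF v(2)] yH] by (simp add: right_diff_distrib)
        then have "ip (q n) (q n) \<le> 2 * ip (p n) (p n) + 2 * ip (\<lambda>y'. (1 / s2) * R (d n) y') (\<lambda>y'. (1 / s2) * R (d n) y')"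
          using norm_add_le[OF pH[of n] cmult_H[OF RdH, of "1 / s2"]] by simp
        also have "ip (\<lambda>y'. (1 / s2) * R (d n) y') (\<lambda>y'. (1 / s2) * R (d n) y') = (1 / s2)\<^sup>2 * ip (R (d n)) (R (d n))"
          by (rule ip_cmult_both[OF RdH])
        also have "\<dots> \<le> (1 / s2)\<^sup>2 * (L * C\<^sup>2 * ip (d n) (d n))"
          by (intro mult_left_mono R_norm_le[OF dH]) auto
        finally show "ip (q n) (q n) \<le> 2 * ip (p n) (p n) + 2 * ((1 / s2)\<^sup>2 * (L * C\<^sup>2 * ip (d n) (d n)))" by simp
      qed
      have "(\<lambda>n. 2 * ip (p n) (p n) + 2 * ((1 / s2)\<^sup>2 * (L * C\<^sup>2 * ip (d n) (d n)))) \<longlonglongrightarrow> 2 * 0 + 2 * ((1 / s2)\<^sup>2 * (L * C\<^sup>2 * 0))"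
        by (intro tendsto_intros Np0 Nd)
      then show "(\<lambda>n. 2 * ip (p n) (p n) + 2 * ((1 / s2)\<^sup>2 * (L * C\<^sup>2 * ip (d n) (d n)))) \<longlonglongrightarrow> 0" by simp
    qed
    have Rx: "R x = y"
    proof
      fix z
      have "(\<lambda>n. R (v n) z) \<longlonglongrightarrow> y z"
      proof (rule LIMSEQ_I)
        fix e :: real assume "0 < e"
        then obtain N where N: "\<forall>n\<ge>N. \<forall>x. \<bar>R (w (r n)) x - y x\<bar> \<le> e / 2" using lim[of "e / 2"] by auto
        have "norm (R (v n) z - y z) < e" if n: "N \<le> n" for n
        proof -
          have "\<bar>R (v n) z - y z\<bar> \<le> e / 2" using N n unfolding v_def by blast
          then show ?thesis using \<open>0 < e\<close> by simp
        qed
        then show "\<exists>no. \<forall>n\<ge>no. norm (R (v n) z - y z) < e" by blast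
      qed
      moreover have "(\<lambda>n. R (v n) z) \<longlonglongrightarrow> R x z"
      proof (rule Lim_null[THEN iffD2], rule tendsto_rabs_zero_cancel, rule tendsto_sandwich[OF _ _ tendsto_const])
        show "eventually (\<lambda>n. 0 \<le> \<bar>R (v n) z - R x z\<bar>) sequentially" by simp
        show "eventually (\<lambda>n. \<bar>R (v n) z - R x z\<bar> \<le> C * sqrt (ip (q n) (q n))) sequentially"
          using R_bound[OF qH, of _ z] unfolding q_def R_diff[OF v(2) xH] by simp
        have "(\<lambda>n. C * sqrt (ip (q n) (q n))) \<longlonglongrightarrow> C * sqrt 0" by (intro tendsto_intros Nq)
        then show "(\<lambda>n. C * sqrt (ip (q n) (q n))) \<longlonglongrightarrow> 0" by simp
      qed
      ultimately show "R x z = y z" using LIMSEQ_unique by blast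
    qed
    have RRx: "R (R x) = (\<lambda>y'. s2 * x y')" 
    proof -
      have "s2 * x y' = R y y'" for y' using s2 by (simp add: x_def)
      then show ?thesis unfolding Rx by simp
    qed
    have xV: "x \<in> V"
    proof -
      have "ip x \<phi> = 0" if p: "\<phi> \<in> S" for \<phi>
      proof -
        have e: "ip x \<phi> = - ip (q n) \<phi>" for n
        proof -
          have "ip (v n) \<phi> = 0" using v(1)[of n] p by (simp add: V_def)
          then show ?thesis unfolding q_def using ip_diff[OF v(2) xH S_facts(2)[OF p]] by simp
        qed
        have "(ip x \<phi>)\<^sup>2 \<le> ip (q n) (q n)" for n
          using Cauchy_Schwarz[OF qH S_facts(2)[OF p], of n] S_facts(3)[OF p] e[of n] by simp
        then have "(ip x \<phi>)\<^sup>2 \<le> 0" by (intro LIMSEQ_le_const[OF Nq]) auto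
        then show ?thesis by simp
      qed
      then show ?thesis using xH by (simp add: V_def)
    qed
    define s where "s = sqrt s2"
    have s: "0 < s" "s * s = s2" using s2 by (auto simp: s_def)
    have xK: "x \<in> K" using R_K[OF cmult_H[OF yH, of "1 / s2"]] unfolding R_cmult[OF yH] x_def .
    define z where "z = (\<lambda>y'. R x y' - s * x y')"
    have zK: "z \<in> K"
    proof -
      have "R (\<lambda>y'. x y' - s * ((1 / s2) * y y')) = (\<lambda>y'. R x y' - s * ((1 / s2) * R y y'))"
        unfolding R_diff[OF xH cmult_H[OF cmult_H[OF yH]]] R_cmult[OF cmult_H[OF yH]] R_cmult[OF yH] ..
      also have "\<dots> = z" by (rule ext) (simp only: z_def fun_cong[OF x_def])
      finally have "R (\<lambda>y'. x y' - s * ((1 / s2) * y y')) = z" .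
      then show ?thesis using R_K[OF diff_H[OF xH cmult_H[OF cmult_H[OF yH, of "1 / s2"], of s]]] by (simp only:)
    qed
    have "R z = (\<lambda>y'. R (R x) y' - s * R x y')"
      unfolding z_def R_diff[OF R_H[OF xH] cmult_H[OF xH]] R_cmult[OF xH] ..
    also have "\<dots> = (\<lambda>y'. - s * z y')" unfolding RRx z_def by (simp add: s(2)[symmetric] algebra_simps)
    finally have "z = (\<lambda>y'. 0)" by (rule R_no_negative_eigenvalue[OF zK s(1)])
    then have Rxs: "R x = (\<lambda>y'. s * x y')" unfolding z_def by (metis eq_iff_diff_eq_0)
    have "ip x x = 0" by (rule no_eigenvector_in_V[OF xV xK s(1) Rxs])
    then have "y = (\<lambda>y'. 0)" using null_imp_R_zero[OF xH] Rx by simp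
    then have "(\<lambda>n. ip (R (v n)) (R (v n))) \<longlonglongrightarrow> 0" using Nd unfolding d_def by simp
    moreover have "(\<lambda>n. s2 - 1 / real (Suc n)) \<longlonglongrightarrow> s2 - 0"
      by (intro tendsto_intros LIMSEQ_Suc[OF lim_1_over_n])
    ultimately have "s2 - 0 \<le> 0" using vlow by (intro LIMSEQ_le[where X="\<lambda>n. s2 - 1 / real (Suc n)"]) (auto intro: less_imp_le)
    then show False using s2 by simp
  qed
  then have "ip (R w) (R w) = 0" using le[OF assms] ip_nonneg[OF R_H[OF V_H[OF assms]]] by simp
  then show ?thesis by (rule K_zero[OF R_K[OF V_H[OF assms]]])
qed

lemma complement_null: "w \<in> V \<Longrightarrow> ip w w = 0"
  using R_injective[OF V_H R_vanishes_on_complement] by blast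

end

section \<open>Eigenfunction expansions\<close>

context compact_symmetric
begin

lemma finite_sum_props:
  assumes "finite F" "F \<subseteq> H"
  shows "(\<lambda>y. \<Sum>\<phi>\<in>F. a \<phi> * \<phi> y) \<in> H \<and> (\<forall>g\<in>H. ip (\<lambda>y. \<Sum>\<phi>\<in>F. a \<phi> * \<phi> y) g = (\<Sum>\<phi>\<in>F. a \<phi> * ip \<phi> g)) \<and>
    R (\<lambda>y. \<Sum>\<phi>\<in>F. a \<phi> * \<phi> y) = (\<lambda>y. \<Sum>\<phi>\<in>F. a \<phi> * R \<phi> y)"
  using assms
proof (induction rule: finite_induct)
  case empty
  then show ?case using zero_H ip_zero R_zero by simp
next
  case (insert \<psi> F)
  define g where "g = (\<lambda>y. \<Sum>\<phi>\<in>F. a \<phi> * \<phi> y)"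
  have IH: "g \<in> H" "\<forall>h\<in>H. ip g h = (\<Sum>\<phi>\<in>F. a \<phi> * ip \<phi> h)" "R g = (\<lambda>y. \<Sum>\<phi>\<in>F. a \<phi> * R \<phi> y)"
    using insert.IH insert.prems by (auto simp: g_def)
  have \<psi>: "\<psi> \<in> H" "(\<lambda>y. a \<psi> * \<psi> y) \<in> H" using insert.prems cmult_H by auto
  have eq: "(\<lambda>y. \<Sum>\<phi>\<in>insert \<psi> F. a \<phi> * \<phi> y) = (\<lambda>y. a \<psi> * \<psi> y + g y)"
    using insert.hyps by (simp add: g_def)
  have "ip (\<lambda>y. a \<psi> * \<psi> y + g y) h = (\<Sum>\<phi>\<in>insert \<psi> F. a \<phi> * ip \<phi> h)" if h: "h \<in> H" for h
    using ip_add[OF \<psi>(2) IH(1) h] ip_cmult[OF \<psi>(1) h] IH(2) h insert.hyps by simp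
  moreover have "R (\<lambda>y. a \<psi> * \<psi> y + g y) = (\<lambda>y. \<Sum>\<phi>\<in>insert \<psi> F. a \<phi> * R \<phi> y)"
    unfolding R_add[OF \<psi>(2) IH(1)] R_cmult[OF \<psi>(1)] IH(3) using insert.hyps by simp
  ultimately show ?case unfolding eq using add_H[OF \<psi>(2) IH(1)] by blast
qed

lemma sum_H: "finite F \<Longrightarrow> F \<subseteq> S \<Longrightarrow> (\<lambda>y. \<Sum>\<phi>\<in>F. a \<phi> * \<phi> y) \<in> H"
  and ip_sum: "finite F \<Longrightarrow> F \<subseteq> S \<Longrightarrow> g \<in> H \<Longrightarrow> ip (\<lambda>y. \<Sum>\<phi>\<in>F. a \<phi> * \<phi> y) g = (\<Sum>\<phi>\<in>F. a \<phi> * ip \<phi> g)"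
  and R_sum: "finite F \<Longrightarrow> F \<subseteq> S \<Longrightarrow> R (\<lambda>y. \<Sum>\<phi>\<in>F. a \<phi> * \<phi> y) = (\<lambda>y. \<Sum>\<phi>\<in>F. a \<phi> * R \<phi> y)"
  using finite_sum_props[of F a] S_facts(2) by blast+

lemma ip_sum_S:
  assumes "finite F" "F \<subseteq> S" "\<psi> \<in> S"
  shows "ip (\<lambda>y. \<Sum>\<phi>\<in>F. a \<phi> * \<phi> y) \<psi> = (if \<psi> \<in> F then a \<psi> else 0)"
proof -
  have "ip (\<lambda>y. \<Sum>\<phi>\<in>F. a \<phi> * \<phi> y) \<psi> = (\<Sum>\<phi>\<in>F. a \<phi> * ip \<phi> \<psi>)"
    by (rule ip_sum[OF assms(1,2) S_facts(2)[OF assms(3)]])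
  also have "\<dots> = (\<Sum>\<phi>\<in>F. if \<phi> = \<psi> then a \<phi> else 0)"
    using assms S_orthogonal by (intro sum.cong refl) (auto dest: subsetD)
  also have "\<dots> = (if \<psi> \<in> F then a \<psi> else 0)" using assms(1) by (simp add: sum.delta')
  finally show ?thesis .
qed

lemma norm_sum_S:
  assumes "finite F" "F \<subseteq> S"
  shows "ip (\<lambda>y. \<Sum>\<phi>\<in>F. a \<phi> * \<phi> y) (\<lambda>y. \<Sum>\<phi>\<in>F. a \<phi> * \<phi> y) = (\<Sum>\<phi>\<in>F. (a \<phi>)\<^sup>2)"
proof -
  have "ip (\<lambda>y. \<Sum>\<phi>\<in>F. a \<phi> * \<phi> y) (\<lambda>y. \<Sum>\<phi>\<in>F. a \<phi> * \<phi> y) = (\<Sum>\<phi>\<in>F. a \<phi> * ip \<phi> (\<lambda>y. \<Sum>\<phi>\<in>F. a \<phi> * \<phi> y))"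
    by (rule ip_sum[OF assms sum_H[OF assms]])
  also have "\<dots> = (\<Sum>\<phi>\<in>F. (a \<phi>)\<^sup>2)"
  proof (rule sum.cong[OF refl])
    fix \<psi> assume "\<psi> \<in> F"
    then show "a \<psi> * ip \<psi> (\<lambda>y. \<Sum>\<phi>\<in>F. a \<phi> * \<phi> y) = (a \<psi>)\<^sup>2"
      using ip_sum_S[OF assms, of \<psi> a] assms(2) by (auto simp: ip_sym[of \<psi>] power2_eq_square)
  qed
  finally show ?thesis .
qed

lemma Bessel:
  assumes F: "finite F" "F \<subseteq> S" and h: "h \<in> H"
  shows "(\<Sum>\<phi>\<in>F. (ip \<phi> h)\<^sup>2) \<le> ip h h"
proof -
  define p where "p = (\<lambda>y. \<Sum>\<phi>\<in>F. ip \<phi> h * \<phi> y)"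
  have p: "p \<in> H" unfolding p_def by (rule sum_H[OF F])
  have "0 \<le> ip (\<lambda>y. h y - 1 * p y) (\<lambda>y. h y - 1 * p y)"
    using diff_H[OF h p] by (intro ip_nonneg) simp
  also have "\<dots> = ip h h - 2 * 1 * ip h p + 1\<^sup>2 * ip p p" by (rule norm_diff_expand[OF h p])
  also have "ip h p = ip p h" by (rule ip_sym)
  also have "ip p h = (\<Sum>\<phi>\<in>F. (ip \<phi> h)\<^sup>2)"
    using ip_sum[OF F h, of "\<lambda>\<phi>. ip \<phi> h"] unfolding p_def by (simp add: power2_eq_square)
  also have "ip p p = (\<Sum>\<phi>\<in>F. (ip \<phi> h)\<^sup>2)" unfolding p_def by (rule norm_sum_S[OF F])
  finally show ?thesis by simp
qed

lemma R_sum_bound: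
  assumes F: "finite F" "F \<subseteq> S"
  shows "\<bar>\<Sum>\<phi>\<in>F. a \<phi> * R \<phi> x\<bar> \<le> C * sqrt (\<Sum>\<phi>\<in>F. (a \<phi>)\<^sup>2)"
  using R_bound[OF sum_H[OF F], of a x] unfolding R_sum[OF F] norm_sum_S[OF F] .

text \<open>
  Applying the bound on \<open>R\<close> to the combination with coefficients \<open>R \<phi> x\<close> bounds their square sum by its
  own square root.
\<close>

lemma pointwise_Bessel:
  assumes F: "finite F" "F \<subseteq> S"
  shows "(\<Sum>\<phi>\<in>F. (R \<phi> x)\<^sup>2) \<le> C\<^sup>2"
proof -
  define s where "s = (\<Sum>\<phi>\<in>F. (R \<phi> x)\<^sup>2)"
  have s0: "0 \<le> s" unfolding s_def by (intro sum_nonneg) auto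
  have "s \<le> C * sqrt s"
    using R_sum_bound[OF F, of "\<lambda>\<phi>. R \<phi> x" x] s0 by (simp add: s_def power2_eq_square)
  then have le: "sqrt s * sqrt s \<le> C * sqrt s" using s0 by simp
  have "sqrt s \<le> C"
  proof (cases "s = 0")
    case False
    then have "0 < sqrt s" using s0 by simp
    from mult_right_le_imp_le[OF le this] show ?thesis .
  qed (simp add: C_nonneg)
  then have "(sqrt s)\<^sup>2 \<le> C\<^sup>2" using s0 by (intro power_mono) auto
  then show ?thesis using s0 by (simp add: s_def)
qed

text \<open>
  Summing the pointwise Bessel inequality over the space; this is the Hilbert-Schmidt property of \<open>R\<close>.
\<close>

lemma sum_\<mu>_squares_le:
  assumes F: "finite F" "F \<subseteq> S"
  shows "(\<Sum>\<phi>\<in>F. (\<mu> \<phi>)\<^sup>2) \<le> L * C\<^sup>2"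
proof -
  have inj: "inj_on R F"
  proof (rule inj_onI)
    fix \<phi> \<psi> assume *: "\<phi> \<in> F" "\<psi> \<in> F" "R \<phi> = R \<psi>"
    then have S: "\<phi> \<in> S" "\<psi> \<in> S" using F by auto
    have "ip (R \<phi>) \<phi> = \<mu> \<phi>" using ip_cmult[OF S_facts(2)[OF S(1)] S_facts(2)[OF S(1)]] S_facts(3,5)[OF S(1)] by simp
    moreover have "ip (R \<psi>) \<phi> = \<mu> \<psi> * ip \<psi> \<phi>" using ip_cmult[OF S_facts(2)[OF S(2)] S_facts(2)[OF S(1)]] S_facts(5)[OF S(2)] by simp
    ultimately have "ip \<psi> \<phi> \<noteq> 0" using *(3) S_facts(4)[OF S(1)] by force
    then show "\<phi> = \<psi>" using S_orthogonal[OF S(2,1)] by (auto split: if_splits)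
  qed
  have "(\<Sum>f\<in>R ` F. ip f f) \<le> L * C\<^sup>2"
  proof (rule ip_le_sup)
    show "finite (R ` F)" using F by simp
    show "R ` F \<subseteq> H" using F S_facts(2) R_H by blast
    show "(\<Sum>f\<in>R ` F. (f x)\<^sup>2) \<le> C\<^sup>2" for x
      using pointwise_Bessel[OF F, of x] by (simp add: sum.reindex[OF inj])
  qed
  then have "(\<Sum>\<phi>\<in>F. ip (R \<phi>) (R \<phi>)) \<le> L * C\<^sup>2" by (simp add: sum.reindex[OF inj])
  moreover have "(\<Sum>\<phi>\<in>F. ip (R \<phi>) (R \<phi>)) = (\<Sum>\<phi>\<in>F. (\<mu> \<phi>)\<^sup>2)"
  proof (rule sum.cong[OF refl])
    fix \<phi> assume "\<phi> \<in> F"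
    then have p: "\<phi> \<in> S" using F by auto
    show "ip (R \<phi>) (R \<phi>) = (\<mu> \<phi>)\<^sup>2" unfolding S_facts(5)[OF p] ip_cmult_both[OF S_facts(2)[OF p]] S_facts(3)[OF p] by simp
  qed
  ultimately show ?thesis by simp
qed

lemma summable_\<mu>_squares: "(\<lambda>\<phi>. (\<mu> \<phi>)\<^sup>2) summable_on S"
proof (rule nonneg_bdd_above_summable_on)
  show "bdd_above (sum (\<lambda>\<phi>. (\<mu> \<phi>)\<^sup>2) ` {F. F \<subseteq> S \<and> finite F})"
    by (rule bdd_aboveI[of _ "L * C\<^sup>2"]) (use sum_\<mu>_squares_le in auto)
qed simp

lemma eigenfunction_bound:
  assumes "\<phi> \<in> S"
  shows "\<bar>\<phi> x\<bar> \<le> C / \<mu> \<phi>"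
proof -
  have "\<bar>R \<phi> x\<bar> \<le> C" using R_bound[OF S_facts(2)[OF assms], of x] S_facts(3)[OF assms] by simp
  then show ?thesis using S_facts(4)[OF assms] unfolding S_facts(5)[OF assms] by (simp add: abs_mult field_simps)
qed

text \<open>
  The series converges uniformly by Bessel's inequality and the bound on \<open>R\<close>. The difference of \<open>R h\<close> and
  its sum is a uniform limit of elements of \<open>K\<close> and orthogonal to all eigenvectors, so it is a null vector
  in \<open>K\<close> and hence zero at every point.
\<close>

lemma eigenfunction_expansion:
  assumes h: "h \<in> H"
  shows "(\<lambda>\<phi>. \<bar>R \<phi> x * ip \<phi> h\<bar>) summable_on S" "((\<lambda>\<phi>. R \<phi> x * ip \<phi> h) has_sum R h x) S"
proof -
  have abs: "(\<lambda>\<phi>. \<bar>R \<phi> x * ip \<phi> h\<bar>) summable_on S" for x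
  proof (rule nonneg_bdd_above_summable_on)
    have "(\<Sum>\<phi>\<in>F. \<bar>R \<phi> x * ip \<phi> h\<bar>) \<le> C\<^sup>2 + ip h h" if F: "finite F" "F \<subseteq> S" for F
    proof -
      have "(\<Sum>\<phi>\<in>F. \<bar>R \<phi> x * ip \<phi> h\<bar>) \<le> (\<Sum>\<phi>\<in>F. (R \<phi> x)\<^sup>2 + (ip \<phi> h)\<^sup>2)"
      proof (rule sum_mono)
        fix \<phi>
        have "2 * (\<bar>R \<phi> x\<bar> * \<bar>ip \<phi> h\<bar>) \<le> (R \<phi> x)\<^sup>2 + (ip \<phi> h)\<^sup>2"
          using sum_squares_bound[of "\<bar>R \<phi> x\<bar>" "\<bar>ip \<phi> h\<bar>"] by simp
        moreover have "0 \<le> \<bar>R \<phi> x\<bar> * \<bar>ip \<phi> h\<bar>" by simp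
        ultimately show "\<bar>R \<phi> x * ip \<phi> h\<bar> \<le> (R \<phi> x)\<^sup>2 + (ip \<phi> h)\<^sup>2" unfolding abs_mult by linarith
      qed
      also have "\<dots> \<le> C\<^sup>2 + ip h h" unfolding sum.distrib by (intro add_mono pointwise_Bessel[OF F] Bessel[OF F h])
      finally show ?thesis .
    qed
    then show "bdd_above (sum (\<lambda>\<phi>. \<bar>R \<phi> x * ip \<phi> h\<bar>) ` {F. F \<subseteq> S \<and> finite F})"
      by (intro bdd_aboveI[of _ "C\<^sup>2 + ip h h"]) auto
  qed simp
  then show "(\<lambda>\<phi>. \<bar>R \<phi> x * ip \<phi> h\<bar>) summable_on S" .
  have summ: "(\<lambda>\<phi>. R \<phi> x * ip \<phi> h) summable_on S" for x
    by (rule abs_summable_summable) (use abs in simp)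
  define z where "z = (\<lambda>x. \<Sum>\<^sub>\<infinity>\<phi>\<in>S. R \<phi> x * ip \<phi> h)"
  have z: "((\<lambda>\<phi>. R \<phi> x * ip \<phi> h) has_sum z x) S" for x
    unfolding z_def by (rule has_sum_infsum[OF summ])
  have qs: "(\<lambda>\<phi>. (ip \<phi> h)\<^sup>2) summable_on S"
  proof (rule nonneg_bdd_above_summable_on)
    show "bdd_above (sum (\<lambda>\<phi>. (ip \<phi> h)\<^sup>2) ` {F. F \<subseteq> S \<and> finite F})"
      by (rule bdd_aboveI[of _ "ip h h"]) (use Bessel h in auto)
  qed simp
  define q where "q = (\<Sum>\<^sub>\<infinity>\<phi>\<in>S. (ip \<phi> h)\<^sup>2)"
  have q: "((\<lambda>\<phi>. (ip \<phi> h)\<^sup>2) has_sum q) S" unfolding q_def by (rule has_sum_infsum[OF qs])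
  have fin_le: "(\<Sum>\<phi>\<in>F. (ip \<phi> h)\<^sup>2) \<le> q" if "finite F" "F \<subseteq> S" for F
    unfolding q_def by (rule finite_sum_le_infsum[OF qs that]) auto
  have tail: "\<bar>z x - (\<Sum>\<phi>\<in>F. R \<phi> x * ip \<phi> h)\<bar> \<le> C * sqrt (q - (\<Sum>\<phi>\<in>F. (ip \<phi> h)\<^sup>2))" if F: "finite F" "F \<subseteq> S" for F x
  proof -
    have "((\<lambda>\<phi>. R \<phi> x * ip \<phi> h) has_sum (z x - (\<Sum>\<phi>\<in>F. R \<phi> x * ip \<phi> h))) (S - F)"
      by (rule has_sum_Diff[OF z has_sum_finite[OF F(1)] F(2)])
    then have lim: "((\<lambda>G. \<bar>\<Sum>\<phi>\<in>G. R \<phi> x * ip \<phi> h\<bar>) \<longlongrightarrow> \<bar>z x - (\<Sum>\<phi>\<in>F. R \<phi> x * ip \<phi> h)\<bar>) (finite_subsets_at_top (S - F))"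
      unfolding has_sum_def by (rule tendsto_rabs)
    show ?thesis
    proof (rule tendsto_upperbound[OF lim])
      show "eventually (\<lambda>G. \<bar>\<Sum>\<phi>\<in>G. R \<phi> x * ip \<phi> h\<bar> \<le> C * sqrt (q - (\<Sum>\<phi>\<in>F. (ip \<phi> h)\<^sup>2))) (finite_subsets_at_top (S - F))"
      proof (rule eventually_finite_subsets_at_top_weakI)
        fix G assume G: "finite G" "G \<subseteq> S - F"
        have FG: "finite (F \<union> G)" "F \<union> G \<subseteq> S" using F G by auto
        have "(\<Sum>\<phi>\<in>F. (ip \<phi> h)\<^sup>2) + (\<Sum>\<phi>\<in>G. (ip \<phi> h)\<^sup>2) = (\<Sum>\<phi>\<in>F \<union> G. (ip \<phi> h)\<^sup>2)"
          using F G by (intro sum.union_disjoint[symmetric]) auto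
        then have le: "(\<Sum>\<phi>\<in>G. (ip \<phi> h)\<^sup>2) \<le> q - (\<Sum>\<phi>\<in>F. (ip \<phi> h)\<^sup>2)" using fin_le[OF FG] by linarith
        have "\<bar>\<Sum>\<phi>\<in>G. R \<phi> x * ip \<phi> h\<bar> \<le> C * sqrt (\<Sum>\<phi>\<in>G. (ip \<phi> h)\<^sup>2)"
          using R_sum_bound[of G "\<lambda>\<phi>. ip \<phi> h" x] G by (simp add: mult.commute subset_iff)
        also have "\<dots> \<le> C * sqrt (q - (\<Sum>\<phi>\<in>F. (ip \<phi> h)\<^sup>2))"
          using le C_nonneg by (intro mult_left_mono real_sqrt_le_mono) auto
        finally show "\<bar>\<Sum>\<phi>\<in>G. R \<phi> x * ip \<phi> h\<bar> \<le> C * sqrt (q - (\<Sum>\<phi>\<in>F. (ip \<phi> h)\<^sup>2))" .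
      qed
    qed simp
  qed
  have "\<forall>n. \<exists>F. finite F \<and> F \<subseteq> S \<and> q - (\<Sum>\<phi>\<in>F. (ip \<phi> h)\<^sup>2) < 1 / real (Suc n)"
  proof
    fix n
    have "eventually (\<lambda>F. q - 1 / real (Suc n) < (\<Sum>\<phi>\<in>F. (ip \<phi> h)\<^sup>2)) (finite_subsets_at_top S)"
      using q unfolding has_sum_def by (rule order_tendstoD(1)) simp
    then obtain F where F: "finite F" "F \<subseteq> S" "q - 1 / real (Suc n) < (\<Sum>\<phi>\<in>F. (ip \<phi> h)\<^sup>2)"
      unfolding eventually_finite_subsets_at_top by blast
    then show "\<exists>F. finite F \<and> F \<subseteq> S \<and> q - (\<Sum>\<phi>\<in>F. (ip \<phi> h)\<^sup>2) < 1 / real (Suc n)"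
      by (intro exI[of _ F]) linarith
  qed
  from choice[OF this] obtain Fn where "\<forall>n. finite (Fn n) \<and> Fn n \<subseteq> S \<and> q - (\<Sum>\<phi>\<in>Fn n. (ip \<phi> h)\<^sup>2) < 1 / real (Suc n)"
    by blast
  then have Fn: "\<And>n. finite (Fn n)" "\<And>n. Fn n \<subseteq> S" "\<And>n. q - (\<Sum>\<phi>\<in>Fn n. (ip \<phi> h)\<^sup>2) < 1 / real (Suc n)"
    by blast+
  define hn where "hn = (\<lambda>n y. h y - (\<Sum>\<phi>\<in>Fn n. ip \<phi> h * \<phi> y))"
  have hnH: "hn n \<in> H" for n unfolding hn_def by (rule diff_H[OF h sum_H[OF Fn(1,2)]])
  have Rhn: "R (hn n) = (\<lambda>y. R h y - (\<Sum>\<phi>\<in>Fn n. ip \<phi> h * R \<phi> y))" for n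
    unfolding hn_def R_diff[OF h sum_H[OF Fn(1,2)]] R_sum[OF Fn(1,2)] ..
  define g where "g = (\<lambda>y. R h y - z y)"
  have close: "\<bar>R (hn n) y - g y\<bar> \<le> C * sqrt (1 / real (Suc n))" for n y
  proof -
    have "\<bar>R (hn n) y - g y\<bar> = \<bar>z y - (\<Sum>\<phi>\<in>Fn n. R \<phi> y * ip \<phi> h)\<bar>"
      unfolding Rhn g_def by (simp add: mult.commute)
    also have "\<dots> \<le> C * sqrt (q - (\<Sum>\<phi>\<in>Fn n. (ip \<phi> h)\<^sup>2))" by (rule tail[OF Fn(1,2)])
    also have "\<dots> \<le> C * sqrt (1 / real (Suc n))"
      using Fn(3)[of n] C_nonneg by (intro mult_left_mono real_sqrt_le_mono) auto
    finally show ?thesis .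
  qed
  have gK: "g \<in> K"
  proof (rule K_limit[of "\<lambda>n. R (hn n)"])
    show "R (hn n) \<in> K" for n by (rule R_K[OF hnH])
    fix e :: real assume "0 < e"
    have "(\<lambda>n. C * sqrt (1 / real (Suc n))) \<longlonglongrightarrow> C * sqrt 0"
      by (intro tendsto_intros LIMSEQ_Suc[OF lim_1_over_n])
    then have "eventually (\<lambda>n. C * sqrt (1 / real (Suc n)) < e) sequentially"
      using \<open>0 < e\<close> by (intro order_tendstoD(2)) auto
    then obtain N where "\<forall>n\<ge>N. C * sqrt (1 / real (Suc n)) < e" by (auto simp: eventually_sequentially)
    then show "\<exists>N. \<forall>n\<ge>N. \<forall>x. \<bar>R (hn n) x - g x\<bar> \<le> e" using close by (meson less_imp_le order_trans)
  qed
  then have gH: "g \<in> H" using K_H by blast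
  have "g \<in> V"
  proof -
    have "ip g \<psi> = 0" if p: "\<psi> \<in> S" for \<psi>
    proof -
      have pH: "\<psi> \<in> H" by (rule S_facts(2)[OF p])
      have "(ip g \<psi>)\<^sup>2 \<le> (2 * (L * C\<^sup>2) + 2 * (\<mu> \<psi>)\<^sup>2) * (1 / real (Suc n))" for n
      proof -
        define d where "d = (\<lambda>y. R (hn n) y - g y)"
        have dH: "d \<in> H" unfolding d_def by (rule diff_H[OF R_H[OF hnH] gH])
        have "(ip d \<psi>)\<^sup>2 \<le> ip d d" using Cauchy_Schwarz[OF dH pH] S_facts(3)[OF p] by simp
        also have "\<dots> \<le> L * (C * sqrt (1 / real (Suc n)))\<^sup>2"
          by (rule norm_le_sup[OF dH]) (use close in \<open>simp add: d_def\<close>)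
        also have "\<dots> = L * C\<^sup>2 * (1 / real (Suc n))" by (simp add: power_mult_distrib)
        finally have 1: "(ip d \<psi>)\<^sup>2 \<le> L * C\<^sup>2 * (1 / real (Suc n))" .
        have "ip (R (hn n)) \<psi> = \<mu> \<psi> * ip (hn n) \<psi>"
          using R_sym[OF hnH pH] ip_cmult_right[OF pH hnH] S_facts(5)[OF p] by simp
        moreover have "ip (hn n) \<psi> = ip h \<psi> - (if \<psi> \<in> Fn n then ip \<psi> h else 0)"
          unfolding hn_def ip_diff[OF h sum_H[OF Fn(1,2)] pH] ip_sum_S[OF Fn(1,2) p] ..
        moreover have "(ip h \<psi> - (if \<psi> \<in> Fn n then ip \<psi> h else 0))\<^sup>2 \<le> 1 / real (Suc n)"
        proof (cases "\<psi> \<in> Fn n")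
          case False
          have "(\<Sum>\<phi>\<in>insert \<psi> (Fn n). (ip \<phi> h)\<^sup>2) \<le> q" using Fn(1,2) p by (intro fin_le) auto
          then have "(ip \<psi> h)\<^sup>2 \<le> 1 / real (Suc n)" using False Fn(1) Fn(3)[of n] by simp
          then show ?thesis using False by (simp add: ip_sym[of h])
        qed (simp add: ip_sym[of h])
        ultimately have 2: "(ip (R (hn n)) \<psi>)\<^sup>2 \<le> (\<mu> \<psi>)\<^sup>2 * (1 / real (Suc n))"
          by (simp only: power_mult_distrib) (intro mult_left_mono, auto)
        have "ip g \<psi> = ip (R (hn n)) \<psi> - ip d \<psi>"
          unfolding d_def ip_diff[OF R_H[OF hnH] gH pH] by simp
        then have "(ip g \<psi>)\<^sup>2 \<le> 2 * (ip (R (hn n)) \<psi>)\<^sup>2 + 2 * (ip d \<psi>)\<^sup>2"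
          using sum_squares_bound[of "ip (R (hn n)) \<psi>" "- ip d \<psi>"] by (simp add: power2_diff)
        then show ?thesis using 1 2 by (simp only: distrib_right mult.assoc)
      qed
      moreover have "(\<lambda>n. (2 * (L * C\<^sup>2) + 2 * (\<mu> \<psi>)\<^sup>2) * (1 / real (Suc n))) \<longlonglongrightarrow> (2 * (L * C\<^sup>2) + 2 * (\<mu> \<psi>)\<^sup>2) * 0"
        by (intro tendsto_intros LIMSEQ_Suc[OF lim_1_over_n])
      ultimately have "(ip g \<psi>)\<^sup>2 \<le> (2 * (L * C\<^sup>2) + 2 * (\<mu> \<psi>)\<^sup>2) * 0"
        by (intro LIMSEQ_le_const) auto
      then show ?thesis by simp
    qed
    then show ?thesis using gH by (simp add: V_def)
  qed
  then have "g = (\<lambda>y. 0)" using complement_null K_zero[OF gK] by blast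
  then have "R h x = z x" unfolding g_def by (metis eq_iff_diff_eq_0)
  then show "((\<lambda>\<phi>. R \<phi> x * ip \<phi> h) has_sum R h x) S" using z by simp
qed

end

section \<open>Kernels with decaying coefficients\<close>

context compact_symmetric
begin

definition kernel_sum :: "(('p \<Rightarrow> real) \<Rightarrow> real) \<Rightarrow> 'p \<Rightarrow> 'p \<Rightarrow> real" where
  "kernel_sum a x y = (\<Sum>\<^sub>\<infinity>\<phi>\<in>S. a \<phi> * \<phi> x * \<phi> y)"

text \<open>
  The exponent 4 compensates two factors \<open>\<bar>\<phi> x\<bar> \<le> C / \<mu> \<phi>\<close> and leaves the summable \<open>(\<mu> \<phi>)\<^sup>2\<close>.
\<close>

definition decays :: "(('p \<Rightarrow> real) \<Rightarrow> real) \<Rightarrow> real \<Rightarrow> bool" where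
  "decays a A \<longleftrightarrow> (\<forall>\<phi>\<in>S. \<bar>a \<phi>\<bar> \<le> A * \<mu> \<phi> ^ 4)"

lemma kernel_term_bound:
  assumes "decays a A" "\<phi> \<in> S"
  shows "\<bar>a \<phi> * \<phi> x * \<phi> y\<bar> \<le> A * C\<^sup>2 * (\<mu> \<phi>)\<^sup>2"
proof -
  have m: "0 < \<mu> \<phi>" by (rule S_facts(4)[OF assms(2)])
  have "\<bar>a \<phi> * \<phi> x * \<phi> y\<bar> = \<bar>a \<phi>\<bar> * (\<bar>\<phi> x\<bar> * \<bar>\<phi> y\<bar>)" by (simp add: abs_mult mult.assoc)
  also have "\<dots> \<le> (A * \<mu> \<phi> ^ 4) * ((C / \<mu> \<phi>) * (C / \<mu> \<phi>))"
    using assms eigenfunction_bound[OF assms(2)] C_nonneg m 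
    by (intro mult_mono) (auto simp: decays_def intro: order_trans[OF abs_ge_zero])
  also have "\<dots> = A * C\<^sup>2 * (\<mu> \<phi>)\<^sup>2" using m by (simp add: field_simps power2_eq_square eval_nat_numeral)
  finally show ?thesis .
qed

lemma kernel_sum_uniform:
  assumes a: "decays a A" and e: "0 < e"
  shows "eventually (\<lambda>F. \<forall>x y. \<bar>(\<Sum>\<phi>\<in>F. a \<phi> * \<phi> x * \<phi> y) - kernel_sum a x y\<bar> \<le> e) (finite_subsets_at_top S)"
proof -
  have "uniform_limit UNIV (\<lambda>F p. \<Sum>\<phi>\<in>F. a \<phi> * \<phi> (fst p) * \<phi> (snd p)) (\<lambda>p. \<Sum>\<^sub>\<infinity>\<phi>\<in>S. a \<phi> * \<phi> (fst p) * \<phi> (snd p)) (finite_subsets_at_top S)"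
  proof (rule Weierstrass_m_test_general)
    show "(\<lambda>\<phi>. A * C\<^sup>2 * (\<mu> \<phi>)\<^sup>2) summable_on S"
      by (intro summable_on_cmult_right summable_\<mu>_squares)
    show "norm (a \<phi> * \<phi> (fst p) * \<phi> (snd p)) \<le> A * C\<^sup>2 * (\<mu> \<phi>)\<^sup>2" if "\<phi> \<in> S" for \<phi> p
      using kernel_term_bound[OF a that] by simp
  qed
  from uniform_limitD[OF this e] show ?thesis
    by (rule eventually_mono) (force simp: kernel_sum_def dist_real_def intro: less_imp_le)
qed

lemma kernel_sum_approximation:
  assumes a: "decays a A" and e: "0 < e"
  obtains F where "finite F" "F \<subseteq> S" "\<And>x y. \<bar>(\<Sum>\<phi>\<in>F. a \<phi> * \<phi> x * \<phi> y) - kernel_sum a x y\<bar> \<le> e"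
proof -
  define P where "P = (\<lambda>F. \<forall>x y. \<bar>(\<Sum>\<phi>\<in>F. a \<phi> * \<phi> x * \<phi> y) - kernel_sum a x y\<bar> \<le> e)"
  have "eventually P (finite_subsets_at_top S)" unfolding P_def by (rule kernel_sum_uniform[OF a e])
  then obtain X where X: "finite X" "X \<subseteq> S" "\<forall>Y. finite Y \<and> X \<subseteq> Y \<and> Y \<subseteq> S \<longrightarrow> P Y"
    unfolding eventually_finite_subsets_at_top by blast
  then have "P X" by blast
  then show thesis using X(1,2) by (intro that[of X]) (simp_all add: P_def)
qed

lemma kernel_sum_has_sum:
  assumes a: "decays a A"
  shows "((\<lambda>\<phi>. a \<phi> * \<phi> x * \<phi> y) has_sum kernel_sum a x y) S"
proof -
  have "(\<lambda>\<phi>. norm (a \<phi> * \<phi> x * \<phi> y)) summable_on S"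
  proof (rule Infinite_Sum.abs_summable_on_comparison_test')
    show "(\<lambda>\<phi>. A * C\<^sup>2 * (\<mu> \<phi>)\<^sup>2) summable_on S" by (intro summable_on_cmult_right summable_\<mu>_squares)
    show "norm (a \<phi> * \<phi> x * \<phi> y) \<le> A * C\<^sup>2 * (\<mu> \<phi>)\<^sup>2" if "\<phi> \<in> S" for \<phi>
      using kernel_term_bound[OF a that] by simp
  qed
  then show ?thesis unfolding kernel_sum_def by (rule has_sum_infsum[OF abs_summable_summable])
qed

lemma kernel_sum_bound:
  assumes a: "decays a A" and A: "0 \<le> A"
  shows "\<bar>kernel_sum a x y\<bar> \<le> A * C\<^sup>2 * (L * C\<^sup>2)"
proof -
  have lim: "((\<lambda>F. \<bar>\<Sum>\<phi>\<in>F. a \<phi> * \<phi> x * \<phi> y\<bar>) \<longlongrightarrow> \<bar>kernel_sum a x y\<bar>) (finite_subsets_at_top S)"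
    using kernel_sum_has_sum[OF a] unfolding has_sum_def by (intro tendsto_rabs) auto
  show ?thesis
  proof (rule tendsto_upperbound[OF lim], rule eventually_finite_subsets_at_top_weakI)
    fix F assume F: "finite F" "F \<subseteq> S"
    have "\<bar>\<Sum>\<phi>\<in>F. a \<phi> * \<phi> x * \<phi> y\<bar> \<le> (\<Sum>\<phi>\<in>F. A * C\<^sup>2 * (\<mu> \<phi>)\<^sup>2)"
      using F kernel_term_bound[OF a] by (intro order_trans[OF sum_abs] sum_mono) auto
    also have "\<dots> = A * C\<^sup>2 * (\<Sum>\<phi>\<in>F. (\<mu> \<phi>)\<^sup>2)" by (simp add: sum_distrib_left)
    also have "\<dots> \<le> A * C\<^sup>2 * (L * C\<^sup>2)"
      using A by (intro mult_left_mono sum_\<mu>_squares_le[OF F]) auto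
    finally show "\<bar>\<Sum>\<phi>\<in>F. a \<phi> * \<phi> x * \<phi> y\<bar> \<le> A * C\<^sup>2 * (L * C\<^sup>2)" .
  qed simp
qed

lemma kernel_sum_K:
  assumes a: "decays a A"
  shows "kernel_sum a x \<in> K"
proof -
  have "\<exists>F. finite F \<and> F \<subseteq> S \<and> (\<forall>y. \<bar>(\<Sum>\<phi>\<in>F. a \<phi> * \<phi> x * \<phi> y) - kernel_sum a x y\<bar> \<le> 1 / real (Suc n))" for n
  proof -
    have e: "0 < 1 / real (Suc n)" by simp
    show ?thesis by (rule kernel_sum_approximation[OF a e]) blast
  qed
  then have "\<exists>Fn. \<forall>n. finite (Fn n) \<and> Fn n \<subseteq> S \<and> (\<forall>y. \<bar>(\<Sum>\<phi>\<in>Fn n. a \<phi> * \<phi> x * \<phi> y) - kernel_sum a x y\<bar> \<le> 1 / real (Suc n))"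
    by (intro choice allI)
  then obtain Fn where Fn0: "\<forall>n. finite (Fn n) \<and> Fn n \<subseteq> S \<and> (\<forall>y. \<bar>(\<Sum>\<phi>\<in>Fn n. a \<phi> * \<phi> x * \<phi> y) - kernel_sum a x y\<bar> \<le> 1 / real (Suc n))"
    by (rule exE)
  have Fn: "finite (Fn n)" "Fn n \<subseteq> S" "\<bar>(\<Sum>\<phi>\<in>Fn n. a \<phi> * \<phi> x * \<phi> y) - kernel_sum a x y\<bar> \<le> 1 / real (Suc n)" for n y
    using Fn0 by auto
  show ?thesis
  proof (rule K_limit[of "\<lambda>n y. \<Sum>\<phi>\<in>Fn n. a \<phi> * \<phi> x * \<phi> y"])
    fix n
    have F: "finite (Fn n)" "Fn n \<subseteq> S" by (rule Fn)+
    have "R (\<lambda>y. \<Sum>\<phi>\<in>Fn n. (a \<phi> * \<phi> x / \<mu> \<phi>) * \<phi> y) = (\<lambda>y. \<Sum>\<phi>\<in>Fn n. (a \<phi> * \<phi> x / \<mu> \<phi>) * R \<phi> y)"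
      by (rule R_sum[OF F])
    also have "\<dots> = (\<lambda>y. \<Sum>\<phi>\<in>Fn n. a \<phi> * \<phi> x * \<phi> y)"
    proof (rule ext, rule sum.cong[OF refl])
      fix y \<phi> assume "\<phi> \<in> Fn n"
      then have p: "\<phi> \<in> S" using F by auto
      show "(a \<phi> * \<phi> x / \<mu> \<phi>) * R \<phi> y = a \<phi> * \<phi> x * \<phi> y"
        using S_facts(4)[OF p] fun_cong[OF S_facts(5)[OF p], of y] by simp
    qed
    finally show "(\<lambda>y. \<Sum>\<phi>\<in>Fn n. a \<phi> * \<phi> x * \<phi> y) \<in> K" using R_K[OF sum_H[OF F, of "\<lambda>\<phi>. a \<phi> * \<phi> x / \<mu> \<phi>"]] by simp
  next
    fix e :: real assume "0 < e"
    then obtain N where N: "inverse (real (Suc N)) < e" using reals_Archimedean by blast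
    have "\<bar>(\<Sum>\<phi>\<in>Fn n. a \<phi> * \<phi> x * \<phi> y) - kernel_sum a x y\<bar> \<le> e" if n: "N \<le> n" for n y
    proof -
      have "\<bar>(\<Sum>\<phi>\<in>Fn n. a \<phi> * \<phi> x * \<phi> y) - kernel_sum a x y\<bar> \<le> 1 / real (Suc n)" by (rule Fn)
      also have "\<dots> \<le> inverse (real (Suc N))" using n by (simp add: inverse_eq_divide frac_le)
      finally show ?thesis using N by simp
    qed
    then show "\<exists>N. \<forall>n\<ge>N. \<forall>y. \<bar>(\<Sum>\<phi>\<in>Fn n. a \<phi> * \<phi> x * \<phi> y) - kernel_sum a x y\<bar> \<le> e" by blast
  qed
qed

lemma kernel_sum_H:
  assumes "decays a A"
  shows "kernel_sum a x \<in> H"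
  using kernel_sum_K[OF assms] K_H by blast

lemma approx_norm:
  assumes "F \<subseteq> S" "finite F" "f \<in> H" "\<And>y. \<bar>(\<Sum>\<phi>\<in>F. b \<phi> * \<phi> y) - f y\<bar> \<le> e"
  shows "(\<lambda>y. (\<Sum>\<phi>\<in>F. b \<phi> * \<phi> y) - f y) \<in> H"
    "ip (\<lambda>y. (\<Sum>\<phi>\<in>F. b \<phi> * \<phi> y) - f y) (\<lambda>y. (\<Sum>\<phi>\<in>F. b \<phi> * \<phi> y) - f y) \<le> L * e\<^sup>2"
proof -
  show h: "(\<lambda>y. (\<Sum>\<phi>\<in>F. b \<phi> * \<phi> y) - f y) \<in> H" by (rule diff_H[OF sum_H[OF assms(2,1)] assms(3)])
  show "ip (\<lambda>y. (\<Sum>\<phi>\<in>F. b \<phi> * \<phi> y) - f y) (\<lambda>y. (\<Sum>\<phi>\<in>F. b \<phi> * \<phi> y) - f y) \<le> L * e\<^sup>2"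
    by (rule norm_le_sup[OF h assms(4)])
qed

lemma kernel_sum_ip:
  assumes a: "decays a A" and g: "g \<in> H"
  shows "((\<lambda>\<phi>. a \<phi> * \<phi> x * ip \<phi> g) has_sum ip (kernel_sum a x) g) S"
  unfolding has_sum_def
proof (rule tendstoI)
  fix e :: real assume "0 < e"
  define B where "B = sqrt (L * ip g g)"
  define e1 where "e1 = e / (2 * (B + 1))"
  have sq: "0 \<le> B" using L_nonneg ip_nonneg[OF g] by (simp add: B_def)
  have e1: "0 < e1" "e1 * B < e"
  proof -
    show "0 < e1" unfolding e1_def using \<open>0 < e\<close> sq by (intro divide_pos_pos) auto
    then have "e1 * B \<le> e1 * (B + 1)" by (intro mult_left_mono) auto
    also have "\<dots> = e / 2" unfolding e1_def using sq by (simp add: field_simps)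
    also have "\<dots> < e" using \<open>0 < e\<close> by simp
    finally show "e1 * B < e" .
  qed
  have "eventually (\<lambda>F. finite F \<and> F \<subseteq> S) (finite_subsets_at_top S)"
    by (simp add: eventually_finite_subsets_at_top_weakI)
  with kernel_sum_uniform[OF a e1(1)]
  show "eventually (\<lambda>F. dist (\<Sum>\<phi>\<in>F. a \<phi> * \<phi> x * ip \<phi> g) (ip (kernel_sum a x) g) < e) (finite_subsets_at_top S)"
  proof eventually_elim
    case (elim F)
    then have F: "finite F" "F \<subseteq> S" by auto
    have kH: "kernel_sum a x \<in> H" by (rule kernel_sum_H[OF a])
    define d where "d = (\<lambda>y. (\<Sum>\<phi>\<in>F. a \<phi> * \<phi> x * \<phi> y) - kernel_sum a x y)"
    have d: "d \<in> H" "ip d d \<le> L * e1\<^sup>2" unfolding d_def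
      by (rule approx_norm[OF F(2,1) kH, of "\<lambda>\<phi>. a \<phi> * \<phi> x"], use elim in blast)+
    have "ip d g = (\<Sum>\<phi>\<in>F. a \<phi> * \<phi> x * ip \<phi> g) - ip (kernel_sum a x) g"
      unfolding d_def ip_diff[OF sum_H[OF F] kH g] ip_sum[OF F g] ..
    moreover have "\<bar>ip d g\<bar> \<le> e1 * B"
    proof -
      have "(ip d g)\<^sup>2 \<le> ip d d * ip g g" by (rule Cauchy_Schwarz[OF d(1) g])
      also have "\<dots> \<le> (L * e1\<^sup>2) * ip g g" by (rule mult_right_mono[OF d(2) ip_nonneg[OF g]])
      also have "\<dots> = (e1 * B)\<^sup>2" using L_nonneg ip_nonneg[OF g] by (simp add: power_mult_distrib B_def)
      finally show ?thesis using e1(1) sq by (simp add: power2_le_iff_abs_le)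
    qed
    ultimately show ?case using e1(2) by (simp add: dist_real_def)
  qed
qed

text \<open>
  \<open>R\<close> may be applied term by term since it is bounded with respect to the uniform convergence of the
  series.
\<close>

lemma kernel_sum_R:
  assumes a: "decays a A"
  shows "R (kernel_sum a x) = kernel_sum (\<lambda>\<phi>. a \<phi> * \<mu> \<phi>) x"
proof
  fix y
  have kH: "kernel_sum a x \<in> H" by (rule kernel_sum_H[OF a])
  have "((\<lambda>\<phi>. a \<phi> * \<phi> x * R \<phi> y) has_sum R (kernel_sum a x) y) S"
    unfolding has_sum_def
  proof (rule tendstoI)
    fix e :: real assume "0 < e"
    define e1 where "e1 = e / (2 * (C * sqrt L + 1))"
    have sq: "0 \<le> C * sqrt L" using L_nonneg C_nonneg by simp
    have e1: "0 < e1" "e1 * (C * sqrt L) < e"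
    proof -
      show "0 < e1" unfolding e1_def using \<open>0 < e\<close> sq by (intro divide_pos_pos) auto
      then have "e1 * (C * sqrt L) \<le> e1 * (C * sqrt L + 1)" by (intro mult_left_mono) auto
      also have "\<dots> = e / 2" unfolding e1_def using sq by (simp add: field_simps)
      also have "\<dots> < e" using \<open>0 < e\<close> by simp
      finally show "e1 * (C * sqrt L) < e" .
    qed
    have "eventually (\<lambda>F. finite F \<and> F \<subseteq> S) (finite_subsets_at_top S)"
      by (simp add: eventually_finite_subsets_at_top_weakI)
    with kernel_sum_uniform[OF a e1(1)]
    show "eventually (\<lambda>F. dist (\<Sum>\<phi>\<in>F. a \<phi> * \<phi> x * R \<phi> y) (R (kernel_sum a x) y) < e) (finite_subsets_at_top S)"
    proof eventually_elim
      case (elim F)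
      then have F: "finite F" "F \<subseteq> S" by auto
      define d where "d = (\<lambda>y. (\<Sum>\<phi>\<in>F. a \<phi> * \<phi> x * \<phi> y) - kernel_sum a x y)"
      have d: "d \<in> H" "ip d d \<le> L * e1\<^sup>2" unfolding d_def
        by (rule approx_norm[OF F(2,1) kH, of "\<lambda>\<phi>. a \<phi> * \<phi> x"], use elim in blast)+
      have "R d y = (\<Sum>\<phi>\<in>F. a \<phi> * \<phi> x * R \<phi> y) - R (kernel_sum a x) y"
        unfolding d_def R_diff[OF sum_H[OF F] kH] R_sum[OF F] ..
      moreover have "\<bar>R d y\<bar> \<le> e1 * (C * sqrt L)"
      proof -
        have "\<bar>R d y\<bar> \<le> C * sqrt (ip d d)" by (rule R_bound[OF d(1)])
        also have "\<dots> \<le> C * sqrt (L * e1\<^sup>2)" using C_nonneg d(2) by (intro mult_left_mono real_sqrt_le_mono)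
        also have "\<dots> = e1 * (C * sqrt L)" using e1(1) by (simp add: real_sqrt_mult)
        finally show ?thesis .
      qed
      ultimately show ?case using e1(2) by (simp add: dist_real_def)
    qed
  qed
  then have "(\<Sum>\<^sub>\<infinity>\<phi>\<in>S. a \<phi> * \<phi> x * R \<phi> y) = R (kernel_sum a x) y" by (rule infsumI)
  moreover have "(\<Sum>\<^sub>\<infinity>\<phi>\<in>S. a \<phi> * \<phi> x * R \<phi> y) = kernel_sum (\<lambda>\<phi>. a \<phi> * \<mu> \<phi>) x y"
    unfolding kernel_sum_def
  proof (rule infsum_cong)
    fix \<phi> assume p: "\<phi> \<in> S"
    show "a \<phi> * \<phi> x * R \<phi> y = a \<phi> * \<mu> \<phi> * \<phi> x * \<phi> y" unfolding S_facts(5)[OF p] by (simp add: mult_ac)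
  qed
  ultimately show "R (kernel_sum a x) y = kernel_sum (\<lambda>\<phi>. a \<phi> * \<mu> \<phi>) x y" by simp
qed

lemma kernel_sum_lincomb:
  assumes a: "decays a A" and b: "decays b B"
  shows "kernel_sum (\<lambda>\<phi>. c * a \<phi> + d * b \<phi>) x y = c * kernel_sum a x y + d * kernel_sum b x y"
proof -
  have "((\<lambda>\<phi>. c * (a \<phi> * \<phi> x * \<phi> y) + d * (b \<phi> * \<phi> x * \<phi> y)) has_sum (c * kernel_sum a x y + d * kernel_sum b x y)) S"
    by (intro has_sum_add has_sum_cmult_right kernel_sum_has_sum[OF a] kernel_sum_has_sum[OF b])
  then have "(\<Sum>\<^sub>\<infinity>\<phi>\<in>S. c * (a \<phi> * \<phi> x * \<phi> y) + d * (b \<phi> * \<phi> x * \<phi> y)) = c * kernel_sum a x y + d * kernel_sum b x y"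
    by (rule infsumI)
  then show ?thesis unfolding kernel_sum_def by (simp add: algebra_simps)
qed

end

section \<open>The spectral heat kernel\<close>

lemma exp_minus_inverse_le:
  fixes m t :: real
  assumes "0 < m" "0 < t"
  shows "exp (- (t / m)) \<le> fact n * m ^ n / t ^ n"
proof -
  define s where "s = t / m"
  have s: "0 < s" using assms by (simp add: s_def)
  have "s ^ n / fact n \<le> exp s"
  proof -
    have "s ^ n /\<^sub>R fact n = (\<Sum>k\<in>{n}. s ^ k /\<^sub>R fact k)" by simp
    also have "\<dots> \<le> (\<Sum>k. s ^ k /\<^sub>R fact k)"
      using s by (intro sum_le_suminf summable_exp_generic) auto
    also have "\<dots> = exp s" by (simp add: exp_def)
    finally show ?thesis by (simp add: divide_inverse mult.commute)
  qed
  then have "exp (- s) \<le> fact n / s ^ n" using s by (simp add: exp_minus field_simps)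
  also have "\<dots> = fact n * m ^ n / t ^ n" using assms by (simp add: s_def power_divide)
  finally show ?thesis by (simp add: s_def)
qed

lemma exp_remainder_bounds:
  fixes z :: real
  shows "\<bar>exp z - 1\<bar> \<le> \<bar>z\<bar> * exp \<bar>z\<bar>" "\<bar>exp z - 1 - z\<bar> \<le> z\<^sup>2 * exp \<bar>z\<bar>"
proof -
  obtain t where t: "\<bar>t\<bar> \<le> \<bar>z\<bar>" "exp z = (\<Sum>m<1. z ^ m / fact m) + exp t / fact 1 * z ^ 1"
    using Maclaurin_exp_le[of z 1] by blast
  have "exp t \<le> exp \<bar>z\<bar>" using t(1) by simp
  then show "\<bar>exp z - 1\<bar> \<le> \<bar>z\<bar> * exp \<bar>z\<bar>" using t(2) by (simp add: abs_mult mult.commute mult_left_mono)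
  obtain u where u: "\<bar>u\<bar> \<le> \<bar>z\<bar>" "exp z = (\<Sum>m<2. z ^ m / fact m) + exp u / fact 2 * z ^ 2"
    using Maclaurin_exp_le[of z 2] by blast
  have eu: "exp u \<le> exp \<bar>z\<bar>" using u(1) by simp
  have "exp z - 1 - z = exp u / 2 * z\<^sup>2" using u(2) by (simp add: numeral_2_eq_2)
  moreover have "0 \<le> exp u / 2 * z\<^sup>2" by simp
  ultimately have "\<bar>exp z - 1 - z\<bar> = exp u / 2 * z\<^sup>2" by (simp only: abs_of_nonneg)
  also have "\<dots> \<le> exp \<bar>z\<bar> * z\<^sup>2"
  proof (rule mult_right_mono)
    show "exp u / 2 \<le> exp \<bar>z\<bar>" using eu exp_gt_zero[of u] by linarith
  qed simp
  finally show "\<bar>exp z - 1 - z\<bar> \<le> z\<^sup>2 * exp \<bar>z\<bar>" by (simp add: mult.commute)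
qed

text \<open>
  With \<open>1/m - c\<close> in place of an eigenvalue, the exponential beats every power of \<open>m\<close>. The sixth power is
  used because the square of \<open>1/m\<close> costs two of them.
\<close>

lemma exponential_decay_bound:
  fixes c t0 T :: real
  assumes "0 < t0"
  obtains A where "0 \<le> A" "\<And>m t. 0 < m \<Longrightarrow> t0 \<le> t \<Longrightarrow> t \<le> T \<Longrightarrow>
    (1 + \<bar>1 / m - c\<bar> + (1 / m - c)\<^sup>2) * exp (- (1 / m - c) * t) \<le> A * m ^ 4"
proof
  define A where "A = exp (\<bar>c\<bar> * \<bar>T\<bar>) * ((2 + 4 * c\<^sup>2) * (24 / t0 ^ 4) + 4 * (720 / t0 ^ 6))"
  show A: "0 \<le> A" unfolding A_def using assms by (intro mult_nonneg_nonneg add_nonneg_nonneg) auto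
  fix m t :: real assume m: "0 < m" and t: "t0 \<le> t" "t \<le> T"
  have tpos: "0 < t" using assms t by simp
  have e4: "exp (- (t / m)) \<le> (24 / t0 ^ 4) * m ^ 4"
  proof -
    have "exp (- (t / m)) \<le> fact 4 * m ^ 4 / t ^ 4" by (rule exp_minus_inverse_le[OF m tpos])
    also have "\<dots> \<le> fact 4 * m ^ 4 / t0 ^ 4" using assms t m by (intro divide_left_mono power_mono mult_pos_pos zero_less_power) auto
    finally show ?thesis by (simp add: fact_numeral)
  qed
  have e6: "(1 / m)\<^sup>2 * exp (- (t / m)) \<le> (720 / t0 ^ 6) * m ^ 4"
  proof -
    have "exp (- (t / m)) \<le> fact 6 * m ^ 6 / t ^ 6" by (rule exp_minus_inverse_le[OF m tpos])
    also have "\<dots> \<le> fact 6 * m ^ 6 / t0 ^ 6" using assms t m by (intro divide_left_mono power_mono mult_pos_pos zero_less_power) auto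
    finally have "(1 / m)\<^sup>2 * exp (- (t / m)) \<le> (1 / m)\<^sup>2 * (fact 6 * m ^ 6 / t0 ^ 6)" by (intro mult_left_mono) auto
    also have "\<dots> = (720 / t0 ^ 6) * m ^ 4" using m by (simp add: fact_numeral field_simps eval_nat_numeral)
    finally show ?thesis .
  qed
  define l where "l = 1 / m - c"
  have "1 + \<bar>l\<bar> + l\<^sup>2 \<le> 2 + 2 * l\<^sup>2"
    using sum_squares_bound[of "\<bar>l\<bar>" 1] zero_le_power2[of "\<bar>l\<bar>"] by simp
  also have "l\<^sup>2 \<le> 2 * (1 / m)\<^sup>2 + 2 * c\<^sup>2"
    using sum_squares_bound[of "1 / m" "- c"] by (simp add: l_def power2_diff)
  finally have pl: "1 + \<bar>l\<bar> + l\<^sup>2 \<le> (2 + 4 * c\<^sup>2) + 4 * (1 / m)\<^sup>2" by simp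
  have ex: "exp (- l * t) = exp (c * t) * exp (- (t / m))" by (simp add: l_def exp_add[symmetric] algebra_simps)
  have ct: "exp (c * t) \<le> exp (\<bar>c\<bar> * \<bar>T\<bar>)"
  proof -
    have "c * t \<le> \<bar>c\<bar> * t" using tpos by (intro mult_right_mono) auto
    also have "\<dots> \<le> \<bar>c\<bar> * \<bar>T\<bar>" using t by (intro mult_left_mono) auto
    finally show ?thesis by simp
  qed
  have "(1 + \<bar>l\<bar> + l\<^sup>2) * exp (- l * t) \<le> ((2 + 4 * c\<^sup>2) + 4 * (1 / m)\<^sup>2) * (exp (c * t) * exp (- (t / m)))"
    unfolding ex using pl by (intro mult_right_mono) auto
  also have "\<dots> = exp (c * t) * ((2 + 4 * c\<^sup>2) * exp (- (t / m)) + 4 * ((1 / m)\<^sup>2 * exp (- (t / m))))"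
    by (simp add: algebra_simps)
  also have "\<dots> \<le> exp (c * t) * ((2 + 4 * c\<^sup>2) * ((24 / t0 ^ 4) * m ^ 4) + 4 * ((720 / t0 ^ 6) * m ^ 4))"
    using e4 e6 by (intro mult_left_mono add_mono) auto
  also have "\<dots> \<le> exp (\<bar>c\<bar> * \<bar>T\<bar>) * ((2 + 4 * c\<^sup>2) * ((24 / t0 ^ 4) * m ^ 4) + 4 * ((720 / t0 ^ 6) * m ^ 4))"
    using ct assms by (intro mult_right_mono add_nonneg_nonneg mult_nonneg_nonneg) auto
  also have "\<dots> = A * m ^ 4" by (simp add: A_def algebra_simps add_divide_distrib)
  finally show "(1 + \<bar>1 / m - c\<bar> + (1 / m - c)\<^sup>2) * exp (- (1 / m - c) * t) \<le> A * m ^ 4" by (simp add: l_def)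
qed

context compact_symmetric
begin

text \<open>
  The eigenvalue of \<open>D\<close> that belongs to the eigenvalue \<open>\<mu> \<phi>\<close> of the resolvent \<open>(D + c)\<inverse>\<close>.
\<close>

definition ev :: "real \<Rightarrow> ('p \<Rightarrow> real) \<Rightarrow> real" where "ev c \<phi> = 1 / \<mu> \<phi> - c"

definition heat :: "real \<Rightarrow> real \<Rightarrow> 'p \<Rightarrow> 'p \<Rightarrow> real" where
  "heat c t = kernel_sum (\<lambda>\<phi>. exp (- ev c \<phi> * t))"

definition heat_deriv :: "real \<Rightarrow> real \<Rightarrow> 'p \<Rightarrow> 'p \<Rightarrow> real" where
  "heat_deriv c t = kernel_sum (\<lambda>\<phi>. - ev c \<phi> * exp (- ev c \<phi> * t))"

lemma heat_decays:
  assumes "0 < t0"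
  obtains A where "0 \<le> A" "\<And>t \<phi>. t0 \<le> t \<Longrightarrow> t \<le> T \<Longrightarrow> \<phi> \<in> S \<Longrightarrow>
    (1 + \<bar>ev c \<phi>\<bar> + (ev c \<phi>)\<^sup>2) * exp (- ev c \<phi> * t) \<le> A * \<mu> \<phi> ^ 4"
proof -
  obtain A where A: "0 \<le> A" "\<And>m t. 0 < m \<Longrightarrow> t0 \<le> t \<Longrightarrow> t \<le> T \<Longrightarrow>
    (1 + \<bar>1 / m - c\<bar> + (1 / m - c)\<^sup>2) * exp (- (1 / m - c) * t) \<le> A * m ^ 4"
    using exponential_decay_bound[OF assms] by blast
  show thesis
    by (rule that[OF A(1)]) (use A(2) S_facts(4) in \<open>simp add: ev_def\<close>)
qed

lemma decaysI:
  assumes "0 < t"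
  obtains A where "0 \<le> A" "decays (\<lambda>\<phi>. exp (- ev c \<phi> * t)) A" "decays (\<lambda>\<phi>. - ev c \<phi> * exp (- ev c \<phi> * t)) A"
    "decays (\<lambda>\<phi>. 1 / \<mu> \<phi> * exp (- ev c \<phi> * t)) (A * (1 + \<bar>c\<bar>))"
proof -
  obtain A where A: "0 \<le> A" "\<And>s \<phi>. t \<le> s \<Longrightarrow> s \<le> t \<Longrightarrow> \<phi> \<in> S \<Longrightarrow>
    (1 + \<bar>ev c \<phi>\<bar> + (ev c \<phi>)\<^sup>2) * exp (- ev c \<phi> * s) \<le> A * \<mu> \<phi> ^ 4"
    using heat_decays[OF assms, of t c] by blast
  have *: "(1 + \<bar>ev c \<phi>\<bar> + (ev c \<phi>)\<^sup>2) * exp (- ev c \<phi> * t) \<le> A * \<mu> \<phi> ^ 4" if "\<phi> \<in> S" for \<phi>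
    using A(2)[OF _ _ that] by simp
  have le: "b * exp (- ev c \<phi> * t) \<le> A * \<mu> \<phi> ^ 4" if "\<phi> \<in> S" "b \<le> 1 + \<bar>ev c \<phi>\<bar>" for b \<phi>
  proof -
    have "b * exp (- ev c \<phi> * t) \<le> (1 + \<bar>ev c \<phi>\<bar> + (ev c \<phi>)\<^sup>2) * exp (- ev c \<phi> * t)"
      using that(2) zero_le_power2[of "ev c \<phi>"] by (intro mult_right_mono) (linarith, simp)
    then show ?thesis using *[OF that(1)] by linarith
  qed
  show thesis
  proof (rule that[OF A(1)])
    show "decays (\<lambda>\<phi>. exp (- ev c \<phi> * t)) A"
      unfolding decays_def using le[of _ 1] by simp
    show "decays (\<lambda>\<phi>. - ev c \<phi> * exp (- ev c \<phi> * t)) A"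
      unfolding decays_def
    proof
      fix \<phi> assume "\<phi> \<in> S"
      from le[OF this, of "\<bar>ev c \<phi>\<bar>"] show "\<bar>- ev c \<phi> * exp (- ev c \<phi> * t)\<bar> \<le> A * \<mu> \<phi> ^ 4" by (simp add: abs_mult)
    qed
    show "decays (\<lambda>\<phi>. 1 / \<mu> \<phi> * exp (- ev c \<phi> * t)) (A * (1 + \<bar>c\<bar>))"
      unfolding decays_def
    proof
      fix \<phi> assume p: "\<phi> \<in> S"
      have m: "0 < \<mu> \<phi>" by (rule S_facts(4)[OF p])
      have "1 / \<mu> \<phi> \<le> \<bar>ev c \<phi>\<bar> + \<bar>c\<bar>" unfolding ev_def by linarith
      also have "\<dots> \<le> (1 + \<bar>c\<bar>) * (1 + \<bar>ev c \<phi>\<bar>)" by (simp add: algebra_simps)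
      finally have "1 / \<mu> \<phi> * exp (- ev c \<phi> * t) \<le> (1 + \<bar>c\<bar>) * (1 + \<bar>ev c \<phi>\<bar>) * exp (- ev c \<phi> * t)"
        by (intro mult_right_mono) auto
      also have "\<dots> = (1 + \<bar>c\<bar>) * ((1 + \<bar>ev c \<phi>\<bar>) * exp (- ev c \<phi> * t))" by simp
      also have "\<dots> \<le> (1 + \<bar>c\<bar>) * (A * \<mu> \<phi> ^ 4)" by (intro mult_left_mono le[OF p]) auto
      finally show "\<bar>1 / \<mu> \<phi> * exp (- ev c \<phi> * t)\<bar> \<le> A * (1 + \<bar>c\<bar>) * \<mu> \<phi> ^ 4"
        using m by (simp add: abs_mult mult_ac)
    qed
  qed
qed

text \<open>
  The coefficients \<open>exp (- \<lambda> t) / \<mu>\<close> still decay, and \<open>R\<close> multiplies the coefficients by \<open>\<mu>\<close>. Being in the range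
  of the resolvent is what puts the kernel into the domain of \<open>D\<close>, and \<open>c * R g - g\<close> is \<open>- D (R g)\<close>.
\<close>

lemma heat_in_range:
  assumes "0 < t"
  shows "\<exists>g\<in>H. heat c t x = R g \<and> heat_deriv c t x = (\<lambda>y. c * R g y - g y)"
proof -
  obtain A where A: "0 \<le> A" "decays (\<lambda>\<phi>. exp (- ev c \<phi> * t)) A" "decays (\<lambda>\<phi>. - ev c \<phi> * exp (- ev c \<phi> * t)) A"
    "decays (\<lambda>\<phi>. 1 / \<mu> \<phi> * exp (- ev c \<phi> * t)) (A * (1 + \<bar>c\<bar>))"
    by (rule decaysI[OF assms])
  define g where "g = kernel_sum (\<lambda>\<phi>. 1 / \<mu> \<phi> * exp (- ev c \<phi> * t)) x"
  have gH: "g \<in> H" unfolding g_def by (rule kernel_sum_H[OF A(4)])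
  have Rg: "R g = heat c t x"
    unfolding g_def kernel_sum_R[OF A(4)] heat_def kernel_sum_def
  proof (rule ext, rule infsum_cong)
    fix y \<phi> assume "\<phi> \<in> S"
    then have "0 < \<mu> \<phi>" by (rule S_facts(4))
    then show "1 / \<mu> \<phi> * exp (- ev c \<phi> * t) * \<mu> \<phi> * \<phi> x * \<phi> y = exp (- ev c \<phi> * t) * \<phi> x * \<phi> y" by simp
  qed
  have "heat_deriv c t x = (\<lambda>y. c * heat c t x y + (-1) * g y)"
  proof
    fix y
    have e: "- ev c \<phi> * exp (- ev c \<phi> * t) = c * exp (- ev c \<phi> * t) + (-1) * (1 / \<mu> \<phi> * exp (- ev c \<phi> * t))" for \<phi>
    proof -
      have "- ev c \<phi> = c - 1 / \<mu> \<phi>" by (simp add: ev_def)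
      then have "- ev c \<phi> * exp (- ev c \<phi> * t) = (c - 1 / \<mu> \<phi>) * exp (- ev c \<phi> * t)" by simp
      then show ?thesis by (simp add: left_diff_distrib)
    qed
    show "heat_deriv c t x y = c * heat c t x y + (-1) * g y"
      unfolding heat_deriv_def heat_def g_def e by (rule kernel_sum_lincomb[OF A(2,4)])
  qed
  then show ?thesis using gH Rg by (intro bexI[of _ g]) auto
qed

lemma heat_deriv_H:
  assumes "0 < t" shows "heat_deriv c t x \<in> H"
proof -
  obtain A where "decays (\<lambda>\<phi>. - ev c \<phi> * exp (- ev c \<phi> * t)) A" by (rule decaysI[OF assms])
  then show ?thesis unfolding heat_deriv_def by (rule kernel_sum_H)
qed

text \<open>
  Taylor estimates for \<open>exp (- \<lambda> t)\<close> are summed over the spectrum. They are uniform in \<open>y\<close>, so they imply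
  estimates in \<open>L\<^sup>2\<close>.
\<close>

lemma heat_time_estimates:
  assumes t: "0 < t"
  obtains B where "0 \<le> B"
    "\<And>h y. h \<noteq> 0 \<Longrightarrow> \<bar>h\<bar> \<le> t / 2 \<Longrightarrow> \<bar>(heat c (t + h) x y - heat c t x y) / h - heat_deriv c t x y\<bar> \<le> B * \<bar>h\<bar>"
    "\<And>s y. \<bar>s - t\<bar> \<le> t / 2 \<Longrightarrow> \<bar>heat_deriv c s x y - heat_deriv c t x y\<bar> \<le> B * \<bar>s - t\<bar>"
proof -
  have t2: "0 < t / 2" using t by simp
  obtain A where A: "0 \<le> A" "\<And>s \<phi>. t / 2 \<le> s \<Longrightarrow> s \<le> 3 * t / 2 \<Longrightarrow> \<phi> \<in> S \<Longrightarrow>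
    (1 + \<bar>ev c \<phi>\<bar> + (ev c \<phi>)\<^sup>2) * exp (- ev c \<phi> * s) \<le> A * \<mu> \<phi> ^ 4"
    using heat_decays[OF t2, of "3 * t / 2" c] by blast
  have sq: "(ev c \<phi>)\<^sup>2 * exp (- ev c \<phi> * s) \<le> A * \<mu> \<phi> ^ 4" if "t / 2 \<le> s" "s \<le> 3 * t / 2" "\<phi> \<in> S" for s \<phi>
  proof -
    have "(ev c \<phi>)\<^sup>2 * exp (- ev c \<phi> * s) \<le> (1 + \<bar>ev c \<phi>\<bar> + (ev c \<phi>)\<^sup>2) * exp (- ev c \<phi> * s)"
      by (intro mult_right_mono) auto
    then show ?thesis using A(2)[OF that] by linarith
  qed
  \<comment> \<open>The exponent is at most the larger of its values at the two times \<open>t / 2\<close> and \<open>3 * t / 2\<close>.\<close>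
  have main: "(ev c \<phi>)\<^sup>2 * (exp (- ev c \<phi> * t) * exp \<bar>ev c \<phi> * h\<bar>) \<le> 2 * A * \<mu> \<phi> ^ 4" if h: "\<bar>h\<bar> \<le> t / 2" and p: "\<phi> \<in> S" for \<phi> h
  proof -
    have "\<bar>ev c \<phi> * h\<bar> \<le> \<bar>ev c \<phi>\<bar> * (t / 2)" unfolding abs_mult using h by (intro mult_left_mono) auto
    then have "- ev c \<phi> * t + \<bar>ev c \<phi> * h\<bar> \<le> max (- ev c \<phi> * (t / 2)) (- ev c \<phi> * (3 * t / 2))"
      by (cases "0 \<le> ev c \<phi>") (auto simp: max_def algebra_simps)
    then have "exp (- ev c \<phi> * t + \<bar>ev c \<phi> * h\<bar>) \<le> exp (max (- ev c \<phi> * (t / 2)) (- ev c \<phi> * (3 * t / 2)))" by simp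
    also have "\<dots> \<le> exp (- ev c \<phi> * (t / 2)) + exp (- ev c \<phi> * (3 * t / 2))" by (simp add: max_def)
    finally have "exp (- ev c \<phi> * t) * exp \<bar>ev c \<phi> * h\<bar> \<le> exp (- ev c \<phi> * (t / 2)) + exp (- ev c \<phi> * (3 * t / 2))"
      by (simp add: exp_add[symmetric])
    then have "(ev c \<phi>)\<^sup>2 * (exp (- ev c \<phi> * t) * exp \<bar>ev c \<phi> * h\<bar>) \<le> (ev c \<phi>)\<^sup>2 * (exp (- ev c \<phi> * (t / 2)) + exp (- ev c \<phi> * (3 * t / 2)))"
      by (intro mult_left_mono) auto
    also have "\<dots> = (ev c \<phi>)\<^sup>2 * exp (- ev c \<phi> * (t / 2)) + (ev c \<phi>)\<^sup>2 * exp (- ev c \<phi> * (3 * t / 2))" by (simp add: distrib_left)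
    also have "\<dots> \<le> A * \<mu> \<phi> ^ 4 + A * \<mu> \<phi> ^ 4" using t p by (intro add_mono sq) auto
    finally show ?thesis by simp
  qed
  define W where "W = (\<lambda>t \<phi>. exp (- ev c \<phi> * t))"
  define W1 where "W1 = (\<lambda>t \<phi>. - ev c \<phi> * exp (- ev c \<phi> * t))"
  have dec: "\<exists>A. decays (W s) A" "\<exists>A. decays (W1 s) A" if s: "0 < s" for s
  proof -
    obtain A where "decays (\<lambda>\<phi>. exp (- ev c \<phi> * s)) A" "decays (\<lambda>\<phi>. - ev c \<phi> * exp (- ev c \<phi> * s)) A"
      by (rule decaysI[OF s])
    then show "\<exists>A. decays (W s) A" "\<exists>A. decays (W1 s) A" by (auto simp: W_def W1_def)
  qed
  define B where "B = 2 * A * C\<^sup>2 * (L * C\<^sup>2)"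
  have B0: "0 \<le> B" unfolding B_def using A(1) L_nonneg by simp
  have hW: "heat c s = kernel_sum (W s)" "heat_deriv c s = kernel_sum (W1 s)" for s
    by (simp_all add: heat_def heat_deriv_def W_def W1_def)
  show thesis
  proof (rule that[OF B0])
    fix h y assume h: "h \<noteq> 0" "\<bar>h\<bar> \<le> t / 2"
    have th: "0 < t + h" using h t by auto
    obtain A1 where A1: "decays (W (t + h)) A1" using dec(1)[OF th] by blast
    obtain A2 where A2: "decays (W t) A2" using dec(1)[OF t] by blast
    obtain A3 where A3: "decays (W1 t) A3" using dec(2)[OF t] by blast
    define D where "D = (\<lambda>\<phi>. 1 * (W (t + h) \<phi> + (-1) * W t \<phi>) + (- h) * W1 t \<phi>)"
    have A12: "decays (\<lambda>\<phi>. 1 * W (t + h) \<phi> + (-1) * W t \<phi>) (A1 + A2)"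
      unfolding decays_def
    proof
      fix \<phi> assume p: "\<phi> \<in> S"
      have "\<bar>1 * W (t + h) \<phi> + (-1) * W t \<phi>\<bar> \<le> \<bar>W (t + h) \<phi>\<bar> + \<bar>W t \<phi>\<bar>" by simp
      also have "\<dots> \<le> A1 * \<mu> \<phi> ^ 4 + A2 * \<mu> \<phi> ^ 4" using A1 A2 p unfolding decays_def by (intro add_mono) auto
      finally show "\<bar>1 * W (t + h) \<phi> + (-1) * W t \<phi>\<bar> \<le> (A1 + A2) * \<mu> \<phi> ^ 4" by (simp add: distrib_right)
    qed
    have "decays D (h\<^sup>2 * (2 * A))"
      unfolding decays_def
    proof
      fix \<phi> assume p: "\<phi> \<in> S"
      define z where "z = - ev c \<phi> * h"
      have "D \<phi> = exp (- ev c \<phi> * t) * (exp z - 1 - z)"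
        by (simp add: D_def W_def W1_def z_def exp_add[symmetric] algebra_simps)
      then have "\<bar>D \<phi>\<bar> = exp (- ev c \<phi> * t) * \<bar>exp z - 1 - z\<bar>" by (simp add: abs_mult)
      also have "\<dots> \<le> exp (- ev c \<phi> * t) * (z\<^sup>2 * exp \<bar>z\<bar>)" by (intro mult_left_mono exp_remainder_bounds) auto
      also have "\<dots> = h\<^sup>2 * ((ev c \<phi>)\<^sup>2 * (exp (- ev c \<phi> * t) * exp \<bar>ev c \<phi> * h\<bar>))"
        by (simp add: z_def power_mult_distrib mult_ac)
      also have "\<dots> \<le> h\<^sup>2 * (2 * A * \<mu> \<phi> ^ 4)" by (intro mult_left_mono main[OF h(2) p]) auto
      finally show "\<bar>D \<phi>\<bar> \<le> h\<^sup>2 * (2 * A) * \<mu> \<phi> ^ 4" by (simp add: mult.assoc)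
    qed
    then have bd: "\<bar>kernel_sum D x y\<bar> \<le> h\<^sup>2 * (2 * A) * C\<^sup>2 * (L * C\<^sup>2)"
      by (rule kernel_sum_bound) (use A(1) in auto)
    have "kernel_sum D x y = 1 * kernel_sum (\<lambda>\<phi>. 1 * W (t + h) \<phi> + (-1) * W t \<phi>) x y + (- h) * kernel_sum (W1 t) x y"
      using kernel_sum_lincomb[OF A12 A3, of 1 "- h" x y] unfolding D_def by simp
    also have "kernel_sum (\<lambda>\<phi>. 1 * W (t + h) \<phi> + (-1) * W t \<phi>) x y = 1 * kernel_sum (W (t + h)) x y + (-1) * kernel_sum (W t) x y"
      by (rule kernel_sum_lincomb[OF A1 A2])
    finally have "kernel_sum D x y = heat c (t + h) x y - heat c t x y - h * heat_deriv c t x y" by (simp add: hW)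
    then have "(heat c (t + h) x y - heat c t x y) / h - heat_deriv c t x y = kernel_sum D x y / h"
      using h(1) by (simp add: field_simps)
    then have "\<bar>(heat c (t + h) x y - heat c t x y) / h - heat_deriv c t x y\<bar> = \<bar>kernel_sum D x y\<bar> / \<bar>h\<bar>" by simp
    also have "\<dots> \<le> (h\<^sup>2 * (2 * A) * C\<^sup>2 * (L * C\<^sup>2)) / \<bar>h\<bar>" using bd by (intro divide_right_mono) auto
    also have "\<dots> = B * (h\<^sup>2 / \<bar>h\<bar>)" by (simp add: B_def)
    also have "h\<^sup>2 / \<bar>h\<bar> = \<bar>h\<bar>"
    proof -
      have "h\<^sup>2 = \<bar>h\<bar> * \<bar>h\<bar>" by (simp add: power2_eq_square)
      then show ?thesis using h(1) by (metis abs_eq_0 nonzero_mult_div_cancel_right)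
    qed
    finally show "\<bar>(heat c (t + h) x y - heat c t x y) / h - heat_deriv c t x y\<bar> \<le> B * \<bar>h\<bar>" .
  next
    fix s y assume s: "\<bar>s - t\<bar> \<le> t / 2"
    have "t - s \<le> t / 2" using s unfolding abs_le_iff by linarith
    then have s0: "0 < s" using t by linarith
    obtain A1 where A1: "decays (W1 s) A1" using dec(2)[OF s0] by blast
    obtain A2 where A2: "decays (W1 t) A2" using dec(2)[OF t] by blast
    define h where "h = s - t"
    have "decays (\<lambda>\<phi>. 1 * W1 s \<phi> + (-1) * W1 t \<phi>) (\<bar>h\<bar> * (2 * A))"
      unfolding decays_def
    proof
      fix \<phi> assume p: "\<phi> \<in> S"
      define z where "z = - ev c \<phi> * h"
      have "1 * W1 s \<phi> + (-1) * W1 t \<phi> = - ev c \<phi> * (exp (- ev c \<phi> * t) * (exp z - 1))"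
        by (simp add: W1_def z_def h_def exp_add[symmetric] algebra_simps)
      then have "\<bar>1 * W1 s \<phi> + (-1) * W1 t \<phi>\<bar> = \<bar>ev c \<phi>\<bar> * (exp (- ev c \<phi> * t) * \<bar>exp z - 1\<bar>)" by (simp add: abs_mult)
      also have "\<dots> \<le> \<bar>ev c \<phi>\<bar> * (exp (- ev c \<phi> * t) * (\<bar>z\<bar> * exp \<bar>z\<bar>))" by (intro mult_left_mono exp_remainder_bounds) auto
      also have "\<dots> = \<bar>h\<bar> * ((ev c \<phi>)\<^sup>2 * (exp (- ev c \<phi> * t) * exp \<bar>ev c \<phi> * h\<bar>))"
        by (simp add: z_def abs_mult power2_eq_square mult_ac)
      also have "\<dots> \<le> \<bar>h\<bar> * (2 * A * \<mu> \<phi> ^ 4)" using s p by (intro mult_left_mono main) (auto simp: h_def)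
      finally show "\<bar>1 * W1 s \<phi> + (-1) * W1 t \<phi>\<bar> \<le> \<bar>h\<bar> * (2 * A) * \<mu> \<phi> ^ 4" by (simp add: mult.assoc)
    qed
    then have "\<bar>kernel_sum (\<lambda>\<phi>. 1 * W1 s \<phi> + (-1) * W1 t \<phi>) x y\<bar> \<le> \<bar>h\<bar> * (2 * A) * C\<^sup>2 * (L * C\<^sup>2)"
      by (rule kernel_sum_bound) (use A(1) in auto)
    then show "\<bar>heat_deriv c s x y - heat_deriv c t x y\<bar> \<le> B * \<bar>s - t\<bar>"
      unfolding kernel_sum_lincomb[OF A1 A2] by (simp add: hW B_def h_def mult_ac)
  qed
qed

text \<open>
  Pairing with \<open>R h\<close> gives \<open>\<Sum> exp (- \<lambda> t) (R \<phi>) x (ip \<phi> h)\<close>. For \<open>t < 1\<close> this is dominated by the absolutely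
  convergent expansion of \<open>R h x\<close> because \<open>\<lambda>\<close> is bounded below, so the limit may be taken termwise.
\<close>

lemma heat_initial_condition:
  assumes h: "h \<in> H"
  shows "((\<lambda>t. ip (heat c t x) (R h)) \<longlongrightarrow> R h x) (at_right 0)"
proof -
  define b where "b = (\<lambda>\<phi>. R \<phi> x * ip \<phi> h)"
  have ex: "(\<lambda>\<phi>. \<bar>b \<phi>\<bar>) summable_on S" "(b has_sum R h x) S"
    using eigenfunction_expansion[OF h, of x] by (simp_all add: b_def)
  have RhH: "R h \<in> H" by (rule R_H[OF h])
  have eq: "ip (heat c t x) (R h) = (\<Sum>\<^sub>\<infinity>\<phi>\<in>S. exp (- ev c \<phi> * t) * b \<phi>)" if t: "0 < t" for t
  proof -
    obtain A where A: "decays (\<lambda>\<phi>. exp (- ev c \<phi> * t)) A" by (rule decaysI[OF t])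
    have "ip (heat c t x) (R h) = (\<Sum>\<^sub>\<infinity>\<phi>\<in>S. exp (- ev c \<phi> * t) * \<phi> x * ip \<phi> (R h))"
      unfolding heat_def by (rule infsumI[OF kernel_sum_ip[OF A RhH], symmetric])
    also have "\<dots> = (\<Sum>\<^sub>\<infinity>\<phi>\<in>S. exp (- ev c \<phi> * t) * b \<phi>)"
    proof (rule infsum_cong)
      fix \<phi> assume p: "\<phi> \<in> S"
      have "ip \<phi> (R h) = ip (R \<phi>) h" using R_sym[OF S_facts(2)[OF p] h] by simp
      also have "\<dots> = \<mu> \<phi> * ip \<phi> h" unfolding S_facts(5)[OF p] by (rule ip_cmult[OF S_facts(2)[OF p] h])
      finally show "exp (- ev c \<phi> * t) * \<phi> x * ip \<phi> (R h) = exp (- ev c \<phi> * t) * b \<phi>"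
        unfolding b_def S_facts(5)[OF p] by simp
    qed
    finally show ?thesis .
  qed
  define Z where "Z = (\<lambda>t. \<Sum>\<^sub>\<infinity>\<phi>\<in>S. exp (- ev c \<phi> * t) * b \<phi>)"
  have unif: "uniform_limit {0<..<1} (\<lambda>F t. \<Sum>\<phi>\<in>F. exp (- ev c \<phi> * t) * b \<phi>) Z (finite_subsets_at_top S)"
    unfolding Z_def
  proof (rule Weierstrass_m_test_general)
    show "(\<lambda>\<phi>. exp \<bar>c\<bar> * \<bar>b \<phi>\<bar>) summable_on S" by (intro summable_on_cmult_right ex(1))
    fix \<phi> and t :: real assume p: "\<phi> \<in> S" and t: "t \<in> {0<..<1}"
    have "- ev c \<phi> \<le> \<bar>c\<bar>" using S_facts(4)[OF p] by (simp add: ev_def) (smt (verit) divide_pos_pos)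
    then have "- ev c \<phi> * t \<le> \<bar>c\<bar> * t" using t by (intro mult_right_mono) auto
    also have "\<dots> \<le> \<bar>c\<bar>" using t mult_left_le[of t "\<bar>c\<bar>"] by simp
    finally have "exp (- ev c \<phi> * t) \<le> exp \<bar>c\<bar>" by simp
    then show "norm (exp (- ev c \<phi> * t) * b \<phi>) \<le> exp \<bar>c\<bar> * \<bar>b \<phi>\<bar>" by (simp add: abs_mult mult_right_mono)
  qed
  have "(Z \<longlongrightarrow> R h x) (at_right 0)"
  proof (rule swap_uniform_limit'[OF _ _ unif])
    show "\<forall>\<^sub>F F in finite_subsets_at_top S. ((\<lambda>t. \<Sum>\<phi>\<in>F. exp (- ev c \<phi> * t) * b \<phi>) \<longlongrightarrow> (\<Sum>\<phi>\<in>F. b \<phi>)) (at_right 0)"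
    proof (rule always_eventually, rule allI)
      fix F
      have "((\<lambda>t. \<Sum>\<phi>\<in>F. exp (- ev c \<phi> * t) * b \<phi>) \<longlongrightarrow> (\<Sum>\<phi>\<in>F. exp (- ev c \<phi> * 0) * b \<phi>)) (at_right 0)"
        by (intro tendsto_intros)
      then show "((\<lambda>t. \<Sum>\<phi>\<in>F. exp (- ev c \<phi> * t) * b \<phi>) \<longlongrightarrow> (\<Sum>\<phi>\<in>F. b \<phi>)) (at_right 0)" by simp
    qed
    show "((\<lambda>F. \<Sum>\<phi>\<in>F. b \<phi>) \<longlongrightarrow> R h x) (finite_subsets_at_top S)" using ex(2) unfolding has_sum_def by simp
    show "\<forall>\<^sub>F t in at_right 0. t \<in> {0<..<1::real}" by (rule eventually_at_right_real) simp
  qed simp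
  moreover have "eventually (\<lambda>t. Z t = ip (heat c t x) (R h)) (at_right 0)"
    unfolding eventually_at_right_field using eq by (intro exI[of _ 1]) (auto simp: Z_def)
  ultimately show ?thesis by (rule Lim_transform_eventually)
qed

end

section \<open>Transport along an edge\<close>

text \<open>
  Banach's theorem for the supremum distance, with Lipschitz constant 1/2. The set \<open>Z\<close> consists of bounded
  functions and is closed under uniform limits.
\<close>

lemma contraction_fixed_point:
  fixes \<Phi> :: "('i \<Rightarrow> real) \<Rightarrow> 'i \<Rightarrow> real" and Z :: "('i \<Rightarrow> real) set"
  assumes Z0: "(\<lambda>i. 0) \<in> Z" and maps: "\<And>f. f \<in> Z \<Longrightarrow> \<Phi> f \<in> Z"
    and contr: "\<And>f g B i. f \<in> Z \<Longrightarrow> g \<in> Z \<Longrightarrow> (\<And>j. \<bar>f j - g j\<bar> \<le> B) \<Longrightarrow> \<bar>\<Phi> f i - \<Phi> g i\<bar> \<le> B / 2"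
    and bdd: "\<And>f. f \<in> Z \<Longrightarrow> \<exists>B. \<forall>i. \<bar>f i\<bar> \<le> B"
    and closed: "\<And>fs g. (\<And>n::nat. fs n \<in> Z) \<Longrightarrow> (\<And>e. 0 < e \<Longrightarrow> \<exists>N. \<forall>n\<ge>N. \<forall>i. \<bar>fs n i - g i\<bar> \<le> e) \<Longrightarrow> g \<in> Z"
  shows "\<exists>f\<in>Z. \<Phi> f = f"
proof -
  define F where "F = (\<lambda>n. (\<Phi> ^^ n) (\<lambda>i. 0))"
  have FS: "F (Suc n) = \<Phi> (F n)" for n by (simp add: F_def)
  have FZ: "F n \<in> Z" for n by (induction n) (auto simp: F_def Z0 maps)
  obtain B where B: "\<forall>i. \<bar>F 1 i\<bar> \<le> B" using bdd[OF FZ] by blast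
  have B0: "0 \<le> B" using B by (meson abs_ge_zero order_trans)
  have step: "\<bar>F (Suc n) i - F n i\<bar> \<le> B / 2 ^ n" for n i
  proof (induction n arbitrary: i)
    case 0
    then show ?case using B by (simp add: F_def)
  next
    case (Suc n)
    have "\<bar>\<Phi> (F (Suc n)) i - \<Phi> (F n) i\<bar> \<le> (B / 2 ^ n) / 2"
      by (rule contr[OF FZ FZ Suc.IH])
    then show ?case by (simp add: FS mult.commute)
  qed
  have far: "\<bar>F (n + m) i - F n i\<bar> \<le> 2 * B / 2 ^ n - 2 * B / 2 ^ (n + m)" for n m i
  proof (induction m)
    case (Suc m)
    have "\<bar>F (n + Suc m) i - F n i\<bar> \<le> \<bar>F (Suc (n + m)) i - F (n + m) i\<bar> + \<bar>F (n + m) i - F n i\<bar>" by simp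
    also have "\<dots> \<le> B / 2 ^ (n + m) + (2 * B / 2 ^ n - 2 * B / 2 ^ (n + m))" by (intro add_mono step Suc.IH)
    also have "\<dots> = 2 * B / 2 ^ n - 2 * B / 2 ^ (n + Suc m)" by (simp add: field_simps)
    finally show ?case .
  qed simp
  have lim0: "(\<lambda>n. 2 * B / 2 ^ n) \<longlonglongrightarrow> 0"
    using tendsto_mult[OF tendsto_const[of "2 * B"] LIMSEQ_inverse_realpow_zero[of 2]] by (simp add: divide_inverse)
  have small: "\<exists>N. \<forall>n\<ge>N. 2 * B / 2 ^ n \<le> e" if "0 < e" for e
    using order_tendstoD(2)[OF lim0 that] unfolding eventually_sequentially by (meson less_imp_le)
  have far': "\<bar>F m i - F n i\<bar> \<le> 2 * B / 2 ^ n" if "n \<le> m" for n m i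
  proof -
    have "\<bar>F (n + (m - n)) i - F n i\<bar> \<le> 2 * B / 2 ^ n - 2 * B / 2 ^ (n + (m - n))" by (rule far)
    also have "\<dots> \<le> 2 * B / 2 ^ n" using B0 by simp
    finally have "\<bar>F (n + (m - n)) i - F n i\<bar> \<le> 2 * B / 2 ^ n" .
    then show ?thesis using that by simp
  qed
  have "Cauchy (\<lambda>n. F n i)" for i
  proof (rule CauchyI)
    fix e :: real assume "0 < e"
    then obtain N where N: "\<forall>n\<ge>N. 2 * B / 2 ^ n \<le> e / 4" using small[of "e / 4"] by auto
    have "norm (F m i - F n i) < e" if "N \<le> m" "N \<le> n" for m n
    proof -
      have "\<bar>F m i - F N i\<bar> \<le> e / 4" "\<bar>F n i - F N i\<bar> \<le> e / 4"
        using far'[OF that(1), of i] far'[OF that(2), of i] N by (auto intro: order_trans)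
      then have "\<bar>F m i - F n i\<bar> \<le> e / 2" by linarith
      then show ?thesis using \<open>0 < e\<close> by simp
    qed
    then show "\<exists>M. \<forall>m\<ge>M. \<forall>n\<ge>M. norm (F m i - F n i) < e" by blast
  qed
  then have conv: "convergent (\<lambda>n. F n i)" for i by (simp add: Cauchy_convergent_iff)
  define f where "f = (\<lambda>i. lim (\<lambda>n. F n i))"
  have lim: "(\<lambda>n. F n i) \<longlonglongrightarrow> f i" for i using conv[of i] by (simp add: f_def convergent_LIMSEQ_iff)
  have close: "\<bar>F n i - f i\<bar> \<le> 2 * B / 2 ^ n" for n i
  proof -
    have "(\<lambda>m. \<bar>F n i - F m i\<bar>) \<longlonglongrightarrow> \<bar>F n i - f i\<bar>" by (intro tendsto_intros lim)
    then show ?thesis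
    proof (rule LIMSEQ_le_const2)
      show "\<exists>N. \<forall>m\<ge>N. \<bar>F n i - F m i\<bar> \<le> 2 * B / 2 ^ n" using far'[of n _ i] by (metis abs_minus_commute)
    qed
  qed
  have fZ: "f \<in> Z"
  proof (rule closed[OF FZ])
    fix e :: real assume "0 < e"
    then obtain N where N: "\<forall>n\<ge>N. 2 * B / 2 ^ n \<le> e" using small by blast
    show "\<exists>N. \<forall>n\<ge>N. \<forall>i. \<bar>F n i - f i\<bar> \<le> e" using N close by (meson order_trans)
  qed
  have "\<Phi> f i = f i" for i
  proof -
    have "\<bar>\<Phi> f i - f i\<bar> \<le> 2 * B / 2 ^ n" for n
    proof -
      define X where "X = 2 * B / 2 ^ n"
      have "\<bar>\<Phi> (F n) i - \<Phi> f i\<bar> \<le> X / 2" unfolding X_def by (rule contr[OF FZ fZ close])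
      moreover have "\<bar>\<Phi> (F n) i - f i\<bar> \<le> X / 2" using close[of "Suc n" i] by (simp add: FS X_def)
      ultimately have "\<bar>\<Phi> f i - f i\<bar> \<le> X" by linarith
      then show ?thesis by (simp add: X_def)
    qed
    then have "\<bar>\<Phi> f i - f i\<bar> \<le> 0" by (intro LIMSEQ_le_const[OF lim0]) auto
    then show ?thesis by simp
  qed
  then show ?thesis using fZ by blast
qed

lemma exp_ac_primitive: "ac_primitive a b (\<lambda>s. exp (c * s)) (\<lambda>s. c * exp (c * s))"
  by (rule C1_imp_ac_primitive) (auto intro!: derivative_eq_intros continuous_intros)

lemma exp_mult_square_integrable:
  assumes "square_integrable (lebesgue_on {0..b}) g"
  shows "square_integrable (lebesgue_on {0..b}) (\<lambda>s. exp (c * s) * g s)"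
proof -
  have cont: "continuous_on {0..b} (\<lambda>s. exp (c * s))" by (intro continuous_intros)
  have "bounded ((\<lambda>s. exp (c * s)) ` {0..b})"
    by (intro compact_imp_bounded compact_continuous_image cont) auto
  then obtain B where B: "\<forall>s\<in>{0..b}. \<bar>exp (c * s)\<bar> \<le> B" by (auto simp: bounded_iff)
  show ?thesis
  proof (rule square_integrable_bounded_mult[OF assms])
    show "(\<lambda>s. exp (c * s)) \<in> borel_measurable (lebesgue_on {0..b})"
      by (intro continuous_imp_measurable_on_sets_lebesgue cont) auto
    show "\<bar>exp (c * x)\<bar> \<le> B" if "x \<in> space (lebesgue_on {0..b})" for x using B that by simp
  qed
qed

text \<open>
  The solution of \<open>w' = c w + g\<close> with \<open>w 0 = 0\<close>.
\<close>

definition transport :: "real \<Rightarrow> (real \<Rightarrow> real) \<Rightarrow> real \<Rightarrow> real" where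
  "transport c g s = exp (c * s) * integral {0..s} (\<lambda>y. exp (- c * y) * g y)"

lemma transport_ac_primitive:
  assumes g: "square_integrable (lebesgue_on {0..b}) g"
  shows "ac_primitive 0 b (transport c g) (\<lambda>s. c * transport c g s + g s)"
proof -
  have "ac_primitive 0 b (\<lambda>s. exp (c * s) * integral {0..s} (\<lambda>y. exp (- c * y) * g y))
     (\<lambda>s. c * exp (c * s) * integral {0..s} (\<lambda>y. exp (- c * y) * g y) + exp (c * s) * (exp (- c * s) * g s))"
    by (rule ac_primitive_mult[OF exp_ac_primitive indefinite_integral_ac_primitive[OF exp_mult_square_integrable[OF g]]])
  moreover have e: "exp (c * s) * (exp (- c * s) * g s) = g s" for s by (simp add: mult.assoc[symmetric] exp_add[symmetric])
  ultimately show ?thesis unfolding transport_def by (simp only: mult.assoc e)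
qed

lemma transport_unique:
  assumes w: "ac_primitive 0 b w w'" and eq: "negligible {s\<in>{0..b}. w' s \<noteq> c * w s + g s}"
    and g: "square_integrable (lebesgue_on {0..b}) g" and s: "s \<in> {0..b}"
  shows "w s = exp (c * s) * w 0 + transport c g s"
proof -
  have "ac_primitive 0 b (\<lambda>s. exp (- c * s) * w s) (\<lambda>s. - c * exp (- c * s) * w s + exp (- c * s) * w' s)"
    by (rule ac_primitive_mult[OF exp_ac_primitive w])
  then have "ac_primitive 0 b (\<lambda>s. exp (- c * s) * w s) (\<lambda>s. exp (- c * s) * g s)"
  proof (rule ac_primitive_cong_ae)
    show "negligible {s\<in>{0..b}. - c * exp (- c * s) * w s + exp (- c * s) * w' s \<noteq> exp (- c * s) * g s}"
      by (rule negligible_subset[OF eq]) (auto simp: algebra_simps)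
  qed
  from ac_primitive_FTC[OF this, of 0 s]
  have "((\<lambda>s. exp (- c * s) * g s) has_integral (exp (- c * s) * w s - w 0)) {0..s}" using s by simp
  then have "exp (- c * s) * w s = w 0 + integral {0..s} (\<lambda>y. exp (- c * y) * g y)" by (simp add: integral_unique)
  then have "exp (c * s) * (exp (- c * s) * w s) = exp (c * s) * (w 0 + integral {0..s} (\<lambda>y. exp (- c * y) * g y))" by simp
  moreover have "exp (c * s) * (exp (- c * s) * w s) = w s" by (simp add: mult.assoc[symmetric] exp_add[symmetric])
  ultimately show ?thesis by (simp add: transport_def algebra_simps)
qed

text \<open>
  The solution of \<open>w' = c w - g\<close> with \<open>w b = 0\<close>, which is the stable direction for \<open>c > 0\<close>.
\<close>

definition transport_back :: "real \<Rightarrow> real \<Rightarrow> (real \<Rightarrow> real) \<Rightarrow> real \<Rightarrow> real" where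
  "transport_back b c g s = exp (- c * (b - s)) * transport c g b - transport c g s"

lemma transport_integrand_integrable:
  assumes "square_integrable (lebesgue_on {0..b}) g" "0 \<le> u" "v \<le> b"
  shows "(\<lambda>y. exp (c * y) * g y) integrable_on {u..v}"
  using square_integrable_subinterval(1)[OF exp_mult_square_integrable[OF assms(1)] assms(2,3)]
  by (simp add: absolutely_integrable_on_def)

lemma transport_back_eq:
  assumes g: "square_integrable (lebesgue_on {0..b}) g" and s: "s \<in> {0..b}"
  shows "transport_back b c g s = exp (c * s) * integral {s..b} (\<lambda>y. exp (- c * y) * g y)"
proof -
  have "integral {0..b} (\<lambda>y. exp (- c * y) * g y) = integral {0..s} (\<lambda>y. exp (- c * y) * g y) + integral {s..b} (\<lambda>y. exp (- c * y) * g y)"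
    using s by (intro Henstock_Kurzweil_Integration.integral_combine[symmetric] transport_integrand_integrable[OF g]) auto
  moreover have "exp (- c * (b - s)) * (exp (c * b) * x) = exp (c * s) * x" for x
    by (simp add: mult.assoc[symmetric] exp_add[symmetric] algebra_simps)
  ultimately show ?thesis unfolding transport_back_def transport_def by (simp only: distrib_left)
qed

lemma transport_back_ac_primitive:
  assumes g: "square_integrable (lebesgue_on {0..b}) g"
  shows "ac_primitive 0 b (transport_back b c g) (\<lambda>s. c * transport_back b c g s - g s)"
proof -
  have "ac_primitive 0 b (\<lambda>s. (exp (- c * b) * transport c g b) * exp (c * s) + (-1) * transport c g s)
     (\<lambda>s. (exp (- c * b) * transport c g b) * (c * exp (c * s)) + (-1) * (c * transport c g s + g s))"
    by (intro ac_primitive_add ac_primitive_cmult exp_ac_primitive transport_ac_primitive g)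
  moreover have "exp (- c * b) * exp (c * s) = exp (- c * (b - s))" for s
    by (simp add: exp_add[symmetric] algebra_simps)
  then have "(\<lambda>s. (exp (- c * b) * transport c g b) * exp (c * s) + (-1) * transport c g s) = transport_back b c g"
    "(\<lambda>s. (exp (- c * b) * transport c g b) * (c * exp (c * s)) + (-1) * (c * transport c g s + g s)) = (\<lambda>s. c * transport_back b c g s - g s)"
    unfolding transport_back_def by (auto simp: fun_eq_iff algebra_simps)
  ultimately show ?thesis by simp
qed

lemma transport_add:
  assumes "square_integrable (lebesgue_on {0..b}) g" "square_integrable (lebesgue_on {0..b}) h" "s \<in> {0..b}"
  shows "transport c (\<lambda>y. g y + h y) s = transport c g s + transport c h s"
proof -
  have "integral {0..s} (\<lambda>y. exp (- c * y) * g y + exp (- c * y) * h y) = integral {0..s} (\<lambda>y. exp (- c * y) * g y) + integral {0..s} (\<lambda>y. exp (- c * y) * h y)"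
    using assms(3) by (intro Henstock_Kurzweil_Integration.integral_add transport_integrand_integrable[OF assms(1)] transport_integrand_integrable[OF assms(2)]) auto
  then show ?thesis by (simp add: transport_def distrib_left)
qed

lemma transport_cmult: "transport c (\<lambda>y. d * g y) s = d * transport c g s"
proof -
  have "(\<lambda>y. exp (- c * y) * (d * g y)) = (\<lambda>y. d * (exp (- c * y) * g y))" by (simp add: mult_ac)
  then show ?thesis by (simp add: transport_def)
qed

lemma transport_back_add:
  assumes "square_integrable (lebesgue_on {0..b}) g" "square_integrable (lebesgue_on {0..b}) h" "s \<in> {0..b}"
  shows "transport_back b c (\<lambda>y. g y + h y) s = transport_back b c g s + transport_back b c h s"
  using assms transport_add[OF assms(1,2)] unfolding transport_back_def by (simp add: distrib_left)

lemma transport_back_cmult: "transport_back b c (\<lambda>y. d * g y) s = d * transport_back b c g s"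
  unfolding transport_back_def transport_cmult by (simp add: algebra_simps)

lemma transport_bounds:
  assumes g: "square_integrable (lebesgue_on {0..b}) g" and s: "s \<in> {0..b}" and k: "0 \<le> k"
  shows "\<bar>transport (- k) g s\<bar> \<le> integral {0..b} (\<lambda>y. \<bar>g y\<bar>)"
    and "\<bar>transport_back b k g s\<bar> \<le> integral {0..b} (\<lambda>y. \<bar>g y\<bar>)"
proof -
  have int: "(\<lambda>y. \<bar>g y\<bar>) integrable_on {u..v}" if "0 \<le> u" "v \<le> b" for u v
    using square_integrable_subinterval(1)[OF g that] by (simp add: absolutely_integrable_on_def)
  have gen: "\<bar>exp d * integral {u..v} (\<lambda>y. exp (c * y) * g y)\<bar> \<le> integral {0..b} (\<lambda>y. \<bar>g y\<bar>)"
    if uv: "0 \<le> u" "v \<le> b" and d: "\<And>y. y \<in> {u..v} \<Longrightarrow> d + c * y \<le> 0" for u v c d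
  proof -
    have e: "exp d * integral {u..v} (\<lambda>y. exp (c * y) * g y) = integral {u..v} (\<lambda>y. exp d * (exp (c * y) * g y))" by simp
    have "norm (integral {u..v} (\<lambda>y. exp d * (exp (c * y) * g y))) \<le> integral {u..v} (\<lambda>y. \<bar>g y\<bar>)"
    proof (rule integral_norm_bound_integral)
      show "(\<lambda>y. exp d * (exp (c * y) * g y)) integrable_on {u..v}"
        using integrable_cmul[OF transport_integrand_integrable[OF g uv], of "exp d" c] by simp
      show "(\<lambda>y. \<bar>g y\<bar>) integrable_on {u..v}" by (rule int[OF uv])
      fix y assume "y \<in> {u..v}"
      then have "exp (d + c * y) \<le> 1" using d by simp
      then have "exp (d + c * y) * \<bar>g y\<bar> \<le> 1 * \<bar>g y\<bar>" by (intro mult_right_mono) auto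
      then show "norm (exp d * (exp (c * y) * g y)) \<le> \<bar>g y\<bar>" by (simp add: exp_add abs_mult mult.assoc)
    qed
    also have "\<dots> \<le> integral {0..b} (\<lambda>y. \<bar>g y\<bar>)" using uv int[OF uv] int[of 0 b] by (intro integral_subset_le) auto
    finally show ?thesis unfolding e by simp
  qed
  show "\<bar>transport (- k) g s\<bar> \<le> integral {0..b} (\<lambda>y. \<bar>g y\<bar>)"
    unfolding transport_def minus_minus
  proof (rule gen)
    fix y assume y: "y \<in> {0..s}"
    then have "k * y \<le> k * s" using k by (intro mult_left_mono) auto
    then show "- k * s + k * y \<le> 0" by simp
  qed (use s in auto)
  show "\<bar>transport_back b k g s\<bar> \<le> integral {0..b} (\<lambda>y. \<bar>g y\<bar>)"
    unfolding transport_back_eq[OF g s]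
  proof (rule gen)
    fix y assume y: "y \<in> {s..b}"
    then have "k * s \<le> k * y" using k by (intro mult_left_mono) auto
    then show "k * s + - k * y \<le> 0" by simp
  qed (use s in auto)
qed

lemma transport_back_unique:
  assumes w: "ac_primitive 0 b w w'" and eq: "negligible {s\<in>{0..b}. w' s \<noteq> c * w s - g s}"
    and g: "square_integrable (lebesgue_on {0..b}) g" and s: "s \<in> {0..b}"
  shows "w s = exp (- c * (b - s)) * w b + transport_back b c g s"
proof -
  have g': "square_integrable (lebesgue_on {0..b}) (\<lambda>s. -1 * g s)" by (rule square_integrable_cmult[OF g])
  have eq': "negligible {s\<in>{0..b}. w' s \<noteq> c * w s + -1 * g s}" using eq by simp
  have 1: "w r = exp (c * r) * w 0 - transport c g r" if "r \<in> {0..b}" for r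
    using transport_unique[OF w eq' g' that] unfolding transport_cmult by simp
  have 2: "w b = exp (c * b) * w 0 - transport c g b" using 1[of b] s by simp
  have e: "exp (- c * (b - s)) * (exp (c * b) * w 0) = exp (c * s) * w 0"
    by (simp add: mult.assoc[symmetric] exp_add[symmetric] algebra_simps)
  have "exp (- c * (b - s)) * w b = exp (c * s) * w 0 - exp (- c * (b - s)) * transport c g b"
  proof -
    have "exp (- c * (b - s)) * (exp (c * b) * w 0 - transport c g b)
        = exp (- c * (b - s)) * (exp (c * b) * w 0) - exp (- c * (b - s)) * transport c g b" by (rule right_diff_distrib)
    then show ?thesis unfolding 2 e .
  qed
  then show ?thesis unfolding transport_back_def using 1[OF s] by linarith
qed

lemma ae_equal_on_interval:
  assumes f: "f \<in> borel_measurable (lebesgue_on {0..b})" and neg: "negligible {s\<in>{0..b::real}. f s \<noteq> (g s :: real)}"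
  shows "AE s in lebesgue_on {0..b}. f s = g s" and "g \<in> borel_measurable (lebesgue_on {0..b})"
proof -
  have N: "{s\<in>{0..b}. f s \<noteq> g s} \<in> null_sets lebesgue" using neg by (simp add: negligible_iff_null_sets)
  have "AE s in lebesgue. s \<in> {0..b} \<longrightarrow> f s = g s"
    by (rule AE_I'[OF N]) auto
  then show "AE s in lebesgue_on {0..b}. f s = g s"
    by (simp add: AE_restrict_space_iff)
  have "f measurable_on {0..b}" using f measurable_on_iff_borel_measurable[of "{0..b}" f] by auto
  then have "g measurable_on {0..b}" by (rule measurable_on_spike[OF _ neg]) auto
  then show "g \<in> borel_measurable (lebesgue_on {0..b})" using measurable_on_iff_borel_measurable[of "{0..b}" g] by auto
qed

lemma square_integrable_cong_ae:
  assumes f: "square_integrable (lebesgue_on {0..b}) f" and neg: "negligible {s\<in>{0..b::real}. f s \<noteq> g s}"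
  shows "square_integrable (lebesgue_on {0..b}) g"
proof -
  have fm: "f \<in> borel_measurable (lebesgue_on {0..b})" "integrable (lebesgue_on {0..b}) (\<lambda>s. (f s)\<^sup>2)"
    using f by (auto simp: square_integrable_def)
  note ae = ae_equal_on_interval[OF fm(1) neg]
  have "integrable (lebesgue_on {0..b}) (\<lambda>s. (g s)\<^sup>2)"
    using fm ae by (subst integrable_cong_AE[where g="\<lambda>s. (f s)\<^sup>2"]) auto
  then show ?thesis using ae(2) by (simp add: square_integrable_def)
qed

lemma absolutely_continuous_on_cong:
  assumes f: "absolutely_continuous_on S f" and eq: "\<And>s. s \<in> S \<Longrightarrow> f s = g s"
  shows "absolutely_continuous_on S g"
proof -
  have *: "(\<Sum>K\<in>\<D>. \<bar>f (Sup K) - f (Inf K)\<bar>) = (\<Sum>K\<in>\<D>. \<bar>g (Sup K) - g (Inf K)\<bar>)" if D: "\<D> division_of T" "T \<subseteq> S" for \<D> T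
  proof (rule sum.cong[OF refl])
    fix K assume K: "K \<in> \<D>"
    have "Inf K \<in> T" "Sup K \<in> T" using division_interval[OF D(1) K] by metis+
    then show "\<bar>f (Sup K) - f (Inf K)\<bar> = \<bar>g (Sup K) - g (Inf K)\<bar>" using eq D(2) by (simp add: subset_iff)
  qed
  show ?thesis
    unfolding absolutely_continuous_on_def
  proof (intro allI impI)
    fix \<epsilon> :: real assume "0 < \<epsilon>"
    with f obtain \<delta> where "0 < \<delta>" and d: "\<forall>\<D> T. \<D> division_of T \<and> T \<subseteq> S \<and> (\<Sum>K\<in>\<D>. Sup K - Inf K) < \<delta> \<longrightarrow>
        (\<Sum>K\<in>\<D>. \<bar>f (Sup K) - f (Inf K)\<bar>) < \<epsilon>"
      unfolding absolutely_continuous_on_def by blast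
    then show "\<exists>\<delta>>0. \<forall>\<D> T. \<D> division_of T \<and> T \<subseteq> S \<and> (\<Sum>K\<in>\<D>. Sup K - Inf K) < \<delta> \<longrightarrow>
        (\<Sum>K\<in>\<D>. \<bar>g (Sup K) - g (Inf K)\<bar>) < \<epsilon>"
      using * by (intro exI[of _ \<delta>]) auto
  qed
qed

section \<open>Quantum graphs\<close>

definition ends :: "('v, 'e) pre_digraph \<Rightarrow> ('e \<Rightarrow> real) \<Rightarrow> 'e point set" where
  "ends G l = (\<lambda>a. (a, 0)) ` arcs G \<union> (\<lambda>a. (a, l a)) ` arcs G"

lemma L2_iff: "f \<in> L2 G l \<longleftrightarrow> (\<forall>a\<in>arcs G. square_integrable (lebesgue_on {0..l a}) (\<lambda>s. f (a, s)))"
  by (auto simp: L2_def square_integrable_def)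

definition graph_ip :: "('v, 'e) pre_digraph \<Rightarrow> ('e \<Rightarrow> real) \<Rightarrow> ('e point \<Rightarrow> real) \<Rightarrow> ('e point \<Rightarrow> real) \<Rightarrow> real" where
  "graph_ip G l f g = graph_integral G l (\<lambda>y. f y * g y)"

lemma graph_semi_inner_space:
  fixes l :: "'e \<Rightarrow> real"
  shows "semi_inner_space (L2 G l) (graph_ip G l)"
proof
  show "(\<lambda>y. 0) \<in> L2 G l"
    unfolding L2_iff by (auto simp: square_integrable_def)
  show "(\<lambda>y. f y + g y) \<in> L2 G l" if "f \<in> L2 G l" "g \<in> L2 G l" for f g :: "'e point \<Rightarrow> real"
    using that unfolding L2_iff by (auto intro: square_integrable_add)
  show "(\<lambda>y. c * f y) \<in> L2 G l" if "f \<in> L2 G l" for f :: "'e point \<Rightarrow> real" and c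
    using that unfolding L2_iff by (auto intro: square_integrable_cmult)
  show "graph_ip G l f g = graph_ip G l g f" for f g
    by (simp add: graph_ip_def mult.commute)
  fix f h :: "'e point \<Rightarrow> real" assume f: "f \<in> L2 G l" and h: "h \<in> L2 G l"
  have fh: "integrable (lebesgue_on {0..l a}) (\<lambda>s. f (a, s) * h (a, s))" if "a \<in> arcs G" for a
    using f h that unfolding L2_iff by (intro square_integrable_mult_integrable) auto
  show "graph_ip G l (\<lambda>y. c * f y) h = c * graph_ip G l f h" for c
    unfolding graph_ip_def graph_integral_def sum_distrib_left
    by (intro sum.cong refl) (simp add: mult.assoc)
  show "0 \<le> graph_ip G l f f"
    unfolding graph_ip_def graph_integral_def by (intro sum_nonneg integral_nonneg_AE) auto
  fix g :: "'e point \<Rightarrow> real" assume g: "g \<in> L2 G l"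
  have gh: "integrable (lebesgue_on {0..l a}) (\<lambda>s. g (a, s) * h (a, s))" if "a \<in> arcs G" for a
    using g h that unfolding L2_iff by (intro square_integrable_mult_integrable) auto
  show "graph_ip G l (\<lambda>y. f y + g y) h = graph_ip G l f h + graph_ip G l g h"
    unfolding graph_ip_def graph_integral_def sum.distrib[symmetric]
    by (intro sum.cong refl) (simp add: distrib_right fh gh)
qed

text \<open>
  All vertex conditions at once: \<open>\<rho>\<close> acts on functions on the set of all ends of edges.
\<close>

locale quantum_graph =
  fixes G :: "('v, 'e) pre_digraph" and l :: "'e \<Rightarrow> real" and U :: "'e point \<Rightarrow> real"
    and \<rho> :: "'e point \<Rightarrow> 'e point \<Rightarrow> real"
  assumes finite_arcs: "finite (arcs G)"
    and l_pos: "a \<in> arcs G \<Longrightarrow> 0 < l a"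
    and U_L2: "U \<in> L2 G l"
    and \<rho>_sym: "p \<in> ends G l \<Longrightarrow> q \<in> ends G l \<Longrightarrow> \<rho> p q = \<rho> q p"
    and \<rho>_involution: "p \<in> ends G l \<Longrightarrow> r \<in> ends G l \<Longrightarrow> (\<Sum>q\<in>ends G l. \<rho> p q * \<rho> q r) = (if p = r then 1 else 0)"
begin

abbreviation "E \<equiv> arcs G"
abbreviation "X \<equiv> points G l"
abbreviation "Q \<equiv> ends G l"
abbreviation "H \<equiv> L2 G l"
abbreviation "ip \<equiv> graph_ip G l"

sublocale semi_inner_space H ip by (rule graph_semi_inner_space)

lemma finite_Q: "finite Q" using finite_arcs by (simp add: ends_def)

lemma Q_X: "p \<in> Q \<Longrightarrow> p \<in> X"
  using l_pos by (auto simp: ends_def points_def less_imp_le)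

lemma QE: assumes "p \<in> Q" obtains a where "a \<in> E" "p = (a, 0)" | a where "a \<in> E" "p = (a, l a)"
  using assms by (auto simp: ends_def)

lemma Q_memb: "a \<in> E \<Longrightarrow> (a, 0) \<in> Q" "a \<in> E \<Longrightarrow> (a, l a) \<in> Q"
  by (auto simp: ends_def)

lemma sum_Q: "(\<Sum>p\<in>Q. f p) = (\<Sum>a\<in>E. f (a, 0) + f (a, l a))" for f :: "'e point \<Rightarrow> real"
proof -
  have "(\<lambda>a. (a, 0)) ` E \<inter> (\<lambda>a. (a, l a)) ` E = {}" using l_pos by force
  then have "(\<Sum>p\<in>Q. f p) = (\<Sum>p\<in>(\<lambda>a. (a, 0)) ` E. f p) + (\<Sum>p\<in>(\<lambda>a. (a, l a)) ` E. f p)"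
    unfolding ends_def using finite_arcs by (intro sum.union_disjoint) auto
  also have "\<dots> = (\<Sum>a\<in>E. f (a, 0)) + (\<Sum>a\<in>E. f (a, l a))"
    by (simp add: sum.reindex inj_on_def)
  finally show ?thesis by (simp add: sum.distrib)
qed

definition vertex_condition :: "('e point \<Rightarrow> real) \<Rightarrow> ('e point \<Rightarrow> real) \<Rightarrow> bool" where
  "vertex_condition f d \<longleftrightarrow> (\<forall>p\<in>Q. f p = (\<Sum>q\<in>Q. \<rho> p q * f q) \<and> d p = - (\<Sum>q\<in>Q. \<rho> p q * d q))"

definition dom :: "('e point \<Rightarrow> real) set" where
  "dom = {f. f \<in> H \<and> C1_on_edges G l f \<and>
     (\<forall>a\<in>E. absolutely_continuous_on {0..l a} (\<lambda>s. edge_deriv l f (a, s))) \<and>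
     schroedinger l U f \<in> H \<and> vertex_condition f (outward_deriv l f)}"

definition solves :: "real \<Rightarrow> ('e point \<Rightarrow> real) \<Rightarrow> ('e point \<Rightarrow> real) \<Rightarrow> bool" where
  "solves c h f \<longleftrightarrow> f \<in> dom \<and> (\<forall>a\<in>E. negligible {s\<in>{0..l a}. schroedinger l U f (a, s) + c * f (a, s) \<noteq> h (a, s)})"

definition continuous_edges :: "('e point \<Rightarrow> real) \<Rightarrow> bool" where
  "continuous_edges f \<longleftrightarrow> (\<forall>a\<in>E. continuous_on {0..l a} (\<lambda>s. f (a, s)))"

definition K :: "('e point \<Rightarrow> real) set" where
  "K = {f. continuous_edges f \<and> (\<forall>p. p \<notin> X \<longrightarrow> f p = 0)}"

lemma continuous_edges_H: "continuous_edges f \<Longrightarrow> f \<in> H"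
  unfolding continuous_edges_def L2_iff by (auto intro: continuous_imp_square_integrable)

lemma L2_mult_continuous:
  assumes "g \<in> H" "continuous_edges f"
  shows "(\<lambda>p. g p * f p) \<in> H"
  unfolding L2_iff
proof
  fix a assume a: "a \<in> E"
  have c: "continuous_on {0..l a} (\<lambda>s. f (a, s))" using assms(2) a by (auto simp: continuous_edges_def)
  then have "bounded ((\<lambda>s. f (a, s)) ` {0..l a})" by (intro compact_imp_bounded compact_continuous_image) auto
  then obtain B where B: "\<forall>s\<in>{0..l a}. \<bar>f (a, s)\<bar> \<le> B" by (auto simp: bounded_iff)
  have "square_integrable (lebesgue_on {0..l a}) (\<lambda>s. f (a, s) * g (a, s))"
  proof (rule square_integrable_bounded_mult)
    show "square_integrable (lebesgue_on {0..l a}) (\<lambda>s. g (a, s))" using assms(1) a by (auto simp: L2_iff)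
    show "(\<lambda>s. f (a, s)) \<in> borel_measurable (lebesgue_on {0..l a})"
      by (intro continuous_imp_measurable_on_sets_lebesgue c) auto
    show "\<bar>f (a, s)\<bar> \<le> B" if "s \<in> space (lebesgue_on {0..l a})" for s using B that by simp
  qed
  then show "square_integrable (lebesgue_on {0..l a}) (\<lambda>s. g (a, s) * f (a, s))" by (simp add: mult.commute)
qed

lemma continuous_edges_bounded:
  assumes "continuous_edges f"
  obtains B where "0 \<le> B" "\<And>p. p \<in> X \<Longrightarrow> \<bar>f p\<bar> \<le> B"
proof -
  have "\<forall>a\<in>E. \<exists>B\<ge>0. \<forall>s\<in>{0..l a}. \<bar>f (a, s)\<bar> \<le> B"
  proof
    fix a assume a: "a \<in> E"
    have "bounded ((\<lambda>s. f (a, s)) ` {0..l a})"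
      using assms a by (intro compact_imp_bounded compact_continuous_image) (auto simp: continuous_edges_def)
    then obtain B where "\<forall>s\<in>{0..l a}. \<bar>f (a, s)\<bar> \<le> B" by (auto simp: bounded_iff)
    then show "\<exists>B\<ge>0. \<forall>s\<in>{0..l a}. \<bar>f (a, s)\<bar> \<le> B" by (intro exI[of _ "\<bar>B\<bar>"]) (auto intro: order_trans)
  qed
  from bchoice[OF this] obtain B where B: "\<forall>a\<in>E. 0 \<le> B a \<and> (\<forall>s\<in>{0..l a}. \<bar>f (a, s)\<bar> \<le> B a)" by blast
  show thesis
  proof (rule that[of "\<Sum>a\<in>E. B a"])
    show "0 \<le> (\<Sum>a\<in>E. B a)" using B by (intro sum_nonneg) auto
    fix p assume "p \<in> X"
    then obtain a s where p: "p = (a, s)" "a \<in> E" "s \<in> {0..l a}" by (auto simp: points_def)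
    have "\<bar>f p\<bar> \<le> B a" using B p by auto
    also have "\<dots> \<le> (\<Sum>a\<in>E. B a)" using B p finite_arcs by (intro member_le_sum) auto
    finally show "\<bar>f p\<bar> \<le> (\<Sum>a\<in>E. B a)" .
  qed
qed

lemma dom_edge:
  assumes f: "f \<in> dom" and a: "a \<in> E"
  shows "s \<in> {0..l a} \<Longrightarrow> ((\<lambda>s. f (a, s)) has_real_derivative edge_deriv l f (a, s)) (at s within {0..l a})"
    and "continuous_on {0..l a} (\<lambda>s. edge_deriv l f (a, s))"
    and "ac_primitive 0 (l a) (\<lambda>s. f (a, s)) (\<lambda>s. edge_deriv l f (a, s))"
    and "ac_primitive 0 (l a) (\<lambda>s. edge_deriv l f (a, s)) (\<lambda>s. - schroedinger l U f (a, s) - U (a, s) * f (a, s))"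
proof -
  show d: "((\<lambda>s. f (a, s)) has_real_derivative edge_deriv l f (a, s)) (at s within {0..l a})" if "s \<in> {0..l a}" for s
  proof -
    have "(\<lambda>r. f (a, r)) differentiable (at s within {0..l a})" using f a that by (auto simp: dom_def C1_on_edges_def)
    then show ?thesis by (simp add: edge_deriv_def has_real_derivative_iff_has_vector_derivative vector_derivative_works)
  qed
  show c: "continuous_on {0..l a} (\<lambda>s. edge_deriv l f (a, s))" using f a by (auto simp: dom_def C1_on_edges_def)
  show "ac_primitive 0 (l a) (\<lambda>s. f (a, s)) (\<lambda>s. edge_deriv l f (a, s))"
    by (rule C1_imp_ac_primitive[OF d c])
  have "ac_primitive 0 (l a) (\<lambda>s. edge_deriv l f (a, s)) (\<lambda>s. vector_derivative (\<lambda>s. edge_deriv l f (a, s)) (at s within {0..l a}))"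
    using f a by (intro absolutely_continuous_imp_ac_primitive) (auto simp: dom_def)
  then show "ac_primitive 0 (l a) (\<lambda>s. edge_deriv l f (a, s)) (\<lambda>s. - schroedinger l U f (a, s) - U (a, s) * f (a, s))"
    by (simp add: schroedinger_def edge_deriv_def[of l "edge_deriv l f"])
qed

lemma dom_continuous: "f \<in> dom \<Longrightarrow> continuous_edges f"
  unfolding continuous_edges_def using ac_primitive_continuous[OF dom_edge(3)] by blast

text \<open>
  For a function given with its first two derivatives along the edges, the domain reduces to the
  vertex condition.
\<close>

lemma domI:
  assumes der: "\<And>a s. a \<in> E \<Longrightarrow> s \<in> {0..l a} \<Longrightarrow> ((\<lambda>s. f (a, s)) has_real_derivative p (a, s)) (at s within {0..l a})"
    and ac: "\<And>a. a \<in> E \<Longrightarrow> ac_primitive 0 (l a) (\<lambda>s. p (a, s)) (\<lambda>s. g (a, s))"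
    and g: "g \<in> H"
    and vc: "vertex_condition f (\<lambda>q. if snd q = 0 then p q else - p q)"
  shows "f \<in> dom" "\<And>a. a \<in> E \<Longrightarrow> negligible {s\<in>{0..l a}. schroedinger l U f (a, s) \<noteq> - (g (a, s) + U (a, s) * f (a, s))}"
    "\<And>a s. a \<in> E \<Longrightarrow> s \<in> {0..l a} \<Longrightarrow> edge_deriv l f (a, s) = p (a, s)"
proof -
  show ed: "edge_deriv l f (a, s) = p (a, s)" if "a \<in> E" "s \<in> {0..l a}" for a s
    using der[OF that] l_pos[OF that(1)] that(2)
    by (simp add: edge_deriv_def has_real_derivative_iff_has_vector_derivative vector_derivative_within_cbox[of 0 "l a", unfolded cbox_interval])
  have cp: "continuous_on {0..l a} (\<lambda>s. p (a, s))" if "a \<in> E" for a by (rule ac_primitive_continuous[OF ac[OF that]])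
  have C1: "C1_on_edges G l f"
    unfolding C1_on_edges_def
  proof (intro ballI conjI)
    fix a s assume a: "a \<in> E" and s: "s \<in> {0..l a}"
    show "(\<lambda>r. f (a, r)) differentiable at s within {0..l a}"
      using der[OF a s] by (auto simp: differentiable_def has_field_derivative_def)
  next
    fix a assume a: "a \<in> E"
    show "continuous_on {0..l a} (\<lambda>s. edge_deriv l f (a, s))"
      by (subst continuous_on_cong[OF refl ed[OF a]]) (use cp[OF a] in auto)
  qed
  have AC: "absolutely_continuous_on {0..l a} (\<lambda>s. edge_deriv l f (a, s))" if a: "a \<in> E" for a
  proof -
    have "absolutely_continuous_on {0..l a} (\<lambda>s. p (a, s))" using ac[OF a] by (simp add: ac_primitive_def)
    then show ?thesis by (rule absolutely_continuous_on_cong) (use ed[OF a] in auto)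
  qed
  have cf: "continuous_edges f"
    unfolding continuous_edges_def by (intro ballI DERIV_continuous_on[OF der])
  have neg: "negligible {s\<in>{0..l a}. schroedinger l U f (a, s) \<noteq> - (g (a, s) + U (a, s) * f (a, s))}" if a: "a \<in> E" for a
  proof -
    obtain N where N: "negligible N" "\<forall>s\<in>{0..l a} - N. ((\<lambda>s. p (a, s)) has_real_derivative g (a, s)) (at s within {0..l a})"
      using ac[OF a] by (auto simp: ac_primitive_def)
    have "schroedinger l U f (a, s) = - (g (a, s) + U (a, s) * f (a, s))" if s: "s \<in> {0..l a}" "s \<notin> N" for s
    proof -
      have "((\<lambda>s. p (a, s)) has_real_derivative g (a, s)) (at s within {0..l a})" using N s by auto
      then have "((\<lambda>s. edge_deriv l f (a, s)) has_real_derivative g (a, s)) (at s within {0..l a})"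
        by (rule has_field_derivative_transform_within[where d=1]) (use ed[OF a] s in auto)
      then have "edge_deriv l (edge_deriv l f) (a, s) = g (a, s)"
        using l_pos[OF a] s(1)
        by (simp add: edge_deriv_def[of l "edge_deriv l f"] has_real_derivative_iff_has_vector_derivative vector_derivative_within_cbox[of 0 "l a", unfolded cbox_interval])
      then show ?thesis by (simp add: schroedinger_def)
    qed
    then show ?thesis by (intro negligible_subset[OF N(1)]) auto
  qed
  then show "\<And>a. a \<in> E \<Longrightarrow> negligible {s\<in>{0..l a}. schroedinger l U f (a, s) \<noteq> - (g (a, s) + U (a, s) * f (a, s))}" .
  have "schroedinger l U f \<in> H"
  proof -
    have H: "(\<lambda>q. -1 * (g q + U q * f q)) \<in> H"
      by (intro cmult_H add_H g L2_mult_continuous[OF U_L2 cf])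
    show ?thesis
      unfolding L2_iff
    proof
      fix a assume a: "a \<in> E"
      show "square_integrable (lebesgue_on {0..l a}) (\<lambda>s. schroedinger l U f (a, s))"
      proof (rule square_integrable_cong_ae)
        show "square_integrable (lebesgue_on {0..l a}) (\<lambda>s. -1 * (g (a, s) + U (a, s) * f (a, s)))" using H a unfolding L2_iff by auto
        show "negligible {s\<in>{0..l a}. -1 * (g (a, s) + U (a, s) * f (a, s)) \<noteq> schroedinger l U f (a, s)}"
          by (rule negligible_subset[OF neg[OF a]]) auto
      qed
    qed
  qed
  moreover have "vertex_condition f (outward_deriv l f)"
  proof -
    have o: "outward_deriv l f q = (if snd q = 0 then p q else - p q)" if "q \<in> Q" for q
      using Q_X[OF that] ed unfolding points_def outward_deriv_def by auto
    then have "(\<Sum>q\<in>Q. \<rho> r q * outward_deriv l f q) = (\<Sum>q\<in>Q. \<rho> r q * (if snd q = 0 then p q else - p q))" for r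
      by (intro sum.cong refl) simp
    then show ?thesis using vc o unfolding vertex_condition_def by metis
  qed
  ultimately show "f \<in> dom" unfolding dom_def using C1 AC continuous_edges_H[OF cf] by blast
qed

end

section \<open>The resolvent equation as a scattering fixed point\<close>

text \<open>
  Iterating \<open>B \<mapsto> B / 2 + c\<close> from any bound converges to \<open>2 * c\<close>. Applied to fixed points of a contraction, this
  is an a priori estimate.
\<close>

lemma halving_bound:
  assumes bdd: "\<And>i. \<bar>z i\<bar> \<le> B0" and half: "\<And>B. (\<And>i. \<bar>z i\<bar> \<le> B) \<Longrightarrow> (\<And>i. \<bar>z i\<bar> \<le> B / 2 + c)"
  shows "\<bar>z i\<bar> \<le> 2 * (c::real)"
proof -
  have *: "\<forall>i. \<bar>z i\<bar> \<le> 2 * c + (B0 - 2 * c) / 2 ^ n" for n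
  proof (induction n)
    case 0
    then show ?case using bdd by simp
  next
    case (Suc n)
    have eq: "(2 * c + (B0 - 2 * c) / 2 ^ n) / 2 + c = 2 * c + (B0 - 2 * c) / 2 ^ Suc n" by (simp add: field_simps)
    have "\<bar>z i\<bar> \<le> (2 * c + (B0 - 2 * c) / 2 ^ n) / 2 + c" for i using half[of "2 * c + (B0 - 2 * c) / 2 ^ n" i] Suc by blast
    then show ?case unfolding eq by blast
  qed
  have "(\<lambda>n. 2 * c + (B0 - 2 * c) / 2 ^ n) \<longlonglongrightarrow> 2 * c + (B0 - 2 * c) * 0"
    unfolding divide_inverse by (intro tendsto_intros LIMSEQ_inverse_realpow_zero) auto
  then have "(\<lambda>n. 2 * c + (B0 - 2 * c) / 2 ^ n) \<longlonglongrightarrow> 2 * c" by simp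
  then show ?thesis by (rule LIMSEQ_le_const) (use * in auto)
qed

lemma integral_abs_nonneg: "0 \<le> integral S (\<lambda>s. \<bar>g s :: real\<bar>)" for S :: "real set"
  by (cases "(\<lambda>s. \<bar>g s\<bar>) integrable_on S") (auto intro: Henstock_Kurzweil_Integration.integral_nonneg simp: not_integrable_integral)

context quantum_graph begin

text \<open>
  The \<open>L\<^sup>1\<close> norm on the graph.
\<close>

definition N :: "('e point \<Rightarrow> real) \<Rightarrow> real" where
  "N g = (\<Sum>a\<in>E. integral {0..l a} (\<lambda>s. \<bar>g (a, s)\<bar>))"

lemma H_edge: "g \<in> H \<Longrightarrow> a \<in> E \<Longrightarrow> square_integrable (lebesgue_on {0..l a}) (\<lambda>s. g (a, s))"
  by (simp add: L2_iff)

lemma H_abs_integrable: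
  assumes "g \<in> H" "a \<in> E"
  shows "(\<lambda>s. \<bar>g (a, s)\<bar>) integrable_on {0..l a}"
  using square_integrable_subinterval(1)[OF H_edge[OF assms], of 0 "l a"] by (simp add: absolutely_integrable_on_def)

lemma N_nonneg: "0 \<le> N g"
  unfolding N_def by (intro sum_nonneg integral_abs_nonneg)

lemma N_edge: "a \<in> E \<Longrightarrow> integral {0..l a} (\<lambda>s. \<bar>g (a, s)\<bar>) \<le> N g"
  unfolding N_def using finite_arcs by (intro member_le_sum integral_abs_nonneg) auto

lemma N_zero: "N (\<lambda>p. 0) = 0"
  by (simp add: N_def)

definition source :: "real \<Rightarrow> ('e point \<Rightarrow> real) \<Rightarrow> ('e point \<Rightarrow> real) \<Rightarrow> 'e point \<Rightarrow> real" where
  "source k h f = (\<lambda>p. (1 / k) * (h p + U p * f p))"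

lemma source_H: "h \<in> H \<Longrightarrow> continuous_edges f \<Longrightarrow> source k h f \<in> H"
  unfolding source_def by (intro cmult_H add_H L2_mult_continuous U_L2)

lemma N_source:
  assumes h: "h \<in> H" and f: "continuous_edges f" and B: "\<And>p. \<bar>f p\<bar> \<le> B" and k: "0 < k"
  shows "N (source k h f) \<le> (N h + N U * B) / k"
proof -
  have "N (source k h f) \<le> (\<Sum>a\<in>E. (1 / k) * (integral {0..l a} (\<lambda>s. \<bar>h (a, s)\<bar>) + B * integral {0..l a} (\<lambda>s. \<bar>U (a, s)\<bar>)))"
    unfolding N_def
  proof (rule sum_mono)
    fix a assume a: "a \<in> E"
    have i: "(\<lambda>s. \<bar>h (a, s)\<bar>) integrable_on {0..l a}" "(\<lambda>s. \<bar>U (a, s)\<bar>) integrable_on {0..l a}"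
      using H_abs_integrable[OF h a] H_abs_integrable[OF U_L2 a] .
    have iB: "(\<lambda>s. B * \<bar>U (a, s)\<bar>) integrable_on {0..l a}" using integrable_cmul[OF i(2), of B] by simp
    have ih: "(\<lambda>s. \<bar>h (a, s)\<bar> + B * \<bar>U (a, s)\<bar>) integrable_on {0..l a}"
      by (rule Henstock_Kurzweil_Integration.integrable_add[OF i(1) iB])
    have "integral {0..l a} (\<lambda>s. \<bar>source k h f (a, s)\<bar>) \<le> integral {0..l a} (\<lambda>s. (1 / k) * (\<bar>h (a, s)\<bar> + B * \<bar>U (a, s)\<bar>))"
    proof (rule integral_le)
      show "(\<lambda>s. \<bar>source k h f (a, s)\<bar>) integrable_on {0..l a}" by (rule H_abs_integrable[OF source_H[OF h f] a])
      show "(\<lambda>s. (1 / k) * (\<bar>h (a, s)\<bar> + B * \<bar>U (a, s)\<bar>)) integrable_on {0..l a}"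
        using integrable_cmul[OF ih, of "1 / k"] by simp
      fix s
      have "\<bar>h (a, s) + U (a, s) * f (a, s)\<bar> \<le> \<bar>h (a, s)\<bar> + \<bar>U (a, s)\<bar> * \<bar>f (a, s)\<bar>" by (metis abs_triangle_ineq abs_mult)
      also have "\<dots> \<le> \<bar>h (a, s)\<bar> + \<bar>U (a, s)\<bar> * B" by (intro add_left_mono mult_left_mono B) auto
      finally show "\<bar>source k h f (a, s)\<bar> \<le> (1 / k) * (\<bar>h (a, s)\<bar> + B * \<bar>U (a, s)\<bar>)"
        using k by (simp add: source_def abs_mult divide_right_mono mult.commute)
    qed
    also have "\<dots> = (1 / k) * integral {0..l a} (\<lambda>s. \<bar>h (a, s)\<bar> + B * \<bar>U (a, s)\<bar>)" by simp
    also have "\<dots> = (1 / k) * (integral {0..l a} (\<lambda>s. \<bar>h (a, s)\<bar>) + B * integral {0..l a} (\<lambda>s. \<bar>U (a, s)\<bar>))"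
      unfolding Henstock_Kurzweil_Integration.integral_add[OF i(1) iB] by simp
    finally show "integral {0..l a} (\<lambda>s. \<bar>source k h f (a, s)\<bar>) \<le> (1 / k) * (integral {0..l a} (\<lambda>s. \<bar>h (a, s)\<bar>) + B * integral {0..l a} (\<lambda>s. \<bar>U (a, s)\<bar>))" .
  qed
  also have "\<dots> = (N h + N U * B) / k"
    unfolding sum_distrib_left[symmetric] sum.distrib N_def by (simp add: mult.commute)
  finally show ?thesis .
qed

text \<open>
  The wave \<open>u = f + f'/k\<close>, which moves towards the end at 0. It starts at \<open>l a\<close> with the amplitude
  \<open>\<alpha>\<close> leaving the vertex there.
\<close>

definition toward :: "real \<Rightarrow> ('e point \<Rightarrow> real) \<Rightarrow> ('e point \<Rightarrow> real) \<Rightarrow> 'e point \<Rightarrow> real" where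
  "toward k g \<alpha> = (\<lambda>(a, s). exp (- k * (l a - s)) * \<alpha> (a, l a) + transport_back (l a) k (\<lambda>y. g (a, y)) s)"

text \<open>
  The wave \<open>v = f - f'/k\<close>, which moves away from the end at 0, where it starts with the amplitude \<open>\<alpha>\<close>.
\<close>

definition away :: "real \<Rightarrow> ('e point \<Rightarrow> real) \<Rightarrow> ('e point \<Rightarrow> real) \<Rightarrow> 'e point \<Rightarrow> real" where
  "away k g \<alpha> = (\<lambda>(a, s). exp (- k * s) * \<alpha> (a, 0) + transport (- k) (\<lambda>y. g (a, y)) s)"

text \<open>
  What arrives at an end is the wave that was emitted at the opposite end.
\<close>

definition incoming :: "real \<Rightarrow> ('e point \<Rightarrow> real) \<Rightarrow> ('e point \<Rightarrow> real) \<Rightarrow> 'e point \<Rightarrow> real" where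
  "incoming k g \<alpha> p = (if snd p = 0 then toward k g \<alpha> p else away k g \<alpha> p)"

definition scatter :: "real \<Rightarrow> ('e point \<Rightarrow> real) \<Rightarrow> ('e point \<Rightarrow> real) \<Rightarrow> 'e point \<Rightarrow> real" where
  "scatter k g \<alpha> p = (\<Sum>q\<in>Q. \<rho> p q * incoming k g \<alpha> q)"

lemma XE: assumes "p \<in> X" obtains a s where "p = (a, s)" "a \<in> E" "s \<in> {0..l a}"
  using assms by (auto simp: points_def)

lemma toward_diff:
  assumes "g \<in> H" "g' \<in> H" "p \<in> X"
  shows "toward k (\<lambda>p. g p - g' p) (\<lambda>p. \<alpha> p - \<alpha>' p) p = toward k g \<alpha> p - toward k g' \<alpha>' p"
proof -
  obtain a s where p: "p = (a, s)" "a \<in> E" "s \<in> {0..l a}" using assms(3) by (rule XE)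
  show ?thesis
    using transport_back_add[OF H_edge[OF assms(1) p(2)] square_integrable_cmult[OF H_edge[OF assms(2) p(2)], of "-1"] p(3), of k]
    by (simp add: toward_def p transport_back_cmult[of _ _ "-1", simplified] right_diff_distrib)
qed

lemma away_diff:
  assumes "g \<in> H" "g' \<in> H" "p \<in> X"
  shows "away k (\<lambda>p. g p - g' p) (\<lambda>p. \<alpha> p - \<alpha>' p) p = away k g \<alpha> p - away k g' \<alpha>' p"
proof -
  obtain a s where p: "p = (a, s)" "a \<in> E" "s \<in> {0..l a}" using assms(3) by (rule XE)
  show ?thesis
    using transport_add[OF H_edge[OF assms(1) p(2)] square_integrable_cmult[OF H_edge[OF assms(2) p(2)], of "-1"] p(3), of "-k"]
    by (simp add: away_def p transport_cmult[of _ "-1", simplified] right_diff_distrib)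
qed

lemma scatter_diff:
  assumes "g \<in> H" "g' \<in> H"
  shows "scatter k (\<lambda>p. g p - g' p) (\<lambda>p. \<alpha> p - \<alpha>' p) p = scatter k g \<alpha> p - scatter k g' \<alpha>' p"
  unfolding scatter_def sum_subtractf[symmetric]
  by (intro sum.cong refl) (simp add: incoming_def toward_diff[OF assms Q_X] away_diff[OF assms Q_X] right_diff_distrib)

definition w0 :: real where "w0 = (\<Sum>a\<in>E. 1 / l a)"

definition M :: real where "M = (\<Sum>p\<in>Q. \<Sum>q\<in>Q. \<bar>\<rho> p q\<bar>)"

lemma w0_nonneg: "0 \<le> w0" unfolding w0_def using l_pos by (intro sum_nonneg) (simp add: less_imp_le)

lemma M_nonneg: "0 \<le> M" unfolding M_def by (intro sum_nonneg) auto

lemma exp_edge_le: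
  assumes "a \<in> E" "0 < k"
  shows "exp (- k * l a) \<le> w0 / k"
proof -
  have la: "0 < l a" using l_pos assms by blast
  have "k * l a \<le> exp (k * l a)" using exp_ge_add_one_self[of "k * l a"] by linarith
  then have "exp (- k * l a) \<le> 1 / (k * l a)" using la assms(2) by (simp add: exp_minus field_simps)
  also have "\<dots> = (1 / l a) / k" by simp
  also have "1 / l a \<le> w0" unfolding w0_def
    using assms(1) finite_arcs l_pos by (intro member_le_sum) (auto simp: less_imp_le)
  finally show ?thesis using assms(2) by (simp add: divide_right_mono)
qed

text \<open>
  The gain over the trivial bound lies in the last claim: a wave that has crossed the whole edge has been
  damped by \<open>exp (- k * l a)\<close>, which is at most \<open>w0 / k\<close>.
\<close>

lemma toward_away_bound:
  assumes g: "g \<in> H" and \<alpha>: "\<And>q. q \<in> Q \<Longrightarrow> \<bar>\<alpha> q\<bar> \<le> B" and k: "0 < k" and p: "p \<in> X"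
  shows "\<bar>toward k g \<alpha> p\<bar> \<le> B + N g" "\<bar>away k g \<alpha> p\<bar> \<le> B + N g"
    "p \<in> Q \<Longrightarrow> \<bar>incoming k g \<alpha> p\<bar> \<le> w0 / k * B + N g"
proof -
  obtain a s where as: "p = (a, s)" "a \<in> E" "s \<in> {0..l a}" using p by (rule XE)
  have B: "\<bar>\<alpha> (a, 0)\<bar> \<le> B" "\<bar>\<alpha> (a, l a)\<bar> \<le> B" using \<alpha> Q_memb as(2) by blast+
  then have B0: "0 \<le> B" by linarith
  have tb: "\<bar>transport (- k) (\<lambda>y. g (a, y)) r\<bar> \<le> N g" "\<bar>transport_back (l a) k (\<lambda>y. g (a, y)) r\<bar> \<le> N g" if "r \<in> {0..l a}" for r
    using transport_bounds[OF H_edge[OF g as(2)] that, of k] k N_edge[OF as(2), of g] by linarith+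
  have ex: "\<bar>exp (- k * r) * \<alpha> q\<bar> \<le> B" if "0 \<le> r" "\<bar>\<alpha> q\<bar> \<le> B" for r q
  proof -
    have "exp (- k * r) * \<bar>\<alpha> q\<bar> \<le> 1 * B" using that k by (intro mult_mono) auto
    then show ?thesis by (simp add: abs_mult)
  qed
  have ex2: "\<bar>exp (- k * l a) * \<alpha> q\<bar> \<le> w0 / k * B" if "\<bar>\<alpha> q\<bar> \<le> B" for q
  proof -
    have "exp (- k * l a) * \<bar>\<alpha> q\<bar> \<le> w0 / k * B" using that k w0_nonneg exp_edge_le[OF as(2) k] by (intro mult_mono) auto
    then show ?thesis by (simp add: abs_mult)
  qed
  show "\<bar>toward k g \<alpha> p\<bar> \<le> B + N g"
    using ex[of "l a - s", OF _ B(2)] tb(2)[OF as(3)] as by (simp add: toward_def)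
  show "\<bar>away k g \<alpha> p\<bar> \<le> B + N g"
    using ex[of s, OF _ B(1)] tb(1)[OF as(3)] as by (simp add: away_def)
  show "\<bar>incoming k g \<alpha> p\<bar> \<le> w0 / k * B + N g" if "p \<in> Q"
  proof -
    have "s = 0 \<or> s = l a" using that as(1) by (auto simp: ends_def)
    moreover have "\<bar>toward k g \<alpha> (a, 0)\<bar> \<le> w0 / k * B + N g"
      using ex2[OF B(2)] tb(2)[of 0] l_pos[OF as(2)] by (simp add: toward_def)
    moreover have "\<bar>away k g \<alpha> (a, l a)\<bar> \<le> w0 / k * B + N g"
      using ex2[OF B(1)] tb(1)[of "l a"] l_pos[OF as(2)] by (simp add: away_def)
    ultimately show ?thesis using l_pos[OF as(2)] as(1) by (auto simp: incoming_def)
  qed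
qed

lemma scatter_bound:
  assumes g: "g \<in> H" and \<alpha>: "\<And>q. q \<in> Q \<Longrightarrow> \<bar>\<alpha> q\<bar> \<le> B" and k: "0 < k" and p: "p \<in> Q"
  shows "\<bar>scatter k g \<alpha> p\<bar> \<le> M * (w0 / k * B + N g)"
proof -
  have in_le: "\<bar>incoming k g \<alpha> q\<bar> \<le> w0 / k * B + N g" if "q \<in> Q" for q
    by (rule toward_away_bound(3)[OF g \<alpha> k Q_X[OF that] that])
  have nn: "0 \<le> w0 / k * B + N g" using in_le[OF p] by linarith
  have "\<bar>scatter k g \<alpha> p\<bar> \<le> (\<Sum>q\<in>Q. \<bar>\<rho> p q\<bar> * (w0 / k * B + N g))"
    unfolding scatter_def
  proof (rule order_trans[OF sum_abs sum_mono])
    fix q assume "q \<in> Q"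
    from mult_left_mono[OF in_le[OF this] abs_ge_zero[of "\<rho> p q"]]
    show "\<bar>\<rho> p q * incoming k g \<alpha> q\<bar> \<le> \<bar>\<rho> p q\<bar> * (w0 / k * B + N g)" unfolding abs_mult .
  qed
  also have "\<dots> = (\<Sum>q\<in>Q. \<bar>\<rho> p q\<bar>) * (w0 / k * B + N g)" by (simp add: sum_distrib_right)
  also have "(\<Sum>q\<in>Q. \<bar>\<rho> p q\<bar>) \<le> M" unfolding M_def
    using member_le_sum[of p Q "\<lambda>p. \<Sum>q\<in>Q. \<bar>\<rho> p q\<bar>"] p finite_Q by (auto intro: sum_nonneg)
  finally show ?thesis using nn by (meson mult_right_mono order_trans)
qed

text \<open>
  The unknown \<open>z\<close> combines the function, at the index \<open>True\<close>, with the amplitudes leaving the vertices, at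
  the index \<open>False\<close>. The new function is built from the new amplitudes, so that it is bounded by the
  damped quantities alone.
\<close>

definition step :: "real \<Rightarrow> ('e point \<Rightarrow> real) \<Rightarrow> (bool \<times> 'e point \<Rightarrow> real) \<Rightarrow> bool \<times> 'e point \<Rightarrow> real" where
  "step k h z = (let g = source k h (\<lambda>p. z (True, p)); \<beta> = scatter k g (\<lambda>p. z (False, p)) in
     (\<lambda>(b, p). if b then (if p \<in> X then (toward k g \<beta> p + away k g \<beta> p) / 2 else 0)
       else (if p \<in> Q then \<beta> p else 0)))"

lemma step_simps:
  "step k h z (True, p) = (if p \<in> X then
     (toward k (source k h (\<lambda>p. z (True, p))) (scatter k (source k h (\<lambda>p. z (True, p))) (\<lambda>p. z (False, p))) p +
      away k (source k h (\<lambda>p. z (True, p))) (scatter k (source k h (\<lambda>p. z (True, p))) (\<lambda>p. z (False, p))) p) / 2 else 0)"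
  "step k h z (False, p) = (if p \<in> Q then scatter k (source k h (\<lambda>p. z (True, p))) (\<lambda>p. z (False, p)) p else 0)"
  by (simp_all add: step_def Let_def)

definition k0 :: real where "k0 = 2 * (M + 1) * (w0 + N U) + 1"

lemma k0_ge_1: "1 \<le> k0"
  using M_nonneg w0_nonneg N_nonneg[of U] by (simp add: k0_def)

text \<open>
  All terms that depend on \<open>z\<close> carry a factor \<open>1/k\<close>: the amplitudes through the damping and the function
  through the source \<open>(h + U f)/k\<close>. The choice of \<open>k0\<close> makes the total factor at most 1/2.
\<close>

lemma step_bound:
  assumes h: "h \<in> H" and z: "continuous_edges (\<lambda>p. z (True, p))" and B: "\<And>i. \<bar>z i\<bar> \<le> B" and k: "k0 \<le> k"
  shows "\<bar>step k h z i\<bar> \<le> B / 2 + (M + 1) * N h / k"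
proof -
  define g where "g = source k h (\<lambda>p. z (True, p))"
  define \<beta> where "\<beta> = scatter k g (\<lambda>p. z (False, p))"
  have k1: "0 < k" using k k0_ge_1 by linarith
  have B0: "0 \<le> B" using B[of undefined] by linarith
  have gH: "g \<in> H" unfolding g_def by (rule source_H[OF h z])
  have Ng: "N g \<le> (N h + N U * B) / k" unfolding g_def by (rule N_source[OF h z B k1])
  define D where "D = w0 / k * B + N g"
  have D0: "0 \<le> D" unfolding D_def using w0_nonneg B0 k1 N_nonneg[of g] by simp
  have \<beta>: "\<bar>\<beta> q\<bar> \<le> M * D" if "q \<in> Q" for q
    unfolding \<beta>_def D_def by (rule scatter_bound[OF gH B k1 that])
  have MD: "M * D + N g \<le> (M + 1) * D" using w0_nonneg B0 k1 by (simp add: D_def distrib_right)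
  have "\<bar>step k h z i\<bar> \<le> (M + 1) * D"
  proof -
    obtain b p where i: "i = (b, p)" by (cases i) blast
    have "\<bar>(toward k g \<beta> p + away k g \<beta> p) / 2\<bar> \<le> (M + 1) * D" if p: "p \<in> X"
      using toward_away_bound(1)[where \<alpha>=\<beta> and B="M * D", OF gH \<beta> k1 p] toward_away_bound(2)[where \<alpha>=\<beta> and B="M * D", OF gH \<beta> k1 p] MD
      by simp
    moreover have "\<bar>\<beta> p\<bar> \<le> (M + 1) * D" if "p \<in> Q" using \<beta>[OF that] D0 by (simp add: distrib_right)
    moreover have "0 \<le> (M + 1) * D" using D0 M_nonneg by simp
    ultimately show ?thesis unfolding i
      by (cases b) (simp_all add: step_simps g_def[symmetric] \<beta>_def[symmetric])
  qed
  also have "(M + 1) * D \<le> (M + 1) * ((w0 + N U) * B / k + N h / k)"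
  proof (rule mult_left_mono)
    show "D \<le> (w0 + N U) * B / k + N h / k" using Ng by (simp add: D_def field_simps add_divide_distrib)
  qed (use M_nonneg in simp)
  also have "\<dots> = ((M + 1) * (w0 + N U) / k) * B + (M + 1) * N h / k" by (simp add: field_simps)
  also have "\<dots> \<le> (1 / 2) * B + (M + 1) * N h / k"
  proof (rule add_right_mono[OF mult_right_mono[OF _ B0]])
    show "(M + 1) * (w0 + N U) / k \<le> 1 / 2" using k k1 by (simp add: k0_def field_simps)
  qed
  finally show ?thesis by simp
qed

lemma continuous_edges_diff: "continuous_edges f \<Longrightarrow> continuous_edges g \<Longrightarrow> continuous_edges (\<lambda>p. f p - g p)"
  unfolding continuous_edges_def by (auto intro: continuous_on_diff)

text \<open>
  The map is affine, so its contraction property is \<open>step_bound\<close> for a vanishing right hand side.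
\<close>

lemma step_diff:
  assumes h: "h \<in> H" "h' \<in> H" and z: "continuous_edges (\<lambda>p. z (True, p))" "continuous_edges (\<lambda>p. z' (True, p))"
  shows "step k (\<lambda>p. h p - h' p) (\<lambda>i. z i - z' i) i = step k h z i - step k h' z' i"
proof -
  obtain b p where i: "i = (b, p)" by (cases i) blast
  define g where "g = source k h (\<lambda>p. z (True, p))"
  define g' where "g' = source k h' (\<lambda>p. z' (True, p))"
  have H: "g \<in> H" "g' \<in> H" unfolding g_def g'_def using source_H h z by blast+
  have s: "source k (\<lambda>p. h p - h' p) (\<lambda>p. z (True, p) - z' (True, p)) = (\<lambda>p. g p - g' p)"
    by (simp add: source_def g_def g'_def fun_eq_iff diff_divide_distrib add_divide_distrib right_diff_distrib)
  have sc: "scatter k (\<lambda>p. g p - g' p) (\<lambda>p. z (False, p) - z' (False, p)) = (\<lambda>p. scatter k g (\<lambda>p. z (False, p)) p - scatter k g' (\<lambda>p. z' (False, p)) p)"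
    using scatter_diff[OF H] by (simp add: fun_eq_iff)
  show ?thesis unfolding i
    by (cases b) (simp_all add: step_simps s sc toward_diff[OF H] away_diff[OF H] g_def[symmetric] g'_def[symmetric] diff_divide_distrib add_divide_distrib)
qed

lemma toward_ac_primitive:
  assumes g: "g \<in> H" and a: "a \<in> E"
  shows "ac_primitive 0 (l a) (\<lambda>s. toward k g \<alpha> (a, s)) (\<lambda>s. k * toward k g \<alpha> (a, s) - g (a, s))"
proof -
  have "ac_primitive 0 (l a) (\<lambda>s. (exp (- k * l a) * \<alpha> (a, l a)) * exp (k * s) + transport_back (l a) k (\<lambda>y. g (a, y)) s)
     (\<lambda>s. (exp (- k * l a) * \<alpha> (a, l a)) * (k * exp (k * s)) + (k * transport_back (l a) k (\<lambda>y. g (a, y)) s - g (a, s)))"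
    by (intro ac_primitive_add ac_primitive_cmult exp_ac_primitive transport_back_ac_primitive H_edge[OF g a])
  moreover have "exp (- k * (l a - s)) = exp (- k * l a) * exp (k * s)" for s
    by (simp add: exp_add[symmetric] algebra_simps)
  then have t: "toward k g \<alpha> (a, s) = (exp (- k * l a) * \<alpha> (a, l a)) * exp (k * s) + transport_back (l a) k (\<lambda>y. g (a, y)) s" for s
    unfolding toward_def prod.case by (simp only: mult_ac)
  have "(exp (- k * l a) * \<alpha> (a, l a)) * (k * exp (k * s)) + (k * transport_back (l a) k (\<lambda>y. g (a, y)) s - g (a, s)) = k * toward k g \<alpha> (a, s) - g (a, s)" for s
    unfolding t by (simp add: distrib_left mult_ac)
  ultimately show ?thesis unfolding t by (simp only:)
qed

lemma away_ac_primitive: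
  assumes g: "g \<in> H" and a: "a \<in> E"
  shows "ac_primitive 0 (l a) (\<lambda>s. away k g \<alpha> (a, s)) (\<lambda>s. - k * away k g \<alpha> (a, s) + g (a, s))"
proof -
  have "ac_primitive 0 (l a) (\<lambda>s. \<alpha> (a, 0) * exp (- k * s) + transport (- k) (\<lambda>y. g (a, y)) s)
     (\<lambda>s. \<alpha> (a, 0) * (- k * exp (- k * s)) + (- k * transport (- k) (\<lambda>y. g (a, y)) s + g (a, s)))"
    by (intro ac_primitive_add ac_primitive_cmult exp_ac_primitive transport_ac_primitive H_edge[OF g a])
  moreover have "(\<lambda>s. \<alpha> (a, 0) * exp (- k * s) + transport (- k) (\<lambda>y. g (a, y)) s) = (\<lambda>s. away k g \<alpha> (a, s))"
    "(\<lambda>s. \<alpha> (a, 0) * (- k * exp (- k * s)) + (- k * transport (- k) (\<lambda>y. g (a, y)) s + g (a, s))) = (\<lambda>s. - k * away k g \<alpha> (a, s) + g (a, s))"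
    unfolding away_def by (auto simp: fun_eq_iff distrib_left mult_ac)
  ultimately show ?thesis by simp
qed

lemma toward_end: "toward k g \<alpha> (a, l a) = \<alpha> (a, l a)"
  by (simp add: toward_def transport_back_def)

lemma away_end: "away k g \<alpha> (a, 0) = \<alpha> (a, 0)"
  by (simp add: away_def transport_def)

end

context quantum_graph begin

lemma continuous_edges_limit:
  assumes fs: "\<And>n::nat. continuous_edges (fs n)" and lim: "\<And>e. 0 < e \<Longrightarrow> \<exists>N. \<forall>n\<ge>N. \<forall>p. \<bar>fs n p - g p\<bar> \<le> e"
  shows "continuous_edges g"
  unfolding continuous_edges_def
proof
  fix a assume a: "a \<in> E"
  show "continuous_on {0..l a} (\<lambda>s. g (a, s))"
  proof (rule uniform_limit_theorem[of _ "\<lambda>n s. fs n (a, s)" sequentially])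
    show "\<forall>\<^sub>F n in sequentially. continuous_on {0..l a} (\<lambda>s. fs n (a, s))"
      using fs a by (simp add: continuous_edges_def)
    show "uniform_limit {0..l a} (\<lambda>n s. fs n (a, s)) (\<lambda>s. g (a, s)) sequentially"
    proof (rule uniform_limitI)
      fix e :: real assume "0 < e"
      then obtain N where N: "\<forall>n\<ge>N. \<forall>p. \<bar>fs n p - g p\<bar> \<le> e / 2" using lim[of "e / 2"] by auto
      show "\<forall>\<^sub>F n in sequentially. \<forall>s\<in>{0..l a}. dist (fs n (a, s)) (g (a, s)) < e"
        unfolding eventually_sequentially
      proof (intro exI[of _ N] allI impI ballI)
        fix n s assume "N \<le> n"
        then have "\<bar>fs n (a, s) - g (a, s)\<bar> \<le> e / 2" using N by blast
        then show "dist (fs n (a, s)) (g (a, s)) < e" using \<open>0 < e\<close> by (simp add: dist_real_def)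
      qed
    qed
  qed simp
qed

lemma toward_away_cong:
  assumes "\<And>q. q \<in> Q \<Longrightarrow> \<alpha> q = \<beta> q" "p \<in> X"
  shows "toward k g \<alpha> p = toward k g \<beta> p" "away k g \<alpha> p = away k g \<beta> p"
proof -
  obtain a s where p: "p = (a, s)" "a \<in> E" "s \<in> {0..l a}" using assms(2) by (rule XE)
  show "toward k g \<alpha> p = toward k g \<beta> p" "away k g \<alpha> p = away k g \<beta> p"
    using assms(1) Q_memb[OF p(2)] by (simp_all add: p(1) toward_def away_def)
qed

text \<open>
  The amplitude leaving the vertex at an end is \<open>f - f'/k\<close> with the outward derivative. The cut-off
  outside of the graph makes the family bounded.
\<close>

definition amplitudes :: "real \<Rightarrow> ('e point \<Rightarrow> real) \<Rightarrow> bool \<times> 'e point \<Rightarrow> real" where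
  "amplitudes k f = (\<lambda>(b, p). if b then (if p \<in> X then f p else 0)
     else (if p \<in> Q then f p - outward_deriv l f p / k else 0))"

text \<open>
  The equations for \<open>f \<plusminus> f'/k\<close> hold almost everywhere and determine these functions by
  \<open>transport_unique\<close> and \<open>transport_back_unique\<close>. The vertex conditions \<open>\<rho> f = f\<close> and \<open>\<rho> f' = - f'\<close>
  turn \<open>f + f'/k\<close>, the arriving amplitude, into \<open>f - f'/k\<close>.
\<close>

lemma solution_fixed_point:
  assumes h: "h \<in> H" and f: "solves (k\<^sup>2) h f" and k: "0 < k"
  shows "step k h (amplitudes k f) = amplitudes k f"
    and "continuous_edges (\<lambda>p. amplitudes k f (True, p))"
    and "\<exists>B. \<forall>i. \<bar>amplitudes k f i\<bar> \<le> B"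
    and "p \<in> X \<Longrightarrow> edge_deriv l f p = k * (toward k (source k h (\<lambda>p. amplitudes k f (True, p))) (\<lambda>p. amplitudes k f (False, p)) p
            - away k (source k h (\<lambda>p. amplitudes k f (True, p))) (\<lambda>p. amplitudes k f (False, p)) p) / 2"
proof -
  define z where "z = amplitudes k f"
  define g where "g = source k h (\<lambda>p. z (True, p))"
  define \<alpha> where "\<alpha> = (\<lambda>p. z (False, p))"
  have dom: "f \<in> dom" using f by (simp add: solves_def)
  have zT: "z (True, p) = f p" if "p \<in> X" for p using that by (simp add: z_def amplitudes_def)
  have zE: "z (True, (a, s)) = f (a, s)" if "a \<in> E" "s \<in> {0..l a}" for a s using that by (intro zT) (simp add: points_def)
  have cont: "continuous_edges (\<lambda>p. z (True, p))"
    unfolding continuous_edges_def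
  proof
    fix a assume a: "a \<in> E"
    have "continuous_on {0..l a} (\<lambda>s. f (a, s))" using dom_continuous[OF dom] a by (simp add: continuous_edges_def)
    then show "continuous_on {0..l a} (\<lambda>s. z (True, (a, s)))" by (rule continuous_on_eq) (simp add: zE[OF a])
  qed
  have gH: "g \<in> H" unfolding g_def by (rule source_H[OF h cont])
  have key: "toward k g \<alpha> p = f p + edge_deriv l f p / k \<and> away k g \<alpha> p = f p - edge_deriv l f p / k" if "p \<in> X" for p
  proof -
    obtain a s where p: "p = (a, s)" "a \<in> E" "s \<in> {0..l a}" using \<open>p \<in> X\<close> by (rule XE)
    have la: "0 < l a" using l_pos p(2) by blast
    note F = dom_edge(3)[OF dom p(2)] dom_edge(4)[OF dom p(2)]
    have eq: "negligible {s\<in>{0..l a}. schroedinger l U f (a, s) + k\<^sup>2 * f (a, s) \<noteq> h (a, s)}"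
      using f p(2) by (simp add: solves_def)
    have "f (a, s) + (1 / k) * edge_deriv l f (a, s) = exp (- k * (l a - s)) * (f (a, l a) + (1 / k) * edge_deriv l f (a, l a)) + transport_back (l a) k (\<lambda>y. g (a, y)) s"
    proof (rule transport_back_unique[OF ac_primitive_add[OF F(1) ac_primitive_cmult[OF F(2), of "1 / k"]] _ H_edge[OF gH p(2)] p(3)])
      show "negligible {s\<in>{0..l a}. edge_deriv l f (a, s) + (1 / k) * (- schroedinger l U f (a, s) - U (a, s) * f (a, s)) \<noteq>
          k * (f (a, s) + (1 / k) * edge_deriv l f (a, s)) - g (a, s)}"
      proof (rule negligible_subset[OF eq], clarify)
        fix s assume s: "s \<in> {0..l a}" and ne: "edge_deriv l f (a, s) + (1 / k) * (- schroedinger l U f (a, s) - U (a, s) * f (a, s)) \<noteq>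
          k * (f (a, s) + (1 / k) * edge_deriv l f (a, s)) - g (a, s)" and e: "schroedinger l U f (a, s) + k\<^sup>2 * f (a, s) = h (a, s)"
        have "g (a, s) = (1 / k) * (h (a, s) + U (a, s) * f (a, s))" using zE[OF p(2) s] by (simp add: g_def source_def)
        with ne show False using k unfolding e[symmetric] by (simp add: field_simps power2_eq_square)
      qed
    qed
    moreover have "\<alpha> (a, l a) = f (a, l a) + (1 / k) * edge_deriv l f (a, l a)"
      using la Q_memb[OF p(2)] by (simp add: \<alpha>_def z_def amplitudes_def outward_deriv_def)
    ultimately have 1: "toward k g \<alpha> p = f p + edge_deriv l f p / k" by (simp add: p(1) toward_def)
    have "f (a, s) + (- 1 / k) * edge_deriv l f (a, s) = exp (- k * s) * (f (a, 0) + (- 1 / k) * edge_deriv l f (a, 0)) + transport (- k) (\<lambda>y. g (a, y)) s"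
    proof (rule transport_unique[OF ac_primitive_add[OF F(1) ac_primitive_cmult[OF F(2), of "- 1 / k"]] _ H_edge[OF gH p(2)] p(3)])
      show "negligible {s\<in>{0..l a}. edge_deriv l f (a, s) + (- 1 / k) * (- schroedinger l U f (a, s) - U (a, s) * f (a, s)) \<noteq>
          - k * (f (a, s) + (- 1 / k) * edge_deriv l f (a, s)) + g (a, s)}"
      proof (rule negligible_subset[OF eq], clarify)
        fix s assume s: "s \<in> {0..l a}" and ne: "edge_deriv l f (a, s) + (- 1 / k) * (- schroedinger l U f (a, s) - U (a, s) * f (a, s)) \<noteq>
          - k * (f (a, s) + (- 1 / k) * edge_deriv l f (a, s)) + g (a, s)" and e: "schroedinger l U f (a, s) + k\<^sup>2 * f (a, s) = h (a, s)"
        have "g (a, s) = (1 / k) * (h (a, s) + U (a, s) * f (a, s))" using zE[OF p(2) s] by (simp add: g_def source_def)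
        with ne show False using k unfolding e[symmetric] by (simp add: field_simps power2_eq_square)
      qed
    qed
    moreover have "\<alpha> (a, 0) = f (a, 0) + (- 1 / k) * edge_deriv l f (a, 0)"
      using la Q_memb[OF p(2)] by (simp add: \<alpha>_def z_def amplitudes_def outward_deriv_def)
    ultimately have 2: "away k g \<alpha> p = f p - edge_deriv l f p / k" by (simp add: p(1) away_def)
    show ?thesis using 1 2 by blast
  qed
  have inc: "incoming k g \<alpha> p = f p + outward_deriv l f p / k" if "p \<in> Q" for p
    using key[OF Q_X[OF that]] by (simp add: incoming_def outward_deriv_def)
  have vc: "f p = (\<Sum>q\<in>Q. \<rho> p q * f q) \<and> outward_deriv l f p = - (\<Sum>q\<in>Q. \<rho> p q * outward_deriv l f q)" if "p \<in> Q" for p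
    using dom that unfolding dom_def vertex_condition_def by blast
  have sc: "scatter k g \<alpha> p = \<alpha> p" if p: "p \<in> Q" for p
  proof -
    have "scatter k g \<alpha> p = (\<Sum>q\<in>Q. \<rho> p q * f q + (1 / k) * (\<rho> p q * outward_deriv l f q))"
      unfolding scatter_def by (intro sum.cong refl) (simp add: inc distrib_left)
    also have "\<dots> = (\<Sum>q\<in>Q. \<rho> p q * f q) + (1 / k) * (\<Sum>q\<in>Q. \<rho> p q * outward_deriv l f q)"
      by (simp only: sum.distrib sum_distrib_left)
    also have "\<dots> = f p + (1 / k) * (- outward_deriv l f p)"
    proof -
      have "(\<Sum>q\<in>Q. \<rho> p q * f q) = f p" "(\<Sum>q\<in>Q. \<rho> p q * outward_deriv l f q) = - outward_deriv l f p"
        using vc[OF p] by linarith+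
      then show ?thesis by (simp only:)
    qed
    also have "\<dots> = \<alpha> p" using p by (simp add: \<alpha>_def z_def amplitudes_def)
    finally show ?thesis .
  qed
  show "step k h (amplitudes k f) = amplitudes k f"
  proof
    fix i show "step k h (amplitudes k f) i = amplitudes k f i"
    proof -
      obtain b p where bp: "i = (b, p)" by (cases i) blast
      have T: "step k h z (True, p) = z (True, p)"
        unfolding step_simps g_def[symmetric] \<alpha>_def[symmetric]
        using toward_away_cong[where \<alpha>="scatter k g \<alpha>" and \<beta>=\<alpha>, OF sc, of p k g] key[of p]
        by (simp add: z_def amplitudes_def)
      have F: "step k h z (False, p) = z (False, p)"
        unfolding step_simps g_def[symmetric] \<alpha>_def[symmetric] using sc[of p]
        by (simp add: \<alpha>_def) (simp add: z_def amplitudes_def)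
      show ?thesis using T F unfolding bp z_def by (cases b) auto
    qed
  qed
  show "continuous_edges (\<lambda>p. amplitudes k f (True, p))" using cont by (simp add: z_def)
  show "\<exists>B. \<forall>i. \<bar>amplitudes k f i\<bar> \<le> B"
  proof -
    obtain B where B: "0 \<le> B" "\<And>p. p \<in> X \<Longrightarrow> \<bar>f p\<bar> \<le> B" using continuous_edges_bounded[OF dom_continuous[OF dom]] by blast
    define A where "A = (\<Sum>q\<in>Q. \<bar>f q - outward_deriv l f q / k\<bar>)"
    have A: "\<bar>f q - outward_deriv l f q / k\<bar> \<le> A" if "q \<in> Q" for q
      unfolding A_def using member_le_sum[OF that, of "\<lambda>q. \<bar>f q - outward_deriv l f q / k\<bar>"] finite_Q by simp
    have A0: "0 \<le> A" unfolding A_def by (intro sum_nonneg) auto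
    have "\<bar>amplitudes k f (b, p)\<bar> \<le> A + B" for b p
      using A[of p] B(2)[of p] B(1) A0 unfolding amplitudes_def by (cases b; cases "p \<in> X"; cases "p \<in> Q") auto
    then show ?thesis by (metis surj_pair)
  qed
  show "p \<in> X \<Longrightarrow> edge_deriv l f p = k * (toward k (source k h (\<lambda>p. amplitudes k f (True, p))) (\<lambda>p. amplitudes k f (False, p)) p
            - away k (source k h (\<lambda>p. amplitudes k f (True, p))) (\<lambda>p. amplitudes k f (False, p)) p) / 2"
    using key[of p] k unfolding g_def \<alpha>_def z_def by simp
qed

lemma a_priori:
  assumes h: "h \<in> H" and f: "solves (k\<^sup>2) h f" and k: "k0 \<le> k"
  shows "\<bar>amplitudes k f i\<bar> \<le> 2 * (M + 1) / k * N h"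
proof -
  have k1: "0 < k" using k k0_ge_1 by linarith
  note A = solution_fixed_point[OF h f k1]
  obtain B where B: "\<forall>i. \<bar>amplitudes k f i\<bar> \<le> B" using A(3) by blast
  have "\<bar>amplitudes k f i\<bar> \<le> 2 * ((M + 1) * N h / k)"
  proof (rule halving_bound[where z="amplitudes k f"])
    show "\<bar>amplitudes k f i\<bar> \<le> B" for i by (rule B[rule_format])
    show "\<bar>amplitudes k f i\<bar> \<le> D / 2 + (M + 1) * N h / k" if "\<And>i. \<bar>amplitudes k f i\<bar> \<le> D" for D i
      using step_bound[OF h A(2) that k, of i] unfolding A(1) .
  qed
  also have "2 * ((M + 1) * N h / k) = 2 * (M + 1) / k * N h" using k1 by (simp add: field_simps)
  finally show ?thesis .
qed

lemma a_priori_bound: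
  assumes h: "h \<in> H" and f: "solves (k\<^sup>2) h f" and k: "k0 \<le> k" and p: "p \<in> X"
  shows "\<bar>f p\<bar> \<le> 2 * (M + 1) / k * N h"
  using a_priori[OF h f k, of "(True, p)"] p unfolding amplitudes_def by simp

lemma a_priori_deriv_bound:
  assumes h: "h \<in> H" and f: "solves (k\<^sup>2) h f" and k: "k0 \<le> k" and p: "p \<in> X"
  shows "\<bar>edge_deriv l f p\<bar> \<le> (2 * (M + 1) + 1 + N U * (2 * (M + 1) / k)) * N h"
proof -
  define z where "z = amplitudes k f"
  define g where "g = source k h (\<lambda>p. z (True, p))"
  define B where "B = 2 * (M + 1) / k * N h"
  have k1: "0 < k" using k k0_ge_1 by linarith
  have zB: "\<bar>z i\<bar> \<le> B" for i using a_priori[OF h f k, of i] unfolding z_def B_def .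
  have c: "continuous_edges (\<lambda>p. z (True, p))" using solution_fixed_point(2)[OF h f k1] by (simp add: z_def)
  have gH: "g \<in> H" unfolding g_def by (rule source_H[OF h c])
  have Ng: "N g \<le> (N h + N U * B) / k" unfolding g_def by (rule N_source[OF h c zB k1])
  have t: "\<bar>toward k g (\<lambda>p. z (False, p)) p\<bar> \<le> B + N g" "\<bar>away k g (\<lambda>p. z (False, p)) p\<bar> \<le> B + N g"
    by (rule toward_away_bound[OF gH zB k1 p])+
  have "\<bar>edge_deriv l f p\<bar> = k * \<bar>toward k g (\<lambda>p. z (False, p)) p - away k g (\<lambda>p. z (False, p)) p\<bar> / 2"
  proof -
    have e: "edge_deriv l f p = k * (toward k g (\<lambda>p. z (False, p)) p - away k g (\<lambda>p. z (False, p)) p) / 2"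
      using solution_fixed_point(4)[OF h f k1 p] unfolding z_def g_def .
    show ?thesis unfolding e using k1 by (simp add: abs_mult)
  qed
  also have "\<dots> \<le> k * (2 * (B + N g)) / 2" using t k1 by (intro divide_right_mono mult_left_mono) auto
  also have "\<dots> \<le> k * (B + (N h + N U * B) / k)"
  proof -
    have "k * (B + N g) \<le> k * (B + (N h + N U * B) / k)" using k1 by (intro mult_left_mono add_left_mono Ng) auto
    moreover have "k * (2 * x) / 2 = k * x" for x by simp
    ultimately show ?thesis by (simp only:)
  qed
  also have "\<dots> = (2 * (M + 1) + 1 + N U * (2 * (M + 1) / k)) * N h" using k1 by (simp add: B_def field_simps)
  finally show ?thesis .
qed

lemma wave_continuous:
  assumes "g \<in> H"
  shows "continuous_edges (\<lambda>p. if p \<in> X then (toward k g \<alpha> p + away k g \<alpha> p) / 2 else 0)"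
  unfolding continuous_edges_def
proof
  fix a assume a: "a \<in> E"
  have "continuous_on {0..l a} (\<lambda>s. (toward k g \<alpha> (a, s) + away k g \<alpha> (a, s)) / 2)"
    by (intro continuous_intros ac_primitive_continuous[OF toward_ac_primitive[OF assms a]] ac_primitive_continuous[OF away_ac_primitive[OF assms a]]) auto
  then show "continuous_on {0..l a} (\<lambda>s. if (a, s) \<in> X then (toward k g \<alpha> (a, s) + away k g \<alpha> (a, s)) / 2 else 0)"
    by (rule continuous_on_eq) (use a in \<open>auto simp: points_def\<close>)
qed

lemma fixed_point_exists:
  assumes h: "h \<in> H" and k: "k0 \<le> k"
  obtains z where "step k h z = z" "continuous_edges (\<lambda>p. z (True, p))"
proof -
  define Z where "Z = {z :: bool \<times> 'e point \<Rightarrow> real. continuous_edges (\<lambda>p. z (True, p)) \<and> (\<exists>B. \<forall>i. \<bar>z i\<bar> \<le> B)}"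
  have "\<exists>z\<in>Z. step k h z = z"
  proof (rule contraction_fixed_point)
    show "(\<lambda>i. 0) \<in> Z" unfolding Z_def continuous_edges_def by auto
    show "step k h z \<in> Z" if z: "z \<in> Z" for z
    proof -
      obtain B where c: "continuous_edges (\<lambda>p. z (True, p))" and B: "\<And>i. \<bar>z i\<bar> \<le> B" using z by (auto simp: Z_def)
      have "continuous_edges (\<lambda>p. step k h z (True, p))"
        unfolding step_simps by (rule wave_continuous[OF source_H[OF h c]])
      moreover have "\<forall>i. \<bar>step k h z i\<bar> \<le> B / 2 + (M + 1) * N h / k" using step_bound[OF h c B k] by blast
      ultimately show ?thesis unfolding Z_def by blast
    qed
    show "\<bar>step k h z i - step k h w i\<bar> \<le> B / 2" if z: "z \<in> Z" "w \<in> Z" and B: "\<And>j. \<bar>z j - w j\<bar> \<le> B" for z w B i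
    proof -
      have c: "continuous_edges (\<lambda>p. z (True, p))" "continuous_edges (\<lambda>p. w (True, p))" using z by (auto simp: Z_def)
      have "\<bar>step k (\<lambda>p. h p - h p) (\<lambda>i. z i - w i) i\<bar> \<le> B / 2 + (M + 1) * N (\<lambda>p. h p - h p) / k"
        by (rule step_bound[OF diff_H[OF h h] _ B k]) (rule continuous_edges_diff[OF c])
      then show ?thesis unfolding step_diff[OF h h c] by (simp add: N_zero)
    qed
    show "\<exists>B. \<forall>i. \<bar>z i\<bar> \<le> B" if "z \<in> Z" for z using that by (simp add: Z_def)
    show "w \<in> Z" if zs: "\<And>n::nat. zs n \<in> Z" and lim: "\<And>e. 0 < e \<Longrightarrow> \<exists>N. \<forall>n\<ge>N. \<forall>i. \<bar>zs n i - w i\<bar> \<le> e" for zs w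
    proof -
      have "continuous_edges (\<lambda>p. w (True, p))"
        by (rule continuous_edges_limit[where fs="\<lambda>n p. zs n (True, p)"]) (use zs lim in \<open>auto simp: Z_def, metis\<close>)
      moreover have "\<exists>B. \<forall>i. \<bar>w i\<bar> \<le> B"
      proof -
        obtain n where n: "\<forall>i. \<bar>zs n i - w i\<bar> \<le> 1" using lim[of 1] by auto
        obtain B where B: "\<forall>i. \<bar>zs n i\<bar> \<le> B" using zs[of n] by (auto simp: Z_def)
        have "\<bar>w i\<bar> \<le> B + 1" for i using n[rule_format, of i] B[rule_format, of i] by linarith
        then show ?thesis by blast
      qed
      ultimately show ?thesis by (simp add: Z_def)
    qed
  qed
  then show thesis using that by (auto simp: Z_def)
qed

text \<open>
  For a fixed point, \<open>f = (u + v)/2\<close> has the continuous derivative \<open>k (u - v)/2\<close>, whose derivative is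
  \<open>k\<^sup>2 f - (h + U f)\<close>. At an end, \<open>f\<close> is half the sum and \<open>f'/k\<close> half the difference of the arriving and
  the leaving amplitude. As \<open>\<rho>\<close> exchanges these two, the vertex conditions hold.
\<close>

lemma solution_exists:
  assumes h: "h \<in> H" and k: "k0 \<le> k"
  shows "\<exists>f. solves (k\<^sup>2) h f"
proof -
  have k1: "0 < k" using k k0_ge_1 by linarith
  obtain z where z: "step k h z = z" and c: "continuous_edges (\<lambda>p. z (True, p))" using fixed_point_exists[OF h k] by blast
  define f where "f = (\<lambda>p. z (True, p))"
  define \<alpha> where "\<alpha> = (\<lambda>p. z (False, p))"
  define g where "g = source k h f"
  have gH: "g \<in> H" unfolding g_def using source_H[OF h] c by (simp add: f_def)
  have sc: "scatter k g \<alpha> p = \<alpha> p" if "p \<in> Q" for p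
    using step_simps(2)[of k h z p] that unfolding z by (simp add: g_def f_def \<alpha>_def)
  define u where "u = toward k g \<alpha>"
  define v where "v = away k g \<alpha>"
  have fuv: "f p = (u p + v p) / 2" if "p \<in> X" for p
  proof -
    have "z (True, p) = (toward k g (scatter k g \<alpha>) p + away k g (scatter k g \<alpha>) p) / 2"
      using step_simps(1)[of k h z p] that unfolding z by (simp add: g_def f_def \<alpha>_def)
    then show ?thesis using toward_away_cong[where \<alpha>="scatter k g \<alpha>" and \<beta>=\<alpha>, OF sc that, of k g]
      by (simp add: f_def u_def v_def)
  qed
  have fE: "f (a, s) = (u (a, s) + v (a, s)) / 2" if "a \<in> E" "s \<in> {0..l a}" for a s
    using that by (intro fuv) (simp add: points_def)
  define p where "p = (\<lambda>q. k * (u q - v q) / 2)"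
  define d where "d = (\<lambda>q. k\<^sup>2 * f q + (-1) * (h q + U q * f q))"
  have ac: "ac_primitive 0 (l a) (\<lambda>s. u (a, s)) (\<lambda>s. k * u (a, s) - g (a, s))"
    "ac_primitive 0 (l a) (\<lambda>s. v (a, s)) (\<lambda>s. - k * v (a, s) + g (a, s))" if "a \<in> E" for a
    unfolding u_def v_def by (rule toward_ac_primitive[OF gH that] away_ac_primitive[OF gH that])+
  have fc: "continuous_edges f" using c by (simp add: f_def)
  have dH: "d \<in> H" unfolding d_def
    by (intro add_H cmult_H h L2_mult_continuous[OF U_L2 fc] continuous_edges_H[OF fc])
  have der: "((\<lambda>s. f (a, s)) has_real_derivative p (a, s)) (at s within {0..l a})" if a: "a \<in> E" and s: "s \<in> {0..l a}" for a s
  proof -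
    have "ac_primitive 0 (l a) (\<lambda>s. (1/2) * (u (a, s) + v (a, s))) (\<lambda>s. (1/2) * ((k * u (a, s) - g (a, s)) + (- k * v (a, s) + g (a, s))))"
      by (intro ac_primitive_cmult ac_primitive_add ac a)
    moreover have "(\<lambda>s. (1/2) * ((k * u (a, s) - g (a, s)) + (- k * v (a, s) + g (a, s)))) = (\<lambda>s. p (a, s))"
      by (simp add: p_def fun_eq_iff algebra_simps)
    moreover have "continuous_on {0..l a} (\<lambda>s. p (a, s))" unfolding p_def
      using ac_primitive_continuous[OF ac(1)[OF a]] ac_primitive_continuous[OF ac(2)[OF a]] by (intro continuous_intros) auto
    ultimately have "((\<lambda>s. (1/2) * (u (a, s) + v (a, s))) has_real_derivative p (a, s)) (at s within {0..l a})"
      using s by (intro ac_primitive_continuous_deriv) auto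
    then show ?thesis
      by (rule has_field_derivative_transform_within[where d=1]) (use fE[OF a] s in auto)
  qed
  have acp: "ac_primitive 0 (l a) (\<lambda>s. p (a, s)) (\<lambda>s. d (a, s))" if a: "a \<in> E" for a
  proof -
    have pr: "ac_primitive 0 (l a) (\<lambda>s. (k/2) * (u (a, s) + (-1) * v (a, s))) (\<lambda>s. (k/2) * ((k * u (a, s) - g (a, s)) + (-1) * (- k * v (a, s) + g (a, s))))"
      by (intro ac_primitive_cmult ac_primitive_add ac a)
    have pe: "(\<lambda>s. (k/2) * (u (a, s) + (-1) * v (a, s))) = (\<lambda>s. p (a, s))"
      by (simp add: p_def fun_eq_iff)
    have "(k/2) * ((k * u (a, s) - g (a, s)) + (-1) * (- k * v (a, s) + g (a, s))) = d (a, s)" if "s \<in> {0..l a}" for s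
    proof -
      have "(k/2) * ((k * u (a, s) - g (a, s)) + (-1) * (- k * v (a, s) + g (a, s))) = k\<^sup>2 * ((u (a, s) + v (a, s)) / 2) - k * g (a, s)"
        by (simp add: power2_eq_square algebra_simps)
      also have "\<dots> = k\<^sup>2 * f (a, s) - (h (a, s) + U (a, s) * f (a, s))"
        using k1 unfolding fE[OF a that, symmetric] by (simp add: g_def source_def)
      also have "\<dots> = d (a, s)" by (simp add: d_def)
      finally show ?thesis .
    qed
    then have ng: "negligible {s\<in>{0..l a}. (k/2) * ((k * u (a, s) - g (a, s)) + (-1) * (- k * v (a, s) + g (a, s))) \<noteq> d (a, s)}"
      by (intro negligible_subset[OF negligible_empty]) blast
    show ?thesis using ac_primitive_cong_ae[OF pr ng] unfolding pe .
  qed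
  have inc: "incoming k g \<alpha> q = (if snd q = 0 then u q else v q)" for q by (simp add: incoming_def u_def v_def)
  have out: "\<alpha> q = (if snd q = 0 then v q else u q)" if "q \<in> Q" for q
    using that l_pos by (cases rule: QE) (auto simp: u_def v_def toward_end away_end)
  have fq: "f q = (1/2) * \<alpha> q + (1/2) * incoming k g \<alpha> q" if "q \<in> Q" for q
    using out[OF that] inc[of q] fuv[OF Q_X[OF that]] by simp
  have dq: "(if snd q = 0 then p q else - p q) = (k/2) * incoming k g \<alpha> q + (- (k/2)) * \<alpha> q" if "q \<in> Q" for q
    using out[OF that] inc[of q] by (simp add: p_def right_diff_distrib diff_divide_distrib)
  have ri: "(\<Sum>q\<in>Q. \<rho> r q * incoming k g \<alpha> q) = \<alpha> r" if "r \<in> Q" for r using sc[OF that] by (simp add: scatter_def)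
  \<comment> \<open>\<open>\<rho>\<close> maps arriving to leaving amplitudes; as an involution it also maps them back.\<close>
  have ra: "(\<Sum>q\<in>Q. \<rho> r q * \<alpha> q) = incoming k g \<alpha> r" if r: "r \<in> Q" for r
  proof -
    have "(\<Sum>q\<in>Q. \<rho> r q * \<alpha> q) = (\<Sum>q\<in>Q. \<Sum>t\<in>Q. \<rho> r q * (\<rho> q t * incoming k g \<alpha> t))"
      by (intro sum.cong refl) (simp add: ri[symmetric] sum_distrib_left)
    also have "\<dots> = (\<Sum>t\<in>Q. \<Sum>q\<in>Q. \<rho> r q * (\<rho> q t * incoming k g \<alpha> t))" by (rule sum.swap)
    also have "\<dots> = (\<Sum>t\<in>Q. (\<Sum>q\<in>Q. \<rho> r q * \<rho> q t) * incoming k g \<alpha> t)" by (simp add: sum_distrib_right mult.assoc)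
    also have "\<dots> = (\<Sum>t\<in>Q. (if r = t then 1 else 0) * incoming k g \<alpha> t)" by (intro sum.cong refl) (simp add: \<rho>_involution[OF r])
    also have "\<dots> = incoming k g \<alpha> r" using r finite_Q by (simp add: if_distrib[of "\<lambda>x. x * _"] cong: if_cong)
    finally show ?thesis .
  qed
  have lin: "(\<Sum>q\<in>Q. \<rho> r q * (c1 * x q + c2 * y q)) = c1 * (\<Sum>q\<in>Q. \<rho> r q * x q) + c2 * (\<Sum>q\<in>Q. \<rho> r q * y q)" for r c1 c2 x y
    by (simp add: distrib_left sum.distrib sum_distrib_left mult_ac)
  have vc: "vertex_condition f (\<lambda>q. if snd q = 0 then p q else - p q)"
    unfolding vertex_condition_def
  proof
    fix r assume r: "r \<in> Q"
    have 1: "(\<Sum>q\<in>Q. \<rho> r q * f q) = (1/2) * incoming k g \<alpha> r + (1/2) * \<alpha> r"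
      using sum.cong[OF refl, of Q "\<lambda>q. \<rho> r q * f q" "\<lambda>q. \<rho> r q * ((1/2) * \<alpha> q + (1/2) * incoming k g \<alpha> q)"] fq
      unfolding lin ri[OF r] ra[OF r] by auto
    have 2: "(\<Sum>q\<in>Q. \<rho> r q * (if snd q = 0 then p q else - p q)) = (k/2) * \<alpha> r + (- (k/2)) * incoming k g \<alpha> r"
      using sum.cong[OF refl, of Q "\<lambda>q. \<rho> r q * (if snd q = 0 then p q else - p q)" "\<lambda>q. \<rho> r q * ((k/2) * incoming k g \<alpha> q + (- (k/2)) * \<alpha> q)"] dq
      unfolding lin ri[OF r] ra[OF r] by auto
    show "f r = (\<Sum>q\<in>Q. \<rho> r q * f q) \<and> (if snd r = 0 then p r else - p r) = - (\<Sum>q\<in>Q. \<rho> r q * (if snd q = 0 then p q else - p q))"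
      unfolding 1 2 using fq[OF r] dq[OF r] by simp
  qed
  have D1: "f \<in> dom" by (rule domI(1)[OF _ _ dH vc]) (fact der acp)+
  have D2: "negligible {s\<in>{0..l a}. schroedinger l U f (a, s) \<noteq> - (d (a, s) + U (a, s) * f (a, s))}" if "a \<in> E" for a
    by (rule domI(2)[OF _ _ dH vc that]) (fact der acp)+
  have "negligible {s\<in>{0..l a}. schroedinger l U f (a, s) + k\<^sup>2 * f (a, s) \<noteq> h (a, s)}" if "a \<in> E" for a
    by (rule negligible_subset[OF D2[OF that]]) (auto simp: d_def)
  then show ?thesis using D1 unfolding solves_def by blast
qed

end

context quantum_graph begin

section \<open>The resolvent\<close>

lemma solves_lincomb:
  assumes f: "solves c h f" and f': "solves c h' f'"
    and F: "\<And>p. p \<in> X \<Longrightarrow> F p = s * f p + t * f' p" and J: "\<And>p. p \<in> X \<Longrightarrow> J p = s * h p + t * h' p"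
  shows "solves c J F"
proof -
  have D: "f \<in> dom" "f' \<in> dom" using f f' by (auto simp: solves_def)
  have in_X: "(a, r) \<in> X" if "a \<in> E" "r \<in> {0..l a}" for a r using that by (simp add: points_def)
  define p where "p = (\<lambda>q. s * edge_deriv l f q + t * edge_deriv l f' q)"
  define g where "g = (\<lambda>q. s * (-1 * schroedinger l U f q + (-1) * (U q * f q)) + t * (-1 * schroedinger l U f' q + (-1) * (U q * f' q)))"
  have der: "((\<lambda>r. F (a, r)) has_real_derivative p (a, r)) (at r within {0..l a})" if a: "a \<in> E" and r: "r \<in> {0..l a}" for a r
  proof -
    have "((\<lambda>r. s * f (a, r) + t * f' (a, r)) has_real_derivative p (a, r)) (at r within {0..l a})"
      unfolding p_def by (intro DERIV_add DERIV_cmult dom_edge(1)[OF D(1) a r] dom_edge(1)[OF D(2) a r])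
    then show ?thesis
      by (rule has_field_derivative_transform_within[where d=1]) (use F[OF in_X[OF a]] r in auto)
  qed
  have ac: "ac_primitive 0 (l a) (\<lambda>r. p (a, r)) (\<lambda>r. g (a, r))" if a: "a \<in> E" for a
    using ac_primitive_add[OF ac_primitive_cmult[OF dom_edge(4)[OF D(1) a], of s] ac_primitive_cmult[OF dom_edge(4)[OF D(2) a], of t]]
    unfolding p_def g_def by simp
  have sH: "schroedinger l U f \<in> H" "schroedinger l U f' \<in> H" using D by (auto simp: dom_def)
  have gH: "g \<in> H" unfolding g_def
    by (intro add_H cmult_H sH L2_mult_continuous[OF U_L2] dom_continuous D)
  have vc: "vertex_condition F (\<lambda>q. if snd q = 0 then p q else - p q)"
    unfolding vertex_condition_def
  proof
    fix r assume r: "r \<in> Q"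
    have lin: "(\<Sum>q\<in>Q. \<rho> r q * (s * x q + t * y q)) = s * (\<Sum>q\<in>Q. \<rho> r q * x q) + t * (\<Sum>q\<in>Q. \<rho> r q * y q)" for x y
      by (simp add: distrib_left sum.distrib sum_distrib_left mult_ac)
    have o: "(if snd q = 0 then p q else - p q) = s * outward_deriv l f q + t * outward_deriv l f' q" for q
      by (simp add: p_def outward_deriv_def)
    have vd: "(\<Sum>q\<in>Q. \<rho> r q * j q) = j r" "(\<Sum>q\<in>Q. \<rho> r q * outward_deriv l j q) = - outward_deriv l j r" if "j \<in> dom" for j
    proof -
      have "j r = (\<Sum>q\<in>Q. \<rho> r q * j q) \<and> outward_deriv l j r = - (\<Sum>q\<in>Q. \<rho> r q * outward_deriv l j q)"
        using that r unfolding dom_def vertex_condition_def by blast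
      then show "(\<Sum>q\<in>Q. \<rho> r q * j q) = j r" "(\<Sum>q\<in>Q. \<rho> r q * outward_deriv l j q) = - outward_deriv l j r" by linarith+
    qed
    have v: "(\<Sum>q\<in>Q. \<rho> r q * f q) = f r" "(\<Sum>q\<in>Q. \<rho> r q * f' q) = f' r"
      "(\<Sum>q\<in>Q. \<rho> r q * outward_deriv l f q) = - outward_deriv l f r" "(\<Sum>q\<in>Q. \<rho> r q * outward_deriv l f' q) = - outward_deriv l f' r"
      using vd D by blast+
    have "(\<Sum>q\<in>Q. \<rho> r q * F q) = (\<Sum>q\<in>Q. \<rho> r q * (s * f q + t * f' q))"
      by (intro sum.cong refl) (simp add: F[OF Q_X])
    then show "F r = (\<Sum>q\<in>Q. \<rho> r q * F q) \<and> (if snd r = 0 then p r else - p r) = - (\<Sum>q\<in>Q. \<rho> r q * (if snd q = 0 then p q else - p q))"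
      unfolding o lin v by (simp add: F[OF Q_X[OF r]])
  qed
  have D1: "F \<in> dom" by (rule domI(1)[OF _ _ gH vc]) (fact der ac)+
  have D2: "negligible {r\<in>{0..l a}. schroedinger l U F (a, r) \<noteq> - (g (a, r) + U (a, r) * F (a, r))}" if "a \<in> E" for a
    by (rule domI(2)[OF _ _ gH vc that]) (fact der ac)+
  have "negligible {r\<in>{0..l a}. schroedinger l U F (a, r) + c * F (a, r) \<noteq> J (a, r)}" if a: "a \<in> E" for a
  proof -
    have n: "negligible {r\<in>{0..l a}. schroedinger l U f (a, r) + c * f (a, r) \<noteq> h (a, r)}"
      "negligible {r\<in>{0..l a}. schroedinger l U f' (a, r) + c * f' (a, r) \<noteq> h' (a, r)}" using f f' a by (auto simp: solves_def)
    show ?thesis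
    proof (rule negligible_subset[OF negligible_Un[OF D2[OF a] negligible_Un[OF n]]], rule subsetI, rule ccontr)
      fix r assume r: "r \<in> {r\<in>{0..l a}. schroedinger l U F (a, r) + c * F (a, r) \<noteq> J (a, r)}"
      assume "r \<notin> {r\<in>{0..l a}. schroedinger l U F (a, r) \<noteq> - (g (a, r) + U (a, r) * F (a, r))} \<union>
         ({r\<in>{0..l a}. schroedinger l U f (a, r) + c * f (a, r) \<noteq> h (a, r)} \<union> {r\<in>{0..l a}. schroedinger l U f' (a, r) + c * f' (a, r) \<noteq> h' (a, r)})"
      then have e: "schroedinger l U F (a, r) = - (g (a, r) + U (a, r) * F (a, r))"
        "h (a, r) = schroedinger l U f (a, r) + c * f (a, r)" "h' (a, r) = schroedinger l U f' (a, r) + c * f' (a, r)" using r by auto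
      have x: "(a, r) \<in> X" using r a by (simp add: points_def)
      have "schroedinger l U F (a, r) + c * F (a, r) = J (a, r)"
        unfolding e(1) J[OF x] F[OF x] e(2,3) g_def by (simp add: algebra_simps)
      then show False using r by simp
    qed
  qed
  then show ?thesis using D1 by (simp add: solves_def)
qed

lemma solves_cong:
  assumes "solves c h f" "\<And>p. p \<in> X \<Longrightarrow> F p = f p" "\<And>p. p \<in> X \<Longrightarrow> J p = h p"
  shows "solves c J F"
  by (rule solves_lincomb[OF assms(1,1), of _ 1 0]) (use assms in auto)

lemma solves_shift:
  assumes f: "solves c h f" and J: "\<And>p. p \<in> X \<Longrightarrow> J p = h p + (c' - c) * f p"
  shows "solves c' J f"
proof -
  have "negligible {s\<in>{0..l a}. schroedinger l U f (a, s) + c' * f (a, s) \<noteq> J (a, s)}" if a: "a \<in> E" for a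
  proof -
    have "negligible {s\<in>{0..l a}. schroedinger l U f (a, s) + c * f (a, s) \<noteq> h (a, s)}" using f a by (simp add: solves_def)
    then show ?thesis
    proof (rule negligible_subset, clarify)
      fix s assume s: "s \<in> {0..l a}" and ne: "schroedinger l U f (a, s) + c' * f (a, s) \<noteq> J (a, s)"
        and e: "schroedinger l U f (a, s) + c * f (a, s) = h (a, s)"
      have "J (a, s) = h (a, s) + (c' - c) * f (a, s)" using s a by (intro J) (simp add: points_def)
      also have "\<dots> = schroedinger l U f (a, s) + c' * f (a, s)" unfolding e[symmetric] by (simp add: algebra_simps)
      finally show False using ne by simp
    qed
  qed
  then show ?thesis using f by (simp add: solves_def)
qed

lemma solution_unique:
  assumes "solves (k\<^sup>2) h f" "solves (k\<^sup>2) h f'" "k0 \<le> k" "p \<in> X"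
  shows "f p = f' p"
proof -
  have "solves (k\<^sup>2) (\<lambda>p. 0) (\<lambda>p. f p - f' p)"
    by (rule solves_lincomb[OF assms(1,2), of _ 1 "-1"]) auto
  from a_priori_bound[OF zero_H this assms(3,4)] show ?thesis by (simp add: N_zero)
qed

text \<open>
  The resolvent. Off the graph it is set to zero, which makes it unique as a function.
\<close>

definition R :: "('e point \<Rightarrow> real) \<Rightarrow> 'e point \<Rightarrow> real" where
  "R h p = (if p \<in> X then (SOME f. solves (k0\<^sup>2) h f) p else 0)"

lemma R_solves: "h \<in> H \<Longrightarrow> solves (k0\<^sup>2) h (R h)"
  using solves_cong[OF someI_ex[OF solution_exists[OF _ order_refl]], of h "R h" h] by (simp add: R_def)

lemma R_outside: "p \<notin> X \<Longrightarrow> R h p = 0" by (simp add: R_def)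

lemma R_eqI:
  assumes "h \<in> H" "solves (k0\<^sup>2) h f" "\<And>p. p \<notin> X \<Longrightarrow> f p = 0"
  shows "R h = f"
proof
  fix p show "R h p = f p"
    using solution_unique[OF R_solves[OF assms(1)] assms(2) order_refl, of p] R_outside[of p h] assms(3)[of p] by (cases "p \<in> X") auto
qed

lemma R_dom: "h \<in> H \<Longrightarrow> R h \<in> dom" using R_solves by (simp add: solves_def)

lemma R_in_K: "h \<in> H \<Longrightarrow> R h \<in> K"
  using dom_continuous[OF R_dom] R_outside by (simp add: K_def)

lemma resolvent_add: "f \<in> H \<Longrightarrow> g \<in> H \<Longrightarrow> R (\<lambda>y. f y + g y) = (\<lambda>y. R f y + R g y)"
  by (rule R_eqI[OF add_H]) (auto intro!: solves_lincomb[OF R_solves R_solves, of f g _ 1 1] simp: R_outside)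

lemma resolvent_cmult: "f \<in> H \<Longrightarrow> R (\<lambda>y. c * f y) = (\<lambda>y. c * R f y)"
  by (rule R_eqI[OF cmult_H]) (auto intro!: solves_lincomb[OF R_solves R_solves, of f f _ c 0] simp: R_outside)

lemma graph_integral_cong_ae:
  assumes "\<And>a. a \<in> E \<Longrightarrow> (\<lambda>s. F (a, s)) \<in> borel_measurable (lebesgue_on {0..l a})"
    and "\<And>a. a \<in> E \<Longrightarrow> negligible {s\<in>{0..l a}. F (a, s) \<noteq> J (a, s)}"
  shows "graph_integral G l F = graph_integral G l J"
  unfolding graph_integral_def
proof (rule sum.cong[OF refl])
  fix a assume a: "a \<in> E"
  note ae = ae_equal_on_interval[OF assms(1)[OF a] assms(2)[OF a]]
  show "(\<integral>s. F (a, s) \<partial>lebesgue_on {0..l a}) = (\<integral>s. J (a, s) \<partial>lebesgue_on {0..l a})"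
    by (rule integral_cong_AE[OF assms(1)[OF a] ae(2,1)])
qed

lemma H_measurable: "f \<in> H \<Longrightarrow> a \<in> E \<Longrightarrow> (\<lambda>s. f (a, s)) \<in> borel_measurable (lebesgue_on {0..l a})"
  by (simp add: L2_def)

lemma ip_cong_ae:
  assumes "f \<in> H" "g \<in> H" "\<And>a. a \<in> E \<Longrightarrow> negligible {s\<in>{0..l a}. f (a, s) \<noteq> f' (a, s)}"
  shows "ip f g = ip f' g"
  unfolding graph_ip_def
proof (rule graph_integral_cong_ae)
  fix a assume a: "a \<in> E"
  show "(\<lambda>s. f (a, s) * g (a, s)) \<in> borel_measurable (lebesgue_on {0..l a})"
    by (intro borel_measurable_times H_measurable assms a)
  show "negligible {s\<in>{0..l a}. f (a, s) * g (a, s) \<noteq> f' (a, s) * g (a, s)}"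
    by (rule negligible_subset[OF assms(3)[OF a]]) auto
qed

lemma ip_HK:
  assumes "f \<in> H" "g \<in> H"
  shows "ip f g = (\<Sum>a\<in>E. integral {0..l a} (\<lambda>s. f (a, s) * g (a, s)))"
    and "a \<in> E \<Longrightarrow> (\<lambda>s. f (a, s) * g (a, s)) integrable_on {0..l a}"
proof -
  have i: "integrable (lebesgue_on {0..l a}) (\<lambda>s. f (a, s) * g (a, s))" if "a \<in> E" for a
    using H_edge[OF assms(1) that] H_edge[OF assms(2) that] by (rule square_integrable_mult_integrable)
  show "ip f g = (\<Sum>a\<in>E. integral {0..l a} (\<lambda>s. f (a, s) * g (a, s)))"
    unfolding graph_ip_def graph_integral_def by (intro sum.cong refl lebesgue_integral_eq_integral i) auto
  show "a \<in> E \<Longrightarrow> (\<lambda>s. f (a, s) * g (a, s)) integrable_on {0..l a}"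
    by (intro integrable_on_lebesgue_on i) auto
qed

lemma dom_H: "f \<in> dom \<Longrightarrow> f \<in> H" "f \<in> dom \<Longrightarrow> schroedinger l U f \<in> H"
  by (auto simp: dom_def)

text \<open>
  \<open>f\<close> and the outward derivative of \<open>g\<close> belong to the eigenspaces of the symmetric matrix \<open>\<rho>\<close> for 1
  and \<open>-1\<close>, so they are orthogonal.
\<close>

lemma boundary_form_zero:
  assumes f: "f \<in> dom" and g: "g \<in> dom"
  shows "(\<Sum>q\<in>Q. f q * outward_deriv l g q) = 0"
proof -
  have vf: "f q = (\<Sum>r\<in>Q. \<rho> q r * f r)" if "q \<in> Q" for q using f that unfolding dom_def vertex_condition_def by blast
  have vg: "outward_deriv l g q = - (\<Sum>r\<in>Q. \<rho> q r * outward_deriv l g r)" if "q \<in> Q" for q using g that unfolding dom_def vertex_condition_def by blast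
  have "(\<Sum>q\<in>Q. f q * outward_deriv l g q) = (\<Sum>q\<in>Q. \<Sum>r\<in>Q. \<rho> q r * f r * outward_deriv l g q)"
    by (rule sum.cong[OF refl]) (subst vf, auto simp: sum_distrib_right)
  also have "\<dots> = (\<Sum>r\<in>Q. \<Sum>q\<in>Q. \<rho> q r * f r * outward_deriv l g q)" by (rule sum.swap)
  also have "\<dots> = (\<Sum>r\<in>Q. f r * (\<Sum>q\<in>Q. \<rho> r q * outward_deriv l g q))"
    by (intro sum.cong refl) (auto simp: sum_distrib_left \<rho>_sym mult_ac intro!: sum.cong)
  also have "\<dots> = (\<Sum>r\<in>Q. f r * (- outward_deriv l g r))"
  proof (rule sum.cong[OF refl])
    fix r assume "r \<in> Q"
    from vg[OF this] have "(\<Sum>q\<in>Q. \<rho> r q * outward_deriv l g q) = - outward_deriv l g r" by linarith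
    then show "f r * (\<Sum>q\<in>Q. \<rho> r q * outward_deriv l g q) = f r * (- outward_deriv l g r)" by (simp only:)
  qed
  finally show ?thesis by (simp add: sum_negf)
qed

text \<open>
  Integration by parts of \<open>f g' - f' g\<close> on each edge. The potential cancels, and the boundary terms
  vanish by the vertex conditions.
\<close>

lemma Green:
  assumes f: "f \<in> dom" and g: "g \<in> dom"
  shows "ip (schroedinger l U f) g = ip f (schroedinger l U g)"
proof -
  define W where "W = (\<lambda>p. f p * edge_deriv l g p + (-1) * (edge_deriv l f p * g p))"
  note fg = dom_H[OF f] dom_H[OF g]
  have edge: "integral {0..l a} (\<lambda>s. schroedinger l U f (a, s) * g (a, s)) - integral {0..l a} (\<lambda>s. f (a, s) * schroedinger l U g (a, s)) = W (a, l a) - W (a, 0)"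
    if a: "a \<in> E" for a
  proof -
    have "ac_primitive 0 (l a) (\<lambda>s. f (a, s) * edge_deriv l g (a, s) + (-1) * (edge_deriv l f (a, s) * g (a, s)))
       (\<lambda>s. (edge_deriv l f (a, s) * edge_deriv l g (a, s) + f (a, s) * (- schroedinger l U g (a, s) - U (a, s) * g (a, s)))
          + (-1) * ((- schroedinger l U f (a, s) - U (a, s) * f (a, s)) * g (a, s) + edge_deriv l f (a, s) * edge_deriv l g (a, s)))"
      by (intro ac_primitive_add ac_primitive_cmult ac_primitive_mult dom_edge(3,4) f g a)
    moreover have "(edge_deriv l f (a, s) * edge_deriv l g (a, s) + f (a, s) * (- schroedinger l U g (a, s) - U (a, s) * g (a, s)))
          + (-1) * ((- schroedinger l U f (a, s) - U (a, s) * f (a, s)) * g (a, s) + edge_deriv l f (a, s) * edge_deriv l g (a, s))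
        = schroedinger l U f (a, s) * g (a, s) - f (a, s) * schroedinger l U g (a, s)" for s
      by (simp add: algebra_simps)
    ultimately have "ac_primitive 0 (l a) (\<lambda>s. W (a, s)) (\<lambda>s. schroedinger l U f (a, s) * g (a, s) - f (a, s) * schroedinger l U g (a, s))"
      unfolding W_def by (simp only:)
    from ac_primitive_FTC[OF this, of 0 "l a"]
    have "((\<lambda>s. schroedinger l U f (a, s) * g (a, s) - f (a, s) * schroedinger l U g (a, s)) has_integral W (a, l a) - W (a, 0)) {0..l a}"
      using l_pos[OF a] by simp
    then have "integral {0..l a} (\<lambda>s. schroedinger l U f (a, s) * g (a, s) - f (a, s) * schroedinger l U g (a, s)) = W (a, l a) - W (a, 0)"
      by (rule integral_unique)
    then show ?thesis
      using Henstock_Kurzweil_Integration.integral_diff[OF ip_HK(2)[OF fg(2,3) a] ip_HK(2)[OF fg(1,4) a]] by simp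
  qed
  have "ip (schroedinger l U f) g - ip f (schroedinger l U g) = (\<Sum>a\<in>E. W (a, l a) - W (a, 0))"
    unfolding ip_HK(1)[OF fg(2,3)] ip_HK(1)[OF fg(1,4)] sum_subtractf[symmetric] by (intro sum.cong refl edge)
  also have "\<dots> = (\<Sum>a\<in>E. - (f (a, 0) * outward_deriv l g (a, 0) - g (a, 0) * outward_deriv l f (a, 0))
       + - (f (a, l a) * outward_deriv l g (a, l a) - g (a, l a) * outward_deriv l f (a, l a)))"
    using l_pos by (intro sum.cong refl) (simp add: W_def outward_deriv_def less_imp_neq[symmetric] mult.commute)
  also have "\<dots> = (\<Sum>q\<in>Q. - (f q * outward_deriv l g q - g q * outward_deriv l f q))" by (rule sum_Q[symmetric])
  also have "\<dots> = 0" using boundary_form_zero[OF f g] boundary_form_zero[OF g f] by (simp add: sum_negf sum_subtractf)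
  finally show ?thesis by simp
qed

lemma solves_ip:
  assumes "solves c h f" "g \<in> H" "h \<in> H"
  shows "ip h g = ip (schroedinger l U f) g + c * ip f g"
proof -
  have d: "f \<in> dom" using assms by (simp add: solves_def)
  note d = dom_H[OF d]
  have "ip h g = ip (\<lambda>p. schroedinger l U f p + c * f p) g"
  proof (rule ip_cong_ae[OF assms(3,2)])
    fix a assume "a \<in> E"
    then have "negligible {s\<in>{0..l a}. schroedinger l U f (a, s) + c * f (a, s) \<noteq> h (a, s)}" using assms(1) by (simp add: solves_def)
    then show "negligible {s\<in>{0..l a}. h (a, s) \<noteq> schroedinger l U f (a, s) + c * f (a, s)}" by (rule negligible_subset) auto
  qed
  then show ?thesis by (simp add: ip_add[OF d(2) cmult_H[OF d(1)] assms(2)] ip_cmult[OF d(1) assms(2)])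
qed

lemma resolvent_sym:
  assumes "f \<in> H" "g \<in> H"
  shows "ip (R f) g = ip f (R g)"
proof -
  note D = R_dom[OF assms(1)] R_dom[OF assms(2)]
  have "ip (R f) g = ip g (R f)" by (rule ip_sym)
  also have "\<dots> = ip (schroedinger l U (R g)) (R f) + k0\<^sup>2 * ip (R g) (R f)"
    by (rule solves_ip[OF R_solves[OF assms(2)] dom_H(1)[OF D(1)] assms(2)])
  also have "\<dots> = ip (schroedinger l U (R f)) (R g) + k0\<^sup>2 * ip (R f) (R g)"
    unfolding Green[OF D(2,1)] ip_sym[of "R g"] by simp
  also have "\<dots> = ip f (R g)"
    by (rule solves_ip[OF R_solves[OF assms(1)] dom_H(1)[OF D(2)] assms(1), symmetric])
  finally show ?thesis .
qed

definition total_length :: real where "total_length = (\<Sum>a\<in>E. l a)"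

lemma total_length_nonneg: "0 \<le> total_length"
  unfolding total_length_def using l_pos by (intro sum_nonneg) (simp add: less_imp_le)

lemma N_le_norm:
  assumes h: "h \<in> H"
  shows "N h \<le> sqrt total_length * sqrt (ip h h)"
proof -
  have h': "(\<lambda>p. \<bar>h p\<bar>) \<in> H" using h by (auto simp: L2_def intro!: borel_measurable_abs)
  have c: "continuous_edges (\<lambda>p. 1)" by (simp add: continuous_edges_def)
  note one = continuous_edges_H[OF c]
  have 1: "ip (\<lambda>p. \<bar>h p\<bar>) (\<lambda>p. 1) = N h" unfolding ip_HK(1)[OF h' one] N_def by simp
  have 2: "ip (\<lambda>p. 1) (\<lambda>p. 1) = total_length" unfolding ip_HK(1)[OF one one] total_length_def using l_pos by (intro sum.cong refl) (simp add: less_imp_le)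
  have 3: "ip (\<lambda>p. \<bar>h p\<bar>) (\<lambda>p. \<bar>h p\<bar>) = ip h h" by (simp add: graph_ip_def)
  have "(N h)\<^sup>2 \<le> total_length * ip h h" using Cauchy_Schwarz[OF h' one] unfolding 1 2 3 by (simp add: mult.commute)
  then show ?thesis unfolding real_sqrt_mult[symmetric] by (rule real_le_rsqrt)
qed

lemma ip_le_sup_graph:
  assumes F: "finite F" "F \<subseteq> H" and B: "\<And>x. (\<Sum>f\<in>F. (f x)\<^sup>2) \<le> B"
  shows "(\<Sum>f\<in>F. ip f f) \<le> total_length * B"
proof -
  have i: "(\<lambda>s. f (a, s) * f (a, s)) integrable_on {0..l a}" if "f \<in> F" "a \<in> E" for f a using ip_HK(2)[of f f a] that F by auto
  have "(\<Sum>f\<in>F. ip f f) = (\<Sum>f\<in>F. \<Sum>a\<in>E. integral {0..l a} (\<lambda>s. f (a, s) * f (a, s)))"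
    using F by (intro sum.cong refl ip_HK(1)) auto
  also have "\<dots> = (\<Sum>a\<in>E. \<Sum>f\<in>F. integral {0..l a} (\<lambda>s. f (a, s) * f (a, s)))" by (rule sum.swap)
  also have "\<dots> = (\<Sum>a\<in>E. integral {0..l a} (\<lambda>s. \<Sum>f\<in>F. f (a, s) * f (a, s)))"
    using F i by (intro sum.cong refl Henstock_Kurzweil_Integration.integral_sum[symmetric]) auto
  also have "\<dots> \<le> (\<Sum>a\<in>E. l a * B)"
  proof (rule sum_mono)
    fix a assume a: "a \<in> E"
    have "integral {0..l a} (\<lambda>s. \<Sum>f\<in>F. f (a, s) * f (a, s)) \<le> integral {0..l a} (\<lambda>s. B)"
      using i[OF _ a] F B by (intro integral_le integrable_sum) (auto simp: power2_eq_square)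
    then show "integral {0..l a} (\<lambda>s. \<Sum>f\<in>F. f (a, s) * f (a, s)) \<le> l a * B" using l_pos[OF a] by simp
  qed
  finally show ?thesis by (simp add: total_length_def sum_distrib_right)
qed

lemma continuous_null_imp_zero:
  assumes f: "continuous_edges f" and z: "ip f f = 0" and p: "p \<in> X"
  shows "f p = 0"
proof -
  obtain a s where as: "p = (a, s)" "a \<in> E" "s \<in> {0..l a}" using p by (rule XE)
  note fH = continuous_edges_H[OF f]
  have "(\<Sum>a\<in>E. integral {0..l a} (\<lambda>s. f (a, s) * f (a, s))) = 0" using z unfolding ip_HK(1)[OF fH fH] .
  moreover have "0 \<le> integral {0..l b} (\<lambda>s. f (b, s) * f (b, s))" if "b \<in> E" for b
    by (rule Henstock_Kurzweil_Integration.integral_nonneg[OF ip_HK(2)[OF fH fH that]]) auto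
  ultimately have "integral {0..l a} (\<lambda>s. f (a, s) * f (a, s)) = 0"
    using as(2) finite_arcs by (simp add: sum_nonneg_eq_0_iff)
  then have "((\<lambda>s. f (a, s) * f (a, s)) has_integral 0) (cbox 0 (l a))"
    using integrable_integral[OF ip_HK(2)[OF fH fH as(2)]] by (simp add: cbox_interval)
  then have "f (a, s) * f (a, s) = 0"
    by (rule has_integral_0_cbox_imp_0[rotated 2])
       (use f as l_pos[OF as(2)] in \<open>auto simp: continuous_edges_def cbox_interval intro!: continuous_on_mult\<close>)
  then show ?thesis using as by simp
qed

lemma solves_zero_rhs_null:
  assumes h: "h \<in> H" and f: "solves c h f" and z: "\<And>p. p \<in> X \<Longrightarrow> f p = 0"
  shows "ip h h = 0"
proof -
  have z0: "solves c (\<lambda>p. 0) f" by (rule solves_lincomb[OF f f, of _ 0 0]) (use z in auto)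
  have "ip h h = ip (\<lambda>p. 0) h"
  proof (rule ip_cong_ae[OF h h])
    fix a assume a: "a \<in> E"
    have "negligible {s\<in>{0..l a}. schroedinger l U f (a, s) + c * f (a, s) \<noteq> h (a, s)}"
      "negligible {s\<in>{0..l a}. schroedinger l U f (a, s) + c * f (a, s) \<noteq> 0}" using f z0 a by (auto simp: solves_def)
    then have "negligible ({s\<in>{0..l a}. schroedinger l U f (a, s) + c * f (a, s) \<noteq> h (a, s)} \<union> {s\<in>{0..l a}. schroedinger l U f (a, s) + c * f (a, s) \<noteq> 0})"
      by (rule negligible_Un)
    then show "negligible {s\<in>{0..l a}. h (a, s) \<noteq> 0}" by (rule negligible_subset) auto
  qed
  then show ?thesis using ip_zero[OF h] by simp
qed

end

context quantum_graph begin

section \<open>Compactness of the resolvent\<close>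

definition deriv_const :: real where
  "deriv_const = (2 * (M + 1) + 1 + N U * (2 * (M + 1) / k0)) * sqrt total_length"

definition sup_const :: real where
  "sup_const = 2 * (M + 1) / k0 * sqrt total_length"

lemma sup_const_nonneg: "0 \<le> sup_const"
  using M_nonneg k0_ge_1 total_length_nonneg by (simp add: sup_const_def)

lemma resolvent_bound:
  assumes h: "h \<in> H"
  shows "\<bar>R h x\<bar> \<le> sup_const * sqrt (ip h h)"
proof (cases "x \<in> X")
  case True
  have "\<bar>R h x\<bar> \<le> 2 * (M + 1) / k0 * N h" by (rule a_priori_bound[OF h R_solves[OF h] order_refl True])
  also have "\<dots> \<le> 2 * (M + 1) / k0 * (sqrt total_length * sqrt (ip h h))"
    using M_nonneg k0_ge_1 by (intro mult_left_mono N_le_norm[OF h]) auto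
  finally show ?thesis unfolding sup_const_def by (simp only: mult.assoc)
next
  case False
  then show ?thesis using sup_const_nonneg ip_nonneg[OF h] by (simp add: R_outside)
qed

lemma resolvent_Lipschitz:
  assumes h: "h \<in> H" "ip h h \<le> 1" and a: "a \<in> E" and s: "s \<in> {0..l a}" "r \<in> {0..l a}"
  shows "\<bar>R h (a, s) - R h (a, r)\<bar> \<le> deriv_const * \<bar>s - r\<bar>"
proof -
  define A where "A = 2 * (M + 1) + 1 + N U * (2 * (M + 1) / k0)"
  have A0: "0 \<le> A" using M_nonneg N_nonneg[of U] k0_ge_1 by (simp add: A_def)
  have Nh: "N h \<le> sqrt total_length"
  proof -
    have "sqrt total_length * sqrt (ip h h) \<le> sqrt total_length * 1"
      using h(2) total_length_nonneg by (intro mult_left_mono) auto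
    then show ?thesis using N_le_norm[OF h(1)] by simp
  qed
  have "norm (R h (a, s) - R h (a, r)) \<le> deriv_const * norm (s - r)"
  proof (rule field_differentiable_bound[where S="{0..l a}" and f="\<lambda>s. R h (a, s)" and f'="\<lambda>s. edge_deriv l (R h) (a, s)"])
    show "((\<lambda>s. R h (a, s)) has_field_derivative edge_deriv l (R h) (a, z)) (at z within {0..l a})" if "z \<in> {0..l a}" for z
      by (rule dom_edge(1)[OF R_dom[OF h(1)] a that])
    show "norm (edge_deriv l (R h) (a, z)) \<le> deriv_const" if "z \<in> {0..l a}" for z
    proof -
      have "\<bar>edge_deriv l (R h) (a, z)\<bar> \<le> A * N h" unfolding A_def
        using that a by (intro a_priori_deriv_bound[OF h(1) R_solves[OF h(1)] order_refl]) (simp add: points_def)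
      also have "\<dots> \<le> A * sqrt total_length" by (intro mult_left_mono Nh A0)
      finally show ?thesis by (simp add: deriv_const_def A_def)
    qed
  qed (use s in auto)
  then show ?thesis by simp
qed

text \<open>
  The edges are treated one after the other, passing to a subsequence each time.
\<close>

lemma edgewise_Arzela_Ascoli:
  fixes F :: "nat \<Rightarrow> 'e point \<Rightarrow> real"
  assumes bd: "\<And>n p. \<bar>F n p\<bar> \<le> B" and lip: "\<And>n a s r. a \<in> E \<Longrightarrow> s \<in> {0..l a} \<Longrightarrow> r \<in> {0..l a} \<Longrightarrow> \<bar>F n (a, s) - F n (a, r)\<bar> \<le> D * \<bar>s - r\<bar>"
    and A: "finite A" "A \<subseteq> E"
  shows "\<exists>(r :: nat \<Rightarrow> nat) g. strict_mono r \<and> (\<forall>a\<in>A. continuous_on {0..l a} (\<lambda>s. g (a, s))) \<and>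
     (\<forall>e>0. \<exists>N. \<forall>n\<ge>N. \<forall>a\<in>A. \<forall>s\<in>{0..l a}. \<bar>F (r n) (a, s) - g (a, s)\<bar> \<le> e)"
  using A
proof (induction A rule: finite_induct)
  case empty
  show ?case by (intro exI[of _ id] exI[of _ "\<lambda>p. 0"]) (auto simp: strict_mono_def)
next
  case (insert b A)
  then obtain r :: "nat \<Rightarrow> nat" and g where r: "strict_mono r" and gc: "\<forall>a\<in>A. continuous_on {0..l a} (\<lambda>s. g (a, s))"
    and g: "\<forall>e>0. \<exists>N. \<forall>n\<ge>N. \<forall>a\<in>A. \<forall>s\<in>{0..l a}. \<bar>F (r n) (a, s) - g (a, s)\<bar> \<le> e" by blast
  have bE: "b \<in> E" using insert.prems by simp
  obtain g' k where g'c: "continuous_on {0..l b} g'" and k: "strict_mono (k :: nat \<Rightarrow> nat)"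
    and g': "\<And>e. 0 < e \<Longrightarrow> \<exists>N. \<forall>n s. n \<ge> N \<and> s \<in> {0..l b} \<longrightarrow> norm (F (r (k n)) (b, s) - g' s) < e"
  proof (rule Arzela_Ascoli[where S="{0..l b}" and M=B and \<F>="\<lambda>n s. F (r n) (b, s)"])
    show "norm (F (r n) (b, s)) \<le> B" for n s using bd by simp
    fix s e :: real assume s: "s \<in> {0..l b}" and e: "0 < e"
    show "\<exists>d. 0 < d \<and> (\<forall>n y. y \<in> {0..l b} \<and> norm (s - y) < d \<longrightarrow> norm (F (r n) (b, s) - F (r n) (b, y)) < e)"
    proof (intro exI[of _ "e / (\<bar>D\<bar> + 1)"] conjI allI impI)
      show "0 < e / (\<bar>D\<bar> + 1)" using e by simp
      fix n y assume y: "y \<in> {0..l b} \<and> norm (s - y) < e / (\<bar>D\<bar> + 1)"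
      have "\<bar>F (r n) (b, s) - F (r n) (b, y)\<bar> \<le> D * \<bar>s - y\<bar>" using lip[OF bE s] y by blast
      also have "\<dots> \<le> (\<bar>D\<bar> + 1) * \<bar>s - y\<bar>" by (intro mult_right_mono) auto
      also have "\<dots> < e" using y by (simp add: field_simps)
      finally show "norm (F (r n) (b, s) - F (r n) (b, y)) < e" by simp
    qed
  qed auto
  define G' where "G' = (\<lambda>(a, s). if a = b then g' s else g (a, s))"
  have bA: "b \<notin> A" using insert.hyps by simp
  show ?case
  proof (intro exI[of _ "r \<circ> k"] exI[of _ G'] conjI allI impI ballI)
    show "strict_mono (r \<circ> k)" using r k by (rule strict_mono_o)
    show "continuous_on {0..l a} (\<lambda>s. G' (a, s))" if "a \<in> insert b A" for a
      using that gc g'c bA by (cases "a = b") (auto simp: G'_def)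
    fix e :: real assume e: "0 < e"
    obtain N1 where N1: "\<forall>n\<ge>N1. \<forall>a\<in>A. \<forall>s\<in>{0..l a}. \<bar>F (r n) (a, s) - g (a, s)\<bar> \<le> e" using g e by blast
    obtain N2 where N2: "\<forall>n s. n \<ge> N2 \<and> s \<in> {0..l b} \<longrightarrow> norm (F (r (k n)) (b, s) - g' s) < e" using g'[OF e] by blast
    show "\<exists>N. \<forall>n\<ge>N. \<forall>a\<in>insert b A. \<forall>s\<in>{0..l a}. \<bar>F ((r \<circ> k) n) (a, s) - G' (a, s)\<bar> \<le> e"
    proof (intro exI[of _ "max N1 N2"] allI impI ballI)
      fix n a s assume n: "max N1 N2 \<le> n" and a: "a \<in> insert b A" and s: "s \<in> {0..l a}"
      show "\<bar>F ((r \<circ> k) n) (a, s) - G' (a, s)\<bar> \<le> e"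
      proof (cases "a = b")
        case True
        then have "norm (F (r (k n)) (b, s) - g' s) < e" using N2 n s by simp
        then show ?thesis using True by (simp add: G'_def)
      next
        case False
        have "N1 \<le> k n" using n seq_suble[OF k, of n] by simp
        then show ?thesis using False a s N1 by (simp add: G'_def)
      qed
    qed
  qed
qed

lemma resolvent_compact:
  assumes fs: "\<And>n::nat. fs n \<in> H" "\<And>n. ip (fs n) (fs n) \<le> 1"
  shows "\<exists>(r :: nat \<Rightarrow> nat) g. strict_mono r \<and> g \<in> K \<and> (\<forall>e>0. \<exists>N. \<forall>n\<ge>N. \<forall>x. \<bar>R (fs (r n)) x - g x\<bar> \<le> e)"
proof -
  have bd: "\<bar>R (fs n) p\<bar> \<le> sup_const" for n p
  proof -
    have "sup_const * sqrt (ip (fs n) (fs n)) \<le> sup_const * 1"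
      using fs(2)[of n] sup_const_nonneg by (intro mult_left_mono) auto
    then show ?thesis using resolvent_bound[OF fs(1), of n p] by simp
  qed
  obtain r :: "nat \<Rightarrow> nat" and g where r: "strict_mono r" and gc: "\<forall>a\<in>E. continuous_on {0..l a} (\<lambda>s. g (a, s))"
    and g: "\<forall>e>0. \<exists>N. \<forall>n\<ge>N. \<forall>a\<in>E. \<forall>s\<in>{0..l a}. \<bar>R (fs (r n)) (a, s) - g (a, s)\<bar> \<le> e"
    using edgewise_Arzela_Ascoli[where F="\<lambda>n. R (fs n)", OF bd resolvent_Lipschitz[OF fs] finite_arcs order_refl] by blast
  define g' where "g' = (\<lambda>p. if p \<in> X then g p else 0)"
  have g'K: "g' \<in> K"
    unfolding K_def continuous_edges_def mem_Collect_eq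
  proof (intro conjI ballI)
    fix a assume a: "a \<in> E"
    have "continuous_on {0..l a} (\<lambda>s. g (a, s))" using gc a by blast
    then show "continuous_on {0..l a} (\<lambda>s. g' (a, s))" by (rule continuous_on_eq) (use a in \<open>simp add: g'_def points_def\<close>)
  qed (simp add: g'_def)
  have "\<exists>N. \<forall>n\<ge>N. \<forall>x. \<bar>R (fs (r n)) x - g' x\<bar> \<le> e" if e: "0 < e" for e
  proof -
    obtain N where N: "\<forall>n\<ge>N. \<forall>a\<in>E. \<forall>s\<in>{0..l a}. \<bar>R (fs (r n)) (a, s) - g (a, s)\<bar> \<le> e" using g e by blast
    have "\<bar>R (fs (r n)) x - g' x\<bar> \<le> e" if n: "N \<le> n" for n x
    proof (cases "x \<in> X")
      case True
      then show ?thesis using N n by (auto simp: g'_def elim!: XE)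
    next
      case False
      then show ?thesis using e by (simp add: g'_def R_outside)
    qed
    then show ?thesis by blast
  qed
  then show ?thesis using r g'K by blast
qed

lemma K_zeroI:
  assumes "f \<in> K" "\<And>p. p \<in> X \<Longrightarrow> f p = 0"
  shows "f = (\<lambda>y. 0)"
proof
  fix y show "f y = 0" using assms unfolding K_def by (cases "y \<in> X") blast+
qed

text \<open>
  \<open>R f = - s f\<close> says that \<open>(D + k\<^sup>2) f = 0\<close> with \<open>k\<^sup>2 = k0\<^sup>2 + 1/s\<close>, and this equation has only the zero
  solution because \<open>k \<ge> k0\<close>.
\<close>

lemma resolvent_no_negative_eigenvalue:
  assumes f: "f \<in> K" and s: "0 < s" and e: "R f = (\<lambda>y. - s * f y)"
  shows "f = (\<lambda>y. 0)"
proof -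
  define k where "k = sqrt (k0\<^sup>2 + 1 / s)"
  have k2: "k\<^sup>2 = k0\<^sup>2 + 1 / s" unfolding k_def using s by simp
  have kk: "k0 \<le> k" unfolding k_def using s by (intro real_le_rsqrt) simp
  have fH: "f \<in> H" using f continuous_edges_H by (simp add: K_def)
  have "solves (k\<^sup>2) (\<lambda>p. 0) (R f)"
    by (rule solves_shift[OF R_solves[OF fH]]) (use s e in \<open>simp add: k2\<close>)
  from a_priori_bound[OF zero_H this kk] have "R f p = 0" if "p \<in> X" for p using that by (simp add: N_zero)
  then have "f p = 0" if "p \<in> X" for p using that s unfolding e by simp
  then show ?thesis by (rule K_zeroI[OF f])
qed

sublocale spectral: compact_symmetric H ip K R sup_const total_length
proof
  show "(\<Sum>f\<in>F. ip f f) \<le> total_length * B" if "finite F" "F \<subseteq> H" "\<And>x. (\<Sum>f\<in>F. (f x)\<^sup>2) \<le> B" for F B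
    by (rule ip_le_sup_graph[OF that])
  show "K \<subseteq> H" using continuous_edges_H by (auto simp: K_def)
  show "f = (\<lambda>y. 0)" if "f \<in> K" "ip f f = 0" for f
    using that continuous_null_imp_zero[of f] by (intro K_zeroI) (auto simp: K_def)
  show "g \<in> K" if fs: "\<And>n::nat. fs n \<in> K" and lim: "\<And>e. 0 < e \<Longrightarrow> \<exists>N. \<forall>n\<ge>N. \<forall>x. \<bar>fs n x - g x\<bar> \<le> e" for fs g
  proof -
    have "continuous_edges g" by (rule continuous_edges_limit[OF _ lim]) (use fs in \<open>simp add: K_def\<close>)
    moreover have "g p = 0" if p: "p \<notin> X" for p
    proof -
      have "\<bar>g p\<bar> \<le> e" if e: "0 < e" for e
      proof -
        obtain n where "\<bar>fs n p - g p\<bar> \<le> e" using lim[OF e] by blast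
        moreover have "fs n p = 0" using fs[of n] p unfolding K_def by blast
        ultimately show ?thesis by simp
      qed
      then have "\<bar>g p\<bar> \<le> 0" by (rule field_le_epsilon) simp
      then show ?thesis by simp
    qed
    ultimately show ?thesis by (simp add: K_def)
  qed
  show "R f \<in> K" if "f \<in> H" for f using R_in_K that .
  show "R (\<lambda>y. f y + g y) = (\<lambda>y. R f y + R g y)" if "f \<in> H" "g \<in> H" for f g using resolvent_add that .
  show "R (\<lambda>y. c * f y) = (\<lambda>y. c * R f y)" if "f \<in> H" for f c using resolvent_cmult that .
  show "ip (R f) g = ip f (R g)" if "f \<in> H" "g \<in> H" for f g using resolvent_sym that .
  show "0 \<le> sup_const" by (rule sup_const_nonneg)
  show "0 \<le> total_length" by (rule total_length_nonneg)
  show "\<bar>R f x\<bar> \<le> sup_const * sqrt (ip f f)" if "f \<in> H" for f x using resolvent_bound that .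
  show "\<exists>(r :: nat \<Rightarrow> nat) g. strict_mono r \<and> g \<in> K \<and> (\<forall>e>0. \<exists>N. \<forall>n\<ge>N. \<forall>x. \<bar>R (fs (r n)) x - g x\<bar> \<le> e)"
    if "\<And>n::nat. fs n \<in> H" "\<And>n. ip (fs n) (fs n) \<le> 1" for fs using resolvent_compact that .
  show "ip f f = 0" if "f \<in> H" "R f = (\<lambda>y. 0)" for f
    using solves_zero_rhs_null[OF that(1) R_solves[OF that(1)]] that(2) by simp
  show "f = (\<lambda>y. 0)" if "f \<in> K" "0 < s" "R f = (\<lambda>y. - s * f y)" for f s using resolvent_no_negative_eigenvalue that .
qed

section \<open>The heat kernel of a quantum graph\<close>

definition heat_kernel_of_dom :: "(real \<Rightarrow> 'e point \<Rightarrow> 'e point \<Rightarrow> real) \<Rightarrow> bool" where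
  "heat_kernel_of_dom e \<longleftrightarrow> (\<forall>x\<in>X.
     (\<forall>t>0. e t x \<in> dom) \<and>
     L2_C1 G l (\<lambda>t. e t x) (\<lambda>t y. - schroedinger l U (e t x) y) \<and>
     (\<forall>\<psi>\<in>dom. ((\<lambda>t. graph_integral G l (\<lambda>y. e t x y * \<psi> y)) \<longlongrightarrow> \<psi> x) (at_right 0)))"

lemma L2_norm_ip: "L2_norm G l F = sqrt (ip F F)"
  by (simp add: L2_norm_def graph_ip_def power2_eq_square)

lemma L2_norm_le_sup:
  assumes F0: "F0 \<in> H" and neg: "\<And>a. a \<in> E \<Longrightarrow> negligible {s\<in>{0..l a}. F0 (a, s) \<noteq> F (a, s)}"
    and B: "\<And>y. \<bar>F0 y\<bar> \<le> B"
  shows "0 \<le> L2_norm G l F" "L2_norm G l F \<le> sqrt total_length * B"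
proof -
  have B0: "0 \<le> B" using B[of undefined] by linarith
  have FH: "F \<in> H" unfolding L2_iff
    using square_integrable_cong_ae[OF H_edge[OF F0] neg] by blast
  have "ip F F = ip F0 F"
  proof (rule ip_cong_ae[OF FH FH])
    fix a assume "a \<in> E"
    from neg[OF this] show "negligible {s\<in>{0..l a}. F (a, s) \<noteq> F0 (a, s)}" by (rule negligible_subset) auto
  qed
  also have "\<dots> = ip F F0" by (rule ip_sym)
  also have "ip F F0 = ip F0 F0"
  proof (rule ip_cong_ae[OF FH F0])
    fix a assume "a \<in> E"
    from neg[OF this] show "negligible {s\<in>{0..l a}. F (a, s) \<noteq> F0 (a, s)}" by (rule negligible_subset) auto
  qed
  finally have e: "ip F F = ip F0 F0" .
  show "0 \<le> L2_norm G l F" unfolding L2_norm_ip using ip_nonneg[OF FH] by simp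
  have "ip F0 F0 \<le> total_length * B\<^sup>2" by (rule spectral.norm_le_sup[OF F0 B])
  then have "sqrt (ip F F) \<le> sqrt (total_length * B\<^sup>2)" unfolding e by simp
  then show "L2_norm G l F \<le> sqrt total_length * B" unfolding L2_norm_ip using B0 by (simp add: real_sqrt_mult)
qed

abbreviation "spectral_kernel \<equiv> spectral.heat (k0\<^sup>2)"
abbreviation "spectral_kernel_dt \<equiv> spectral.heat_deriv (k0\<^sup>2)"

lemma kernel_dom: "0 < t \<Longrightarrow> spectral_kernel t x \<in> dom"
  using spectral.heat_in_range[of t "k0\<^sup>2" x] R_dom by auto

lemma kernel_dt_ae:
  assumes t: "0 < t" and a: "a \<in> E"
  shows "negligible {s\<in>{0..l a}. spectral_kernel_dt t x (a, s) \<noteq> - schroedinger l U (spectral_kernel t x) (a, s)}"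
proof -
  obtain g where g: "g \<in> H" "spectral_kernel t x = R g" "spectral_kernel_dt t x = (\<lambda>y. k0\<^sup>2 * R g y - g y)"
    using spectral.heat_in_range[OF t, of "k0\<^sup>2" x] by blast
  have "negligible {s\<in>{0..l a}. schroedinger l U (R g) (a, s) + k0\<^sup>2 * R g (a, s) \<noteq> g (a, s)}"
    using R_solves[OF g(1)] a by (simp add: solves_def)
  then show ?thesis by (rule negligible_subset) (auto simp: g(2,3))
qed

lemma kernel_C1: "L2_C1 G l (\<lambda>t. spectral_kernel t x) (\<lambda>t y. - schroedinger l U (spectral_kernel t x) y)"
  unfolding L2_C1_def
proof (intro allI impI conjI)
  fix t :: real assume t: "0 < t"
  show "spectral_kernel t x \<in> H" using dom_H(1)[OF kernel_dom[OF t]] .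
  show "(\<lambda>y. - schroedinger l U (spectral_kernel t x) y) \<in> H" using cmult_H[OF dom_H(2)[OF kernel_dom[OF t]], of "-1"] by simp
  obtain B where B: "0 \<le> B"
    "\<And>h y. h \<noteq> 0 \<Longrightarrow> \<bar>h\<bar> \<le> t / 2 \<Longrightarrow> \<bar>(spectral_kernel (t + h) x y - spectral_kernel t x y) / h - spectral_kernel_dt t x y\<bar> \<le> B * \<bar>h\<bar>"
    "\<And>s y. \<bar>s - t\<bar> \<le> t / 2 \<Longrightarrow> \<bar>spectral_kernel_dt s x y - spectral_kernel_dt t x y\<bar> \<le> B * \<bar>s - t\<bar>"
    using spectral.heat_time_estimates[OF t, of "k0\<^sup>2" x] by blast
  have lim0: "((\<lambda>h. sqrt total_length * (B * \<bar>h - z\<bar>)) \<longlongrightarrow> 0) (at z)" for z :: real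
  proof -
    have "((\<lambda>h. sqrt total_length * (B * \<bar>h - z\<bar>)) \<longlongrightarrow> sqrt total_length * (B * \<bar>z - z\<bar>)) (at z)" by (intro tendsto_intros)
    then show ?thesis by simp
  qed
  have near: "\<forall>\<^sub>F h in at z. \<bar>h - z\<bar> \<le> t / 2 \<and> h \<noteq> z" for z :: real
    unfolding eventually_at using t by (intro exI[of _ "t / 2"]) (auto simp: dist_real_def)
  show "((\<lambda>h. L2_norm G l (\<lambda>y. (spectral_kernel (t + h) x y - spectral_kernel t x y) / h - - schroedinger l U (spectral_kernel t x) y)) \<longlongrightarrow> 0) (at 0)"
  proof (rule tendsto_sandwich[OF _ _ tendsto_const lim0])
    have *: "0 \<le> L2_norm G l (\<lambda>y. (spectral_kernel (t + h) x y - spectral_kernel t x y) / h - - schroedinger l U (spectral_kernel t x) y) \<and>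
       L2_norm G l (\<lambda>y. (spectral_kernel (t + h) x y - spectral_kernel t x y) / h - - schroedinger l U (spectral_kernel t x) y) \<le> sqrt total_length * (B * \<bar>h - 0\<bar>)"
      if h: "\<bar>h - 0\<bar> \<le> t / 2 \<and> h \<noteq> 0" for h
    proof -
      have th: "0 < t + h" using h t by linarith
      have F0: "(\<lambda>y. (1 / h) * (spectral_kernel (t + h) x y - spectral_kernel t x y) - spectral_kernel_dt t x y) \<in> H"
        by (intro diff_H cmult_H dom_H(1) kernel_dom th t spectral.heat_deriv_H)
      have B': "\<bar>(1 / h) * (spectral_kernel (t + h) x y - spectral_kernel t x y) - spectral_kernel_dt t x y\<bar> \<le> B * \<bar>h - 0\<bar>" for y
        using B(2)[of h y] h by simp
      have neg: "negligible {s\<in>{0..l a}. (1 / h) * (spectral_kernel (t + h) x (a, s) - spectral_kernel t x (a, s)) - spectral_kernel_dt t x (a, s)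
          \<noteq> (spectral_kernel (t + h) x (a, s) - spectral_kernel t x (a, s)) / h - - schroedinger l U (spectral_kernel t x) (a, s)}" if a: "a \<in> E" for a
        by (rule negligible_subset[OF kernel_dt_ae[OF t a, of x]]) auto
      show ?thesis using L2_norm_le_sup[OF F0 _ B', of "\<lambda>y. (spectral_kernel (t + h) x y - spectral_kernel t x y) / h - - schroedinger l U (spectral_kernel t x) y"] neg by blast
    qed
    show "\<forall>\<^sub>F h in at 0. 0 \<le> L2_norm G l (\<lambda>y. (spectral_kernel (t + h) x y - spectral_kernel t x y) / h - - schroedinger l U (spectral_kernel t x) y)"
      by (rule eventually_mono[OF near[of 0]]) (use * in blast)
    show "\<forall>\<^sub>F h in at 0. L2_norm G l (\<lambda>y. (spectral_kernel (t + h) x y - spectral_kernel t x y) / h - - schroedinger l U (spectral_kernel t x) y) \<le> sqrt total_length * (B * \<bar>h - 0\<bar>)"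
      by (rule eventually_mono[OF near[of 0]]) (use * in blast)
  qed
  show "((\<lambda>s. L2_norm G l (\<lambda>y. - schroedinger l U (spectral_kernel s x) y - - schroedinger l U (spectral_kernel t x) y)) \<longlongrightarrow> 0) (at t)"
  proof (rule tendsto_sandwich[OF _ _ tendsto_const lim0])
    have *: "0 \<le> L2_norm G l (\<lambda>y. - schroedinger l U (spectral_kernel s x) y - - schroedinger l U (spectral_kernel t x) y) \<and>
       L2_norm G l (\<lambda>y. - schroedinger l U (spectral_kernel s x) y - - schroedinger l U (spectral_kernel t x) y) \<le> sqrt total_length * (B * \<bar>s - t\<bar>)"
      if h: "\<bar>s - t\<bar> \<le> t / 2 \<and> s \<noteq> t" for s
    proof -
      have s: "0 < s" using h t by linarith
      have F0: "(\<lambda>y. spectral_kernel_dt s x y - spectral_kernel_dt t x y) \<in> H"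
        by (intro diff_H spectral.heat_deriv_H s t)
      have B': "\<bar>spectral_kernel_dt s x y - spectral_kernel_dt t x y\<bar> \<le> B * \<bar>s - t\<bar>" for y
        using B(3)[of s y] h by simp
      have neg: "negligible {r\<in>{0..l a}. spectral_kernel_dt s x (a, r) - spectral_kernel_dt t x (a, r)
          \<noteq> - schroedinger l U (spectral_kernel s x) (a, r) - - schroedinger l U (spectral_kernel t x) (a, r)}" if a: "a \<in> E" for a
        by (rule negligible_subset[OF negligible_Un[OF kernel_dt_ae[OF t a, of x] kernel_dt_ae[OF s a, of x]]]) auto
      show ?thesis using L2_norm_le_sup[OF F0 _ B', of "\<lambda>y. - schroedinger l U (spectral_kernel s x) y - - schroedinger l U (spectral_kernel t x) y"] neg by blast
    qed
    show "\<forall>\<^sub>F s in at t. 0 \<le> L2_norm G l (\<lambda>y. - schroedinger l U (spectral_kernel s x) y - - schroedinger l U (spectral_kernel t x) y)"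
      by (rule eventually_mono[OF near[of t]]) (use * in blast)
    show "\<forall>\<^sub>F s in at t. L2_norm G l (\<lambda>y. - schroedinger l U (spectral_kernel s x) y - - schroedinger l U (spectral_kernel t x) y) \<le> sqrt total_length * (B * \<bar>s - t\<bar>)"
      by (rule eventually_mono[OF near[of t]]) (use * in blast)
  qed
qed

lemma dom_range:
  assumes f: "f \<in> dom"
  obtains h where "h \<in> H" "\<And>p. p \<in> X \<Longrightarrow> f p = R h p"
proof -
  define h where "h = (\<lambda>p. schroedinger l U f p + k0\<^sup>2 * f p)"
  have hH: "h \<in> H" unfolding h_def by (intro add_H cmult_H dom_H f)
  have s: "solves (k0\<^sup>2) h f" using f by (simp add: solves_def h_def)
  show thesis using that[OF hH solution_unique[OF s R_solves[OF hH] order_refl]] by blast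
qed

lemma kernel_initial:
  assumes \<psi>: "\<psi> \<in> dom" and x: "x \<in> X"
  shows "((\<lambda>t. graph_integral G l (\<lambda>y. spectral_kernel t x y * \<psi> y)) \<longlongrightarrow> \<psi> x) (at_right 0)"
proof -
  obtain h where h: "h \<in> H" "\<And>p. p \<in> X \<Longrightarrow> \<psi> p = R h p" using dom_range[OF \<psi>] by blast
  have "graph_integral G l (\<lambda>y. spectral_kernel t x y * \<psi> y) = ip (spectral_kernel t x) (R h)" for t
    unfolding graph_ip_def graph_integral_def
    by (intro sum.cong refl Bochner_Integration.integral_cong) (auto simp: h(2) points_def)
  then show ?thesis using spectral.heat_initial_condition[OF h(1), of "k0\<^sup>2" x] h(2)[OF x] by simp
qed

lemma kernel_exists: "heat_kernel_of_dom spectral_kernel"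
  unfolding heat_kernel_of_dom_def using kernel_dom kernel_C1 kernel_initial by blast

lemma eigenfunction_dom:
  assumes \<phi>: "\<phi> \<in> spectral.S"
  shows "\<phi> \<in> dom" and "g \<in> H \<Longrightarrow> ip (schroedinger l U \<phi>) g = spectral.ev (k0\<^sup>2) \<phi> * ip \<phi> g"
proof -
  note P = spectral.S_facts[OF \<phi>]
  define h where "h = (\<lambda>y. (1 / spectral.\<mu> \<phi>) * \<phi> y)"
  have hH: "h \<in> H" unfolding h_def by (rule cmult_H[OF P(2)])
  have Rh: "R h = \<phi>" unfolding h_def resolvent_cmult[OF P(2)] P(5) using P(4) by simp
  show "\<phi> \<in> dom" using R_dom[OF hH] by (simp add: Rh)
  assume g: "g \<in> H"
  have "ip h g = ip (schroedinger l U \<phi>) g + k0\<^sup>2 * ip \<phi> g"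
    using solves_ip[OF R_solves[OF hH] g hH] by (simp add: Rh)
  moreover have "ip h g = (1 / spectral.\<mu> \<phi>) * ip \<phi> g" unfolding h_def by (rule ip_cmult[OF P(2) g])
  ultimately show "ip (schroedinger l U \<phi>) g = spectral.ev (k0\<^sup>2) \<phi> * ip \<phi> g"
    by (simp add: spectral.ev_def left_diff_distrib)
qed

text \<open>
  By Green's formula the coefficient satisfies \<open>b' = - \<Lambda> b\<close> on \<open>(0,\<infinity>)\<close>, so \<open>exp (\<Lambda> t) b t\<close> is constant. The
  initial condition, tested with \<open>\<phi>\<close> itself, identifies the constant.
\<close>

lemma kernel_coefficient:
  assumes e: "heat_kernel_of_dom e" and x: "x \<in> X" and \<phi>: "\<phi> \<in> spectral.S" and t: "0 < t"
  shows "ip (e t x) \<phi> = exp (- spectral.ev (k0\<^sup>2) \<phi> * t) * \<phi> x"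
proof -
  define \<Lambda> where "\<Lambda> = spectral.ev (k0\<^sup>2) \<phi>"
  define b where "b = (\<lambda>t. ip (e t x) \<phi>)"
  note P = spectral.S_facts[OF \<phi>] and D = eigenfunction_dom[OF \<phi>]
  have ed: "e t x \<in> dom" if "0 < t" for t using e x that by (simp add: heat_kernel_of_dom_def)
  have C1: "((\<lambda>h. L2_norm G l (\<lambda>y. (e (t + h) x y - e t x y) / h - - schroedinger l U (e t x) y)) \<longlongrightarrow> 0) (at 0)"
    if "0 < t" for t using e x that unfolding heat_kernel_of_dom_def L2_C1_def by blast
  have der: "(b has_real_derivative - \<Lambda> * b t) (at t)" if t: "0 < t" for t
    unfolding DERIV_def
  proof (rule LIM_zero_cancel, rule Lim_null_comparison[OF _ C1[OF t]])
    show "\<forall>\<^sub>F h in at 0. norm ((b (t + h) - b t) / h - - \<Lambda> * b t) \<le> L2_norm G l (\<lambda>y. (e (t + h) x y - e t x y) / h - - schroedinger l U (e t x) y)"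
      unfolding eventually_at
    proof (intro exI[of _ t] conjI t ballI impI)
      fix h :: real assume h: "h \<noteq> 0 \<and> dist h 0 < t"
      then have th: "0 < t + h" by (auto simp: dist_real_def)
      define F where "F = (\<lambda>y. (1 / h) * (e (t + h) x y - e t x y) - (-1) * schroedinger l U (e t x) y)"
      note dh = dom_H[OF ed[OF t]] dom_H[OF ed[OF th]]
      have d1: "(\<lambda>y. e (t + h) x y - e t x y) \<in> H" by (rule diff_H[OF dh(3,1)])
      have FH: "F \<in> H" unfolding F_def by (intro diff_H cmult_H d1 dh)
      have "ip F \<phi> = (1 / h) * (ip (e (t + h) x) \<phi> - ip (e t x) \<phi>) - (-1) * ip (schroedinger l U (e t x)) \<phi>"
        unfolding F_def by (simp only: ip_diff[OF cmult_H[OF d1] cmult_H[OF dh(2)] P(2)] ip_cmult[OF d1 P(2)] ip_cmult[OF dh(2) P(2)] ip_diff[OF dh(3,1) P(2)])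
      also have "ip (schroedinger l U (e t x)) \<phi> = ip (e t x) (schroedinger l U \<phi>)" by (rule Green[OF ed[OF t] D(1)])
      also have "\<dots> = ip (schroedinger l U \<phi>) (e t x)" by (rule ip_sym)
      also have "\<dots> = \<Lambda> * b t" unfolding D(2)[OF dh(1)] \<Lambda>_def b_def by (simp add: ip_sym)
      finally have i: "ip F \<phi> = (b (t + h) - b t) / h - - \<Lambda> * b t" by (simp add: b_def)
      have "(ip F \<phi>)\<^sup>2 \<le> ip F F" using Cauchy_Schwarz[OF FH P(2)] P(3) by simp
      then have "\<bar>ip F \<phi>\<bar> \<le> sqrt (ip F F)" by (intro real_le_rsqrt) simp
      then show "norm ((b (t + h) - b t) / h - - \<Lambda> * b t) \<le> L2_norm G l (\<lambda>y. (e (t + h) x y - e t x y) / h - - schroedinger l U (e t x) y)"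
        unfolding i[symmetric] L2_norm_ip[symmetric] by (simp add: F_def)
    qed
  qed
  have "\<exists>c. \<forall>t\<in>{0<..}. exp (\<Lambda> * t) * b t = c"
  proof (rule has_field_derivative_zero_constant)
    fix t :: real assume t: "t \<in> {0<..}"
    have "((\<lambda>t. exp (\<Lambda> * t) * b t) has_real_derivative (exp (\<Lambda> * t) * \<Lambda>) * b t + (- \<Lambda> * b t) * exp (\<Lambda> * t)) (at t)"
    proof (rule DERIV_mult)
      show "((\<lambda>t. exp (\<Lambda> * t)) has_real_derivative exp (\<Lambda> * t) * \<Lambda>) (at t)" by (auto intro!: derivative_eq_intros)
      show "(b has_real_derivative - \<Lambda> * b t) (at t)" using t by (intro der) simp
    qed
    then show "((\<lambda>t. exp (\<Lambda> * t) * b t) has_real_derivative 0) (at t within {0<..})"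
      by (simp add: algebra_simps has_field_derivative_at_within)
  qed (rule convex_real_interval)
  then obtain c where c: "\<And>t. 0 < t \<Longrightarrow> exp (\<Lambda> * t) * b t = c" by auto
  have "((\<lambda>t. ip (e t x) \<phi>) \<longlongrightarrow> \<phi> x) (at_right 0)"
    using e x D(1) unfolding heat_kernel_of_dom_def graph_ip_def by blast
  then have "((\<lambda>t. exp (\<Lambda> * t) * b t) \<longlongrightarrow> exp (\<Lambda> * 0) * \<phi> x) (at_right 0)"
    unfolding b_def by (intro tendsto_intros)
  moreover have "\<forall>\<^sub>F t in at_right 0. exp (\<Lambda> * t) * b t = c"
    by (rule eventually_mono[OF eventually_at_right_less[of "0::real"]]) (rule c)
  ultimately have "((\<lambda>t. c) \<longlongrightarrow> \<phi> x) (at_right (0::real))" by (simp add: tendsto_cong)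
  then have "c = \<phi> x" by (simp add: tendsto_const_iff)
  then have "exp (\<Lambda> * t) * b t = \<phi> x" using c[OF t] by simp
  then have "exp (- \<Lambda> * t) * (exp (\<Lambda> * t) * b t) = exp (- \<Lambda> * t) * \<phi> x" by simp
  then show ?thesis unfolding b_def \<Lambda>_def by (simp add: mult.assoc[symmetric] exp_add[symmetric])
qed

text \<open>
  The difference has vanishing coefficients with respect to all eigenfunctions and is continuous on the
  edges.
\<close>

lemma kernel_unique:
  assumes "heat_kernel_of_dom e" "heat_kernel_of_dom e'" "0 < t" "x \<in> X" "y \<in> X"
  shows "e t x y = e' t x y"
proof -
  define w where "w = (\<lambda>y. e t x y - e' t x y)"
  have d: "e t x \<in> dom" "e' t x \<in> dom" using assms by (auto simp: heat_kernel_of_dom_def)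
  have "w \<in> spectral.V"
    unfolding spectral.V_def w_def using diff_H dom_H(1) d
    by (auto simp: ip_diff spectral.S_facts(2) kernel_coefficient[OF assms(1,4) _ assms(3)] kernel_coefficient[OF assms(2,4) _ assms(3)])
  then have "ip w w = 0" by (rule spectral.complement_null)
  moreover have "continuous_edges w" unfolding w_def by (intro continuous_edges_diff dom_continuous d)
  ultimately have "w y = 0" using continuous_null_imp_zero assms(5) by blast
  then show ?thesis by (simp add: w_def)
qed

end

section \<open>From vertex matrices to an involution on the ends\<close>

definition end_vertex :: "('v, 'e) pre_digraph \<Rightarrow> 'e point \<Rightarrow> 'v" where
  "end_vertex G p = (if snd p = 0 then tail G (fst p) else head G (fst p))"

definition end_index :: "('v, 'e) pre_digraph \<Rightarrow> ('e \<Rightarrow> real) \<Rightarrow> ('v \<Rightarrow> nat \<Rightarrow> 'e point) \<Rightarrow> 'e point \<Rightarrow> nat" where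
  "end_index G l en p = inv_into {..<vertex_degree G l (end_vertex G p)} (en (end_vertex G p)) p"

text \<open>
  The block matrix made of the involutions of the individual vertices, indexed by ends instead of by
  pairs of a vertex and a number.
\<close>

definition glued_involution :: "('v, 'e) pre_digraph \<Rightarrow> ('e \<Rightarrow> real) \<Rightarrow> ('v \<Rightarrow> nat \<Rightarrow> 'e point) \<Rightarrow>
    ('v \<Rightarrow> nat \<Rightarrow> nat \<Rightarrow> real) \<Rightarrow> 'e point \<Rightarrow> 'e point \<Rightarrow> real" where
  "glued_involution G l en r p q = (if end_vertex G p = end_vertex G q
     then r (end_vertex G p) (end_index G l en p) (end_index G l en q) else 0)"

context metric_graph begin

lemma edge_ends_subset: "edge_ends G l v \<subseteq> ends G l"
  by (auto simp: edge_ends_def ends_def)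

lemma end_vertex_eq: "p \<in> edge_ends G l v \<Longrightarrow> end_vertex G p = v"
  using length_pos by (fastforce simp: edge_ends_def end_vertex_def)

lemma end_vertex_props:
  assumes "p \<in> ends G l"
  shows "end_vertex G p \<in> verts G" "p \<in> edge_ends G l (end_vertex G p)"
  using assms length_pos by (auto simp: ends_def end_vertex_def edge_ends_def)

lemma enumeration:
  assumes en: "enumerates_ends G l en" and v: "v \<in> verts G" and i: "i < vertex_degree G l v"
  shows "en v i \<in> ends G l" "end_vertex G (en v i) = v" "end_index G l en (en v i) = i"
proof -
  have b: "bij_betw (en v) {..<vertex_degree G l v} (edge_ends G l v)" using en v by (simp add: enumerates_ends_def)
  have "en v i \<in> edge_ends G l v" using b i by (auto simp: bij_betw_def)
  then show "en v i \<in> ends G l" and e: "end_vertex G (en v i) = v" using edge_ends_subset end_vertex_eq by blast+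
  show "end_index G l en (en v i) = i" unfolding end_index_def e using b i by (intro inv_into_f_f) (auto simp: bij_betw_def)
qed

lemma end_enumerated:
  assumes en: "enumerates_ends G l en" and p: "p \<in> ends G l"
  shows "end_index G l en p < vertex_degree G l (end_vertex G p)" "en (end_vertex G p) (end_index G l en p) = p"
proof -
  have b: "bij_betw (en (end_vertex G p)) {..<vertex_degree G l (end_vertex G p)} (edge_ends G l (end_vertex G p))"
    using en end_vertex_props(1)[OF p] by (simp add: enumerates_ends_def)
  then have im: "p \<in> en (end_vertex G p) ` {..<vertex_degree G l (end_vertex G p)}"
    using end_vertex_props(2)[OF p] by (simp add: bij_betw_def)
  show "end_index G l en p < vertex_degree G l (end_vertex G p)"
    using inv_into_into[OF im] by (simp add: end_index_def)
  show "en (end_vertex G p) (end_index G l en p) = p"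
    using f_inv_into_f[OF im] by (simp add: end_index_def)
qed

lemma glued_sum:
  assumes en: "enumerates_ends G l en" and v: "v \<in> verts G" and i: "i < vertex_degree G l v"
  shows "(\<Sum>q\<in>ends G l. glued_involution G l en r (en v i) q * f q) = (\<Sum>j<vertex_degree G l v. r v i j * f (en v j))"
proof -
  have fin: "finite (ends G l)" by (simp add: ends_def)
  have b: "bij_betw (en v) {..<vertex_degree G l v} (edge_ends G l v)" using en v by (simp add: enumerates_ends_def)
  have "(\<Sum>q\<in>ends G l. glued_involution G l en r (en v i) q * f q) = (\<Sum>q\<in>edge_ends G l v. glued_involution G l en r (en v i) q * f q)"
  proof (rule sum.mono_neutral_right[OF fin edge_ends_subset], rule ballI)
    fix q assume "q \<in> ends G l - edge_ends G l v"
    then have "end_vertex G q \<noteq> v" using end_vertex_props(2) by blast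
    then show "glued_involution G l en r (en v i) q * f q = 0"
      using enumeration(2)[OF en v i] by (simp add: glued_involution_def)
  qed
  also have "\<dots> = (\<Sum>j<vertex_degree G l v. glued_involution G l en r (en v i) (en v j) * f (en v j))"
    by (rule sum.reindex_bij_betw[OF b, symmetric])
  also have "\<dots> = (\<Sum>j<vertex_degree G l v. r v i j * f (en v j))"
    using enumeration(2,3)[OF en v] i by (intro sum.cong refl) (simp add: glued_involution_def)
  finally show ?thesis .
qed

text \<open>
  Each end belongs to exactly one vertex, because edges have positive length. The vertex involutions
  therefore fit together, and the boundary conditions at all vertices become one condition on all ends.
\<close>

lemma quantum_graph_exists:
  assumes U: "U \<in> L2 G l" and en: "enumerates_ends G l en" and sa: "self_adjoint_bc G l A B" and nr: "non_robin G A B"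
  obtains \<rho> where "quantum_graph G l U \<rho>" "Dom G l en A B U = quantum_graph.dom G l U \<rho>"
proof -
  let ?d = "vertex_degree G l"
  define good where "good = (\<lambda>v r. (\<forall>i<?d v. \<forall>j<?d v. r i j = r j i) \<and>
    (\<forall>i<?d v. \<forall>m<?d v. (\<Sum>j<?d v. r i j * r j m) = (if i = m then 1 else (0::real))) \<and>
    (\<forall>f g. A v *\<^sub>v vec (?d v) f + B v *\<^sub>v vec (?d v) g = 0\<^sub>v (?d v) \<longleftrightarrow>
       (\<forall>i<?d v. f i = (\<Sum>j<?d v. r i j * f j)) \<and> (\<forall>i<?d v. g i = - (\<Sum>j<?d v. r i j * g j))))"
  have "\<forall>v\<in>verts G. \<exists>r. good v r"
  proof
    fix v assume v: "v \<in> verts G"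
    have c: "A v \<in> carrier_mat (?d v) (?d v)" "B v \<in> carrier_mat (?d v) (?d v)"
      "transpose_mat (A v * transpose_mat (B v)) = A v * transpose_mat (B v)"
      "vec_space.rank (?d v) (mat_of_cols (?d v) (cols (A v) @ cols (B v))) = ?d v"
      using sa v by (auto simp: self_adjoint_bc_def Let_def)
    have s: "scattering_matrix (A v) (B v) k = scattering_matrix (A v) (B v) k'" if "k \<noteq> 0" "k' \<noteq> 0" for k k'
      using nr v that unfolding non_robin_def by blast
    obtain r :: "nat \<Rightarrow> nat \<Rightarrow> real" where
      r: "\<And>i m. i < ?d v \<Longrightarrow> m < ?d v \<Longrightarrow> r i m = r m i"
      "\<And>i m. i < ?d v \<Longrightarrow> m < ?d v \<Longrightarrow> (\<Sum>j<?d v. r i j * r j m) = (if i = m then 1 else 0)"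
      "\<And>f g. A v *\<^sub>v vec (?d v) f + B v *\<^sub>v vec (?d v) g = 0\<^sub>v (?d v) \<longleftrightarrow>
       (\<forall>i<?d v. f i = (\<Sum>j<?d v. r i j * f j)) \<and> (\<forall>i<?d v. g i = - (\<Sum>j<?d v. r i j * g j))"
      using self_adjoint_non_robin_involution[OF c s] by blast
    have "good v r" unfolding good_def
    proof (intro conjI allI impI)
      show "\<And>i j. i < ?d v \<Longrightarrow> j < ?d v \<Longrightarrow> r i j = r j i" by (rule r(1))
      show "\<And>i m. i < ?d v \<Longrightarrow> m < ?d v \<Longrightarrow> (\<Sum>j<?d v. r i j * r j m) = (if i = m then 1 else 0)" by (rule r(2))
    qed (rule r(3))
    then show "\<exists>r. good v r" by blast
  qed
  from bchoice[OF this] obtain r where r: "\<forall>v\<in>verts G. good v (r v)" by blast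
  define \<rho> where "\<rho> = glued_involution G l en r"
  have sum\<rho>: "(\<Sum>q\<in>ends G l. \<rho> (en v i) q * f q) = (\<Sum>j<?d v. r v i j * f (en v j))"
    if "v \<in> verts G" "i < ?d v" for v i f
    unfolding \<rho>_def by (rule glued_sum[OF en that])
  interpret quantum_graph G l U \<rho>
  proof
    show "finite (arcs G)" by simp
    show "0 < l a" if "a \<in> arcs G" for a using length_pos[OF that] .
    show "U \<in> L2 G l" by (rule U)
    show "\<rho> p q = \<rho> q p" if pq: "p \<in> ends G l" "q \<in> ends G l" for p q
    proof (cases "end_vertex G p = end_vertex G q")
      case True
      have "good (end_vertex G p) (r (end_vertex G p))" using r end_vertex_props(1)[OF pq(1)] by blast
      then have "\<forall>i<?d (end_vertex G p). \<forall>j<?d (end_vertex G p). r (end_vertex G p) i j = r (end_vertex G p) j i" by (simp add: good_def)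
      moreover have "end_index G l en p < ?d (end_vertex G p)" "end_index G l en q < ?d (end_vertex G p)"
        using end_enumerated(1)[OF en pq(1)] end_enumerated(1)[OF en pq(2)] True by simp_all
      ultimately show ?thesis using True by (simp add: \<rho>_def glued_involution_def)
    qed (simp add: \<rho>_def glued_involution_def)
    show "(\<Sum>q\<in>ends G l. \<rho> p q * \<rho> q s) = (if p = s then 1 else 0)" if ps: "p \<in> ends G l" "s \<in> ends G l" for p s
    proof -
      define v where "v = end_vertex G p"
      define i where "i = end_index G l en p"
      have v: "v \<in> verts G" unfolding v_def by (rule end_vertex_props(1)[OF ps(1)])
      have i: "i < ?d v" "en v i = p" unfolding v_def i_def by (rule end_enumerated[OF en ps(1)])+
      have "(\<Sum>q\<in>ends G l. \<rho> p q * \<rho> q s) = (\<Sum>j<?d v. r v i j * \<rho> (en v j) s)"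
        using sum\<rho>[OF v i(1), of "\<lambda>q. \<rho> q s"] i(2) by simp
      also have "\<dots> = (if p = s then 1 else 0)"
      proof (cases "end_vertex G s = v")
        case True
        define m where "m = end_index G l en s"
        have m: "m < ?d v" "en v m = s" unfolding m_def using end_enumerated[OF en ps(2)] True by simp_all
        have "(\<Sum>j<?d v. r v i j * \<rho> (en v j) s) = (\<Sum>j<?d v. r v i j * r v j m)"
          using enumeration(2,3)[OF en v] True by (intro sum.cong refl) (simp add: \<rho>_def glued_involution_def m_def)
        also have "\<dots> = (if i = m then 1 else 0)" 
        proof -
          have "good v (r v)" using r v by blast
          then show ?thesis unfolding good_def using i(1) m(1) by blast
        qed
        also have "(i = m) = (p = s)" using i m i_def m_def by blast
        finally show ?thesis .
      next
        case False
        then have "p \<noteq> s" by (auto simp: v_def)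
        then show ?thesis using False enumeration(2)[OF en v] by (simp add: \<rho>_def glued_involution_def)
      qed
      finally show ?thesis .
    qed
  qed
  have bc: "(\<forall>v\<in>verts G. boundary_condition G l en A B f v) \<longleftrightarrow> vertex_condition f (outward_deriv l f)" for f
  proof -
    define d where "d = outward_deriv l f"
    have "boundary_condition G l en A B f v \<longleftrightarrow> (\<forall>i<?d v. f (en v i) = (\<Sum>q\<in>ends G l. \<rho> (en v i) q * f q) \<and>
        d (en v i) = - (\<Sum>q\<in>ends G l. \<rho> (en v i) q * d q))" if v: "v \<in> verts G" for v
    proof -
      have "good v (r v)" using r v by blast
      then have "\<forall>f g. A v *\<^sub>v vec (?d v) f + B v *\<^sub>v vec (?d v) g = 0\<^sub>v (?d v) \<longleftrightarrow>
        (\<forall>i<?d v. f i = (\<Sum>j<?d v. r v i j * f j)) \<and> (\<forall>i<?d v. g i = - (\<Sum>j<?d v. r v i j * g j))"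
        unfolding good_def by (elim conjE)
      from this[THEN spec, THEN spec, of "\<lambda>i. f (en v i)" "\<lambda>i. d (en v i)"]
      have b: "boundary_condition G l en A B f v \<longleftrightarrow> (\<forall>i<?d v. f (en v i) = (\<Sum>j<?d v. r v i j * f (en v j))) \<and>
          (\<forall>i<?d v. d (en v i) = - (\<Sum>j<?d v. r v i j * d (en v j)))"
        unfolding boundary_condition_def Let_def d_def .
      have s: "(f (en v i) = (\<Sum>q\<in>ends G l. \<rho> (en v i) q * f q)) = (f (en v i) = (\<Sum>j<?d v. r v i j * f (en v j)))"
        "(d (en v i) = - (\<Sum>q\<in>ends G l. \<rho> (en v i) q * d q)) = (d (en v i) = - (\<Sum>j<?d v. r v i j * d (en v j)))"
        if "i < ?d v" for i by (simp_all only: sum\<rho>[OF v that])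
      show ?thesis unfolding b using s by blast
    qed
    then have 1: "(\<forall>v\<in>verts G. boundary_condition G l en A B f v) \<longleftrightarrow>
       (\<forall>v\<in>verts G. \<forall>i<?d v. f (en v i) = (\<Sum>q\<in>ends G l. \<rho> (en v i) q * f q) \<and> d (en v i) = - (\<Sum>q\<in>ends G l. \<rho> (en v i) q * d q))" by simp
    have 2: "(\<forall>p\<in>ends G l. P p) \<longleftrightarrow> (\<forall>v\<in>verts G. \<forall>i<?d v. P (en v i))" for P
      using enumeration(1)[OF en] end_enumerated[OF en] end_vertex_props(1) by metis
    show ?thesis unfolding 1 vertex_condition_def 2 d_def ..
  qed
  have "Dom G l en A B U = dom" unfolding Dom_def dom_def bc ..
  then show thesis using that quantum_graph_axioms by blast
qed

end

section \<open>Existence and uniqueness of the heat kernel\<close>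

theorem theorem1p1:
  fixes G :: "('v, 'e) pre_digraph"
    and l :: "'e \<Rightarrow> real"
    and en :: "'v \<Rightarrow> nat \<Rightarrow> 'e point"
    and A B :: "'v \<Rightarrow> real mat"
    and U :: "'e point \<Rightarrow> real"
  assumes "metric_graph G l"
    and "U \<in> L2 G l"
    and "enumerates_ends G l en"
    and "self_adjoint_bc G l A B"
    and "non_robin G A B"
  shows "(\<exists>e. heat_kernel G l en A B U e) \<and>
    (\<forall>e e'. heat_kernel G l en A B U e \<and> heat_kernel G l en A B U e' \<longrightarrow>
       (\<forall>t>0. \<forall>x\<in>points G l. \<forall>y\<in>points G l. e t x y = e' t x y))"
proof -
  obtain \<rho> where qg: "quantum_graph G l U \<rho>" and D: "Dom G l en A B U = quantum_graph.dom G l U \<rho>"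
    using metric_graph.quantum_graph_exists[OF assms] by blast
  interpret quantum_graph G l U \<rho> by (rule qg)
  have hk: "heat_kernel G l en A B U e \<longleftrightarrow> heat_kernel_of_dom e" for e
    unfolding heat_kernel_def heat_kernel_of_dom_def D ..
  show ?thesis
    unfolding hk
  proof (intro conjI allI impI ballI)
    show "\<exists>e. heat_kernel_of_dom e" by (rule exI[where P=heat_kernel_of_dom, OF kernel_exists])
    fix e e' and t :: real and x y assume "heat_kernel_of_dom e \<and> heat_kernel_of_dom e'" "0 < t" "x \<in> points G l" "y \<in> points G l"
    then show "e t x y = e' t x y" using kernel_unique[of e e' t x y] by blast
  qed
qed

end
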